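(* Let $\ell\ge0$ be an integer and $M=mI$ with $m\ge2$. Let $\{\mathbf a^{(k)},\ k\ge1\}$ be a sequence of masks supported in $\{0,\dots,N\}^s$ such that the symbols of the scheme $\{S_{\mathbf a^{(k)}},\ k\ge1\}$ satisfy sum rules of order $\ell+1$ and $\rho_{\mathcal A}:=\rho(\mathcal T_{\mathcal A}|_{V_\ell})<m^{-\ell}$, where $\mathcal A$ is the set of limit points of $\{\mathbf a^{(k)},\ k\ge1\}$. Then any other asymptotically similar scheme $\{S_{\mathbf b^{(k)}},\ k\ge1\}$ (with masks supported in $\{0,\dots,N\}^s$) whose symbols satisfy sum rules of order $\ell+1$ is $C^\ell$-convergent and the Hölder exponent $\alpha$ of its limit functions satisfies $\alpha\ge-\log_m\rho_{\mathcal A}$.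
   Context: A mask is a real sequence $\mathbf a=\{\mathrm a(\alpha)\}_{\alpha\in\mathbb Z^s}$ supported in $\{0,\dots,N\}^s$ ($N$ fixed). Its symbol is $a_*(z)=\sum_\alpha \mathrm a(\alpha)z^\alpha$, $z\in(\mathbb C\setminus\{0\})^s$. The subdivision operator is $(S_{\mathbf a}\boldsymbol c)(\alpha)=\sum_{\beta\in\mathbb Z^s}\mathrm a(\alpha-M\beta)c(\beta)$. $E=\{0,\dots,m-1\}^s$, $\Xi=\{e^{-i\frac{2\pi}{m}\varepsilon}:\varepsilon\in E\}$ (componentwise), $1=(1,\dots,1)$, $D^\eta$ is the partial derivative of multi-index $\eta$. $a_*$ satisfies sum rules of order $\ell+1$ if $a_*(1)=m^s$ and $D^\eta a_*(\epsilon)=0$ for all $|\eta|\le\ell$, $\epsilon\in\Xi\setminus\{1\}$. The set of limit points of $\{\mathbf a^{(k)}\}$ is the set of masks that are limits of some subsequence. Two non-stationary schemes are asymptotically similar if the sets of limit points of their mask sequences coincide. Let $K=\mathbb Z^s\cap\{\sum_{r\ge1}m^{-r}g_r:\ g_r\in\{-m,\dots,N+1\}^s\}$ and, for $\varepsilon\in E$, $T_{\varepsilon,\mathbf a}=[\mathrm a(\varepsilon+M\alpha-\beta)]_{\alpha,\beta\in K}$. $V_\ell\subset\mathbb R^{|K|}$ is the space of vectors orthogonal to $[p(\alpha)]_{\alpha\in K}$ for all polynomials $p$ of total degree $\le\ell$; it is invariant under all $T_{\varepsilon,\mathbf a}$ whenever $a_*$ satisfies sum rules of order $\ell+1$. $\mathcal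 T_{\mathcal A}|_{V_\ell}=\{T_{\varepsilon,\mathbf a}|_{V_\ell}:\varepsilon\in E,\mathbf a\in\mathcal A\}$. The joint spectral radius of a compact set $\mathcal M$ of square matrices is $\rho(\mathcal M)=\lim_{n\to\infty}\max_{M_1,\dots,M_n\in\mathcal M}\|M_1\cdots M_n\|^{1/n}$. A test function is a compactly supported, sufficiently smooth, stable function $f$ satisfying Strang–Fix conditions of order $\ell+1$: $\hat f(0)=1$, $D^\mu\hat f(\alpha)=0$ for $\alpha\in\mathbb Z^s\setminus\{0\}$, $|\mu|<\ell+1$, where $\hat f(\omega)=\int f(x)e^{-2\pi i x\cdot\omega}dx$. Stable: there are $0<C_1\le C_2<\infty$ with $C_1\|\boldsymbol c\|_{\ell_\infty}\le\|\sum_\alpha c(\alpha)f(\cdot-\alpha)\|_\infty\le C_2\|\boldsymbol c\|_{\ell_\infty}$ for all $\boldsymbol c\in\ell_\infty(\mathbb Z^s)$. A scheme $\{S_{\mathbf b^{(k)}}\}$ is $C^\ell$-convergent if for every $\boldsymbol c\in\ell_\infty(\mathbb Z^s)$ there is $g_{\boldsymbol c}\in C^\ell(\mathbb R^s)$ such that for any test function $f\in C^\ell(\mathbb R^s)$, $\lim_{k\to\infty}\|g_{\boldsymbol c}-\sum_{\alpha}(S_{\mathbf b^{(k)}}\cdots S_{\mathbf b^{(1)}}\boldsymbol c)(\alpha)f(M^k\cdot-\alpha)\|_{C^\ell}=0$. The Hölder exponent of the limit functions of a $C^0$-convergent scheme is $\alpha=n+\zeta$, where $n$ is the largest integer with all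 $g_{\boldsymbol c}\in C^n(\mathbb R^s)$ and $\zeta$ is the supremum of $\nu\in[0,1]$ such that for every limit function $g_{\boldsymbol c}$ there is a constant $C$ with $\max_{|\mu|=n}|D^\mu g_{\boldsymbol c}(x)-D^\mu g_{\boldsymbol c}(y)|\le C|x-y|^\nu$ for all $x,y$.
   Formalization: The masks b^(k) are additionally assumed uniformly bounded; without this the claim fails, since sparse masks with entries tending to infinity leave the set of limit points unchanged but can destroy convergence. *)

theory Defs
  imports "HOL-Analysis.Analysis"
begin

text \<open>
  The dimension \<open>s\<close> is the cardinality of the index type \<open>'s\<close>: \<open>int ^ 's\<close> is \<open>Z\<^sup>s\<close> and
  \<open>real ^ 's\<close> is \<open>R\<^sup>s\<close>. Sequences \<open>(a\<^sub>k)\<close> with \<open>k \<ge> 1\<close> are functions on \<open>nat\<close> whose value at 0 is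
  never used. Formal sums over all of \<open>Z\<^sup>s\<close> are written as sums over the indices with
  nonzero coefficient; these index sets are finite for finitely supported masks (with \<open>m \<ge> 1\<close>) and
  for compactly supported functions.
\<close>

type_synonym 's seq = "int ^ 's \<Rightarrow> real"

definition of_int_vec :: "int ^ 's \<Rightarrow> real ^ 's" where
  "of_int_vec \<alpha> = (\<chi> i. real_of_int (\<alpha> $ i))"


subsection \<open>Partial derivatives and \<open>C\<^sup>k\<close> functions\<close>

definition upd_vec :: "'a ^ 's \<Rightarrow> 's \<Rightarrow> 'a \<Rightarrow> 'a ^ 's" where
  "upd_vec x i t = (\<chi> j. if j = i then t else x $ j)"

definition partial :: "'s \<Rightarrow> (real ^ 's \<Rightarrow> 'b::real_normed_vector) \<Rightarrow> real ^ 's \<Rightarrow> 'b" where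
  "partial i f x = vector_derivative (\<lambda>t. f (upd_vec x i t)) (at (x $ i))"

definition cpartial :: "'s \<Rightarrow> (complex ^ 's \<Rightarrow> complex) \<Rightarrow> complex ^ 's \<Rightarrow> complex" where
  "cpartial i f z = deriv (\<lambda>w. f (upd_vec z i w)) (z $ i)"

text \<open>
  A derivative of order \<open>|\<mu>|\<close> is indexed by the list \<open>\<mu>\<close> of the coordinate directions in which one
  differentiates, so that \<open>|\<mu>|\<close> is the length of \<open>\<mu>\<close>. The index type carries no canonical order;
  where these derivatives are continuous, the order of the directions is irrelevant and lists
  describe exactly the usual multi-index derivatives.
\<close>

definition partials :: "'s list \<Rightarrow> (real ^ 's \<Rightarrow> 'b::real_normed_vector) \<Rightarrow> real ^ 's \<Rightarrow> 'b" where
  "partials \<mu> f = foldr partial \<mu> f"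

definition c_partials :: "'s list \<Rightarrow> (complex ^ 's \<Rightarrow> complex) \<Rightarrow> complex ^ 's \<Rightarrow> complex" where
  "c_partials \<mu> f = foldr cpartial \<mu> f"

definition C_k :: "nat \<Rightarrow> (real ^ 's::finite \<Rightarrow> 'b::real_normed_vector) \<Rightarrow> bool" where
  "C_k k f \<longleftrightarrow>
     (\<forall>\<mu>. length \<mu> < k \<longrightarrow>
        (\<forall>i x. (\<lambda>t. partials \<mu> f (upd_vec x i t)) differentiable (at (x $ i)))) \<and>
     (\<forall>\<mu>. length \<mu> \<le> k \<longrightarrow> continuous_on UNIV (partials \<mu> f))"

definition sup_norm :: "('a \<Rightarrow> 'b::real_normed_vector) \<Rightarrow> ennreal" where
  "sup_norm f = (SUP x. ennreal (norm (f x)))"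

definition C_norm :: "nat \<Rightarrow> (real ^ 's \<Rightarrow> 'b::real_normed_vector) \<Rightarrow> ennreal" where
  "C_norm k f = (SUP \<mu>\<in>{\<mu>. length \<mu> \<le> k}. sup_norm (partials \<mu> f))"


subsection \<open>Masks, symbols and sum rules\<close>

definition supported_mask :: "nat \<Rightarrow> ('s::finite) seq \<Rightarrow> bool" where
  "supported_mask N a \<longleftrightarrow> (\<forall>\<alpha>. a \<alpha> \<noteq> 0 \<longrightarrow> (\<forall>i. \<alpha> $ i \<in> {0..int N}))"

definition symbol :: "('s::finite) seq \<Rightarrow> complex ^ 's \<Rightarrow> complex" where
  "symbol a z = (\<Sum>\<alpha> | a \<alpha> \<noteq> 0. complex_of_real (a \<alpha>) * (\<Prod>i\<in>UNIV. (z $ i) powi (\<alpha> $ i)))"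

definition digits :: "nat \<Rightarrow> (int ^ 's) set" where
  "digits m = {\<epsilon>. \<forall>i. \<epsilon> $ i \<in> {0..<int m}}"

definition Xi :: "nat \<Rightarrow> (complex ^ 's) set" where
  "Xi m = {\<chi> i. exp (- \<i> * (2 * pi / real m) * of_int (\<epsilon> $ i)) | \<epsilon>. \<epsilon> \<in> digits m}"

text \<open>\<open>sum_rules m l a\<close>: sum rules of order \<open>l + 1\<close>.\<close>

definition sum_rules :: "nat \<Rightarrow> nat \<Rightarrow> ('s::finite) seq \<Rightarrow> bool" where
  "sum_rules m l a \<longleftrightarrow>
     symbol a 1 = of_nat m ^ CARD('s) \<and>
     (\<forall>\<eta> \<xi>. length \<eta> \<le> l \<longrightarrow> \<xi> \<in> Xi m - {1} \<longrightarrow> c_partials \<eta> (symbol a) \<xi> = 0)"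

text \<open>
  Convergence in the function space is pointwise convergence, which for masks supported in one
  fixed finite box is convergence in norm.
\<close>

definition limit_points :: "(nat \<Rightarrow> ('s::finite) seq) \<Rightarrow> ('s seq) set" where
  "limit_points a = {p. \<exists>r. strict_mono r \<and> (a \<circ> r) \<longlonglongrightarrow> p}"

definition asymptotically_similar :: "(nat \<Rightarrow> ('s::finite) seq) \<Rightarrow> (nat \<Rightarrow> 's seq) \<Rightarrow> bool" where
  "asymptotically_similar a b \<longleftrightarrow> limit_points a = limit_points b"


subsection \<open>Transition matrices and joint spectral radius\<close>

definition index_set :: "nat \<Rightarrow> nat \<Rightarrow> (int ^ 's::finite) set" where
  "index_set m N = {\<alpha>. \<exists>g :: nat \<Rightarrow> int ^ 's.
     (\<forall>r\<ge>1. \<forall>i. g r $ i \<in> {- int m..int N + 1}) \<and>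
     (\<lambda>r. (1 / real m) ^ Suc r *\<^sub>R of_int_vec (g (Suc r))) sums of_int_vec \<alpha>}"

text \<open>
  \<open>R\<^bsup>|K|\<^esup>\<close> is represented by the functions vanishing outside \<open>K = index_set m N\<close>, and a matrix
  by the linear map it induces there.
\<close>

definition transition :: "nat \<Rightarrow> nat \<Rightarrow> int ^ 's \<Rightarrow> ('s::finite) seq \<Rightarrow> 's seq \<Rightarrow> 's seq" where
  "transition m N \<epsilon> a v =
     (\<lambda>\<alpha>. if \<alpha> \<in> index_set m N then \<Sum>\<beta>\<in>index_set m N. a (\<epsilon> + int m *s \<alpha> - \<beta>) * v \<beta> else 0)"

definition polynomials_upto :: "nat \<Rightarrow> (real ^ 's::finite \<Rightarrow> real) set" where
  "polynomials_upto l =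
     {\<lambda>x. \<Sum>\<eta> | sum \<eta> UNIV \<le> l. c \<eta> * (\<Prod>i\<in>UNIV. (x $ i) ^ \<eta> i) | c :: ('s \<Rightarrow> nat) \<Rightarrow> real. True}"

definition V_space :: "nat \<Rightarrow> nat \<Rightarrow> nat \<Rightarrow> (('s::finite) seq) set" where
  "V_space m N l = {v. (\<forall>\<alpha>. \<alpha> \<notin> index_set m N \<longrightarrow> v \<alpha> = 0) \<and>
     (\<forall>p\<in>polynomials_upto l. (\<Sum>\<alpha>\<in>index_set m N. v \<alpha> * p (of_int_vec \<alpha>)) = 0)}"

definition operator_norm_on ::
    "'i set \<Rightarrow> ('i \<Rightarrow> real) set \<Rightarrow> (('i \<Rightarrow> real) \<Rightarrow> ('i \<Rightarrow> real)) \<Rightarrow> real" where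
  "operator_norm_on I W A = (SUP v\<in>{v \<in> W. L2_set v I \<le> 1}. L2_set (A v) I)"

text \<open>
  Joint spectral radius of the restrictions to the common invariant subspace \<open>W\<close> of the operators
  in \<open>\<M>\<close>, where \<open>I\<close> is a finite index set and \<open>W\<close> consists of vectors supported in \<open>I\<close>. The limit
  exists and does not depend on the norm whenever the set of restrictions is nonempty and compact.
\<close>

definition jsr_on ::
    "'i set \<Rightarrow> ('i \<Rightarrow> real) set \<Rightarrow> (('i \<Rightarrow> real) \<Rightarrow> ('i \<Rightarrow> real)) set \<Rightarrow> real" where
  "jsr_on I W \<M> =
     lim (\<lambda>n. SUP Ms\<in>{Ms. length Ms = n \<and> set Ms \<subseteq> \<M>}.
                root n (operator_norm_on I W (foldr (\<circ>) Ms id)))"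

definition jsr_masks :: "nat \<Rightarrow> nat \<Rightarrow> nat \<Rightarrow> (('s::finite) seq) set \<Rightarrow> real" where
  "jsr_masks m N l \<A> =
     jsr_on (index_set m N) (V_space m N l) {transition m N \<epsilon> a | \<epsilon> a. \<epsilon> \<in> digits m \<and> a \<in> \<A>}"


subsection \<open>Subdivision schemes and their convergence\<close>

definition subdivision :: "nat \<Rightarrow> ('s::finite) seq \<Rightarrow> 's seq \<Rightarrow> 's seq" where
  "subdivision m a c =
     (\<lambda>\<alpha>. \<Sum>\<beta> | a (\<alpha> - int m *s \<beta>) \<noteq> 0. a (\<alpha> - int m *s \<beta>) * c \<beta>)"

primrec iterated_subdivision ::
    "nat \<Rightarrow> (nat \<Rightarrow> ('s::finite) seq) \<Rightarrow> nat \<Rightarrow> 's seq \<Rightarrow> 's seq" where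
  "iterated_subdivision m b 0 c = c"
| "iterated_subdivision m b (Suc k) c = subdivision m (b (Suc k)) (iterated_subdivision m b k c)"

definition shift_combination ::
    "('s::finite) seq \<Rightarrow> (real ^ 's \<Rightarrow> real) \<Rightarrow> real ^ 's \<Rightarrow> real" where
  "shift_combination d f y =
     (\<Sum>\<alpha> | f (y - of_int_vec \<alpha>) \<noteq> 0. d \<alpha> * f (y - of_int_vec \<alpha>))"

definition stable_function :: "(real ^ 's::finite \<Rightarrow> real) \<Rightarrow> bool" where
  "stable_function f \<longleftrightarrow> (\<exists>C1 C2. 0 < C1 \<and> C1 \<le> C2 \<and>
     (\<forall>c. bounded (range c) \<longrightarrow>
        ennreal C1 * sup_norm c \<le> sup_norm (shift_combination c f) \<and>
        sup_norm (shift_combination c f) \<le> ennreal C2 * sup_norm c))"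

definition fourier :: "(real ^ 's::finite \<Rightarrow> real) \<Rightarrow> real ^ 's \<Rightarrow> complex" where
  "fourier f \<omega> =
     (LINT x|lborel. complex_of_real (f x) * exp (- 2 * pi * \<i> * complex_of_real (x \<bullet> \<omega>)))"

text \<open>\<open>strang_fix l f\<close>: Strang--Fix conditions of order \<open>l + 1\<close>.\<close>

definition strang_fix :: "nat \<Rightarrow> (real ^ 's::finite \<Rightarrow> real) \<Rightarrow> bool" where
  "strang_fix l f \<longleftrightarrow> fourier f 0 = 1 \<and>
     (\<forall>\<mu> \<alpha>. length \<mu> < l + 1 \<longrightarrow> \<alpha> \<noteq> 0 \<longrightarrow> partials \<mu> (fourier f) (of_int_vec \<alpha>) = 0)"

definition test_function :: "nat \<Rightarrow> (real ^ 's::finite \<Rightarrow> real) \<Rightarrow> bool" where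
  "test_function l f \<longleftrightarrow>
     compact (closure {x. f x \<noteq> 0}) \<and> C_k l f \<and> stable_function f \<and> strang_fix l f"

text \<open>\<open>g\<close> is the limit in \<open>C\<^sup>l\<close>, for the starting sequence \<open>c\<close>, of the scheme with masks \<open>b\<close>.\<close>

definition limit_function ::
    "nat \<Rightarrow> nat \<Rightarrow> (nat \<Rightarrow> ('s::finite) seq) \<Rightarrow> 's seq \<Rightarrow> (real ^ 's \<Rightarrow> real) \<Rightarrow> bool" where
  "limit_function l m b c g \<longleftrightarrow> C_k l g \<and>
     (\<forall>f. test_function l f \<longrightarrow>
        (\<lambda>k. C_norm l (\<lambda>x. g x -
            shift_combination (iterated_subdivision m b k c) f ((real m ^ k) *\<^sub>R x)))
          \<longlonglongrightarrow> 0)"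

definition C_convergent :: "nat \<Rightarrow> nat \<Rightarrow> (nat \<Rightarrow> ('s::finite) seq) \<Rightarrow> bool" where
  "C_convergent l m b \<longleftrightarrow> (\<forall>c. bounded (range c) \<longrightarrow> (\<exists>g. limit_function l m b c g))"


subsection \<open>Hoelder exponent\<close>

definition limit_functions :: "nat \<Rightarrow> (nat \<Rightarrow> ('s::finite) seq) \<Rightarrow> (real ^ 's \<Rightarrow> real) set" where
  "limit_functions m b = {g. \<exists>c. bounded (range c) \<and> limit_function 0 m b c g}"

text \<open>For \<open>x = y\<close> the left-hand side vanishes, so the convention \<open>0 powr 0 = 0\<close> is harmless.\<close>

definition holder_derivatives :: "nat \<Rightarrow> real \<Rightarrow> (real ^ 's::finite \<Rightarrow> real) \<Rightarrow> bool" where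
  "holder_derivatives n \<nu> g \<longleftrightarrow>
     (\<exists>C. \<forall>\<mu> x y. length \<mu> = n \<longrightarrow> \<bar>partials \<mu> g x - partials \<mu> g y\<bar> \<le> C * norm (x - y) powr \<nu>)"

text \<open>The exponent is \<open>\<infinity>\<close> if there is no largest \<open>n\<close> such that all limit functions are \<open>C\<^sup>n\<close>.\<close>

definition holder_exponent :: "nat \<Rightarrow> (nat \<Rightarrow> ('s::finite) seq) \<Rightarrow> ereal" where
  "holder_exponent m b =
     (let G = limit_functions m b in
      if \<forall>n. \<forall>g\<in>G. C_k n g then \<infinity>
      else let n = (GREATEST n. \<forall>g\<in>G. C_k n g) in
        ereal (real n) +
        (SUP \<nu>\<in>{\<nu>. 0 \<le> \<nu> \<and> \<nu> \<le> 1 \<and> (\<forall>g\<in>G. holder_derivatives n \<nu> g)}. ereal \<nu>))"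

definition ext_log :: "real \<Rightarrow> real \<Rightarrow> ereal" where
  "ext_log b x = (if x = 0 then -\<infinity> else ereal (log b x))"

end

theory Submission
  imports Defs
begin

text \<open>
  A linear functional that annihilates polynomials of degree at most \<open>l\<close> pairs the iterated data
  with products of transition operators on \<open>V\<^sub>l\<close>. By the joint spectral radius and the compactness of
  bounded sequences of masks, only finitely many of whose members are far from a limit point, such
  pairings decay like \<open>\<theta>\<^sup>k\<close> for every \<open>\<theta> > \<rho>\<close>. This applies to differences of order \<open>l + 1\<close>;
  approximating the data locally by Newton polynomials, which the sum rules transport from one level
  to the next, one finds that the difference quotients of order at most \<open>l\<close> converge uniformly, with
  a rate that gives both the derivatives of the limit and their Hoelder modulus. Strang--Fix
  conditions, through Poisson summation, say that the shifts of a test function reproduce polynomials,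
  so every test function leads to the same limit, and the hat function identifies this limit.
  If \<open>\<rho> < m\<^bsup>-(l+1)\<^esup>\<close>, then all limit functions are constant and the exponent is infinite. Otherwise
  \<open>- log\<^sub>m \<rho> \<le> l + 1\<close>, so smoothness beyond order \<open>l\<close> suffices and only the case where exactly \<open>l\<close>
  derivatives exist needs the Hoelder modulus.
\<close>

text \<open>A mask sequence may have a subsequence that leaves every bounded set; such a subsequence
  has no limit point, so equal sets of limit points say nothing about it. The uniform bound on the
  masks of \<open>b\<close> excludes this and makes the compactness argument available. The kernel
  of a difference of order \<open>l + 1\<close> can be wider than \<open>index_set m N\<close>,
  whereas the spectral radius controls only functionals supported there; a few transition steps
  shrink the support at the price of a constant factor. Two formal points shape the end of the
  proof. \<open>limit_function\<close> constrains a function only through test functions, so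
  uniqueness of limits requires that at least one test function be exhibited. And
  \<open>holder_exponent\<close> takes a supremum of admissible exponents, which would be
  \<open>-\<infinity>\<close> over the empty set: when the limit functions have more than
  \<open>l\<close> derivatives, their top derivatives must be shown bounded, although the
  convergence estimates say nothing about them. Compact support of the limit function of the delta
  sequence supplies that bound.\<close>

section \<open>Polynomials and finite differences\<close>

text \<open>\<open>pol d\<close> consists of the polynomials of degree \<open>< d\<close>, so that \<open>pol 0\<close> contains only 0.\<close>

inductive polp :: "nat \<Rightarrow> (real ^ 's::finite \<Rightarrow> real) \<Rightarrow> bool" where
  zero: "polp d (\<lambda>x. 0)"
| const: "polp (Suc d) (\<lambda>x. c)"
| add: "polp d p \<Longrightarrow> polp d q \<Longrightarrow> polp d (\<lambda>x. p x + q x)"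
| mult: "polp d p \<Longrightarrow> polp (Suc d) (\<lambda>x. x $ i * p x)"

definition pol :: "nat \<Rightarrow> (real ^ 's::finite \<Rightarrow> real) set" where
  "pol d = {p. polp d p}"

lemma pol_zero: "(\<lambda>x. 0) \<in> pol d"
  and pol_const: "(\<lambda>x. c) \<in> pol (Suc d)"
  and pol_add: "p \<in> pol d \<Longrightarrow> q \<in> pol d \<Longrightarrow> (\<lambda>x. p x + q x) \<in> pol d"
  and pol_mult: "p \<in> pol d \<Longrightarrow> (\<lambda>x. x $ i * p x) \<in> pol (Suc d)"
  by (auto simp: pol_def intro: polp.intros)

lemma pol_induct [consumes 1, case_names zero const add mult]:
  assumes "p \<in> pol d"
    and "\<And>d. P d (\<lambda>x. 0)"
    and "\<And>d c. P (Suc d) (\<lambda>x. c)"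
    and "\<And>d p q. p \<in> pol d \<Longrightarrow> P d p \<Longrightarrow> q \<in> pol d \<Longrightarrow> P d q \<Longrightarrow> P d (\<lambda>x. p x + q x)"
    and "\<And>d p i. p \<in> pol d \<Longrightarrow> P d p \<Longrightarrow> P (Suc d) (\<lambda>x. x $ i * p x)"
  shows "P d p"
proof -
  have "polp d p" using assms(1) by (simp add: pol_def)
  then show ?thesis
    by (induction rule: polp.induct) (use assms(2-5) in \<open>auto simp: pol_def\<close>)
qed

lemma pol_0_eq: "p \<in> pol 0 \<Longrightarrow> p x = 0"
proof -
  have "p \<in> pol d \<Longrightarrow> d = 0 \<Longrightarrow> p x = 0" for d
    by (induction rule: pol_induct) auto
  then show "p \<in> pol 0 \<Longrightarrow> p x = 0" by blast
qed

lemma pol_scale: "p \<in> pol d \<Longrightarrow> (\<lambda>x. c * p x) \<in> pol d"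
proof (induction rule: pol_induct)
  case (mult d p i)
  have "(\<lambda>x. x $ i * (c * p x)) \<in> pol (Suc d)" by (rule pol_mult) (rule mult.IH)
  then show ?case by (simp add: algebra_simps)
qed (auto simp: pol_zero pol_const distrib_left intro: pol_add)

lemma pol_diff: "p \<in> pol d \<Longrightarrow> q \<in> pol d \<Longrightarrow> (\<lambda>x. p x - q x) \<in> pol d"
  using pol_add[of p d "\<lambda>x. (-1) * q x"] pol_scale[of q d "-1"] by simp

lemma pol_Suc: "p \<in> pol d \<Longrightarrow> p \<in> pol (Suc d)"
  by (induction rule: pol_induct) (auto intro: pol_zero pol_const pol_add pol_mult)

lemma pol_mono: "p \<in> pol d \<Longrightarrow> d \<le> e \<Longrightarrow> p \<in> pol e"
proof (induction e)
  case (Suc e)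
  then show ?case by (cases "d = Suc e") (auto intro: pol_Suc)
qed simp

lemma pol_sum: "(\<And>t. t \<in> T \<Longrightarrow> p t \<in> pol d) \<Longrightarrow> (\<lambda>x. \<Sum>t\<in>T. p t x) \<in> pol d"
  by (induction T rule: infinite_finite_induct) (auto intro: pol_zero pol_add)

lemma pol_affine: "p \<in> pol d \<Longrightarrow> (\<lambda>x. p (x0 + h *\<^sub>R x)) \<in> pol d"
proof (induction rule: pol_induct)
  case (mult d p i)
  have "(\<lambda>x. (x0 $ i) * p (x0 + h *\<^sub>R x) + h * (x $ i * p (x0 + h *\<^sub>R x))) \<in> pol (Suc d)"
    by (intro pol_add pol_scale pol_mult mult.IH pol_Suc)
  then show ?case by (simp add: algebra_simps)
qed (auto simp: pol_zero pol_const intro: pol_add)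

lemma pol_mult_linear: "p \<in> pol d \<Longrightarrow> (\<lambda>x. (x $ i - a) * p x) \<in> pol (Suc d)"
proof -
  assume p: "p \<in> pol d"
  have "(\<lambda>x. x $ i * p x + (- a) * p x) \<in> pol (Suc d)"
    by (intro pol_add pol_scale pol_mult p pol_Suc)
  then show ?thesis by (simp add: algebra_simps)
qed

lemma pol_prod_powers:
  assumes "p \<in> pol d"
  shows "(\<lambda>x. x $ i ^ n * p x) \<in> pol (n + d)"
proof (induction n)
  case (Suc n)
  have "(\<lambda>x. x $ i * (x $ i ^ n * p x)) \<in> pol (Suc (n + d))" by (rule pol_mult) (rule Suc.IH)
  then show ?case by (simp add: algebra_simps)
qed (use assms in simp)

lemma pol_monomial: "finite A \<Longrightarrow> (\<lambda>x. \<Prod>i\<in>A. x $ i ^ \<eta> i) \<in> pol (Suc (sum \<eta> A))"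
proof (induction A rule: finite_induct)
  case (insert i A)
  have "(\<lambda>x. x $ i ^ \<eta> i * (\<Prod>i\<in>A. x $ i ^ \<eta> i)) \<in> pol (\<eta> i + Suc (sum \<eta> A))"
    by (rule pol_prod_powers) (rule insert.IH)
  then show ?case using insert by simp
qed (simp add: pol_const)

lemma pol_gbinomial_mult:
  assumes "p \<in> pol d"
  shows "(\<lambda>x. (x $ i gchoose n) * p x) \<in> pol (n + d)"
proof (induction n)
  case (Suc n)
  have "(\<lambda>x. (1 / real (Suc n)) * ((x $ i - real n) * ((x $ i gchoose n) * p x))) \<in> pol (Suc (n + d))"
    by (intro pol_scale pol_mult_linear Suc.IH)
  moreover have "(1 / real (Suc n)) * ((x $ i - real n) * ((x $ i gchoose n) * p x))
      = (x $ i gchoose Suc n) * p x" for x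
    using gbinomial_mult_1[of "x $ i" n] by (simp add: field_simps)
  ultimately show ?case by (simp only: add_Suc)
qed (use assms in simp)

section \<open>Derivatives and differences of polynomials along a coordinate\<close>

lemma upd_vec_nth [simp]: "upd_vec x i t $ j = (if j = i then t else x $ j)"
  by (simp add: upd_vec_def)

lemma upd_vec_same [simp]: "upd_vec x i (x $ i) = x"
  by (simp add: vec_eq_iff)

definition rdiff :: "real \<Rightarrow> 's::finite \<Rightarrow> (real ^ 's \<Rightarrow> real) \<Rightarrow> real ^ 's \<Rightarrow> real" where
  "rdiff h i p = (\<lambda>x. p (x + axis i h) - p x)"

text \<open>One induction yields the derivative and the first-order Taylor expansion together,
  because the product rule for differences needs both. Truncated subtraction is harmless: constants
  get derivative 0 and affine functions get remainder 0.\<close>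

lemma pol_derivative:
  "p \<in> pol d \<Longrightarrow> \<exists>q\<in>pol (d - 1).
     (\<forall>x. ((\<lambda>t. p (upd_vec x i t)) has_vector_derivative q x) (at (x $ i))) \<and>
     (\<forall>h. \<exists>r\<in>pol (d - 2). \<forall>x. rdiff h i p x = h * q x + r x)"
proof (induction rule: pol_induct)
  case (zero d)
  then show ?case by (intro bexI[of _ "\<lambda>x. 0"]) (auto simp: rdiff_def intro!: pol_zero bexI[of _ "\<lambda>x. 0"])
next
  case (const d c)
  then show ?case by (intro bexI[of _ "\<lambda>x. 0"]) (auto simp: rdiff_def intro!: pol_zero bexI[of _ "\<lambda>x. 0"])
next
  case (add d p p')
  obtain q where q: "q \<in> pol (d - 1)"
    "\<And>x. ((\<lambda>t. p (upd_vec x i t)) has_vector_derivative q x) (at (x $ i))"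
    "\<And>h. \<exists>r\<in>pol (d - 2). \<forall>x. rdiff h i p x = h * q x + r x" using add.IH(1) by blast
  obtain q' where q': "q' \<in> pol (d - 1)"
    "\<And>x. ((\<lambda>t. p' (upd_vec x i t)) has_vector_derivative q' x) (at (x $ i))"
    "\<And>h. \<exists>r\<in>pol (d - 2). \<forall>x. rdiff h i p' x = h * q' x + r x" using add.IH(2) by blast
  have "\<exists>r\<in>pol (d - 2). \<forall>x. rdiff h i (\<lambda>x. p x + p' x) x = h * (q x + q' x) + r x" for h
  proof -
    obtain r where r: "r \<in> pol (d - 2)" "\<And>x. rdiff h i p x = h * q x + r x" using q(3) by blast
    obtain r' where r': "r' \<in> pol (d - 2)" "\<And>x. rdiff h i p' x = h * q' x + r' x" using q'(3) by blast
    have "rdiff h i (\<lambda>x. p x + p' x) x = h * (q x + q' x) + (r x + r' x)" for x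
      using r(2)[of x] r'(2)[of x] by (simp add: rdiff_def algebra_simps)
    then show ?thesis using pol_add[OF r(1) r'(1)] by (intro bexI[of _ "\<lambda>x. r x + r' x"]) auto
  qed
  then show ?case using q q'
    by (intro bexI[of _ "\<lambda>x. q x + q' x"]) (auto intro: pol_add has_vector_derivative_add)
next
  case (mult d p j)
  obtain q where q: "q \<in> pol (d - 1)"
    "\<And>x. ((\<lambda>t. p (upd_vec x i t)) has_vector_derivative q x) (at (x $ i))"
    "\<And>h. \<exists>r\<in>pol (d - 2). \<forall>x. rdiff h i p x = h * q x + r x" using mult.IH by blast
  \<comment> \<open>Multiplication by a coordinate raises the index by one; the truncated case
    \<open>d - k = 0\<close> needs that \<open>s\<close> vanishes.\<close>
  have mult_le: "(\<lambda>x. x $ j * s x) \<in> pol (d - k)" if "s \<in> pol (d - Suc k)" for s k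
  proof (cases "d - k")
    case 0
    then have "d - Suc k = 0" by simp
    then have "s \<in> pol 0" using that by simp
    then have "s x = 0" for x by (rule pol_0_eq)
    then show ?thesis by (simp add: pol_zero)
  next
    case (Suc n)
    then have "d - Suc k = n" by simp
    then show ?thesis using that Suc pol_mult by metis
  qed
  \<comment> \<open>The derivative of the coordinate function \<open>x $ j\<close> in direction
    \<open>i\<close>.\<close>
  define \<delta> :: real where "\<delta> = (if i = j then 1 else 0)"
  define Q where "Q = (\<lambda>x. x $ j * q x + \<delta> * p x)"
  have "Q \<in> pol d"
    unfolding Q_def using mult_le[of q 0] q(1) mult.hyps by (intro pol_add pol_scale) auto
  moreover have "((\<lambda>t. upd_vec x i t $ j * p (upd_vec x i t)) has_vector_derivative Q x) (at (x $ i))" for x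
  proof -
    have "((\<lambda>t. upd_vec x i t $ j) has_vector_derivative \<delta>) (at (x $ i))"
      by (auto simp: \<delta>_def has_vector_derivative_id)
    from has_vector_derivative_mult[OF this q(2)[of x]] show ?thesis
      by (simp add: Q_def algebra_simps)
  qed
  moreover have "\<exists>r\<in>pol (d - 1). \<forall>x. rdiff h i (\<lambda>x. x $ j * p x) x = h * Q x + r x" for h
  proof -
    obtain r where r: "r \<in> pol (d - 2)" "\<And>x. rdiff h i p x = h * q x + r x" using q(3) by blast
    have "r \<in> pol (d - 1)" using r(1) by (rule pol_mono) simp
    \<comment> \<open>Expanding \<open>(x $ j + h * \<delta>) * (p x + h * q x + r x)\<close> leaves
      these second-order terms after \<open>x $ j * p x\<close> and \<open>h * Q x\<close> are
      removed.\<close>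
    then have "(\<lambda>x. x $ j * r x + h * \<delta> * (h * q x + r x)) \<in> pol (d - 1)"
      using mult_le[of r 1] r(1) q(1) by (intro pol_add pol_scale) (auto simp: numeral_2_eq_2)
    moreover have "rdiff h i (\<lambda>x. x $ j * p x) x = h * Q x + (x $ j * r x + h * \<delta> * (h * q x + r x))" for x
    proof -
      have p: "p (x + axis i h) = p x + h * q x + r x" using r(2)[of x] by (simp add: rdiff_def)
      show ?thesis unfolding rdiff_def p Q_def by (auto simp: \<delta>_def axis_def algebra_simps)
    qed
    ultimately show ?thesis by (intro bexI[rotated]) auto
  qed
  ultimately show ?case by (intro bexI[of _ Q]) auto
qed

lemma pol_1_eq: "p \<in> pol (Suc 0) \<Longrightarrow> p x = p y"
proof -
  have "p \<in> pol d \<Longrightarrow> d = Suc 0 \<Longrightarrow> p x = p y" for d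
    by (induction rule: pol_induct) (auto simp: pol_0_eq)
  then show "p \<in> pol (Suc 0) \<Longrightarrow> p x = p y" by blast
qed

lemma partial_pol:
  assumes "p \<in> pol d"
  shows "partial i p \<in> pol (d - 1)"
    and "\<exists>r\<in>pol (d - 2). \<forall>x. rdiff h i p x = h * partial i p x + r x"
    and "((\<lambda>t. p (upd_vec x i t)) has_vector_derivative partial i p x) (at (x $ i))"
proof -
  obtain q where q: "q \<in> pol (d - 1)"
    "\<And>x. ((\<lambda>t. p (upd_vec x i t)) has_vector_derivative q x) (at (x $ i))"
    "\<And>h. \<exists>r\<in>pol (d - 2). \<forall>x. rdiff h i p x = h * q x + r x" using pol_derivative[OF assms] by blast
  have "partial i p = q"
    by (rule ext) (auto simp: partial_def intro: vector_derivative_at q(2))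
  then show "partial i p \<in> pol (d - 1)" "\<exists>r\<in>pol (d - 2). \<forall>x. rdiff h i p x = h * partial i p x + r x"
    "((\<lambda>t. p (upd_vec x i t)) has_vector_derivative partial i p x) (at (x $ i))"
    using q by auto
qed

lemma partials_simps [simp]:
  "partials [] f = f" "partials (i # \<mu>) f = partial i (partials \<mu> f)"
  by (simp_all add: partials_def)

lemma partials_pol: "p \<in> pol d \<Longrightarrow> partials \<mu> p \<in> pol (d - length \<mu>)"
proof (induction \<mu>)
  case (Cons i \<mu>)
  then show ?case using partial_pol(1)[of "partials \<mu> p" "d - length \<mu>" i] by simp
qed simp

lemma rdiff_pol: "p \<in> pol d \<Longrightarrow> rdiff h i p \<in> pol (d - 1)"
proof -
  assume p: "p \<in> pol d"
  obtain r where r: "r \<in> pol (d - 2)" "\<And>x. rdiff h i p x = h * partial i p x + r x"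
    using partial_pol(2)[OF p] by blast
  have "rdiff h i p = (\<lambda>x. h * partial i p x + r x)" using r(2) by auto
  then show "rdiff h i p \<in> pol (d - 1)" using partial_pol(1)[OF p] pol_mono[OF r(1), of "d - 1"]
    by (auto intro!: pol_add pol_scale)
qed

text \<open>Iterates the first-order expansion: each difference acts on the leading derivative and
  lowers every remainder by one further degree.\<close>

lemma rdiffs_partials:
  "p \<in> pol d \<Longrightarrow> \<exists>r\<in>pol (d - length \<mu> - 1). \<forall>x. foldr (rdiff h) \<mu> p x = h ^ length \<mu> * partials \<mu> p x + r x"
proof (induction \<mu>)
  case Nil
  then show ?case by (intro bexI[of _ "\<lambda>x. 0"]) (auto intro: pol_zero)
next
  case (Cons i \<mu>)
  let ?q = "partials \<mu> p"
  obtain r where r: "r \<in> pol (d - length \<mu> - 1)"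
    "\<And>x. foldr (rdiff h) \<mu> p x = h ^ length \<mu> * ?q x + r x" using Cons by blast
  have q: "?q \<in> pol (d - length \<mu>)" using partials_pol[OF Cons.prems] .
  obtain s where s: "s \<in> pol (d - length \<mu> - 2)" "\<And>x. rdiff h i ?q x = h * partial i ?q x + s x"
    using partial_pol(2)[OF q] by blast
  have *: "foldr (rdiff h) (i # \<mu>) p x
      = h ^ length (i # \<mu>) * partials (i # \<mu>) p x + (h ^ length \<mu> * s x + rdiff h i r x)" for x
  proof -
    have "foldr (rdiff h) (i # \<mu>) p x = h ^ length \<mu> * rdiff h i ?q x + rdiff h i r x"
      using r(2) by (simp add: rdiff_def algebra_simps)
    then show ?thesis by (simp add: s(2) algebra_simps)
  qed
  have "(\<lambda>x. h ^ length \<mu> * s x + rdiff h i r x) \<in> pol (d - length (i # \<mu>) - 1)"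
    using rdiff_pol[OF r(1), of h i] s(1) by (intro pol_add pol_scale) (auto simp: numeral_2_eq_2)
  then show ?case by (rule bexI[rotated]) (use * in blast)
qed

text \<open>At degree at most \<open>length \<mu>\<close> the remainder lies in \<open>pol 0\<close>
  and the derivative is constant, so \<open>x\<close> and \<open>y\<close> may differ.\<close>

lemma rdiffs_eq_partials:
  assumes "p \<in> pol (Suc (length \<mu>))"
  shows "foldr (rdiff h) \<mu> p x = h ^ length \<mu> * partials \<mu> p y"
proof -
  obtain r where r: "r \<in> pol 0" "\<And>x. foldr (rdiff h) \<mu> p x = h ^ length \<mu> * partials \<mu> p x + r x"
    using rdiffs_partials[OF assms, of \<mu> h] by auto
  have "partials \<mu> p \<in> pol (Suc 0)" using partials_pol[OF assms, of \<mu>] by simp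
  then have "partials \<mu> p x = partials \<mu> p y" by (rule pol_1_eq)
  then show ?thesis using r pol_0_eq by simp
qed

text \<open>
  Polynomials are reproduced up to lower order terms by any averages whose moments are constant;
  this covers both the action of a mask and the shifts of a test function.
\<close>

lemma pol_average:
  fixes u :: "'y \<Rightarrow> 't \<Rightarrow> real ^ 's::finite"
  assumes mom: "\<And>r y. r \<in> pol (Suc l) \<Longrightarrow> y \<in> Y \<Longrightarrow> (\<Sum>t\<in>I y. w y t * r (u y t)) = \<kappa> r"
    and p: "p \<in> pol (Suc d)" and d: "d \<le> l" and \<kappa>: "\<kappa> (\<lambda>x. 1) = 1"
  shows "\<exists>q\<in>pol d. \<forall>y\<in>Y. (\<Sum>t\<in>I y. w y t * p (v y - u y t)) = p (v y) + q (v y)"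
proof -
  \<comment> \<open>The claim is generalised by a weight \<open>r\<close>: when a factor
    \<open>(v y - u y t) $ i\<close> is added, \<open>v y $ i\<close> leaves the sum and
    \<open>u y t $ i\<close> is absorbed into \<open>r\<close>. The budget
    \<open>e + d \<le> Suc l\<close> keeps the moments of \<open>r\<close> constant in
    \<open>y\<close>.\<close>
  have "\<And>r e. r \<in> pol (Suc e) \<Longrightarrow> e + d \<le> Suc l \<Longrightarrow>
      \<exists>q\<in>pol (d - 1). \<forall>y\<in>Y. (\<Sum>t\<in>I y. w y t * (r (u y t) * p (v y - u y t))) = \<kappa> r * p (v y) + q (v y)"
    if "p \<in> pol d" for d p
    using that
  proof (induction rule: pol_induct)
    case (zero d)
    then show ?case by (intro bexI[of _ "\<lambda>x. 0"]) (auto intro: pol_zero)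
  next
    case (const d c)
    have "r \<in> pol (Suc l)" by (rule pol_mono[OF const(1)]) (use const in simp)
    then show ?case using mom[of r] const
      by (intro bexI[of _ "\<lambda>x. 0"])
        (auto intro: pol_zero simp: mult.assoc[symmetric] sum_distrib_right[symmetric])
  next
    case (add d p p')
    obtain q where q: "q\<in>pol (d - 1)" "\<And>y. y\<in>Y \<Longrightarrow>
      (\<Sum>t\<in>I y. w y t * (r (u y t) * p (v y - u y t))) = \<kappa> r * p (v y) + q (v y)"
      using add.IH(1)[OF add.prems] by blast
    obtain q' where q': "q'\<in>pol (d - 1)" "\<And>y. y\<in>Y \<Longrightarrow>
      (\<Sum>t\<in>I y. w y t * (r (u y t) * p' (v y - u y t))) = \<kappa> r * p' (v y) + q' (v y)"
      using add.IH(2)[OF add.prems] by blast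
    show ?case using q q'
      by (intro bexI[of _ "\<lambda>x. q x + q' x"]) (auto intro!: pol_add simp: distrib_left sum.distrib)
  next
    case (mult d p i)
    show ?case
    proof (cases d)
      case 0
      then have "p x = 0" for x using mult pol_0_eq by blast
      then show ?thesis by (intro bexI[of _ "\<lambda>x. 0"]) (auto intro: pol_zero)
    next
      case (Suc d')
      obtain q where q: "q\<in>pol (d - 1)" "\<And>y. y\<in>Y \<Longrightarrow>
        (\<Sum>t\<in>I y. w y t * (r (u y t) * p (v y - u y t))) = \<kappa> r * p (v y) + q (v y)"
        using mult.IH[OF mult.prems(1)] mult.prems(2) by auto
      let ?r = "\<lambda>x. x $ i * r x"
      obtain q' where q': "q'\<in>pol (d - 1)" "\<And>y. y\<in>Y \<Longrightarrow>
        (\<Sum>t\<in>I y. w y t * (?r (u y t) * p (v y - u y t))) = \<kappa> ?r * p (v y) + q' (v y)"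
        using mult.IH[OF pol_mult[OF mult.prems(1), of i]] mult.prems(2) by auto
      have "(\<Sum>t\<in>I y. w y t * (r (u y t) * ((v y - u y t) $ i * p (v y - u y t))))
          = \<kappa> r * (v y $ i * p (v y)) + (v y $ i * q (v y) - \<kappa> ?r * p (v y) - q' (v y))" if "y \<in> Y" for y
      proof -
        have "(\<Sum>t\<in>I y. w y t * (r (u y t) * ((v y - u y t) $ i * p (v y - u y t))))
          = v y $ i * (\<Sum>t\<in>I y. w y t * (r (u y t) * p (v y - u y t)))
            - (\<Sum>t\<in>I y. w y t * (?r (u y t) * p (v y - u y t)))"
          by (simp add: sum_distrib_left sum_subtractf[symmetric] algebra_simps)
        then show ?thesis using q(2) q'(2) that by (simp add: algebra_simps)
      qed
      moreover have "(\<lambda>x. x $ i * q x - \<kappa> ?r * p x - q' x) \<in> pol (Suc d - 1)"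
        using q(1) q'(1) mult.hyps Suc by (auto intro!: pol_diff pol_scale pol_mult intro: pol_Suc)
      ultimately show ?thesis by (intro bexI[rotated]) auto
    qed
  qed
  from this[OF p pol_const[of 1 0]] d show ?thesis using \<kappa> by simp
qed

section \<open>Finite differences of sequences on the integer lattice\<close>

definition fdiff :: "'s::finite \<Rightarrow> 's seq \<Rightarrow> 's seq" where
  "fdiff i c = (\<lambda>\<alpha>. c (\<alpha> + axis i 1) - c \<alpha>)"

definition fdiffs :: "'s::finite list \<Rightarrow> 's seq \<Rightarrow> 's seq" where
  "fdiffs \<mu> c = foldr fdiff \<mu> c"

lemma fdiffs_simps [simp]: "fdiffs [] c = c" "fdiffs (i # \<mu>) c = fdiff i (fdiffs \<mu> c)"
  by (simp_all add: fdiffs_def)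

lemma fdiff_add: "fdiff i (\<lambda>\<alpha>. c \<alpha> + d \<alpha>) = (\<lambda>\<alpha>. fdiff i c \<alpha> + fdiff i d \<alpha>)"
  and fdiff_diff: "fdiff i (\<lambda>\<alpha>. c \<alpha> - d \<alpha>) = (\<lambda>\<alpha>. fdiff i c \<alpha> - fdiff i d \<alpha>)"
  and fdiff_cmult: "fdiff i (\<lambda>\<alpha>. r * c \<alpha>) = (\<lambda>\<alpha>. r * fdiff i c \<alpha>)"
  and fdiff_shift: "fdiff i (\<lambda>\<alpha>. c (\<gamma> + \<alpha>)) = (\<lambda>\<alpha>. fdiff i c (\<gamma> + \<alpha>))"
  and fdiff_commute: "fdiff i (fdiff j c) = fdiff j (fdiff i c)"
  by (simp_all add: fdiff_def algebra_simps)

lemma fdiffs_add: "fdiffs \<mu> (\<lambda>\<alpha>. c \<alpha> + d \<alpha>) = (\<lambda>\<alpha>. fdiffs \<mu> c \<alpha> + fdiffs \<mu> d \<alpha>)"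
  and fdiffs_diff: "fdiffs \<mu> (\<lambda>\<alpha>. c \<alpha> - d \<alpha>) = (\<lambda>\<alpha>. fdiffs \<mu> c \<alpha> - fdiffs \<mu> d \<alpha>)"
  and fdiffs_cmult: "fdiffs \<mu> (\<lambda>\<alpha>. r * c \<alpha>) = (\<lambda>\<alpha>. r * fdiffs \<mu> c \<alpha>)"
  and fdiffs_shift: "fdiffs \<mu> (\<lambda>\<alpha>. c (\<gamma> + \<alpha>)) = (\<lambda>\<alpha>. fdiffs \<mu> c (\<gamma> + \<alpha>))"
  by (induction \<mu>) (simp_all add: fdiff_add fdiff_diff fdiff_cmult fdiff_shift)

lemma fdiffs_zero: "fdiffs \<mu> (\<lambda>\<alpha>. 0) = (\<lambda>\<alpha>. 0)"
  using fdiffs_cmult[of \<mu> 0 "\<lambda>\<alpha>. 0"] by simp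

lemma fdiffs_sum: "fdiffs \<mu> (\<lambda>\<alpha>. \<Sum>t\<in>T. c t \<alpha>) = (\<lambda>\<alpha>. \<Sum>t\<in>T. fdiffs \<mu> (c t) \<alpha>)"
  by (induction T rule: infinite_finite_induct) (simp_all add: fdiffs_zero fdiffs_add)

text \<open>Differences commute, so a list of directions acts only through its multiset; this is the
  passage from lists to multi-indices.\<close>

lemma fdiffs_mset_cong:
  assumes "mset \<mu> = mset \<nu>" shows "fdiffs \<mu> c = fdiffs \<nu> c"
proof -
  have "fold fdiff (rev \<mu>) = fold fdiff (rev \<nu>)"
    by (rule fold_multiset_equiv) (use assms in \<open>auto simp: fun_eq_iff fdiff_commute\<close>)
  then show ?thesis by (simp add: fdiffs_def foldr_conv_fold)
qed

lemma of_int_vec_nth [simp]: "of_int_vec \<alpha> $ i = real_of_int (\<alpha> $ i)"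
  by (simp add: of_int_vec_def)

lemma of_int_vec_add: "of_int_vec (\<alpha> + \<beta>) = of_int_vec \<alpha> + of_int_vec \<beta>"
  and of_int_vec_diff: "of_int_vec (\<alpha> - \<beta>) = of_int_vec \<alpha> - of_int_vec \<beta>"
  and of_int_vec_minus: "of_int_vec (- \<alpha>) = - of_int_vec \<alpha>"
  and of_int_vec_smult: "of_int_vec (int m *s \<alpha>) = real m *\<^sub>R of_int_vec \<alpha>"
  and of_int_vec_zero [simp]: "of_int_vec 0 = 0"
  and of_int_vec_axis: "of_int_vec (axis i 1) = axis i 1"
  by (simp_all add: vec_eq_iff axis_def)

lemma of_int_vec_eq_0_iff [simp]: "of_int_vec \<alpha> = 0 \<longleftrightarrow> \<alpha> = 0"
  by (simp add: vec_eq_iff)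

text \<open>Transfers the calculus of \<open>rdiff\<close> to lattice samples of mesh width
  \<open>h\<close>; width \<open>1 / m\<close> occurs after one subdivision step.\<close>

lemma fdiffs_sample:
  "fdiffs \<mu> (\<lambda>\<alpha>. p (x + h *\<^sub>R of_int_vec \<alpha>)) = (\<lambda>\<alpha>. foldr (rdiff h) \<mu> p (x + h *\<^sub>R of_int_vec \<alpha>))"
proof (induction \<mu>)
  case (Cons i \<mu>)
  have "x + h *\<^sub>R of_int_vec (\<alpha> + axis i 1) = x + h *\<^sub>R of_int_vec \<alpha> + axis i h" for \<alpha>
    by (simp add: vec_eq_iff axis_def algebra_simps)
  then show ?case unfolding fdiffs_simps Cons foldr.simps comp_def fdiff_def rdiff_def by (simp only:)
qed simp

lemma fdiffs_pol:
  assumes "p \<in> pol (Suc (length \<mu>))"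
  shows "fdiffs \<mu> (\<lambda>\<alpha>. p (x + h *\<^sub>R of_int_vec \<alpha>)) \<alpha> = h ^ length \<mu> * partials \<mu> p y"
  by (simp add: fdiffs_sample rdiffs_eq_partials[OF assms])

lemma fdiffs_pol_1:
  assumes "p \<in> pol (Suc (length \<mu>))"
  shows "fdiffs \<mu> (\<lambda>\<alpha>. p (of_int_vec \<alpha>)) \<alpha> = partials \<mu> p y"
  using fdiffs_pol[OF assms, of 0 1 \<alpha> y] by simp

lemma partials_pol_eq_0: "p \<in> pol (length \<mu>) \<Longrightarrow> partials \<mu> p x = 0"
  using partials_pol[of p "length \<mu>" \<mu>] pol_0_eq by auto

lemma fdiffs_pol_eq_0:
  assumes "p \<in> pol (length \<mu>)"
  shows "fdiffs \<mu> (\<lambda>\<alpha>. p (of_int_vec \<alpha>)) \<alpha> = 0"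
  using fdiffs_pol_1[OF pol_Suc[OF assms]] partials_pol_eq_0[OF assms] by metis

subsection \<open>Newton interpolation\<close>

text \<open>The Newton basis at the origin: tensor products of binomials are dual to the forward
  differences at 0, which is the content of \<open>fdiffs_binomial_pol_0\<close>.\<close>

definition binomial_pol :: "('s::finite \<Rightarrow> nat) \<Rightarrow> real ^ 's \<Rightarrow> real" where
  "binomial_pol \<nu> x = (\<Prod>i\<in>UNIV. x $ i gchoose \<nu> i)"

lemma binomial_pol_in_pol: "binomial_pol \<nu> \<in> pol (Suc (sum \<nu> UNIV))"
proof -
  have "finite A \<Longrightarrow> (\<lambda>x. \<Prod>i\<in>A. x $ i gchoose \<nu> i) \<in> pol (Suc (sum \<nu> A))" for A
  proof (induction A rule: finite_induct)
    case (insert i A)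
    have "(\<lambda>x. (x $ i gchoose \<nu> i) * (\<Prod>i\<in>A. x $ i gchoose \<nu> i)) \<in> pol (\<nu> i + Suc (sum \<nu> A))"
      by (rule pol_gbinomial_mult) (rule insert.IH)
    then show ?case using insert by simp
  qed (simp add: pol_const)
  from this[of UNIV] show ?thesis by (simp add: binomial_pol_def[abs_def])
qed

text \<open>Pascal's rule in the coordinate \<open>i\<close>; the other factors do not see the
  shift.\<close>

lemma fdiff_binomial_pol:
  "fdiff i (\<lambda>\<alpha>. binomial_pol \<nu> (of_int_vec \<alpha>)) \<alpha> =
     (if \<nu> i = 0 then 0 else binomial_pol (\<nu>(i := \<nu> i - 1)) (of_int_vec \<alpha>))"
proof -
  have eq: "binomial_pol \<nu> x = (x $ i gchoose \<nu> i) * (\<Prod>j\<in>UNIV - {i}. x $ j gchoose \<nu> j)"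
    for \<nu> :: "'a \<Rightarrow> nat" and x
    unfolding binomial_pol_def by (rule prod.remove) auto
  have 1: "(\<Prod>j\<in>UNIV - {i}. of_int_vec (\<alpha> + axis i 1) $ j gchoose \<nu> j)
      = (\<Prod>j\<in>UNIV - {i}. of_int_vec \<alpha> $ j gchoose \<nu> j)"
    by (rule prod.cong) (auto simp: axis_def)
  have 2: "(\<Prod>j\<in>UNIV - {i}. of_int_vec \<alpha> $ j gchoose (\<nu>(i := \<nu> i - 1)) j)
      = (\<Prod>j\<in>UNIV - {i}. of_int_vec \<alpha> $ j gchoose \<nu> j)"
    by (rule prod.cong) auto
  show ?thesis
  proof (cases "\<nu> i")
    case 0
    then show ?thesis unfolding fdiff_def eq 1 by simp
  next
    case (Suc k)
    have "(of_int_vec (\<alpha> + axis i 1) $ i gchoose Suc k) - (of_int_vec \<alpha> $ i gchoose Suc k)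
      = (of_int_vec \<alpha> $ i gchoose k)"
      using gbinomial_Suc_Suc[of "of_int_vec \<alpha> $ i" k] by (simp add: axis_def)
    then show ?thesis unfolding fdiff_def eq 1 2 by (simp add: Suc left_diff_distrib[symmetric])
  qed
qed

lemma fdiffs_binomial_pol:
  "fdiffs \<mu> (\<lambda>\<alpha>. binomial_pol \<nu> (of_int_vec \<alpha>)) \<alpha> =
     (if \<forall>i. count_list \<mu> i \<le> \<nu> i then binomial_pol (\<lambda>i. \<nu> i - count_list \<mu> i) (of_int_vec \<alpha>) else 0)"
proof (induction \<mu> arbitrary: \<alpha>)
  case (Cons i \<mu>)
  show ?case
  proof (cases "\<forall>i. count_list \<mu> i \<le> \<nu> i")
    case False
    then have "\<not> (\<forall>j. count_list (i # \<mu>) j \<le> \<nu> j)" by (auto split: if_splits intro: Suc_leD)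
    moreover have "fdiffs \<mu> (\<lambda>\<alpha>. binomial_pol \<nu> (of_int_vec \<alpha>)) = (\<lambda>\<alpha>. 0)"
      by (rule ext) (simp add: Cons.IH False del: not_all)
    ultimately show ?thesis by (simp add: fdiff_def del: count_list.simps not_all)
  next
    case True
    then have eq: "fdiffs \<mu> (\<lambda>\<alpha>. binomial_pol \<nu> (of_int_vec \<alpha>))
        = (\<lambda>\<alpha>. binomial_pol (\<lambda>i. \<nu> i - count_list \<mu> i) (of_int_vec \<alpha>))"
      by (intro ext) (simp add: Cons.IH)
    have "(\<lambda>i. \<nu> i - count_list \<mu> i)(i := \<nu> i - count_list \<mu> i - 1) = (\<lambda>j. \<nu> j - count_list (i # \<mu>) j)"
      by auto
    moreover have "(\<forall>j. count_list (i # \<mu>) j \<le> \<nu> j) \<longleftrightarrow> \<nu> i - count_list \<mu> i \<noteq> 0"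
      using True by (auto simp: Suc_le_eq)
    ultimately show ?thesis unfolding fdiffs_simps eq fdiff_binomial_pol by auto
  qed
qed simp

lemma binomial_pol_0: "binomial_pol \<nu> 0 = (if \<forall>i. \<nu> i = 0 then 1 else 0)"
  unfolding binomial_pol_def by (auto simp: gbinomial_0_left)

lemma fdiffs_binomial_pol_0:
  "fdiffs \<mu> (\<lambda>\<alpha>. binomial_pol \<nu> (of_int_vec \<alpha>)) 0 = (if \<nu> = count_list \<mu> then 1 else 0)"
proof -
  have "(\<forall>i. count_list \<mu> i \<le> \<nu> i) \<and> (\<forall>i. \<nu> i - count_list \<mu> i = 0) \<longleftrightarrow> \<nu> = count_list \<mu>"
    by (auto simp: fun_eq_iff intro: antisym)
  then show ?thesis by (auto simp: fdiffs_binomial_pol binomial_pol_0)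
qed

lemma finite_multiindices: "finite {\<nu> :: 's::finite \<Rightarrow> nat. sum \<nu> UNIV = n}"
proof (rule finite_subset)
  show "{\<nu> :: 's \<Rightarrow> nat. sum \<nu> UNIV = n} \<subseteq> (UNIV \<rightarrow>\<^sub>E {..n})"
    by (auto simp: PiE_def Pi_def extensional_def intro: member_le_sum)
qed (simp add: finite_PiE)

lemma sum_count_list_UNIV: "sum (count_list \<mu>) (UNIV :: 's::finite set) = length \<mu>"
  using sum_count_set[of \<mu> UNIV] by simp

text \<open>Only the differences of exact order \<open>n\<close> are matched, by the part of the
  Newton polynomial of total degree \<open>n\<close>; lower orders are left to the recursion in the
  approximation lemma.\<close>

lemma exists_top_pol:
  fixes c :: "'s::finite seq"
  shows "\<exists>p\<in>pol (Suc n). \<forall>\<mu>. length \<mu> = n \<longrightarrow> fdiffs \<mu> (\<lambda>\<alpha>. p (of_int_vec \<alpha>)) 0 = fdiffs \<mu> c 0"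
proof -
  \<comment> \<open>Any list that represents the multi-index will do, since \<open>fdiffs\<close>
    depends on the multiset only.\<close>
  define A where "A \<nu> = fdiffs (SOME \<mu>. count_list \<mu> = \<nu>) c 0" for \<nu>
  have A: "A (count_list \<mu>) = fdiffs \<mu> c 0" for \<mu>
  proof -
    have "count_list (SOME \<mu>'. count_list \<mu>' = count_list \<mu>) = count_list \<mu>" by (rule someI[of _ \<mu>]) simp
    then have "mset (SOME \<mu>'. count_list \<mu>' = count_list \<mu>) = mset \<mu>"
      by (metis count_mset multiset_eqI)
    then show ?thesis unfolding A_def by (metis fdiffs_mset_cong)
  qed
  define M where "M = {\<nu> :: 's \<Rightarrow> nat. sum \<nu> UNIV = n}"
  define p where "p x = (\<Sum>\<nu>\<in>M. A \<nu> * binomial_pol \<nu> x)" for x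
  have "p \<in> pol (Suc n)" unfolding p_def
    by (intro pol_sum pol_scale) (use binomial_pol_in_pol in \<open>auto simp: M_def\<close>)
  moreover have "fdiffs \<mu> (\<lambda>\<alpha>. p (of_int_vec \<alpha>)) 0 = fdiffs \<mu> c 0" if "length \<mu> = n" for \<mu>
  proof -
    have "count_list \<mu> \<in> M" "finite M" using that by (auto simp: M_def sum_count_list_UNIV finite_multiindices)
    then show ?thesis
      by (simp add: p_def fdiffs_sum fdiffs_cmult fdiffs_binomial_pol_0 if_distrib sum.delta A cong: if_cong)
  qed
  ultimately show ?thesis by blast
qed

section \<open>Lattice paths, and Newton approximation with polynomially growing error\<close>

definition l1 :: "int ^ 's::finite \<Rightarrow> real" where
  "l1 \<beta> = (\<Sum>i\<in>UNIV. real_of_int \<bar>\<beta> $ i\<bar>)"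

lemma l1_nonneg: "0 \<le> l1 \<beta>" by (auto simp: l1_def intro: sum_nonneg)

lemma l1_triangle: "l1 (\<alpha> + \<beta>) \<le> l1 \<alpha> + l1 \<beta>"
  unfolding l1_def sum.distrib[symmetric] by (rule sum_mono) auto

lemma l1_minus: "l1 (- \<alpha>) = l1 \<alpha>" by (simp add: l1_def)

lemma l1_axis: "l1 (axis i 1) = 1"
  unfolding l1_def axis_def by (simp add: if_distrib sum.delta cong: if_cong)

text \<open>A shortest lattice path from \<open>\<beta>\<close> to 0 has \<open>l1 \<beta>\<close>
  unit steps and never leaves the l1 ball of \<open>\<beta>\<close>, so differences have to be
  controlled only there.\<close>

lemma path_bound:
  assumes "\<And>i \<gamma>. l1 \<gamma> \<le> l1 \<beta> \<Longrightarrow> \<bar>fdiff i g \<gamma>\<bar> \<le> M"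
  shows "\<bar>g \<beta> - g 0\<bar> \<le> M * l1 \<beta>"
  using assms
proof (induction "nat (\<Sum>i\<in>UNIV. \<bar>\<beta> $ i\<bar>)" arbitrary: \<beta> rule: less_induct)
  case less
  show ?case
  proof (cases "\<beta> = 0")
    case True
    then show ?thesis by (simp add: l1_def)
  next
    case False
    then obtain i where i: "\<beta> $ i \<noteq> 0" by (auto simp: vec_eq_iff)
    \<comment> \<open>One unit step towards the origin in a nonzero coordinate. It is a forward
      difference based at \<open>\<beta>'\<close> or at \<open>\<beta>\<close>, according to the
      sign of that coordinate.\<close>
    define \<beta>' where "\<beta>' = \<beta> - axis i (sgn (\<beta> $ i))"
    have "(\<Sum>j\<in>UNIV. \<bar>\<beta>' $ j\<bar>) = (\<Sum>j\<in>UNIV. \<bar>\<beta> $ j\<bar> - (if j = i then 1 else 0))"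
      by (rule sum.cong) (use i in \<open>auto simp: \<beta>'_def axis_def sgn_if\<close>)
    then have s: "(\<Sum>j\<in>UNIV. \<bar>\<beta>' $ j\<bar>) = (\<Sum>j\<in>UNIV. \<bar>\<beta> $ j\<bar>) - 1"
      by (simp add: sum_subtractf)
    have l: "l1 \<beta>' = l1 \<beta> - 1"
      unfolding l1_def of_int_sum[symmetric] s by simp
    have "0 \<le> (\<Sum>j\<in>UNIV. \<bar>\<beta>' $ j\<bar>)" by (rule sum_nonneg) auto
    then have "\<bar>g \<beta>' - g 0\<bar> \<le> M * l1 \<beta>'"
      using s l by (intro less.hyps less.prems) auto
    moreover have "\<bar>g \<beta> - g \<beta>'\<bar> \<le> M"
    proof (cases "\<beta> $ i > 0")
      case True
      then have "fdiff i g \<beta>' = g \<beta> - g \<beta>'" by (simp add: fdiff_def \<beta>'_def)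
      then show ?thesis using less.prems[of \<beta>' i] l by simp
    next
      case F: False
      then have "\<beta>' = \<beta> + axis i 1" using i by (simp add: \<beta>'_def vec_eq_iff axis_def sgn_if)
      then have "fdiff i g \<beta> = g \<beta>' - g \<beta>" by (simp add: fdiff_def)
      then show ?thesis using less.prems[of \<beta> i] by (simp add: abs_minus_commute)
    qed
    ultimately show ?thesis by (simp add: l algebra_simps)
  qed
qed

text \<open>The weight with exponent \<open>t\<close> is needed only to make the induction on \<open>n\<close> work.\<close>

lemma newton_approximation_weighted:
  fixes c :: "'s::finite seq"
  assumes "\<And>\<mu> \<beta>. length \<mu> = n \<Longrightarrow> \<bar>fdiffs \<mu> c \<beta>\<bar> \<le> \<delta> * (1 + l1 \<beta>) ^ t"
  shows "\<exists>p\<in>pol n. \<forall>\<beta>. \<bar>c \<beta> - p (of_int_vec \<beta>)\<bar> \<le> \<delta> * (1 + l1 \<beta>) ^ (t + n)"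
  using assms
proof (induction n arbitrary: c t)
  case 0
  from 0[of "[]"] show ?case by (intro bexI[of _ "\<lambda>x. 0"]) (auto intro: pol_zero)
next
  case (Suc n)
  obtain p where p: "p \<in> pol (Suc n)"
    "\<And>\<mu>. length \<mu> = n \<Longrightarrow> fdiffs \<mu> (\<lambda>\<alpha>. p (of_int_vec \<alpha>)) 0 = fdiffs \<mu> c 0"
    using exists_top_pol[of n c] by blast
  define c' where "c' \<beta> = c \<beta> - p (of_int_vec \<beta>)" for \<beta>
  have \<delta>: "0 \<le> \<delta>"
    using Suc.prems[of "replicate (Suc n) undefined" 0] by (simp add: l1_def del: replicate.simps)
  \<comment> \<open>Differences of order \<open>n\<close> of \<open>c'\<close> vanish at 0, and
    those of order \<open>n + 1\<close> agree with those of \<open>c\<close> because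
    \<open>p\<close> has degree at most \<open>n\<close>. Summing along a path costs one power of
    the weight.\<close>
  have "\<bar>fdiffs \<mu> c' \<beta>\<bar> \<le> \<delta> * (1 + l1 \<beta>) ^ Suc t" if "length \<mu> = n" for \<mu> \<beta>
  proof -
    have "fdiffs \<mu> c' 0 = 0" using p(2)[OF that] by (simp add: c'_def[abs_def] fdiffs_diff)
    moreover have "\<bar>fdiff i (fdiffs \<mu> c') \<gamma>\<bar> \<le> \<delta> * (1 + l1 \<beta>) ^ t" if g: "l1 \<gamma> \<le> l1 \<beta>" for i \<gamma>
    proof -
      have "fdiffs (i # \<mu>) c' \<gamma> = fdiffs (i # \<mu>) c \<gamma>"
        using fdiffs_pol_eq_0[of p "i # \<mu>" \<gamma>] p(1) \<open>length \<mu> = n\<close>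
        by (simp only: c'_def[abs_def] fdiffs_diff) simp
      then have "\<bar>fdiff i (fdiffs \<mu> c') \<gamma>\<bar> \<le> \<delta> * (1 + l1 \<gamma>) ^ t"
        using Suc.prems[of "i # \<mu>" \<gamma>] \<open>length \<mu> = n\<close> by simp
      also have "\<dots> \<le> \<delta> * (1 + l1 \<beta>) ^ t"
        using g l1_nonneg[of \<gamma>] by (intro mult_left_mono power_mono \<delta>) auto
      finally show ?thesis .
    qed
    ultimately have "\<bar>fdiffs \<mu> c' \<beta>\<bar> \<le> \<delta> * (1 + l1 \<beta>) ^ t * l1 \<beta>"
      using path_bound[of \<beta> "fdiffs \<mu> c'" "\<delta> * (1 + l1 \<beta>) ^ t"] by simp
    also have "\<dots> \<le> \<delta> * (1 + l1 \<beta>) ^ t * (1 + l1 \<beta>)"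
      using l1_nonneg[of \<beta>] \<delta> by (intro mult_left_mono) auto
    finally show ?thesis by (simp add: algebra_simps)
  qed
  from Suc.IH[OF this] obtain q where q: "q \<in> pol n"
    "\<And>\<beta>. \<bar>c' \<beta> - q (of_int_vec \<beta>)\<bar> \<le> \<delta> * (1 + l1 \<beta>) ^ (Suc t + n)" by blast
  show ?case
  proof (intro bexI allI)
    show "\<bar>c \<beta> - (p (of_int_vec \<beta>) + q (of_int_vec \<beta>))\<bar> \<le> \<delta> * (1 + l1 \<beta>) ^ (t + Suc n)" for \<beta>
      using q(2)[of \<beta>] by (simp add: c'_def diff_diff_eq)
    show "(\<lambda>x. p x + q x) \<in> pol (Suc n)" using pol_add[OF p(1) pol_Suc[OF q(1)]] .
  qed
qed

lemma newton_approximation: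
  fixes c :: "'s::finite seq"
  assumes "\<And>\<mu> \<beta>. length \<mu> = n \<Longrightarrow> \<bar>fdiffs \<mu> c \<beta>\<bar> \<le> \<delta>"
  shows "\<exists>p\<in>pol n. \<forall>\<beta>. \<bar>c \<beta> - p (of_int_vec \<beta>)\<bar> \<le> \<delta> * (1 + l1 \<beta>) ^ n"
  using newton_approximation_weighted[of n c \<delta> 0] assms by simp

section \<open>Masks with sum rules\<close>

definition ibox :: "int \<Rightarrow> int \<Rightarrow> (int ^ 's::finite) set" where
  "ibox lo hi = {\<alpha>. \<forall>i. \<alpha> $ i \<in> {lo..hi}}"

lemma vec_set_eq_image: "{x :: 'a ^ 's. \<forall>i. x $ i \<in> A i} = vec_lambda ` (PiE UNIV A)"
proof -
  have "x \<in> vec_lambda ` (PiE UNIV A)" if "\<forall>i. x $ i \<in> A i" for x :: "'a ^ 's"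
    using that by (intro image_eqI[of _ _ "vec_nth x"]) auto
  then show ?thesis by auto
qed

lemma inj_vec_lambda: "inj_on vec_lambda X"
  by (rule inj_on_inverseI[of _ vec_nth]) (simp add: vec_lambda_inverse)

lemma finite_vec_set: "(\<And>i. finite (A i)) \<Longrightarrow> finite {x :: 'a ^ 's::finite. \<forall>i. x $ i \<in> A i}"
  unfolding vec_set_eq_image by (intro finite_imageI finite_PiE) auto

text \<open>Distributivity over a box; it reduces character sums and the partition of unity of the
  hat function to one-dimensional sums.\<close>

lemma sum_vec_prod:
  fixes f :: "'s::finite \<Rightarrow> 'a \<Rightarrow> 'b::comm_semiring_1"
  assumes "\<And>i. finite (A i)"
  shows "(\<Sum>x | \<forall>i. x $ i \<in> A i. \<Prod>i\<in>UNIV. f i (x $ i)) = (\<Prod>i\<in>UNIV. \<Sum>t\<in>A i. f i t)"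
  unfolding vec_set_eq_image sum.reindex[OF inj_vec_lambda]
  by (subst prod_sum_PiE) (auto simp: assms)

lemma finite_ibox [simp]: "finite (ibox lo hi)"
  unfolding ibox_def by (rule finite_vec_set) auto

lemma supported_maskD: "supported_mask N a \<Longrightarrow> a \<alpha> \<noteq> 0 \<Longrightarrow> \<alpha> \<in> ibox 0 (int N)"
  by (auto simp: supported_mask_def ibox_def)

lemma symbol_ibox:
  assumes "supported_mask N a"
  shows "symbol a z = (\<Sum>\<alpha>\<in>ibox 0 (int N). complex_of_real (a \<alpha>) * (\<Prod>i\<in>UNIV. z $ i powi \<alpha> $ i))"
  unfolding symbol_def by (rule sum.mono_neutral_left) (use supported_maskD[OF assms] in auto)

text \<open>The coefficient produced by differentiating \<open>z^\<alpha>\<close> along the list: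
  the exponent in direction \<open>i\<close> has already dropped by
  \<open>count_list \<eta> i\<close>.\<close>

primrec falling :: "'s::finite list \<Rightarrow> int ^ 's \<Rightarrow> real" where
  "falling [] \<alpha> = 1"
| "falling (i # \<eta>) \<alpha> = real_of_int (\<alpha> $ i - int (count_list \<eta> i)) * falling \<eta> \<alpha>"

lemma c_partials_symbol:
  assumes a: "supported_mask N a" and z: "\<And>i. z $ i \<noteq> 0"
  shows "c_partials \<eta> (symbol a) z = (\<Sum>\<alpha>\<in>ibox 0 (int N).
    complex_of_real (a \<alpha> * falling \<eta> \<alpha>) * (\<Prod>i\<in>UNIV. z $ i powi (\<alpha> $ i - int (count_list \<eta> i))))"
  using z
proof (induction \<eta> arbitrary: z)
  case Nil
  then show ?case by (simp add: c_partials_def symbol_ibox[OF a])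
next
  case (Cons i \<eta>)
  define e where "e \<alpha> j = \<alpha> $ j - int (count_list \<eta> j)" for \<alpha> j
  define R where "R \<alpha> = (\<Prod>j\<in>UNIV - {i}. z $ j powi e \<alpha> j)" for \<alpha>
  have split: "(\<Prod>j\<in>UNIV. upd_vec z i w $ j powi e \<alpha> j) = w powi e \<alpha> i * R \<alpha>" for w \<alpha>
  proof -
    have "(\<Prod>j\<in>UNIV. upd_vec z i w $ j powi e \<alpha> j)
      = w powi e \<alpha> i * (\<Prod>j\<in>UNIV - {i}. upd_vec z i w $ j powi e \<alpha> j)"
      by (subst prod.remove[of _ i]) auto
    also have "(\<Prod>j\<in>UNIV - {i}. upd_vec z i w $ j powi e \<alpha> j) = R \<alpha>"
      unfolding R_def by (rule prod.cong) auto
    finally show ?thesis .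
  qed
  \<comment> \<open>The formula is known only off the coordinate hyperplanes, so the derivative is
    taken through the open set of nonzero \<open>w\<close>.\<close>
  have eq: "c_partials \<eta> (symbol a) (upd_vec z i w) = (\<Sum>\<alpha>\<in>ibox 0 (int N).
      complex_of_real (a \<alpha> * falling \<eta> \<alpha>) * (w powi e \<alpha> i * R \<alpha>))" if "w \<in> - {0}" for w
  proof -
    have "upd_vec z i w $ j \<noteq> 0" for j using that Cons.prems by simp
    from Cons.IH[of "upd_vec z i w", OF this] show ?thesis by (simp only: split flip: e_def)
  qed
  have "((\<lambda>w. c_partials \<eta> (symbol a) (upd_vec z i w)) has_field_derivative
     (\<Sum>\<alpha>\<in>ibox 0 (int N). complex_of_real (a \<alpha> * falling \<eta> \<alpha>) *
       (of_int (e \<alpha> i) * (z $ i) powi (e \<alpha> i - 1) * R \<alpha>))) (at (z $ i))"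
  proof (rule has_field_derivative_transform_within_open)
    show "((\<lambda>w. \<Sum>\<alpha>\<in>ibox 0 (int N). complex_of_real (a \<alpha> * falling \<eta> \<alpha>) * (w powi e \<alpha> i * R \<alpha>))
      has_field_derivative (\<Sum>\<alpha>\<in>ibox 0 (int N). complex_of_real (a \<alpha> * falling \<eta> \<alpha>) *
       (of_int (e \<alpha> i) * (z $ i) powi (e \<alpha> i - 1) * R \<alpha>))) (at (z $ i))"
      using Cons.prems[of i] by (auto intro!: derivative_eq_intros sum.cong)
    show "z $ i \<in> - {0}" using Cons.prems[of i] by simp
  qed (use eq in \<open>auto simp: open_delete\<close>)
  then have "c_partials (i # \<eta>) (symbol a) z = (\<Sum>\<alpha>\<in>ibox 0 (int N). complex_of_real (a \<alpha> * falling \<eta> \<alpha>) *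
       (of_int (e \<alpha> i) * (z $ i) powi (e \<alpha> i - 1) * R \<alpha>))"
    unfolding c_partials_def by (simp add: cpartial_def DERIV_imp_deriv)
  also have "\<dots> = (\<Sum>\<alpha>\<in>ibox 0 (int N). complex_of_real (a \<alpha> * falling (i # \<eta>) \<alpha>) *
      (\<Prod>j\<in>UNIV. z $ j powi (\<alpha> $ j - int (count_list (i # \<eta>) j))))"
  proof (rule sum.cong)
    fix \<alpha> :: "int ^ 'a"
    have "(\<Prod>j\<in>UNIV. z $ j powi (\<alpha> $ j - int (count_list (i # \<eta>) j)))
      = z $ i powi (e \<alpha> i - 1) * (\<Prod>j\<in>UNIV - {i}. z $ j powi (\<alpha> $ j - int (count_list (i # \<eta>) j)))"
      by (subst prod.remove[of _ i]) (auto simp: e_def algebra_simps)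
    also have "(\<Prod>j\<in>UNIV - {i}. z $ j powi (\<alpha> $ j - int (count_list (i # \<eta>) j))) = R \<alpha>"
      unfolding R_def by (rule prod.cong) (auto simp: e_def)
    finally show "complex_of_real (a \<alpha> * falling \<eta> \<alpha>) *
       (of_int (e \<alpha> i) * (z $ i) powi (e \<alpha> i - 1) * R \<alpha>) = complex_of_real (a \<alpha> * falling (i # \<eta>) \<alpha>) *
      (\<Prod>j\<in>UNIV. z $ j powi (\<alpha> $ j - int (count_list (i # \<eta>) j)))"
      by (simp add: e_def)
  qed simp
  finally show ?case .
qed

text \<open>Falling factorials span all polynomials: a coordinate times
  \<open>falling \<eta>\<close> is \<open>falling (i # \<eta>)\<close> plus a multiple of
  \<open>falling \<eta>\<close>. Thus vanishing derivatives of the symbol become vanishing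
  moments.\<close>

lemma falling_span:
  fixes X :: "(int ^ 's::finite) set"
  assumes van: "\<And>\<eta>. length \<eta> \<le> l \<Longrightarrow> (\<Sum>\<alpha>\<in>X. complex_of_real (falling \<eta> \<alpha>) * C \<alpha>) = 0"
    and p: "p \<in> pol (Suc l)"
  shows "(\<Sum>\<alpha>\<in>X. complex_of_real (p (of_int_vec \<alpha>)) * C \<alpha>) = 0"
proof -
  have "\<And>\<eta>. length \<eta> + d \<le> Suc l \<Longrightarrow>
      (\<Sum>\<alpha>\<in>X. complex_of_real (falling \<eta> \<alpha> * p (of_int_vec \<alpha>)) * C \<alpha>) = 0" if "p \<in> pol d" for p d
    using that
  proof (induction rule: pol_induct)
    case (const d c)
    have "(\<Sum>\<alpha>\<in>X. complex_of_real (falling \<eta> \<alpha> * c) * C \<alpha>)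
      = complex_of_real c * (\<Sum>\<alpha>\<in>X. complex_of_real (falling \<eta> \<alpha>) * C \<alpha>)"
      by (simp add: sum_distrib_left algebra_simps)
    then show ?case using van const by simp
  next
    case (mult d p i)
    have "falling \<eta> \<alpha> * (of_int_vec \<alpha> $ i * p (of_int_vec \<alpha>))
      = falling (i # \<eta>) \<alpha> * p (of_int_vec \<alpha>)
        + real (count_list \<eta> i) * (falling \<eta> \<alpha> * p (of_int_vec \<alpha>))" for \<alpha>
      by (simp add: algebra_simps)
    then have "(\<Sum>\<alpha>\<in>X. complex_of_real (falling \<eta> \<alpha> * (of_int_vec \<alpha> $ i * p (of_int_vec \<alpha>))) * C \<alpha>)
      = (\<Sum>\<alpha>\<in>X. complex_of_real (falling (i # \<eta>) \<alpha> * p (of_int_vec \<alpha>)) * C \<alpha>)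
       + of_nat (count_list \<eta> i) * (\<Sum>\<alpha>\<in>X. complex_of_real (falling \<eta> \<alpha> * p (of_int_vec \<alpha>)) * C \<alpha>)"
      by (simp add: sum_distrib_left sum.distrib[symmetric] algebra_simps)
    then show ?case using mult.IH[of "i # \<eta>"] mult.IH[of \<eta>] mult.prems by simp
  qed (simp_all add: algebra_simps sum.distrib)
  from this[OF p, of "[]"] show ?thesis by simp
qed

section \<open>Characters at the points of \<open>Xi m\<close>, and the sum rules as coset
  conditions\<close>

definition character :: "nat \<Rightarrow> int ^ 's \<Rightarrow> int ^ 's::finite \<Rightarrow> complex" where
  "character m \<delta> \<alpha> = (\<Prod>i\<in>UNIV. exp (- \<i> * (2 * pi / real m) * of_int (\<delta> $ i)) powi (\<alpha> $ i))"

lemma character_diff: "character m \<delta> (\<alpha> - \<beta>) = character m \<delta> \<alpha> * character m \<delta> (- \<beta>)"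
proof -
  have "x powi (\<alpha> $ i - \<beta> $ i) = x powi (\<alpha> $ i) * x powi (- \<beta> $ i)" if "x \<noteq> 0" for x :: complex and i
    using power_int_add[of x "\<alpha> $ i" "- \<beta> $ i"] that by simp
  then show ?thesis
    unfolding character_def prod.distrib[symmetric] by (intro prod.cong) auto
qed

lemma exp_root_unity:
  assumes "m > 0" "exp (- \<i> * (2 * pi / real m) * of_int n) = 1"
  shows "int m dvd n"
proof -
  obtain k :: int where k: "- (2 * pi / real m * real_of_int n) = real_of_int (2 * k) * pi"
    using assms(2) unfolding exp_eq_1 by auto
  then have "pi * real_of_int (- n) = pi * real_of_int (k * int m)" using assms(1) by (simp add: field_simps)
  then have "real_of_int (- n) = real_of_int (k * int m)" by (simp only: mult_cancel_left pi_neq_zero) simp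
  then have "- n = k * int m" by linarith
  then show ?thesis by (metis dvd_minus_iff dvd_triv_right)
qed

text \<open>Either every summand is 1, or the sum is a full geometric sum of a nontrivial
  \<open>m\<close>-th root of unity and vanishes.\<close>

lemma geometric_root_sum:
  assumes "m > 0"
  shows "(\<Sum>t\<in>{0..<int m}. exp (- \<i> * (2 * pi / real m) * of_int t) powi n)
    = (if int m dvd n then of_nat m else 0)"
proof -
  define \<omega> where "\<omega> = exp (- \<i> * (2 * pi / real m) * of_int n)"
  have t: "exp (- \<i> * (2 * pi / real m) * of_int (int t)) powi n = \<omega> ^ t" for t :: nat
    unfolding \<omega>_def exp_power_int exp_of_nat_mult[symmetric] by (simp add: algebra_simps)
  have "(\<Sum>t\<in>{0..<int m}. exp (- \<i> * (2 * pi / real m) * of_int t) powi n) = (\<Sum>t<m. \<omega> ^ t)"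
    by (rule sum.reindex_bij_witness[of _ int nat]) (auto simp: t[symmetric])
  also have "\<dots> = (if int m dvd n then of_nat m else 0)"
  proof (cases "int m dvd n")
    case True
    then obtain k where "n = int m * k" by auto
    then have "\<omega> = exp (2 * of_int (- k) * of_real pi * \<i>)" using assms by (simp add: \<omega>_def algebra_simps)
    also have "\<dots> = 1" by (subst exp_eq_1) (auto intro!: exI[of _ "- k"])
    finally show ?thesis using True by simp
  next
    case False
    have "\<omega> \<noteq> 1" using exp_root_unity[OF assms, of n] False unfolding \<omega>_def by blast
    moreover have "\<omega> ^ m = 1"
    proof -
      have "\<omega> ^ m = exp (2 * of_int (- n) * of_real pi * \<i>)"
        using assms by (simp add: \<omega>_def exp_of_nat_mult[symmetric] algebra_simps)
      also have "\<dots> = 1" by (subst exp_eq_1) (auto intro!: exI[of _ "- n"])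
      finally show ?thesis .
    qed
    ultimately show ?thesis using False by (simp add: sum_gp_strict)
  qed
  finally show ?thesis .
qed

text \<open>Orthogonality of characters: up to the factor \<open>m^s\<close>, summation over
  \<open>digits m\<close> is the indicator of the sublattice \<open>m Z^s\<close>.\<close>

lemma character_sum:
  assumes "m > 0"
  shows "(\<Sum>\<delta>\<in>digits m. character m \<delta> (n :: int ^ 's::finite))
     = (if \<forall>i. int m dvd n $ i then of_nat m ^ CARD('s) else 0)"
proof -
  have "(\<Sum>\<delta>\<in>digits m. character m \<delta> n)
    = (\<Prod>i\<in>UNIV. \<Sum>t\<in>{0..<int m}. exp (- \<i> * (2 * pi / real m) * of_int t) powi (n $ i))"
    unfolding digits_def character_def
    by (rule sum_vec_prod[of "\<lambda>i. {0..<int m}" "\<lambda>i t. exp (- \<i> * (2 * pi / real m) * of_int t) powi (n $ i)"]) simp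
  also have "\<dots> = (\<Prod>i\<in>(UNIV :: 's set). if int m dvd n $ i then of_nat m else 0)"
    by (simp only: geometric_root_sum[OF assms])
  finally show ?thesis by auto
qed

text \<open>The sum rules without derivatives: every coset of \<open>m Z^s\<close> carries the same
  share of each moment of degree at most \<open>l\<close>. In this form they are finite linear
  identities, hence stable under pointwise limits, and they say directly how polynomials are
  subdivided.\<close>

definition regular_mask :: "nat \<Rightarrow> nat \<Rightarrow> nat \<Rightarrow> ('s::finite) seq \<Rightarrow> bool" where
  "regular_mask m N l a \<longleftrightarrow> supported_mask N a \<and>
    (\<forall>p\<in>pol (Suc l). \<forall>\<epsilon>.
      (\<Sum>\<alpha> | \<alpha> \<in> ibox 0 (int N) \<and> (\<forall>i. int m dvd (\<alpha> - \<epsilon>) $ i). a \<alpha> * p (of_int_vec \<alpha>))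
        = (\<Sum>\<alpha>\<in>ibox 0 (int N). a \<alpha> * p (of_int_vec \<alpha>)) / real m ^ CARD('s)) \<and>
    (\<Sum>\<alpha>\<in>ibox 0 (int N). a \<alpha>) = real m ^ CARD('s)"

lemma finite_digits [simp]: "finite (digits m :: (int ^ 's::finite) set)"
  unfolding digits_def by (rule finite_vec_set) auto

text \<open>A derivative of the symbol at a point of \<open>Xi m\<close> is a falling-factorial
  moment against the character, times a nonzero monomial in that point; \<open>falling_span\<close>
  then reaches all polynomials.\<close>

lemma sum_rules_vanishing:
  fixes a :: "('s::finite) seq"
  assumes m: "m > 0" and a: "supported_mask N a" and sr: "sum_rules m l a"
    and \<delta>: "\<delta> \<in> digits m" "\<delta> \<noteq> 0" and p: "p \<in> pol (Suc l)"
  shows "(\<Sum>\<alpha>\<in>ibox 0 (int N). complex_of_real (a \<alpha> * p (of_int_vec \<alpha>)) * character m \<delta> \<alpha>) = 0"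
proof -
  define \<xi> :: "complex ^ 's" where "\<xi> = (\<chi> i. exp (- \<i> * (2 * pi / real m) * of_int (\<delta> $ i)))"
  have nz: "\<xi> $ i \<noteq> 0" for i by (simp add: \<xi>_def)
  have "\<xi> \<noteq> 1"
  proof
    assume "\<xi> = 1"
    obtain i where i: "\<delta> $ i \<noteq> 0" using \<delta>(2) by (auto simp: vec_eq_iff)
    have "\<xi> $ i = 1" using \<open>\<xi> = 1\<close> by simp
    then have "int m dvd \<delta> $ i" unfolding \<xi>_def vec_lambda_beta by (rule exp_root_unity[OF m])
    moreover have "0 \<le> \<delta> $ i" "\<delta> $ i < int m" using \<delta>(1) by (auto simp: digits_def)
    ultimately show False using i zdvd_not_zless by fastforce
  qed
  moreover have "\<xi> \<in> Xi m" unfolding Xi_def \<xi>_def using \<delta>(1) by blast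
  ultimately have cp: "c_partials \<eta> (symbol a) \<xi> = 0" if "length \<eta> \<le> l" for \<eta>
    using sr that unfolding sum_rules_def by blast
  have "(\<Sum>\<alpha>\<in>ibox 0 (int N). complex_of_real (falling \<eta> \<alpha>) * (complex_of_real (a \<alpha>) * character m \<delta> \<alpha>)) = 0"
    if \<eta>: "length \<eta> \<le> l" for \<eta>
  proof -
    have "(\<Prod>i\<in>UNIV. \<xi> $ i powi (\<alpha> $ i - int (count_list \<eta> i)))
       = character m \<delta> \<alpha> * (\<Prod>i\<in>UNIV. \<xi> $ i powi (- int (count_list \<eta> i)))" for \<alpha>
    proof -
      have "\<xi> $ i powi (\<alpha> $ i - int (count_list \<eta> i)) = \<xi> $ i powi (\<alpha> $ i) * \<xi> $ i powi (- int (count_list \<eta> i))" for i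
        using power_int_add[of "\<xi> $ i" "\<alpha> $ i" "- int (count_list \<eta> i)"] nz[of i] by simp
      then show ?thesis by (simp add: character_def prod.distrib \<xi>_def)
    qed
    then have "c_partials \<eta> (symbol a) \<xi>
      = (\<Sum>\<alpha>\<in>ibox 0 (int N). complex_of_real (falling \<eta> \<alpha>) * (complex_of_real (a \<alpha>) * character m \<delta> \<alpha>))
        * (\<Prod>i\<in>UNIV. \<xi> $ i powi (- int (count_list \<eta> i)))"
      unfolding c_partials_symbol[OF a nz] sum_distrib_right by (intro sum.cong) simp_all
    moreover have "(\<Prod>i\<in>UNIV. \<xi> $ i powi (- int (count_list \<eta> i))) \<noteq> 0"
    proof -
      have "\<xi> $ i powi e \<noteq> 0" for i e using nz[of i] by (simp add: power_int_eq_0_iff)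
      then show ?thesis unfolding prod_zero_iff[OF finite] by blast
    qed
    ultimately show ?thesis unfolding cp[OF \<eta>] by (simp only: eq_commute[of 0] mult_eq_0_iff simp_thms)
  qed
  from falling_span[OF this p] show ?thesis by (simp add: ac_simps)
qed

lemma zero_in_digits: "m > 0 \<Longrightarrow> 0 \<in> digits m"
  by (simp add: digits_def)

lemma regular_maskI:
  fixes a :: "('s::finite) seq"
  assumes m: "m > 0" and a: "supported_mask N a" and sr: "sum_rules m l a"
  shows "regular_mask m N l a"
  unfolding regular_mask_def
proof (intro conjI ballI allI)
  show "supported_mask N a" by (rule a)
  have "complex_of_real (\<Sum>\<alpha>\<in>ibox 0 (int N). a \<alpha>) = symbol a 1"
    by (simp add: symbol_ibox[OF a])
  also have "\<dots> = complex_of_real (real m ^ CARD('s))" using sr by (simp add: sum_rules_def)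
  finally show "(\<Sum>\<alpha>\<in>ibox 0 (int N). a \<alpha>) = real m ^ CARD('s)" by (simp only: of_real_eq_iff)
next
  fix p :: "real ^ 's \<Rightarrow> real" and \<epsilon> :: "int ^ 's" assume p: "p \<in> pol (Suc l)"
  let ?B = "ibox 0 (int N) :: (int ^ 's) set"
  let ?f = "\<lambda>\<alpha>. complex_of_real (a \<alpha> * p (of_int_vec \<alpha>))"
  let ?M = "complex_of_real (real m ^ CARD('s))"
  have M: "?M \<noteq> 0" using m by simp
  \<comment> \<open>Finite Fourier inversion: the coset indicator becomes a character sum, and every
    nontrivial character contributes 0 by the sum rules.\<close>
  have "?M * (\<Sum>\<alpha> | \<alpha> \<in> ?B \<and> (\<forall>i. int m dvd (\<alpha> - \<epsilon>) $ i). ?f \<alpha>)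
      = (\<Sum>\<alpha>\<in>?B. ?f \<alpha> * (if \<forall>i. int m dvd (\<alpha> - \<epsilon>) $ i then of_nat m ^ CARD('s) else 0))"
    unfolding sum_distrib_left by (rule sum.mono_neutral_cong_left) auto
  also have "\<dots> = (\<Sum>\<alpha>\<in>?B. \<Sum>\<delta>\<in>digits m. ?f \<alpha> * character m \<delta> (\<alpha> - \<epsilon>))"
    by (simp only: character_sum[OF m, symmetric] sum_distrib_left)
  also have "\<dots> = (\<Sum>\<delta>\<in>digits m. character m \<delta> (- \<epsilon>) * (\<Sum>\<alpha>\<in>?B. ?f \<alpha> * character m \<delta> \<alpha>))"
    unfolding sum.swap[of _ ?B] sum_distrib_left by (simp add: character_diff algebra_simps)
  also have "\<dots> = (\<Sum>\<delta>\<in>(digits m :: (int ^ 's) set). if \<delta> = 0 then (\<Sum>\<alpha>\<in>?B. ?f \<alpha>) else 0)"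
  proof (rule sum.cong[OF refl])
    fix \<delta> :: "int ^ 's" assume "\<delta> \<in> digits m"
    then show "character m \<delta> (- \<epsilon>) * (\<Sum>\<alpha>\<in>?B. ?f \<alpha> * character m \<delta> \<alpha>) = (if \<delta> = 0 then (\<Sum>\<alpha>\<in>?B. ?f \<alpha>) else 0)"
      using sum_rules_vanishing[OF m a sr _ _ p, of \<delta>] by (auto simp: character_def)
  qed
  also have "\<dots> = (\<Sum>\<alpha>\<in>?B. ?f \<alpha>)" by (simp add: zero_in_digits[OF m] sum.delta')
  finally have "complex_of_real (\<Sum>\<alpha> | \<alpha> \<in> ?B \<and> (\<forall>i. int m dvd (\<alpha> - \<epsilon>) $ i). a \<alpha> * p (of_int_vec \<alpha>))
    = complex_of_real ((\<Sum>\<alpha>\<in>?B. a \<alpha> * p (of_int_vec \<alpha>)) / real m ^ CARD('s))"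
    using M by (simp add: field_simps)
  then show "(\<Sum>\<alpha> | \<alpha> \<in> ?B \<and> (\<forall>i. int m dvd (\<alpha> - \<epsilon>) $ i). a \<alpha> * p (of_int_vec \<alpha>))
     = (\<Sum>\<alpha>\<in>?B. a \<alpha> * p (of_int_vec \<alpha>)) / real m ^ CARD('s)"
    by (simp only: of_real_eq_iff)
qed

lemma regular_mask_limit:
  fixes a :: "nat \<Rightarrow> ('s::finite) seq"
  assumes "\<And>k. regular_mask m N l (a k)" and lim: "\<And>\<alpha>. (\<lambda>k. a k \<alpha>) \<longlonglongrightarrow> p \<alpha>"
  shows "regular_mask m N l p"
  unfolding regular_mask_def supported_mask_def
proof (intro conjI ballI allI impI)
  note reg = assms(1)[unfolded regular_mask_def]
  fix \<alpha> :: "int ^ 's" and i assume "p \<alpha> \<noteq> 0"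
  have "\<exists>k. a k \<alpha> \<noteq> 0"
  proof (rule ccontr)
    assume "\<nexists>k. a k \<alpha> \<noteq> 0"
    then have "(\<lambda>k. a k \<alpha>) = (\<lambda>k. 0)" by auto
    then show False using lim[of \<alpha>] \<open>p \<alpha> \<noteq> 0\<close> by (simp add: tendsto_const_iff)
  qed
  then show "\<alpha> $ i \<in> {0..int N}" using reg by (auto simp: supported_mask_def)
next
  note reg = assms(1)[unfolded regular_mask_def]
  fix q :: "real ^ 's \<Rightarrow> real" and \<epsilon> :: "int ^ 's" assume q: "q \<in> pol (Suc l)"
  let ?B = "ibox 0 (int N) :: (int ^ 's) set" and ?C = "{\<alpha>. \<alpha> \<in> ibox 0 (int N) \<and> (\<forall>i. int m dvd (\<alpha> - \<epsilon>) $ i)}"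
  have A: "(\<lambda>k. \<Sum>\<alpha>\<in>?C. a k \<alpha> * q (of_int_vec \<alpha>)) \<longlonglongrightarrow> (\<Sum>\<alpha>\<in>?C. p \<alpha> * q (of_int_vec \<alpha>))"
    by (intro tendsto_intros lim)
  have B: "(\<lambda>k. (\<Sum>\<alpha>\<in>?B. a k \<alpha> * q (of_int_vec \<alpha>)) / real m ^ CARD('s))
      \<longlonglongrightarrow> (\<Sum>\<alpha>\<in>?B. p \<alpha> * q (of_int_vec \<alpha>)) / real m ^ CARD('s)"
    unfolding divide_inverse by (intro tendsto_intros lim)
  show "(\<Sum>\<alpha>\<in>?C. p \<alpha> * q (of_int_vec \<alpha>)) = (\<Sum>\<alpha>\<in>?B. p \<alpha> * q (of_int_vec \<alpha>)) / real m ^ CARD('s)"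
  proof (rule LIMSEQ_unique[OF _ _])
    have "(\<Sum>\<alpha>\<in>?C. a k \<alpha> * q (of_int_vec \<alpha>)) = (\<Sum>\<alpha>\<in>?B. a k \<alpha> * q (of_int_vec \<alpha>)) / real m ^ CARD('s)" for k
      using reg q by blast
    then show "(\<lambda>k. (\<Sum>\<alpha>\<in>?B. a k \<alpha> * q (of_int_vec \<alpha>)) / real m ^ CARD('s))
      \<longlonglongrightarrow> (\<Sum>\<alpha>\<in>?C. p \<alpha> * q (of_int_vec \<alpha>))" using A by simp
  qed (rule B)
next
  have "(\<lambda>k. \<Sum>\<alpha>\<in>ibox 0 (int N). a k \<alpha>) \<longlonglongrightarrow> (\<Sum>\<alpha>\<in>ibox 0 (int N). p \<alpha>)" by (intro tendsto_intros lim)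
  moreover have "(\<Sum>\<alpha>\<in>ibox 0 (int N). a k \<alpha>) = real m ^ CARD('s)" for k
    using assms(1) by (simp add: regular_mask_def)
  ultimately show "(\<Sum>\<alpha>\<in>ibox 0 (int N). p \<alpha>) = real m ^ CARD('s)" by (simp add: tendsto_const_iff)
qed

subsection \<open>Subdivision and transition operators\<close>

lemma inj_dilate: "m > 0 \<Longrightarrow> inj (\<lambda>\<beta>. \<alpha> - int m *s (\<beta> :: int ^ 's))"
  by (auto simp: inj_on_def vec_eq_iff)

lemma subdivision_eq:
  assumes "finite F" "\<And>\<beta>. a (\<alpha> - int m *s \<beta>) \<noteq> 0 \<Longrightarrow> \<beta> \<in> F"
  shows "subdivision m a c \<alpha> = (\<Sum>\<beta>\<in>F. a (\<alpha> - int m *s \<beta>) * c \<beta>)"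
  unfolding subdivision_def by (rule sum.mono_neutral_left) (use assms in auto)

text \<open>Substituting \<open>\<gamma> = \<alpha> - m \<beta>\<close> turns the sum over
  \<open>\<beta>\<close> into one over the coset of \<open>\<alpha>\<close>, the form to which coset
  moments and \<open>pol_average\<close> apply.\<close>

lemma subdivision_coset:
  fixes a :: "'s::finite seq"
  assumes m: "m > 0" and a: "supported_mask N a"
  shows "subdivision m a (\<lambda>\<alpha>. f (of_int_vec \<alpha>)) \<alpha>
    = (\<Sum>\<gamma> | \<gamma> \<in> ibox 0 (int N) \<and> (\<forall>i. int m dvd (\<gamma> - \<alpha>) $ i).
         a \<gamma> * f ((1 / real m) *\<^sub>R of_int_vec \<alpha> - (1 / real m) *\<^sub>R of_int_vec \<gamma>))"
proof -
  let ?F = "{\<beta>. \<alpha> - int m *s \<beta> \<in> ibox 0 (int N)}"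
  have fin: "finite ?F"
    using finite_vimageI[OF finite_ibox inj_dilate[OF m, of \<alpha>]] by (simp add: vimage_def)
  have "subdivision m a (\<lambda>\<alpha>. f (of_int_vec \<alpha>)) \<alpha> = (\<Sum>\<beta>\<in>?F. a (\<alpha> - int m *s \<beta>) * f (of_int_vec \<beta>))"
    by (rule subdivision_eq[OF fin]) (use supported_maskD[OF a] in auto)
  also have "\<dots> = (\<Sum>\<gamma> | \<gamma> \<in> ibox 0 (int N) \<and> (\<forall>i. int m dvd (\<gamma> - \<alpha>) $ i).
         a \<gamma> * f ((1 / real m) *\<^sub>R of_int_vec \<alpha> - (1 / real m) *\<^sub>R of_int_vec \<gamma>))"
  proof (rule sum.reindex_bij_witness[of _ "\<lambda>\<gamma>. \<chi> i. (\<alpha> $ i - \<gamma> $ i) div int m" "\<lambda>\<beta>. \<alpha> - int m *s \<beta>"])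
    fix \<beta> assume \<beta>: "\<beta> \<in> ?F"
    show "(\<chi> i. (\<alpha> $ i - (\<alpha> - int m *s \<beta>) $ i) div int m) = \<beta>" using m by (simp add: vec_eq_iff)
    show "\<alpha> - int m *s \<beta> \<in> {\<gamma> \<in> ibox 0 (int N). \<forall>i. int m dvd (\<gamma> - \<alpha>) $ i}" using \<beta> by simp
    have "(1 / real m) *\<^sub>R of_int_vec \<alpha> - (1 / real m) *\<^sub>R of_int_vec (\<alpha> - int m *s \<beta>) = of_int_vec \<beta>"
      using m by (simp add: vec_eq_iff field_simps)
    then show "a (\<alpha> - int m *s \<beta>) * f ((1 / real m) *\<^sub>R of_int_vec \<alpha> - (1 / real m) *\<^sub>R of_int_vec (\<alpha> - int m *s \<beta>))
      = a (\<alpha> - int m *s \<beta>) * f (of_int_vec \<beta>)" by simp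
  next
    fix \<gamma> assume \<gamma>: "\<gamma> \<in> {\<gamma> \<in> ibox 0 (int N). \<forall>i. int m dvd (\<gamma> - \<alpha>) $ i}"
    have "int m dvd \<alpha> $ i - \<gamma> $ i" for i using \<gamma> by (simp add: dvd_diff_commute)
    then show *: "\<alpha> - int m *s (\<chi> i. (\<alpha> $ i - \<gamma> $ i) div int m) = \<gamma>" by (simp add: vec_eq_iff)
    then show "(\<chi> i. (\<alpha> $ i - \<gamma> $ i) div int m) \<in> ?F" using \<gamma> by simp
  qed
  finally show ?thesis .
qed

text \<open>The coset sums act as an average with constant moments, so on the finer grid the leading
  part of \<open>p\<close> survives unchanged and only lower degrees are altered.\<close>

lemma subdivision_pol:
  fixes a :: "'s::finite seq"
  assumes m: "m > 0" and a: "regular_mask m N l a" and p: "p \<in> pol (Suc d)" "d \<le> l"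
  shows "\<exists>q\<in>pol d. \<forall>\<alpha>. subdivision m a (\<lambda>\<alpha>. p (of_int_vec \<alpha>)) \<alpha>
    = p ((1 / real m) *\<^sub>R of_int_vec \<alpha>) + q ((1 / real m) *\<^sub>R of_int_vec \<alpha>)"
proof -
  let ?B = "ibox 0 (int N) :: (int ^ 's) set" and ?M = "real m ^ CARD('s)"
  have sup: "supported_mask N a" using a by (simp add: regular_mask_def)
  have "\<exists>q\<in>pol d. \<forall>\<alpha>\<in>UNIV. (\<Sum>\<gamma> | \<gamma> \<in> ?B \<and> (\<forall>i. int m dvd (\<gamma> - \<alpha>) $ i).
         a \<gamma> * p ((1 / real m) *\<^sub>R of_int_vec \<alpha> - (1 / real m) *\<^sub>R of_int_vec \<gamma>))
       = p ((1 / real m) *\<^sub>R of_int_vec \<alpha>) + q ((1 / real m) *\<^sub>R of_int_vec \<alpha>)"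
  proof (rule pol_average[OF _ p])
    fix r :: "real ^ 's \<Rightarrow> real" and \<alpha> :: "int ^ 's" assume "r \<in> pol (Suc l)"
    from pol_affine[OF this, of 0 "1 / real m"]
    show "(\<Sum>\<gamma> | \<gamma> \<in> ?B \<and> (\<forall>i. int m dvd (\<gamma> - \<alpha>) $ i). a \<gamma> * r ((1 / real m) *\<^sub>R of_int_vec \<gamma>))
      = (\<lambda>r. (\<Sum>\<gamma>\<in>?B. a \<gamma> * r ((1 / real m) *\<^sub>R of_int_vec \<gamma>)) / ?M) r"
      using a unfolding regular_mask_def by auto
  next
    show "(\<lambda>r. (\<Sum>\<gamma>\<in>?B. a \<gamma> * r ((1 / real m) *\<^sub>R of_int_vec \<gamma>)) / ?M) (\<lambda>x. 1) = 1"
      using a m by (simp add: regular_mask_def)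
  qed
  then show ?thesis unfolding subdivision_coset[OF m sup] by simp
qed

text \<open>Iterating this pairing turns iterated subdivision into products of transition operators.\<close>

lemma subdivision_pairing:
  assumes fin: "finite X" "finite X'"
    and X': "\<And>\<alpha> \<beta>. \<alpha> \<in> X \<Longrightarrow> a (\<epsilon> + int m *s \<beta> - \<alpha>) \<noteq> 0 \<Longrightarrow> \<beta> \<in> X'"
  shows "(\<Sum>\<alpha>\<in>X. w \<alpha> * subdivision m a c (int m *s \<gamma> + \<epsilon> - \<alpha>))
    = (\<Sum>\<beta>\<in>X'. (\<Sum>\<alpha>\<in>X. a (\<epsilon> + int m *s \<beta> - \<alpha>) * w \<alpha>) * c (\<gamma> - \<beta>))"
proof -
  have "subdivision m a c (int m *s \<gamma> + \<epsilon> - \<alpha>) = (\<Sum>\<beta>\<in>X'. a (\<epsilon> + int m *s \<beta> - \<alpha>) * c (\<gamma> - \<beta>))"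
    if "\<alpha> \<in> X" for \<alpha>
  proof -
    have eq: "int m *s \<gamma> + \<epsilon> - \<alpha> - int m *s (\<gamma> - \<beta>) = \<epsilon> + int m *s \<beta> - \<alpha>" for \<beta>
      by (simp add: vec_eq_iff algebra_simps)
    have inj: "inj_on (\<lambda>\<beta>. \<gamma> - \<beta>) X'" by (simp add: inj_on_def)
    have "subdivision m a c (int m *s \<gamma> + \<epsilon> - \<alpha>)
      = (\<Sum>\<beta>\<in>(\<lambda>\<beta>. \<gamma> - \<beta>) ` X'. a (int m *s \<gamma> + \<epsilon> - \<alpha> - int m *s \<beta>) * c \<beta>)"
    proof (rule subdivision_eq)
      fix \<beta> assume "a (int m *s \<gamma> + \<epsilon> - \<alpha> - int m *s \<beta>) \<noteq> 0"
      then have "a (\<epsilon> + int m *s (\<gamma> - \<beta>) - \<alpha>) \<noteq> 0" unfolding eq[of "\<gamma> - \<beta>", symmetric] by simp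
      then have "\<gamma> - \<beta> \<in> X'" by (rule X'[OF that])
      then show "\<beta> \<in> (\<lambda>\<beta>. \<gamma> - \<beta>) ` X'" by (intro image_eqI[of _ _ "\<gamma> - \<beta>"]) auto
    qed (use fin in simp)
    also have "\<dots> = (\<Sum>\<beta>\<in>X'. a (\<epsilon> + int m *s \<beta> - \<alpha>) * c (\<gamma> - \<beta>))"
      unfolding sum.reindex[OF inj] comp_def eq ..
    finally show ?thesis .
  qed
  then have "(\<Sum>\<alpha>\<in>X. w \<alpha> * subdivision m a c (int m *s \<gamma> + \<epsilon> - \<alpha>))
    = (\<Sum>\<alpha>\<in>X. \<Sum>\<beta>\<in>X'. a (\<epsilon> + int m *s \<beta> - \<alpha>) * w \<alpha> * c (\<gamma> - \<beta>))"
    by (simp add: sum_distrib_left algebra_simps)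
  also have "\<dots> = (\<Sum>\<beta>\<in>X'. (\<Sum>\<alpha>\<in>X. a (\<epsilon> + int m *s \<beta> - \<alpha>) * w \<alpha>) * c (\<gamma> - \<beta>))"
    by (subst sum.swap) (simp add: sum_distrib_right)
  finally show ?thesis .
qed

definition annihilates :: "nat \<Rightarrow> (int ^ 's::finite) set \<Rightarrow> 's seq \<Rightarrow> bool" where
  "annihilates l X w \<longleftrightarrow> (\<forall>p\<in>pol (Suc l). (\<Sum>\<alpha>\<in>X. w \<alpha> * p (of_int_vec \<alpha>)) = 0)"

text \<open>The new weights are the adjoint of subdivision applied to \<open>w\<close>; since
  subdivision sends polynomials of degree at most \<open>l\<close> to samples of such polynomials,
  the annihilation is inherited.\<close>

lemma annihilates_step:
  fixes a :: "'s::finite seq"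
  assumes m: "m > 0" and a: "regular_mask m N l a" and w: "annihilates l X w"
    and fin: "finite X" "finite X'"
    and X': "\<And>\<alpha> \<beta>. \<alpha> \<in> X \<Longrightarrow> a (\<epsilon> + int m *s \<beta> - \<alpha>) \<noteq> 0 \<Longrightarrow> \<beta> \<in> X'"
  shows "annihilates l X' (\<lambda>\<beta>. \<Sum>\<alpha>\<in>X. a (\<epsilon> + int m *s \<beta> - \<alpha>) * w \<alpha>)"
  unfolding annihilates_def
proof
  fix p :: "real ^ 's \<Rightarrow> real" assume p: "p \<in> pol (Suc l)"
  \<comment> \<open>The pairing evaluates data at \<open>\<gamma> - \<beta>\<close>, hence the
    reflection; it is used with \<open>\<gamma> = 0\<close>.\<close>
  have "(\<lambda>x. p (- x)) \<in> pol (Suc l)" using pol_affine[OF p, of 0 "-1"] by simp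
  from subdivision_pol[OF m a this order.refl] obtain q where q: "q \<in> pol l"
    "\<And>\<alpha>. subdivision m a (\<lambda>\<alpha>. p (- of_int_vec \<alpha>)) \<alpha>
      = p (- ((1 / real m) *\<^sub>R of_int_vec \<alpha>)) + q ((1 / real m) *\<^sub>R of_int_vec \<alpha>)" by auto
  let ?r = "\<lambda>x. p ((-1 / real m) *\<^sub>R of_int_vec \<epsilon> + (1 / real m) *\<^sub>R x) + q ((1 / real m) *\<^sub>R of_int_vec \<epsilon> + (-1 / real m) *\<^sub>R x)"
  have "?r \<in> pol (Suc l)" by (intro pol_add pol_affine p pol_Suc[OF q(1)])
  have "(\<Sum>\<beta>\<in>X'. (\<Sum>\<alpha>\<in>X. a (\<epsilon> + int m *s \<beta> - \<alpha>) * w \<alpha>) * p (of_int_vec \<beta>))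
    = (\<Sum>\<beta>\<in>X'. (\<Sum>\<alpha>\<in>X. a (\<epsilon> + int m *s \<beta> - \<alpha>) * w \<alpha>) * (\<lambda>\<alpha>. p (- of_int_vec \<alpha>)) (0 - \<beta>))"
    by (simp add: of_int_vec_minus)
  also have "\<dots> = (\<Sum>\<alpha>\<in>X. w \<alpha> * subdivision m a (\<lambda>\<alpha>. p (- of_int_vec \<alpha>)) (int m *s 0 + \<epsilon> - \<alpha>))"
    by (rule subdivision_pairing[OF fin X', symmetric])
  also have "\<dots> = (\<Sum>\<alpha>\<in>X. w \<alpha> * ?r (of_int_vec \<alpha>))"
    by (rule sum.cong) (auto simp: q(2) of_int_vec_diff scaleR_diff_right)
  also have "\<dots> = 0" by (rule bspec[OF w[unfolded annihilates_def] \<open>?r \<in> pol (Suc l)\<close>])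
  finally show "(\<Sum>\<beta>\<in>X'. (\<Sum>\<alpha>\<in>X. a (\<epsilon> + int m *s \<beta> - \<alpha>) * w \<alpha>) * p (of_int_vec \<beta>)) = 0" .
qed

section \<open>The index set of the transition matrices\<close>

lemma index_set_eq:
  assumes m: "m \<ge> 2"
  shows "index_set m N = {\<alpha> :: int ^ 's::finite. \<forall>i. - int m \<le> (int m - 1) * \<alpha> $ i \<and> (int m - 1) * \<alpha> $ i \<le> int N + 1}"
    (is "_ = ?K")
proof (intro set_eqI iffI)
  fix \<alpha> :: "int ^ 's"
  have geo: "(\<lambda>r. (1 / real m) ^ Suc r) sums (1 / (real m - 1))"
  proof -
    have "(\<lambda>r. (1 / real m) ^ r * (1 / real m)) sums (1 / (1 - 1 / real m) * (1 / real m))"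
      by (rule sums_mult2) (use geometric_sums[of "1 / real m"] m in auto)
    moreover have "1 / (1 - 1 / real m) * (1 / real m) = 1 / (real m - 1)" using m by (simp add: field_simps)
    ultimately show ?thesis by (simp add: mult.commute)
  qed
  {
    assume "\<alpha> \<in> ?K"
    \<comment> \<open>A constant digit sequence represents \<open>\<alpha>\<close>, since the powers
      \<open>m^(-r)\<close> with \<open>r \<ge> 1\<close> sum to \<open>1 / (m - 1)\<close>.\<close>
    define g :: "nat \<Rightarrow> int ^ 's" where "g r = (\<chi> i. (int m - 1) * \<alpha> $ i)" for r
    have "(\<lambda>r. (1 / real m) ^ Suc r *\<^sub>R of_int_vec (g (Suc r))) sums ((1 / (real m - 1)) *\<^sub>R of_int_vec (g 0))"
      unfolding g_def by (intro sums_scaleR_left geo)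
    moreover have "(1 / (real m - 1)) *\<^sub>R of_int_vec (g 0) = of_int_vec \<alpha>"
      using m by (simp add: vec_eq_iff g_def)
    moreover have "\<forall>r\<ge>1. \<forall>i. g r $ i \<in> {- int m..int N + 1}" using \<open>\<alpha> \<in> ?K\<close> by (simp add: g_def)
    ultimately show "\<alpha> \<in> index_set m N" unfolding index_set_def by auto
  next
    assume "\<alpha> \<in> index_set m N"
    then obtain g where g: "\<forall>r\<ge>1. \<forall>i. g r $ i \<in> {- int m..int N + 1}"
      "(\<lambda>r. (1 / real m) ^ Suc r *\<^sub>R of_int_vec (g (Suc r))) sums of_int_vec \<alpha>" unfolding index_set_def by blast
    have "- int m \<le> (int m - 1) * \<alpha> $ i \<and> (int m - 1) * \<alpha> $ i \<le> int N + 1" for i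
    proof -
      have s: "(\<lambda>r. (1 / real m) ^ Suc r * real_of_int (g (Suc r) $ i)) sums real_of_int (\<alpha> $ i)"
        using bounded_linear.sums[OF bounded_linear_vec_nth g(2), of i] by simp
      have gi: "- int m \<le> g (Suc r) $ i" "g (Suc r) $ i \<le> int N + 1" for r using g(1) by auto
      have gr: "- real m \<le> real_of_int (g (Suc r) $ i)" "real_of_int (g (Suc r) $ i) \<le> real N + 1" for r
        using gi[of r] by linarith+
      have "1 / (real m - 1) * (- real m) \<le> real_of_int (\<alpha> $ i)"
        by (rule sums_le[OF mult_left_mono[OF gr(1)] sums_mult2[OF geo] s]) simp
      moreover have "real_of_int (\<alpha> $ i) \<le> 1 / (real m - 1) * (real N + 1)"
        by (rule sums_le[OF mult_left_mono[OF gr(2)] s sums_mult2[OF geo]]) simp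
      ultimately have "- real m \<le> (real m - 1) * real_of_int (\<alpha> $ i)" "(real m - 1) * real_of_int (\<alpha> $ i) \<le> real N + 1"
        using m by (auto simp: field_simps)
      then have "real_of_int (- int m) \<le> real_of_int ((int m - 1) * \<alpha> $ i)"
        "real_of_int ((int m - 1) * \<alpha> $ i) \<le> real_of_int (int N + 1)" by auto
      then show ?thesis unfolding of_int_le_iff by blast
    qed
    then show "\<alpha> \<in> ?K" by blast
  }
qed

lemma finite_index_set: "m \<ge> 2 \<Longrightarrow> finite (index_set m N :: (int ^ 's::finite) set)"
proof -
  assume m: "m \<ge> 2"
  have "index_set m N \<subseteq> (ibox (- int m) (int N + 1) :: (int ^ 's) set)"
  proof
    fix \<alpha> :: "int ^ 's" assume "\<alpha> \<in> index_set m N"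
    then have *: "- int m \<le> (int m - 1) * \<alpha> $ i" "(int m - 1) * \<alpha> $ i \<le> int N + 1" for i
      unfolding index_set_eq[OF m] by auto
    have "- int m \<le> \<alpha> $ i \<and> \<alpha> $ i \<le> int N + 1" for i
    proof (cases "\<alpha> $ i \<ge> 0")
      case True
      then have "1 * \<alpha> $ i \<le> (int m - 1) * \<alpha> $ i" using m by (intro mult_right_mono) auto
      then show ?thesis using * True by (smt (verit) of_nat_0_le_iff)
    next
      case False
      then have "(int m - 1) * \<alpha> $ i \<le> 1 * \<alpha> $ i" using m by (intro mult_right_mono_neg) auto
      then show ?thesis using *[of i] False by linarith
    qed
    then show "\<alpha> \<in> ibox (- int m) (int N + 1)" by (simp add: ibox_def)
  qed
  then show ?thesis by (rule finite_subset) simp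
qed

text \<open>A nonzero entry forces \<open>m \<beta> = \<alpha> - \<epsilon> + \<gamma>\<close> with
  \<open>\<gamma>\<close> in the support box. After multiplication by \<open>m - 1\<close> the
  bounds \<open>- m\<close> and \<open>N + 1\<close> reproduce themselves, so sums over the index
  set lose no term of the adjoint step.\<close>

lemma index_set_closed:
  assumes m: "m \<ge> 2" and a: "supported_mask N (a :: 's::finite seq)" and \<epsilon>: "\<epsilon> \<in> digits m"
    and \<alpha>: "\<alpha> \<in> index_set m N" and nz: "a (\<epsilon> + int m *s \<beta> - \<alpha>) \<noteq> 0"
  shows "\<beta> \<in> index_set m N"
proof -
  have "- int m \<le> (int m - 1) * \<beta> $ i \<and> (int m - 1) * \<beta> $ i \<le> int N + 1" for i
  proof -
    have s: "0 \<le> \<epsilon> $ i + int m * \<beta> $ i - \<alpha> $ i" "\<epsilon> $ i + int m * \<beta> $ i - \<alpha> $ i \<le> int N"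
      using supported_maskD[OF a nz] by (auto simp: ibox_def)
    have e: "0 \<le> \<epsilon> $ i" "\<epsilon> $ i \<le> int m - 1" using \<epsilon> by (auto simp: digits_def)
    have k: "- int m \<le> (int m - 1) * \<alpha> $ i" "(int m - 1) * \<alpha> $ i \<le> int N + 1"
      using \<alpha> unfolding index_set_eq[OF m] by auto
    have m1: "0 \<le> int m - 1" using m by simp
    have "(int m - 1) * (\<alpha> $ i - \<epsilon> $ i) \<le> (int m - 1) * (int m * \<beta> $ i)"
      by (rule mult_left_mono) (use s m1 in auto)
    moreover have "(int m - 1) * \<epsilon> $ i \<le> (int m - 1) * (int m - 1)"
      by (rule mult_left_mono) (use e m1 in auto)
    ultimately have "int m * (- int m) \<le> int m * ((int m - 1) * \<beta> $ i)"
      using k(1) m by (simp add: algebra_simps)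
    then have 1: "- int m \<le> (int m - 1) * \<beta> $ i" by (subst (asm) mult_le_cancel_left_pos) (use m in auto)
    have "(int m - 1) * (int m * \<beta> $ i) \<le> (int m - 1) * (\<alpha> $ i + int N)"
      by (rule mult_left_mono) (use s e m1 in auto)
    then have "int m * ((int m - 1) * \<beta> $ i) \<le> int m * (int N + 1)"
      using k(2) m by (simp add: algebra_simps)
    then have 2: "(int m - 1) * \<beta> $ i \<le> int N + 1" by (subst (asm) mult_le_cancel_left_pos) (use m in auto)
    show ?thesis using 1 2 by blast
  qed
  then show ?thesis unfolding index_set_eq[OF m] by blast
qed

section \<open>Joint spectral radius\<close>

text \<open>Fekete's lemma for \<open>n\<close>-th roots, kept multiplicative because
  \<open>s n\<close> may be 0 and then has no logarithm.\<close>

lemma fekete: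
  fixes s :: "nat \<Rightarrow> real"
  assumes nn: "\<And>n. 0 \<le> s n" and bd: "\<And>n. n \<ge> 1 \<Longrightarrow> s n \<le> B"
    and sub: "\<And>p q. p \<ge> 1 \<Longrightarrow> q \<ge> 1 \<Longrightarrow> s (p + q) ^ (p + q) \<le> s p ^ p * s q ^ q"
  shows "s \<longlonglongrightarrow> (INF n\<in>{1..}. s n)"
proof (rule LIMSEQ_I)
  let ?L = "INF n\<in>{1..}. s n"
  fix e :: real assume e: "0 < e"
  have bdd: "bdd_below (s ` {1..})" using nn by (intro bdd_belowI[of _ 0]) auto
  have lower: "?L \<le> s n" if "n \<ge> 1" for n using that bdd by (intro cINF_lower) auto
  have L0: "0 \<le> ?L" using nn by (intro cINF_greatest) auto
  have B0: "0 \<le> B" using bd[of 1] nn[of 1] by simp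
  \<comment> \<open>A level strictly above the infimum is positive even when the infimum is 0, so
    division by \<open>t\<close> is possible.\<close>
  define t where "t = ?L + e / 2"
  have t: "0 < t" "?L < t" "t < ?L + e" using e L0 by (auto simp: t_def)
  obtain q where q: "q \<ge> 1" "s q < t"
    using t(2) cINF_less_iff[of "{1..}" s t] bdd by auto
  define C where "C = (max 1 B) ^ q * (max 1 (1 / t)) ^ q"
  have C: "C > 0" unfolding C_def by (intro mult_pos_pos zero_less_power) auto
  have step: "s (a * q + r) ^ (a * q + r) \<le> t ^ (a * q) * s r ^ r" if "r \<ge> 1" for a r
  proof (induction a)
    case (Suc a)
    have "s (q + (a * q + r)) ^ (q + (a * q + r)) \<le> s q ^ q * s (a * q + r) ^ (a * q + r)"
      using sub[of q "a * q + r"] q that by simp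
    also have "\<dots> \<le> t ^ q * (t ^ (a * q) * s r ^ r)"
      using q nn t by (intro mult_mono power_mono Suc) auto
    finally show ?case by (simp add: power_add algebra_simps)
  qed simp
  have main: "s n \<le> t * root n C" if n: "n \<ge> 1" for n
  proof -
    \<comment> \<open>The remainder is taken in \<open>1..q\<close> rather than
      \<open>0..q-1\<close>, because submultiplicativity and the bound speak of positive lengths
      only.\<close>
    define r where "r = (n - 1) mod q + 1"
    define a where "a = (n - 1) div q"
    have "(n - 1) mod q < q" using q by simp
    then have r: "1 \<le> r" "r \<le> q" by (auto simp: r_def)
    have "a * q + r = (n - 1) div q * q + (n - 1) mod q + 1" by (simp add: a_def r_def)
    then have n_eq: "n = a * q + r" using n by simp
    have "s r ^ r \<le> (max 1 B) ^ r" using bd[OF r(1)] nn by (intro power_mono) auto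
    also have "\<dots> \<le> (max 1 B) ^ q" using r by (intro power_increasing) auto
    finally have 1: "s r ^ r \<le> (max 1 B) ^ q" .
    have "t ^ (a * q) = t ^ n * (1 / t) ^ r" using t by (simp add: n_eq power_add field_simps)
    also have "(1 / t) ^ r \<le> (max 1 (1 / t)) ^ r" using t by (intro power_mono) auto
    also have "(max 1 (1 / t)) ^ r \<le> (max 1 (1 / t)) ^ q" using r by (intro power_increasing) auto
    finally have 2: "t ^ (a * q) \<le> t ^ n * (max 1 (1 / t)) ^ q" using t by simp
    have "s n ^ n \<le> t ^ (a * q) * s r ^ r" using step[OF r(1)] n_eq by simp
    also have "\<dots> \<le> (t ^ n * (max 1 (1 / t)) ^ q) * (max 1 B) ^ q"
      using 1 2 nn t by (intro mult_mono) auto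
    finally have "s n ^ n \<le> t ^ n * C" by (simp add: C_def algebra_simps)
    also have "\<dots> = (t * root n C) ^ n" using n C by (simp add: power_mult_distrib)
    finally show ?thesis using n t C by (subst (asm) power_mono_iff) (auto simp: nn intro!: mult_nonneg_nonneg)
  qed
  have "(\<lambda>n. t * root n C) \<longlonglongrightarrow> t * 1" by (intro tendsto_mult LIMSEQ_root_const C tendsto_const)
  then have "\<forall>\<^sub>F n in sequentially. t * root n C < ?L + e" using t by (intro order_tendstoD) auto
  then obtain n0 where n0: "\<And>n. n \<ge> n0 \<Longrightarrow> t * root n C < ?L + e" by (auto simp: eventually_sequentially)
  show "\<exists>no. \<forall>n\<ge>no. norm (s n - ?L) < e"
  proof (intro exI allI impI)
    fix n assume "n \<ge> max 1 n0"
    then show "norm (s n - ?L) < e" using main[of n] n0[of n] lower[of n] by auto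
  qed
qed

section \<open>Products of operators with a common norm bound\<close>

definition Prd :: "('a \<Rightarrow> 'a) list \<Rightarrow> 'a \<Rightarrow> 'a" where
  "Prd Ms = foldr (\<circ>) Ms id"

lemma Prd_simps [simp]: "Prd [] v = v" "Prd (A # Ms) v = A (Prd Ms v)"
  by (simp_all add: Prd_def)

lemma Prd_append [simp]: "Prd (Ms @ Ns) v = Prd Ms (Prd Ns v)"
  by (induction Ms) auto

text \<open>The facts about restricted transition operators on which convergence of the spectral
  radius rests: an invariant set \<open>W\<close>, homogeneity, and one norm bound
  \<open>\<Gamma>\<close> for all members.\<close>

locale operator_family =
  fixes I :: "'i set" and W :: "('i \<Rightarrow> real) set" and \<M> :: "(('i \<Rightarrow> real) \<Rightarrow> ('i \<Rightarrow> real)) set" and \<Gamma> :: real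
  assumes finite_I: "finite I"
    and W_zero: "(\<lambda>_. 0) \<in> W" and W_scale: "v \<in> W \<Longrightarrow> (\<lambda>i. r * v i) \<in> W"
    and M_nonempty: "\<M> \<noteq> {}" and \<Gamma>_nonneg: "0 \<le> \<Gamma>"
    and M_W: "A \<in> \<M> \<Longrightarrow> v \<in> W \<Longrightarrow> A v \<in> W"
    and M_scale: "A \<in> \<M> \<Longrightarrow> v \<in> W \<Longrightarrow> A (\<lambda>i. r * v i) = (\<lambda>i. r * A v i)"
    and M_bound: "A \<in> \<M> \<Longrightarrow> v \<in> W \<Longrightarrow> L2_set (A v) I \<le> \<Gamma> * L2_set v I"
begin


lemma Prd_props:
  assumes "set Ms \<subseteq> \<M>" "v \<in> W"
  shows "Prd Ms v \<in> W" "Prd Ms (\<lambda>i. r * v i) = (\<lambda>i. r * Prd Ms v i)"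
    "L2_set (Prd Ms v) I \<le> \<Gamma> ^ length Ms * L2_set v I"
  using assms
proof (induction Ms)
  case (Cons A Ms)
  { case 1 then show ?case using Cons M_W by auto }
  { case 2 then show ?case using Cons M_scale by auto }
  { case 3
    have "L2_set (A (Prd Ms v)) I \<le> \<Gamma> * L2_set (Prd Ms v) I" using 3 Cons(1) by (intro M_bound) auto
    also have "\<dots> \<le> \<Gamma> * (\<Gamma> ^ length Ms * L2_set v I)" using 3 Cons(3) \<Gamma>_nonneg by (intro mult_left_mono) auto
    finally show ?case by (simp add: algebra_simps) }
qed auto

definition "opn Ms = operator_norm_on I W (Prd Ms)"

lemma opn_bdd:
  assumes "set Ms \<subseteq> \<M>"
  shows "bdd_above ((\<lambda>v. L2_set (Prd Ms v) I) ` {v \<in> W. L2_set v I \<le> 1})"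
proof (rule bdd_aboveI2)
  fix v assume "v \<in> {v \<in> W. L2_set v I \<le> 1}"
  then show "L2_set (Prd Ms v) I \<le> \<Gamma> ^ length Ms * 1"
    using Prd_props(3)[OF assms, of v] mult_left_mono[of "L2_set v I" 1 "\<Gamma> ^ length Ms"] \<Gamma>_nonneg by auto
qed

lemma opn_nonneg: "set Ms \<subseteq> \<M> \<Longrightarrow> 0 \<le> opn Ms"
  unfolding opn_def operator_norm_on_def
  by (rule order_trans[OF _ cSUP_upper[OF _ opn_bdd, of "\<lambda>_. 0"]]) (auto simp: W_zero L2_set_0')

text \<open>Normalising \<open>v\<close> reduces to the unit ball of the supremum; a vector with
  \<open>L2_set v I = 0\<close> is covered by the crude bound instead.\<close>

lemma opn_bound:
  assumes "set Ms \<subseteq> \<M>" "v \<in> W"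
  shows "L2_set (Prd Ms v) I \<le> opn Ms * L2_set v I"
proof (cases "L2_set v I = 0")
  case True
  then show ?thesis using Prd_props(3)[OF assms] by simp
next
  case False
  then have n: "L2_set v I > 0" by (simp add: order_less_le)
  define u where "u = (\<lambda>i. (1 / L2_set v I) * v i)"
  have u: "u \<in> W" unfolding u_def by (rule W_scale[OF assms(2)])
  have "L2_set u I = 1" using n unfolding u_def by (subst L2_set_right_distrib[symmetric]) auto
  then have "L2_set (Prd Ms u) I \<le> opn Ms"
    unfolding opn_def operator_norm_on_def using u by (intro cSUP_upper opn_bdd assms) auto
  moreover have "L2_set (Prd Ms u) I = (1 / L2_set v I) * L2_set (Prd Ms v) I"
    unfolding u_def Prd_props(2)[OF assms] using n by (subst L2_set_right_distrib[symmetric]) auto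
  ultimately show ?thesis using n by (simp add: field_simps)
qed

lemma opn_le:
  assumes "\<And>v. v \<in> W \<Longrightarrow> L2_set (Prd Ms v) I \<le> c * L2_set v I" "0 \<le> c"
  shows "opn Ms \<le> c"
  unfolding opn_def operator_norm_on_def
proof (rule cSUP_least)
  show "{v \<in> W. L2_set v I \<le> 1} \<noteq> {}" using W_zero by (auto simp: L2_set_0' intro!: exI[of _ "\<lambda>_. 0"])
  fix v assume "v \<in> {v \<in> W. L2_set v I \<le> 1}"
  then show "L2_set (Prd Ms v) I \<le> c"
    using assms(1)[of v] mult_left_mono[of "L2_set v I" 1 c] assms(2) by auto
qed

definition "words n = {Ms. length Ms = n \<and> set Ms \<subseteq> \<M>}"
definition "sr n = (SUP Ms\<in>words n. root n (opn Ms))"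

lemma words_nonempty: "words n \<noteq> {}"
proof -
  obtain A where "A \<in> \<M>" using M_nonempty by blast
  then have "replicate n A \<in> words n" by (auto simp: words_def)
  then show ?thesis by blast
qed

lemma root_opn_le: "n \<ge> 1 \<Longrightarrow> Ms \<in> words n \<Longrightarrow> root n (opn Ms) \<le> \<Gamma>"
proof -
  assume n: "n \<ge> 1" and Ms: "Ms \<in> words n"
  then have "opn Ms \<le> \<Gamma> ^ n" using Prd_props(3)[of Ms] \<Gamma>_nonneg by (intro opn_le) (auto simp: words_def)
  then show "root n (opn Ms) \<le> \<Gamma>"
    using real_root_le_mono[of n "opn Ms" "\<Gamma> ^ n"] n \<Gamma>_nonneg by (simp add: real_root_power_cancel)
qed

lemma sr_upper: "n \<ge> 1 \<Longrightarrow> Ms \<in> words n \<Longrightarrow> root n (opn Ms) \<le> sr n"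
  unfolding sr_def by (intro cSUP_upper bdd_aboveI2[of _ _ \<Gamma>] root_opn_le)

lemma sr_nonneg: "0 \<le> sr n"
proof (cases "n = 0")
  case True
  \<comment> \<open>By the convention \<open>root 0 x = 0\<close> this supremum runs over
    zeros.\<close>
  have "sr 0 = (SUP Ms\<in>words 0. 0)" unfolding sr_def by simp
  also have "\<dots> = 0" using words_nonempty[of 0] by (simp add: cSUP_const)
  finally show ?thesis using True by simp
next
  case False
  obtain Ms where Ms: "Ms \<in> words n" using words_nonempty by blast
  then have "0 \<le> root n (opn Ms)" using opn_nonneg[of Ms] by (auto simp: words_def real_root_ge_zero)
  then show ?thesis using sr_upper[of n Ms] Ms False by linarith
qed

lemma opn_le_sr: "n \<ge> 1 \<Longrightarrow> Ms \<in> words n \<Longrightarrow> opn Ms \<le> sr n ^ n"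
proof -
  assume n: "n \<ge> 1" and Ms: "Ms \<in> words n"
  have o: "0 \<le> opn Ms" using Ms opn_nonneg[of Ms] by (simp add: words_def)
  have "root n (opn Ms) ^ n \<le> sr n ^ n"
    using sr_upper[OF n Ms] o by (intro power_mono real_root_ge_zero)
  then show ?thesis using n o by simp
qed

text \<open>A word of length \<open>p + q\<close> splits into a prefix and a suffix, and operator
  norms are submultiplicative.\<close>

lemma sr_submult:
  assumes "p \<ge> 1" "q \<ge> 1"
  shows "sr (p + q) ^ (p + q) \<le> sr p ^ p * sr q ^ q"
proof -
  have "sr (p + q) \<le> root (p + q) (sr p ^ p * sr q ^ q)"
    unfolding sr_def[of "p + q"]
  proof (rule cSUP_least[OF words_nonempty])
    fix Ms assume "Ms \<in> words (p + q)"
    then have Ms: "length Ms = p + q" "set Ms \<subseteq> \<M>" by (auto simp: words_def)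
    define P where "P = take p Ms"
    define Q where "Q = drop p Ms"
    have PQ: "Ms = P @ Q" "P \<in> words p" "Q \<in> words q"
      using Ms set_take_subset[of p Ms] set_drop_subset[of p Ms] by (auto simp: P_def Q_def words_def)
    have sub: "set P \<subseteq> \<M>" "set Q \<subseteq> \<M>" using PQ by (auto simp: words_def)
    have "opn Ms \<le> sr p ^ p * sr q ^ q"
    proof (rule opn_le)
      fix v assume v: "v \<in> W"
      have "L2_set (Prd Ms v) I \<le> opn P * L2_set (Prd Q v) I"
        unfolding PQ(1) Prd_append using opn_bound[OF sub(1) Prd_props(1)[OF sub(2) v]] .
      also have "\<dots> \<le> opn P * (opn Q * L2_set v I)"
        using opn_bound[OF sub(2) v] opn_nonneg[OF sub(1)] by (intro mult_left_mono)
      also have "\<dots> \<le> sr p ^ p * (sr q ^ q * L2_set v I)"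
        using opn_le_sr[OF assms(1) PQ(2)] opn_le_sr[OF assms(2) PQ(3)] opn_nonneg[OF sub(2)] sr_nonneg
        by (intro mult_mono) auto
      finally show "L2_set (Prd Ms v) I \<le> sr p ^ p * sr q ^ q * L2_set v I" by (simp add: mult.assoc)
    qed (simp add: sr_nonneg)
    then show "root (p + q) (opn Ms) \<le> root (p + q) (sr p ^ p * sr q ^ q)"
      using assms by (intro real_root_le_mono) auto
  qed
  then have "sr (p + q) ^ (p + q) \<le> root (p + q) (sr p ^ p * sr q ^ q) ^ (p + q)"
    by (intro power_mono sr_nonneg)
  also have "\<dots> = sr p ^ p * sr q ^ q" using assms by (intro real_root_pow_pos2) (auto simp: sr_nonneg)
  finally show ?thesis .
qed

lemma sr_le: "n \<ge> 1 \<Longrightarrow> sr n \<le> \<Gamma>"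
  unfolding sr_def by (intro cSUP_least words_nonempty root_opn_le)

text \<open>\<open>jsr_on\<close> is defined by \<open>lim\<close>, which is meaningful only once
  convergence is known; Fekete's lemma provides it.\<close>

lemma jsr_on_tendsto: "sr \<longlonglongrightarrow> jsr_on I W \<M>"
proof -
  have "sr \<longlonglongrightarrow> (INF n\<in>{1..}. sr n)" by (rule fekete[OF sr_nonneg sr_le sr_submult])
  moreover have "jsr_on I W \<M> = lim sr"
    unfolding jsr_on_def sr_def[abs_def] words_def opn_def Prd_def ..
  ultimately show ?thesis by (metis limI)
qed

lemma jsr_on_nonneg: "0 \<le> jsr_on I W \<M>"
  by (rule LIMSEQ_le_const[OF jsr_on_tendsto]) (auto simp: sr_nonneg)

text \<open>Extracts one block length with a contraction factor strictly below
  \<open>\<theta>\<close>; the gap between \<open>\<kappa>\<close> and \<open>\<theta>\<close> is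
  later spent on perturbing the masks.\<close>

lemma jsr_on_less:
  assumes "jsr_on I W \<M> < \<theta>"
  shows "\<exists>n\<ge>1. \<exists>\<kappa>. 0 \<le> \<kappa> \<and> \<kappa> < \<theta> \<and>
    (\<forall>Ms v. length Ms = n \<longrightarrow> set Ms \<subseteq> \<M> \<longrightarrow> v \<in> W \<longrightarrow> L2_set (Prd Ms v) I \<le> \<kappa> ^ n * L2_set v I)"
proof -
  have "\<forall>\<^sub>F n in sequentially. sr n < \<theta> \<and> n \<ge> 1"
    using order_tendstoD(2)[OF jsr_on_tendsto assms] eventually_ge_at_top[of 1] by eventually_elim auto
  then obtain n where n: "sr n < \<theta>" "n \<ge> 1" by (auto simp: eventually_sequentially)
  have "L2_set (Prd Ms v) I \<le> sr n ^ n * L2_set v I" if "length Ms = n" "set Ms \<subseteq> \<M>" "v \<in> W" for Ms v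
  proof -
    have "L2_set (Prd Ms v) I \<le> opn Ms * L2_set v I" by (rule opn_bound[OF that(2,3)])
    also have "\<dots> \<le> sr n ^ n * L2_set v I"
      using that by (intro mult_right_mono opn_le_sr n) (auto simp: words_def)
    finally show ?thesis .
  qed
  then show ?thesis using n sr_nonneg by blast
qed

end

subsection \<open>Compactness of bounded sequences of masks\<close>

text \<open>Bolzano-Weierstrass one index at a time, passing to a further subsequence for
  each.\<close>

lemma pointwise_convergent_subsequence:
  fixes u :: "nat \<Rightarrow> 'a \<Rightarrow> real"
  assumes "finite F" and bd: "\<And>k \<alpha>. \<bar>u k \<alpha>\<bar> \<le> B"
  shows "\<exists>r p. strict_mono r \<and> (\<forall>\<alpha>\<in>F. (\<lambda>n. u (r n) \<alpha>) \<longlonglongrightarrow> p \<alpha>)"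
  using assms(1)
proof (induction F rule: finite_induct)
  case empty
  show ?case by (intro exI[of _ id]) (auto simp: strict_mono_def)
next
  case (insert \<alpha> F)
  then obtain r p where r: "strict_mono r" "\<And>\<beta>. \<beta> \<in> F \<Longrightarrow> (\<lambda>n. u (r n) \<beta>) \<longlonglongrightarrow> p \<beta>" by blast
  have "bounded (range (\<lambda>n. u (r n) \<alpha>))" using bd by (intro boundedI[of _ B]) auto
  then obtain l r' where r': "strict_mono r'" "((\<lambda>n. u (r n) \<alpha>) \<circ> r') \<longlonglongrightarrow> l"
    using bounded_imp_convergent_subsequence by blast
  have "(\<lambda>n. u ((r \<circ> r') n) \<beta>) \<longlonglongrightarrow> (p(\<alpha> := l)) \<beta>" if "\<beta> \<in> insert \<alpha> F" for \<beta>
  proof (cases "\<beta> = \<alpha>")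
    case True
    then show ?thesis using r'(2) by (simp add: comp_def)
  next
    case False
    then have "(\<lambda>n. u (r n) \<beta>) \<longlonglongrightarrow> p \<beta>" using that r(2) by simp
    from LIMSEQ_subseq_LIMSEQ[OF this r'(1)] show ?thesis using False by (simp add: comp_def)
  qed
  then show ?case using strict_mono_o[OF r(1) r'(1)] by blast
qed

text \<open>The topology on functions is the product topology, so \<open>limit_points\<close> speaks
  of pointwise convergence.\<close>

lemma tendsto_fun_iff:
  fixes f :: "'b \<Rightarrow> 'a \<Rightarrow> real"
  shows "(f \<longlongrightarrow> l) F \<longleftrightarrow> (\<forall>\<alpha>. ((\<lambda>k. f k \<alpha>) \<longlongrightarrow> l \<alpha>) F)"
  using limitin_componentwise[of "\<lambda>_. euclidean" UNIV f l F]
  by (simp add: euclidean_product_topology flip: limitin_canonical_iff)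

text \<open>Otherwise infinitely many masks stay away from all limit points, and compactness on the
  support box gives a limit point of exactly these. Since the masks vanish off the box, convergence
  at finitely many indices is uniform.\<close>

lemma limit_points_approx:
  fixes b :: "nat \<Rightarrow> ('s::finite) seq"
  assumes sup: "\<And>k. k \<ge> 1 \<Longrightarrow> supported_mask N (b k)"
    and bd: "\<And>k \<alpha>. k \<ge> 1 \<Longrightarrow> \<bar>b k \<alpha>\<bar> \<le> B" and \<eta>: "\<eta> > 0"
  shows "\<exists>K. \<forall>k\<ge>K. \<exists>a\<in>limit_points b. \<forall>\<alpha>. \<bar>b k \<alpha> - a \<alpha>\<bar> < \<eta>"
proof (rule ccontr)
  define Q where "Q k \<longleftrightarrow> (\<exists>a\<in>limit_points b. \<forall>\<alpha>. \<bar>b k \<alpha> - a \<alpha>\<bar> < \<eta>)" for k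
  \<comment> \<open>Index 0 is excluded, because nothing is assumed about
    \<open>b 0\<close>.\<close>
  let ?bad = "{k. k \<ge> 1 \<and> \<not> Q k}"
  assume "\<not> ?thesis"
  then have *: "\<exists>k\<ge>K. \<not> Q k" for K unfolding Q_def by blast
  have "\<exists>k\<ge>K. k \<in> ?bad" for K
  proof -
    obtain k where "k \<ge> max K 1" "\<not> Q k" using *[of "max K 1"] by blast
    then show ?thesis by (intro exI[of _ k]) simp
  qed
  then have "infinite ?bad" unfolding infinite_nat_iff_unbounded_le by blast
  then obtain r :: "nat \<Rightarrow> nat" where r: "strict_mono r" "\<And>n. r n \<in> ?bad"
    using infinite_enumerate by blast
  have r1: "r n \<ge> 1" for n using r(2) by auto
  let ?F = "ibox 0 (int N) :: (int ^ 's) set"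
  obtain r' p where r': "strict_mono r'" "\<And>\<alpha>. \<alpha> \<in> ?F \<Longrightarrow> (\<lambda>n. b (r (r' n)) \<alpha>) \<longlonglongrightarrow> p \<alpha>"
    using pointwise_convergent_subsequence[OF finite_ibox[of 0 "int N"], of "\<lambda>k. b (r k)" B] bd r1 by blast
  define p' where "p' \<alpha> = (if \<alpha> \<in> ?F then p \<alpha> else 0)" for \<alpha>
  have out: "b (r (r' n)) \<alpha> = 0" if "\<alpha> \<notin> ?F" for n \<alpha>
    using supported_maskD[OF sup[OF r1[of "r' n"]]] that by blast
  have "(\<lambda>n. b (r (r' n)) \<alpha>) \<longlonglongrightarrow> p' \<alpha>" for \<alpha>
    using r'(2) out by (cases "\<alpha> \<in> ?F") (auto simp: p'_def)
  then have "(b \<circ> (r \<circ> r')) \<longlonglongrightarrow> p'" by (simp add: tendsto_fun_iff)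
  then have lp: "p' \<in> limit_points b" unfolding limit_points_def using strict_mono_o[OF r(1) r'(1)] by blast
  have "\<forall>\<^sub>F n in sequentially. \<forall>\<alpha>\<in>?F. \<bar>b (r (r' n)) \<alpha> - p \<alpha>\<bar> < \<eta>"
  proof (subst eventually_ball_finite_distrib[OF finite_ibox], intro ballI)
    fix \<alpha> assume "\<alpha> \<in> ?F"
    from tendstoD[OF r'(2)[OF this] \<eta>] show "\<forall>\<^sub>F n in sequentially. \<bar>b (r (r' n)) \<alpha> - p \<alpha>\<bar> < \<eta>"
      by (simp add: dist_real_def)
  qed
  then obtain n where n: "\<forall>\<alpha>\<in>?F. \<bar>b (r (r' n)) \<alpha> - p \<alpha>\<bar> < \<eta>" by (auto simp: eventually_sequentially)
  have "\<bar>b (r (r' n)) \<alpha> - p' \<alpha>\<bar> < \<eta>" for \<alpha>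
    using n out[of \<alpha> n] \<eta> by (cases "\<alpha> \<in> ?F") (auto simp: p'_def)
  then have "Q (r (r' n))" unfolding Q_def using lp by blast
  then show False using r(2)[of "r' n"] by blast
qed

section \<open>Decay of differences\<close>

lemma polynomials_upto_pol:
  assumes "p \<in> polynomials_upto l" shows "p \<in> pol (Suc l)"
proof -
  obtain c where p: "p = (\<lambda>x. \<Sum>\<eta> | sum \<eta> UNIV \<le> l. c \<eta> * (\<Prod>i\<in>UNIV. (x $ i) ^ \<eta> i))"
    using assms unfolding polynomials_upto_def by blast
  show ?thesis unfolding p
  proof (intro pol_sum pol_scale)
    fix \<eta> :: "'a \<Rightarrow> nat" assume "\<eta> \<in> {\<eta>. sum \<eta> UNIV \<le> l}"
    then show "(\<lambda>x. \<Prod>i\<in>UNIV. (x $ i) ^ \<eta> i) \<in> pol (Suc l)"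
      by (intro pol_mono[OF pol_monomial]) auto
  qed
qed

lemma finite_multiindices_le: "finite {\<nu> :: 's::finite \<Rightarrow> nat. sum \<nu> UNIV \<le> n}"
proof -
  have "{\<nu> :: 's \<Rightarrow> nat. sum \<nu> UNIV \<le> n} = (\<Union>k\<le>n. {\<nu>. sum \<nu> UNIV = k})" by auto
  then show ?thesis by (simp add: finite_multiindices)
qed

lemma monomial_in_polynomials_upto:
  assumes "sum \<eta> UNIV \<le> l"
  shows "(\<lambda>x. \<Prod>i\<in>UNIV. (x $ i) ^ \<eta> i) \<in> polynomials_upto l"
  unfolding polynomials_upto_def
proof (intro CollectI exI[of _ "\<lambda>\<nu>. if \<nu> = \<eta> then 1 else 0"] conjI ext)
  fix x :: "real ^ 'a"
  have "(\<Sum>\<nu> | sum \<nu> UNIV \<le> l. (if \<nu> = \<eta> then 1 else 0) * (\<Prod>i\<in>UNIV. (x $ i) ^ \<nu> i))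
    = (\<Sum>\<nu> | sum \<nu> UNIV \<le> l. if \<nu> = \<eta> then (\<Prod>i\<in>UNIV. (x $ i) ^ \<nu> i) else 0)"
    by (rule sum.cong) auto
  then show "(\<Prod>i\<in>UNIV. (x $ i) ^ \<eta> i)
    = (\<Sum>\<nu> | sum \<nu> UNIV \<le> l. (if \<nu> = \<eta> then 1 else 0) * (\<Prod>i\<in>UNIV. (x $ i) ^ \<nu> i))"
    using assms by (simp add: sum.delta finite_multiindices_le)
qed simp

text \<open>Carries a monomial factor through the recursion for \<open>pol\<close>, so that every
  polynomial is reached from the monomials of \<open>polynomials_upto\<close>; this matches
  \<open>V_space\<close> with \<open>annihilates\<close>.\<close>

lemma annihilatesI:
  assumes van: "\<And>p. p \<in> polynomials_upto l \<Longrightarrow> (\<Sum>\<alpha>\<in>X. w \<alpha> * p (of_int_vec \<alpha>)) = 0"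
  shows "annihilates l X (w :: ('s::finite) seq)"
  unfolding annihilates_def
proof
  fix p :: "real ^ 's \<Rightarrow> real" assume p: "p \<in> pol (Suc l)"
  define mon :: "('s \<Rightarrow> nat) \<Rightarrow> real ^ 's \<Rightarrow> real" where "mon \<eta> x = (\<Prod>i\<in>UNIV. (x $ i) ^ \<eta> i)" for \<eta> x
  have "\<And>\<eta>. sum \<eta> UNIV + d \<le> Suc l \<Longrightarrow> (\<Sum>\<alpha>\<in>X. w \<alpha> * (mon \<eta> (of_int_vec \<alpha>) * p (of_int_vec \<alpha>))) = 0"
    if "p \<in> pol d" for p d
    using that
  proof (induction rule: pol_induct)
    case (const d c)
    have "mon \<eta> \<in> polynomials_upto l" using monomial_in_polynomials_upto[of \<eta> l] const by (simp add: mon_def[abs_def])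
    from van[OF this] have "c * (\<Sum>\<alpha>\<in>X. w \<alpha> * mon \<eta> (of_int_vec \<alpha>)) = 0" by simp
    then show ?case by (simp add: sum_distrib_left sum_distrib_right algebra_simps)
  next
    case (mult d p i)
    define \<eta>' where "\<eta>' = (\<lambda>j. \<eta> j + (if j = i then 1 else 0))"
    have "mon \<eta>' x = mon \<eta> x * x $ i" for x
    proof -
      have "mon \<eta>' x = (\<Prod>j\<in>UNIV. x $ j ^ \<eta> j * (if j = i then x $ i else 1))"
        unfolding mon_def \<eta>'_def by (intro prod.cong) auto
      then show ?thesis by (simp add: mon_def prod.distrib)
    qed
    moreover have "sum \<eta>' UNIV = Suc (sum \<eta> UNIV)" by (simp add: \<eta>'_def sum.distrib)
    ultimately show ?case using mult.IH[of \<eta>'] mult.prems by (simp add: algebra_simps)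
  qed (simp_all add: distrib_left sum.distrib)
  from this[OF p, of "\<lambda>_. 0"] show "(\<Sum>\<alpha>\<in>X. w \<alpha> * p (of_int_vec \<alpha>)) = 0" by (simp add: mon_def)
qed

lemma V_space_iff:
  "v \<in> V_space m N l \<longleftrightarrow> (\<forall>\<alpha>. \<alpha> \<notin> index_set m N \<longrightarrow> v \<alpha> = 0) \<and> annihilates l (index_set m N) v"
  using annihilatesI[where l = l and X = "index_set m N" and w = v] polynomials_upto_pol
  by (auto simp: V_space_def annihilates_def)

lemma transition_V_space:
  assumes m: "m \<ge> 2" and a: "regular_mask m N l a" and \<epsilon>: "\<epsilon> \<in> digits m" and v: "v \<in> V_space m N l"
  shows "transition m N \<epsilon> a v \<in> V_space m N l"
proof -
  have sup: "supported_mask N a" using a by (simp add: regular_mask_def)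
  have "annihilates l (index_set m N) (\<lambda>\<beta>. \<Sum>\<alpha>\<in>index_set m N. a (\<epsilon> + int m *s \<beta> - \<alpha>) * v \<alpha>)"
    by (rule annihilates_step[OF _ a]) (use m v finite_index_set[OF m] index_set_closed[OF m sup \<epsilon>] in \<open>auto simp: V_space_iff\<close>)
  then show ?thesis unfolding V_space_iff by (simp add: transition_def annihilates_def)
qed

text \<open>The squared cardinality is crude: each entry of the result is bounded by a sum over the
  index set, and the Euclidean norm by the sum of the entries. What matters is that it does not
  depend on the masks.\<close>

lemma transition_diff_bound:
  fixes v :: "('s::finite) seq"
  assumes m: "m \<ge> 2" and d: "\<And>\<alpha>. \<bar>a \<alpha> - a' \<alpha>\<bar> \<le> \<eta>"
  shows "L2_set (\<lambda>\<alpha>. transition m N \<epsilon> a v \<alpha> - transition m N \<epsilon> a' v \<alpha>) (index_set m N)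
    \<le> (real (card (index_set m N :: (int ^ 's) set)))\<^sup>2 * \<eta> * L2_set v (index_set m N)"
proof -
  let ?K = "index_set m N :: (int ^ 's) set"
  have fin: "finite ?K" by (rule finite_index_set[OF m])
  have \<eta>: "0 \<le> \<eta>" using d[of undefined] by linarith
  have entry: "\<bar>transition m N \<epsilon> a v \<alpha> - transition m N \<epsilon> a' v \<alpha>\<bar> \<le> real (card ?K) * (\<eta> * L2_set v ?K)"
    if "\<alpha> \<in> ?K" for \<alpha>
  proof -
    have "\<bar>transition m N \<epsilon> a v \<alpha> - transition m N \<epsilon> a' v \<alpha>\<bar>
      = \<bar>\<Sum>\<beta>\<in>?K. (a (\<epsilon> + int m *s \<alpha> - \<beta>) - a' (\<epsilon> + int m *s \<alpha> - \<beta>)) * v \<beta>\<bar>"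
      using that by (simp add: transition_def sum_subtractf[symmetric] left_diff_distrib)
    also have "\<dots> \<le> (\<Sum>\<beta>\<in>?K. \<eta> * L2_set v ?K)"
    proof (rule order_trans[OF sum_abs sum_mono])
      fix \<beta> assume "\<beta> \<in> ?K"
      then have "\<bar>v \<beta>\<bar> \<le> L2_set (\<lambda>\<beta>. \<bar>v \<beta>\<bar>) ?K" by (intro member_le_L2_set fin)
      then have "\<bar>v \<beta>\<bar> \<le> L2_set v ?K" by (simp add: L2_set_def)
      then show "\<bar>(a (\<epsilon> + int m *s \<alpha> - \<beta>) - a' (\<epsilon> + int m *s \<alpha> - \<beta>)) * v \<beta>\<bar> \<le> \<eta> * L2_set v ?K"
        unfolding abs_mult by (intro mult_mono d \<eta>) auto
    qed
    finally show ?thesis by simp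
  qed
  have "L2_set (\<lambda>\<alpha>. transition m N \<epsilon> a v \<alpha> - transition m N \<epsilon> a' v \<alpha>) ?K
    \<le> (\<Sum>\<alpha>\<in>?K. real (card ?K) * (\<eta> * L2_set v ?K))"
    by (rule order_trans[OF L2_set_le_sum_abs sum_mono[OF entry]])
  then show ?thesis by (simp add: power2_eq_square mult.assoc)
qed

lemma transition_zero_mask: "transition m N \<epsilon> (\<lambda>_. 0) v = (\<lambda>_. 0)"
  by (auto simp: transition_def)

lemma transition_bound:
  fixes v :: "('s::finite) seq"
  assumes "m \<ge> 2" "\<And>\<alpha>. \<bar>a \<alpha>\<bar> \<le> B"
  shows "L2_set (transition m N \<epsilon> a v) (index_set m N)
    \<le> (real (card (index_set m N :: (int ^ 's) set)))\<^sup>2 * B * L2_set v (index_set m N)"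
  using transition_diff_bound[of m a "\<lambda>_. 0" B] assms by (simp add: transition_zero_mask)

lemma transition_diff: "transition m N \<epsilon> a (\<lambda>\<alpha>. v \<alpha> - w \<alpha>) = (\<lambda>\<alpha>. transition m N \<epsilon> a v \<alpha> - transition m N \<epsilon> a w \<alpha>)"
  by (auto simp: transition_def sum_subtractf[symmetric] right_diff_distrib)

lemma transition_scale: "transition m N \<epsilon> a (\<lambda>\<alpha>. r * v \<alpha>) = (\<lambda>\<alpha>. r * transition m N \<epsilon> a v \<alpha>)"
  by (auto simp: transition_def sum_distrib_left algebra_simps)

text \<open>Telescoping between two products whose factors are exchanged one at a time. The triples
  keep digit, mask and nearby mask aligned, and \<open>1 \<le> \<Gamma>\<close> lets one power of
  \<open>\<Gamma>\<close> serve all terms.\<close>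

lemma perturbed_products:
  fixes v :: "('s::finite) seq" and es :: "((int ^ 's) \<times> 's seq \<times> 's seq) list"
  assumes m: "m \<ge> 2" and \<Gamma>: "1 \<le> \<Gamma>" "(real (card (index_set m N :: (int ^ 's) set)))\<^sup>2 * B \<le> \<Gamma>"
    and D: "D = (real (card (index_set m N :: (int ^ 's) set)))\<^sup>2"
    and es: "\<And>\<epsilon> a a' \<alpha>. (\<epsilon>, a, a') \<in> set es \<Longrightarrow> \<bar>a \<alpha>\<bar> \<le> B \<and> \<bar>a' \<alpha>\<bar> \<le> B \<and> \<bar>a \<alpha> - a' \<alpha>\<bar> \<le> \<eta>"
    and \<eta>: "0 \<le> \<eta>"
  shows "L2_set (Prd (map (\<lambda>(\<epsilon>, a, a'). transition m N \<epsilon> a) es) v) (index_set m N)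
      \<le> \<Gamma> ^ length es * L2_set v (index_set m N)" (is "L2_set (?P es) ?K \<le> _")
    and "L2_set (\<lambda>\<alpha>. Prd (map (\<lambda>(\<epsilon>, a, a'). transition m N \<epsilon> a) es) v \<alpha>
          - Prd (map (\<lambda>(\<epsilon>, a, a'). transition m N \<epsilon> a') es) v \<alpha>) (index_set m N)
      \<le> real (length es) * \<Gamma> ^ length es * D * \<eta> * L2_set v (index_set m N)"
  using es
proof (induction es)
  case Nil
  { case 1 show ?case by simp }
  { case 2 show ?case by (simp add: L2_set_0') }
next
  case (Cons e es)
  obtain \<epsilon> a a' where e: "e = (\<epsilon>, a, a')" by (cases e)
  let ?n = "length es"
  let ?Q = "Prd (map (\<lambda>(\<epsilon>, a, a'). transition m N \<epsilon> a) es) v"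
  let ?Q' = "Prd (map (\<lambda>(\<epsilon>, a, a'). transition m N \<epsilon> a') es) v"
  have T: "L2_set (transition m N \<epsilon> a u) ?K \<le> \<Gamma> * L2_set u ?K" if "\<And>\<alpha>. \<bar>a \<alpha>\<bar> \<le> B" for u \<epsilon> a
    using transition_bound[OF m, of a B N \<epsilon> u] that \<Gamma>(2)
    by (meson L2_set_nonneg mult_right_mono order_trans)
  { case 1
    have a: "\<bar>a \<alpha>\<bar> \<le> B" for \<alpha> using 1[of \<epsilon> a a' \<alpha>] e by simp
    have "L2_set (transition m N \<epsilon> a ?Q) ?K \<le> \<Gamma> * L2_set ?Q ?K" by (rule T[OF a])
    also have "\<dots> \<le> \<Gamma> * (\<Gamma> ^ ?n * L2_set v ?K)"
      by (intro mult_left_mono Cons.IH(1)) (use 1 \<Gamma> in auto)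
    finally show ?case by (simp add: e) }
  { case 2
    have a: "\<bar>a \<alpha>\<bar> \<le> B" "\<bar>a' \<alpha>\<bar> \<le> B" "\<bar>a \<alpha> - a' \<alpha>\<bar> \<le> \<eta>" for \<alpha>
      using 2[of \<epsilon> a a' \<alpha>] e by auto
    have IH1: "L2_set ?Q ?K \<le> \<Gamma> ^ ?n * L2_set v ?K" by (rule Cons.IH(1)) (use 2 in auto)
    have IH2: "L2_set (\<lambda>\<alpha>. ?Q \<alpha> - ?Q' \<alpha>) ?K \<le> real ?n * \<Gamma> ^ ?n * D * \<eta> * L2_set v ?K" by (rule Cons.IH(2)) (use 2 in auto)
    have D0: "0 \<le> D" by (simp add: D)
    let ?A = "\<lambda>\<alpha>. transition m N \<epsilon> a ?Q \<alpha> - transition m N \<epsilon> a' ?Q \<alpha>"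
    let ?B = "transition m N \<epsilon> a' (\<lambda>\<alpha>. ?Q \<alpha> - ?Q' \<alpha>)"
    have "L2_set (\<lambda>\<alpha>. transition m N \<epsilon> a ?Q \<alpha> - transition m N \<epsilon> a' ?Q' \<alpha>) ?K
      = L2_set (\<lambda>\<alpha>. ?A \<alpha> + ?B \<alpha>) ?K" by (simp add: transition_diff)
    also have "\<dots> \<le> L2_set ?A ?K + L2_set ?B ?K" by (rule L2_set_triangle_ineq)
    also have "L2_set ?A ?K \<le> D * \<eta> * L2_set ?Q ?K" unfolding D by (rule transition_diff_bound[OF m a(3)])
    also have "\<dots> \<le> D * \<eta> * (\<Gamma> ^ ?n * L2_set v ?K)" using IH1 D0 \<eta> by (intro mult_left_mono) auto
    also have "\<dots> \<le> \<Gamma> * (D * \<eta> * (\<Gamma> ^ ?n * L2_set v ?K))"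
      using \<Gamma> D0 \<eta> mult_right_mono[of 1 \<Gamma> "D * \<eta> * (\<Gamma> ^ ?n * L2_set v ?K)"] by simp
    also have "L2_set ?B ?K \<le> \<Gamma> * (real ?n * \<Gamma> ^ ?n * D * \<eta> * L2_set v ?K)"
      using T[where a = a' and u = "\<lambda>\<alpha>. ?Q \<alpha> - ?Q' \<alpha>" and \<epsilon> = \<epsilon>, OF a(2)] mult_left_mono[OF IH2, of \<Gamma>] \<Gamma> by linarith
    finally show ?case by (simp add: e algebra_simps) }
qed

lemma operator_family_transitions:
  fixes \<A> :: "(('s::finite) seq) set"
  assumes m: "m \<ge> 2" and ne: "\<A> \<noteq> {}" and reg: "\<And>a. a \<in> \<A> \<Longrightarrow> regular_mask m N l a"
    and bd: "\<And>a \<alpha>. a \<in> \<A> \<Longrightarrow> \<bar>a \<alpha>\<bar> \<le> B"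
  shows "operator_family (index_set m N) (V_space m N l)
    {transition m N \<epsilon> a | \<epsilon> a. \<epsilon> \<in> digits m \<and> a \<in> \<A>} ((real (card (index_set m N :: (int ^ 's) set)))\<^sup>2 * B)"
proof
  show "finite (index_set m N :: (int ^ 's) set)" by (rule finite_index_set[OF m])
  show "(\<lambda>_. 0) \<in> V_space m N l" by (simp add: V_space_def)
  show "(\<lambda>i. r * v i) \<in> V_space m N l" if "v \<in> V_space m N l" for v :: "'s seq" and r
    using that by (auto simp: V_space_def mult.assoc sum_distrib_left[symmetric])
  have "0 \<in> (digits m :: (int ^ 's) set)" by (rule zero_in_digits) (use m in simp)
  then show "{transition m N \<epsilon> a | \<epsilon> a. \<epsilon> \<in> digits m \<and> a \<in> \<A>} \<noteq> {}" using ne by blast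
  obtain a where "a \<in> \<A>" using ne by blast
  then have "0 \<le> B" using bd[of a undefined] by linarith
  then show "0 \<le> (real (card (index_set m N :: (int ^ 's) set)))\<^sup>2 * B" by simp
qed (use transition_V_space[OF m reg] transition_scale transition_bound[OF m bd] in \<open>auto\<close>)

lemma vec_mod_decomp:
  assumes "m > 0"
  obtains \<gamma>' \<epsilon> where "(\<gamma> :: int ^ 's::finite) = int m *s \<gamma>' + \<epsilon>" "\<epsilon> \<in> digits m"
proof
  show "\<gamma> = int m *s (\<chi> i. \<gamma> $ i div int m) + (\<chi> i. \<gamma> $ i mod int m)" by (simp add: vec_eq_iff)
  show "(\<chi> i. \<gamma> $ i mod int m) \<in> digits m" using assms by (simp add: digits_def)
qed

section \<open>Pairing functionals with iterated data\<close>

locale scheme =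
  fixes m N l :: nat and b :: "nat \<Rightarrow> ('s::finite) seq" and B :: real
  assumes m: "m \<ge> 2" and regular: "\<And>k. k \<ge> 1 \<Longrightarrow> regular_mask m N l (b k)"
    and bounded_masks: "\<And>k \<alpha>. k \<ge> 1 \<Longrightarrow> \<bar>b k \<alpha>\<bar> \<le> B"
begin

abbreviation "K \<equiv> index_set m N :: (int ^ 's) set"
abbreviation "V \<equiv> V_space m N l :: ('s seq) set"
abbreviation "it \<equiv> iterated_subdivision m b"

lemma supported: "k \<ge> 1 \<Longrightarrow> supported_mask N (b k)"
  using regular by (simp add: regular_mask_def)

lemma m0: "m > 0" using m by simp

lemma B0: "0 \<le> B" using bounded_masks[of 1 undefined] by linarith

lemma limit_points_props:
  shows "limit_points b \<noteq> {}"
    and "a \<in> limit_points b \<Longrightarrow> regular_mask m N l a"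
    and "a \<in> limit_points b \<Longrightarrow> \<bar>a \<alpha>\<bar> \<le> B"
proof -
  show "limit_points b \<noteq> {}"
    using limit_points_approx[where b = b and N = N and B = B and \<eta> = 1, OF supported bounded_masks] by auto
  assume "a \<in> limit_points b"
  then obtain r where r: "strict_mono r" "(b \<circ> r) \<longlonglongrightarrow> a" unfolding limit_points_def by blast
  \<comment> \<open>A subsequence may start with index 0; shifting it by one removes that
    index.\<close>
  have r1: "r (Suc n) \<ge> 1" for n using strict_monoD[OF r(1), of n "Suc n"] by simp
  have lim: "(\<lambda>n. b (r (Suc n)) \<alpha>) \<longlonglongrightarrow> a \<alpha>" for \<alpha>
    using r(2) LIMSEQ_Suc[of "\<lambda>n. b (r n) \<alpha>"] by (simp add: tendsto_fun_iff)
  show "regular_mask m N l a" by (rule regular_mask_limit[OF regular[OF r1] lim])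
  show "\<bar>a \<alpha>\<bar> \<le> B"
    by (rule LIMSEQ_le_const2[OF tendsto_rabs[OF lim]]) (use bounded_masks[OF r1] in auto)
qed

lemma family: "operator_family K V {transition m N \<epsilon> a | \<epsilon> a. \<epsilon> \<in> digits m \<and> a \<in> limit_points b}
    ((real (card K))\<^sup>2 * B)"
  by (rule operator_family_transitions[OF m]) (use limit_points_props in auto)

lemma jsr_nonneg: "0 \<le> jsr_masks m N l (limit_points b)"
  unfolding jsr_masks_def by (rule operator_family.jsr_on_nonneg[OF family])

definition pair :: "'s seq \<Rightarrow> 's seq \<Rightarrow> int ^ 's \<Rightarrow> real" where
  "pair v c \<gamma> = (\<Sum>\<alpha>\<in>K. v \<alpha> * c (\<gamma> - \<alpha>))"

lemma pair_step:
  assumes "k \<ge> 1" "\<epsilon> \<in> digits m"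
  shows "pair v (subdivision m (b k) c) (int m *s \<gamma> + \<epsilon>) = pair (transition m N \<epsilon> (b k) v) c \<gamma>"
proof -
  have "pair v (subdivision m (b k) c) (int m *s \<gamma> + \<epsilon>)
    = (\<Sum>\<beta>\<in>K. (\<Sum>\<alpha>\<in>K. b k (\<epsilon> + int m *s \<beta> - \<alpha>) * v \<alpha>) * c (\<gamma> - \<beta>))"
    unfolding pair_def
    by (rule subdivision_pairing) (use finite_index_set[OF m] index_set_closed[OF m supported] assms in auto)
  then show ?thesis by (simp add: pair_def transition_def)
qed

text \<open>The last subdivision step is peeled off first, so its transition operator acts on
  \<open>v\<close> first and stands at the right end of the product. The digits arise from repeated
  division of \<open>\<gamma>\<close> by \<open>m\<close>.\<close>

lemma pair_iterate:
  "\<exists>es \<gamma>'. length es = n \<and> set es \<subseteq> digits m \<and>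
     pair v (it (k + n) c) \<gamma> = pair (Prd (map (\<lambda>i. transition m N (es ! i) (b (k + Suc i))) [0..<n]) v) (it k c) \<gamma>'"
proof (induction n arbitrary: v \<gamma>)
  case 0
  show ?case by (intro exI[of _ "[]"] exI[of _ \<gamma>]) simp
next
  case (Suc n)
  obtain \<gamma>1 \<epsilon> where \<gamma>: "\<gamma> = int m *s \<gamma>1 + \<epsilon>" "\<epsilon> \<in> digits m" using vec_mod_decomp[OF m0] by blast
  let ?T = "transition m N \<epsilon> (b (k + Suc n))"
  have 1: "pair v (it (k + Suc n) c) \<gamma> = pair (?T v) (it (k + n) c) \<gamma>1"
    using pair_step[of "k + Suc n" \<epsilon> v "it (k + n) c" \<gamma>1] \<gamma> by simp
  obtain es \<gamma>' where es: "length es = n" "set es \<subseteq> digits m"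
    "pair (?T v) (it (k + n) c) \<gamma>1
      = pair (Prd (map (\<lambda>i. transition m N (es ! i) (b (k + Suc i))) [0..<n]) (?T v)) (it k c) \<gamma>'"
    using Suc.IH by blast
  have "map (\<lambda>i. transition m N ((es @ [\<epsilon>]) ! i) (b (k + Suc i))) [0..<Suc n]
    = map (\<lambda>i. transition m N (es ! i) (b (k + Suc i))) [0..<n] @ [?T]"
    using es(1) by (auto simp: nth_append)
  then have "Prd (map (\<lambda>i. transition m N ((es @ [\<epsilon>]) ! i) (b (k + Suc i))) [0..<Suc n]) v
    = Prd (map (\<lambda>i. transition m N (es ! i) (b (k + Suc i))) [0..<n]) (?T v)" by (simp only: Prd_append Prd_simps)
  then have "pair v (it (k + Suc n) c) \<gamma>
    = pair (Prd (map (\<lambda>i. transition m N ((es @ [\<epsilon>]) ! i) (b (k + Suc i))) [0..<Suc n]) v) (it k c) \<gamma>'"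
    unfolding 1 es(3) by (simp only:)
  then show ?case using es(1,2) \<gamma>(2) by (intro exI[of _ "es @ [\<epsilon>]"] exI[of _ \<gamma>']) auto
qed

text \<open>Late masks are close to limit points, so a block of \<open>n\<close> transitions is a
  small perturbation of a product of limit operators, which contracts with room to spare.\<close>

lemma eventual_contraction:
  assumes \<theta>: "jsr_masks m N l (limit_points b) < \<theta>"
  shows "\<exists>n\<ge>1. \<exists>k0. \<forall>k\<ge>k0. \<forall>es v. length es = n \<longrightarrow> set es \<subseteq> digits m \<longrightarrow> v \<in> V \<longrightarrow>
    L2_set (Prd (map (\<lambda>i. transition m N (es ! i) (b (k + Suc i))) [0..<n]) v) K \<le> \<theta> ^ n * L2_set v K"
proof -
  interpret operator_family K V "{transition m N \<epsilon> a | \<epsilon> a. \<epsilon> \<in> digits m \<and> a \<in> limit_points b}"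
    "(real (card K))\<^sup>2 * B" by (rule family)
  obtain n \<kappa> where n: "n \<ge> 1" "0 \<le> \<kappa>" "\<kappa> < \<theta>" and
    P: "\<And>Ms v. length Ms = n \<Longrightarrow> set Ms \<subseteq> {transition m N \<epsilon> a | \<epsilon> a. \<epsilon> \<in> digits m \<and> a \<in> limit_points b} \<Longrightarrow>
        v \<in> V \<Longrightarrow> L2_set (Prd Ms v) K \<le> \<kappa> ^ n * L2_set v K"
    using jsr_on_less[OF \<theta>[unfolded jsr_masks_def]] by blast
  define D where "D = (real (card K))\<^sup>2"
  define \<Gamma> where "\<Gamma> = max 1 (D * B)"
  have lt: "\<kappa> ^ n < \<theta> ^ n" using n by (intro power_strict_mono) auto
  \<comment> \<open>Chosen so that the perturbation bound uses at most the gap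
    \<open>\<theta>^n - \<kappa>^n\<close>. Writing \<open>D + 1\<close> makes the denominator
    visibly positive.\<close>
  define \<eta> where "\<eta> = (\<theta> ^ n - \<kappa> ^ n) / (real n * \<Gamma> ^ n * (D + 1))"
  have D0: "0 \<le> D" by (simp add: D_def)
  have den: "real n * \<Gamma> ^ n * (D + 1) > 0" using n D0 by (intro mult_pos_pos) (auto simp: \<Gamma>_def)
  have \<eta>: "0 < \<eta>" unfolding \<eta>_def using den lt by simp
  have small: "real n * \<Gamma> ^ n * D * \<eta> \<le> \<theta> ^ n - \<kappa> ^ n"
  proof -
    have "real n * \<Gamma> ^ n * D * \<eta> \<le> real n * \<Gamma> ^ n * (D + 1) * \<eta>"
      using \<eta> by (intro mult_right_mono mult_left_mono) (auto simp: \<Gamma>_def)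
    also have "\<dots> = \<theta> ^ n - \<kappa> ^ n" unfolding \<eta>_def using den by (metis nonzero_mult_div_cancel_left times_divide_eq_right less_irrefl)
    finally show ?thesis .
  qed
  obtain k0 where k0: "\<And>k. k \<ge> k0 \<Longrightarrow> \<exists>a\<in>limit_points b. \<forall>\<alpha>. \<bar>b k \<alpha> - a \<alpha>\<bar> < \<eta>"
    using limit_points_approx[where b = b and N = N and B = B, OF supported bounded_masks \<eta>] by blast
  then obtain A where A: "\<And>k. k \<ge> k0 \<Longrightarrow> A k \<in> limit_points b" "\<And>k \<alpha>. k \<ge> k0 \<Longrightarrow> \<bar>b k \<alpha> - A k \<alpha>\<bar> < \<eta>"
    by metis
  have "L2_set (Prd (map (\<lambda>i. transition m N (es ! i) (b (k + Suc i))) [0..<n]) v) K \<le> \<theta> ^ n * L2_set v K"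
    if k: "k \<ge> k0" and es: "length es = n" "set es \<subseteq> digits m" and v: "v \<in> V" for k es v
  proof -
    define fs where "fs = map (\<lambda>i. (es ! i, b (k + Suc i), A (k + Suc i))) [0..<n]"
    have m1: "map (\<lambda>(\<epsilon>, a, a'). transition m N \<epsilon> a) fs = map (\<lambda>i. transition m N (es ! i) (b (k + Suc i))) [0..<n]"
      and m2: "map (\<lambda>(\<epsilon>, a, a'). transition m N \<epsilon> a') fs = map (\<lambda>i. transition m N (es ! i) (A (k + Suc i))) [0..<n]"
      by (auto simp: fs_def)
    let ?P = "Prd (map (\<lambda>(\<epsilon>, a, a'). transition m N \<epsilon> a) fs) v"
    let ?Q = "Prd (map (\<lambda>(\<epsilon>, a, a'). transition m N \<epsilon> a') fs) v"
    have "L2_set (\<lambda>\<alpha>. ?P \<alpha> - ?Q \<alpha>) K \<le> real (length fs) * \<Gamma> ^ length fs * D * \<eta> * L2_set v K"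
    proof (rule perturbed_products(2)[OF m _ _ D_def])
      show "1 \<le> \<Gamma>" "(real (card K))\<^sup>2 * B \<le> \<Gamma>" by (simp_all add: \<Gamma>_def D_def)
      show "0 \<le> \<eta>" using \<eta> by simp
      fix \<epsilon> a a' \<alpha> assume "(\<epsilon>, a, a') \<in> set fs"
      then obtain i where "a = b (k + Suc i)" "a' = A (k + Suc i)" by (auto simp: fs_def)
      then show "\<bar>a \<alpha>\<bar> \<le> B \<and> \<bar>a' \<alpha>\<bar> \<le> B \<and> \<bar>a \<alpha> - a' \<alpha>\<bar> \<le> \<eta>"
        using bounded_masks[of "k + Suc i" \<alpha>] limit_points_props(3)[OF A(1)[of "k + Suc i"]]
          A(2)[of "k + Suc i" \<alpha>] k by (simp add: less_imp_le)
    qed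
    also have "\<dots> = real n * \<Gamma> ^ n * D * \<eta> * L2_set v K" by (simp add: fs_def)
    also have "\<dots> \<le> (\<theta> ^ n - \<kappa> ^ n) * L2_set v K" using small by (intro mult_right_mono) auto
    finally have 1: "L2_set (\<lambda>\<alpha>. ?P \<alpha> - ?Q \<alpha>) K \<le> (\<theta> ^ n - \<kappa> ^ n) * L2_set v K" .
    have "es ! i \<in> digits m" if "i < n" for i using es that nth_mem by blast
    then have 2: "L2_set ?Q K \<le> \<kappa> ^ n * L2_set v K"
      unfolding m2 using k A(1) v by (intro P) (auto, metis le_SucI trans_le_add1)
    have "L2_set ?P K = L2_set (\<lambda>\<alpha>. (?P \<alpha> - ?Q \<alpha>) + ?Q \<alpha>) K" by simp
    also have "\<dots> \<le> L2_set (\<lambda>\<alpha>. ?P \<alpha> - ?Q \<alpha>) K + L2_set ?Q K" by (rule L2_set_triangle_ineq)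
    also have "\<dots> \<le> (\<theta> ^ n - \<kappa> ^ n) * L2_set v K + \<kappa> ^ n * L2_set v K" using 1 2 by (rule add_mono)
    finally show ?thesis unfolding m1 by (simp add: algebra_simps)
  qed
  then show ?thesis using n(1) by blast
qed

end

text \<open>A difference operator is convolution with a finite kernel; the box is negative because a
  shift by \<open>+ axis i 1\<close> is evaluated as \<open>\<gamma> - \<alpha>\<close>.\<close>

lemma fdiffs_representation:
  "\<exists>w. \<forall>c \<gamma>. fdiffs \<mu> c \<gamma> = (\<Sum>\<alpha>\<in>ibox (- int (length \<mu>)) 0. w \<alpha> * c (\<gamma> - \<alpha>))"
proof (induction \<mu>)
  case Nil
  have "ibox 0 0 = {0 :: int ^ 'a}" by (auto simp: ibox_def vec_eq_iff)
  then show ?case by (intro exI[of _ "\<lambda>_. 1"]) simp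
next
  case (Cons i \<mu>)
  let ?X = "ibox (- int (length \<mu>)) 0 :: (int ^ 'a) set" and ?Y = "ibox (- int (length (i # \<mu>))) 0 :: (int ^ 'a) set"
  obtain w where w: "\<And>c \<gamma>. fdiffs \<mu> c \<gamma> = (\<Sum>\<alpha>\<in>?X. w \<alpha> * c (\<gamma> - \<alpha>))" using Cons by blast
  define u where "u \<alpha> = (if \<alpha> \<in> ?X then w \<alpha> else 0)" for \<alpha>
  have XY: "?X \<subseteq> ?Y" by (auto simp: ibox_def intro: order_trans[rotated])
  have shift: "(\<lambda>\<alpha>. \<alpha> - axis i 1) ` ?X \<subseteq> ?Y"
  proof
    fix \<alpha> assume "\<alpha> \<in> (\<lambda>\<alpha>. \<alpha> - axis i 1) ` ?X"
    then obtain \<beta> where \<beta>: "\<alpha> = \<beta> - axis i 1" "\<And>j. - int (length \<mu>) \<le> \<beta> $ j \<and> \<beta> $ j \<le> 0"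
      by (auto simp: ibox_def)
    have "- int (length (i # \<mu>)) \<le> \<alpha> $ j \<and> \<alpha> $ j \<le> 0" for j
      using \<beta>(2)[of j] by (cases "j = i") (auto simp: \<beta>(1) axis_def)
    then show "\<alpha> \<in> ?Y" by (simp add: ibox_def)
  qed
  have "fdiffs (i # \<mu>) c \<gamma> = (\<Sum>\<alpha>\<in>?Y. (u (\<alpha> + axis i 1) - u \<alpha>) * c (\<gamma> - \<alpha>))" for c \<gamma>
  proof -
    have "fdiffs \<mu> c (\<gamma> + axis i 1) = (\<Sum>\<alpha>\<in>(\<lambda>\<alpha>. \<alpha> - axis i 1) ` ?X. u (\<alpha> + axis i 1) * c (\<gamma> - \<alpha>))"
      by (subst sum.reindex) (auto simp: inj_on_def w u_def algebra_simps intro!: sum.cong)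
    also have "\<dots> = (\<Sum>\<alpha>\<in>?Y. u (\<alpha> + axis i 1) * c (\<gamma> - \<alpha>))"
    proof (rule sum.mono_neutral_left[OF _ shift])
      show "\<forall>\<alpha>\<in>?Y - (\<lambda>\<alpha>. \<alpha> - axis i 1) ` ?X. u (\<alpha> + axis i 1) * c (\<gamma> - \<alpha>) = 0"
      proof
        fix \<alpha> assume "\<alpha> \<in> ?Y - (\<lambda>\<alpha>. \<alpha> - axis i 1) ` ?X"
        then have "\<alpha> + axis i 1 \<notin> ?X" using image_eqI[of \<alpha> "\<lambda>\<alpha>. \<alpha> - axis i 1" "\<alpha> + axis i 1"] by auto
        then show "u (\<alpha> + axis i 1) * c (\<gamma> - \<alpha>) = 0" by (simp add: u_def)
      qed
    qed simp
    finally have 1: "fdiffs \<mu> c (\<gamma> + axis i 1) = (\<Sum>\<alpha>\<in>?Y. u (\<alpha> + axis i 1) * c (\<gamma> - \<alpha>))" .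
    have 2: "fdiffs \<mu> c \<gamma> = (\<Sum>\<alpha>\<in>?Y. u \<alpha> * c (\<gamma> - \<alpha>))"
      unfolding w by (rule sum.mono_neutral_cong_left[OF _ XY]) (auto simp: u_def)
    show ?thesis unfolding fdiffs_simps fdiff_def 1 2 by (simp add: sum_subtractf left_diff_distrib)
  qed
  then show ?case by (intro exI[of _ "\<lambda>\<alpha>. u (\<alpha> + axis i 1) - u \<alpha>"]) blast
qed

context scheme
begin

text \<open>From level \<open>k0\<close> on, blocks of length \<open>n\<close> contract by
  \<open>\<theta>^n\<close>; the finitely many earlier levels, controlled by a crude one-step bound,
  affect only the constant.\<close>

lemma pair_decay:
  assumes \<theta>: "jsr_masks m N l (limit_points b) < \<theta>" and c: "\<And>\<alpha>. \<bar>c \<alpha>\<bar> \<le> S"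
  shows "\<exists>C\<ge>0. \<forall>k. \<forall>v\<in>V. \<forall>\<gamma>. \<bar>pair v (it k c) \<gamma>\<bar> \<le> C * \<theta> ^ k * L2_set v K"
proof -
  have \<theta>0: "0 < \<theta>" using \<theta> jsr_nonneg by linarith
  have S0: "0 \<le> S" using c[of undefined] by linarith
  define H where "H k X \<longleftrightarrow> (\<forall>v\<in>V. \<forall>\<gamma>. \<bar>pair v (it k c) \<gamma>\<bar> \<le> X * L2_set v K)" for k X
  define \<Gamma> where "\<Gamma> = (real (card K))\<^sup>2 * B"
  have fin: "finite K" by (rule finite_index_set[OF m])
  have H0: "H 0 (real (card K) * S)"
    unfolding H_def
  proof (intro ballI allI)
    fix v and \<gamma> :: "int ^ 's" assume "v \<in> V"
    have "\<bar>pair v (it 0 c) \<gamma>\<bar> \<le> (\<Sum>\<alpha>\<in>K. S * L2_set v K)"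
      unfolding pair_def
    proof (rule order_trans[OF sum_abs sum_mono])
      fix \<alpha> assume "\<alpha> \<in> K"
      then have "\<bar>v \<alpha>\<bar> \<le> L2_set (\<lambda>\<beta>. \<bar>v \<beta>\<bar>) K" by (intro member_le_L2_set fin)
      then have "\<bar>v \<alpha>\<bar> \<le> L2_set v K" by (simp add: L2_set_def)
      then have "\<bar>c (\<gamma> - \<alpha>)\<bar> * \<bar>v \<alpha>\<bar> \<le> S * L2_set v K" by (intro mult_mono c S0) auto
      then show "\<bar>v \<alpha> * it 0 c (\<gamma> - \<alpha>)\<bar> \<le> S * L2_set v K" by (simp add: abs_mult mult.commute)
    qed
    then show "\<bar>pair v (it 0 c) \<gamma>\<bar> \<le> real (card K) * S * L2_set v K" by simp
  qed
  have step: "H (Suc k) (X * \<Gamma>)" if "H k X" "0 \<le> X" for k X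
    unfolding H_def
  proof (intro ballI allI)
    fix v and \<gamma> :: "int ^ 's" assume v: "v \<in> V"
    obtain \<gamma>' \<epsilon> where \<gamma>: "\<gamma> = int m *s \<gamma>' + \<epsilon>" "\<epsilon> \<in> digits m" using vec_mod_decomp[OF m0] by blast
    let ?w = "transition m N \<epsilon> (b (Suc k)) v"
    have "\<bar>pair v (it (Suc k) c) \<gamma>\<bar> = \<bar>pair ?w (it k c) \<gamma>'\<bar>"
      using pair_step[of "Suc k" \<epsilon>] \<gamma> by simp
    also have "\<dots> \<le> X * L2_set ?w K"
      using that(1) transition_V_space[OF m regular \<gamma>(2) v, of "Suc k"] unfolding H_def by auto
    also have "\<dots> \<le> X * (\<Gamma> * L2_set v K)"
      unfolding \<Gamma>_def using bounded_masks by (intro mult_left_mono transition_bound m that) auto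
    finally show "\<bar>pair v (it (Suc k) c) \<gamma>\<bar> \<le> X * \<Gamma> * L2_set v K" by simp
  qed
  have ex: "\<exists>X\<ge>0. H k X" for k
  proof (induction k)
    case 0
    show ?case using H0 S0 by (intro exI[of _ "real (card K) * S"]) auto
  next
    case (Suc k)
    then obtain X where "X \<ge> 0" "H k X" by blast
    then show ?case using step[of k X] B0 by (intro exI[of _ "X * \<Gamma>"]) (auto simp: \<Gamma>_def)
  qed
  obtain n k0 where n: "n \<ge> 1" and contr: "\<And>k es v. k \<ge> k0 \<Longrightarrow> length es = n \<Longrightarrow> set es \<subseteq> digits m \<Longrightarrow> v \<in> V \<Longrightarrow>
    L2_set (Prd (map (\<lambda>i. transition m N (es ! i) (b (k + Suc i))) [0..<n]) v) K \<le> \<theta> ^ n * L2_set v K"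
    using eventual_contraction[OF \<theta>] by blast
  have PV: "Prd (map (\<lambda>i. transition m N (es ! i) (b (k + Suc i))) is) v \<in> V"
    if "set is \<subseteq> {0..<length es}" "set es \<subseteq> digits m" "v \<in> V" for k es v "is"
    using that
  proof (induction "is")
    case (Cons i "is")
    have "es ! i \<in> digits m" using Cons.prems nth_mem[of i es] by auto
    then show ?case using Cons transition_V_space[OF m regular] by simp
  qed simp
  have block: "H (k + n) (X * \<theta> ^ n)" if "H k X" "0 \<le> X" "k \<ge> k0" for k X
    unfolding H_def
  proof (intro ballI allI)
    fix v and \<gamma> :: "int ^ 's" assume v: "v \<in> V"
    obtain es \<gamma>' where es: "length es = n" "set es \<subseteq> digits m"
      "pair v (it (k + n) c) \<gamma>
        = pair (Prd (map (\<lambda>i. transition m N (es ! i) (b (k + Suc i))) [0..<n]) v) (it k c) \<gamma>'"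
      using pair_iterate[of n v k c \<gamma>] by blast
    let ?w = "Prd (map (\<lambda>i. transition m N (es ! i) (b (k + Suc i))) [0..<n]) v"
    have "?w \<in> V" using es v by (intro PV) auto
    then have "\<bar>pair v (it (k + n) c) \<gamma>\<bar> \<le> X * L2_set ?w K"
      using that(1) unfolding es(3) H_def by auto
    also have "\<dots> \<le> X * (\<theta> ^ n * L2_set v K)" by (intro mult_left_mono contr that es v)
    finally show "\<bar>pair v (it (k + n) c) \<gamma>\<bar> \<le> X * \<theta> ^ n * L2_set v K" by simp
  qed
  obtain X where X: "\<And>k. X k \<ge> 0" "\<And>k. H k (X k)" using ex by metis
  \<comment> \<open>Dominates every level below \<open>k0 + n\<close>, which starts the recursion in
    steps of \<open>n\<close> for each residue.\<close>
  define C where "C = (\<Sum>k<k0 + n. X k / \<theta> ^ k)"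
  have C0: "0 \<le> C" unfolding C_def using X \<theta>0 by (intro sum_nonneg) auto
  have "H k (C * \<theta> ^ k)" for k
  proof (induction k rule: less_induct)
    case (less k)
    show ?case
    proof (cases "k < k0 + n")
      case True
      then have "X k / \<theta> ^ k \<le> C" unfolding C_def using X \<theta>0 by (intro member_le_sum) auto
      then have "X k \<le> C * \<theta> ^ k" using \<theta>0 by (simp add: field_simps)
      then show ?thesis using X(2)[of k] unfolding H_def by (meson L2_set_nonneg mult_right_mono order_trans)
    next
      case False
      then have "H (k - n + n) (C * \<theta> ^ (k - n) * \<theta> ^ n)"
        using n C0 \<theta>0 by (intro block less.IH) auto
      moreover have "k - n + n = k" using False by simp
      ultimately show ?thesis by (metis mult.assoc power_add)
    qed
  qed
  then show ?thesis unfolding H_def using C0 by blast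
qed

text \<open>
  One transition step maps functionals supported in \<open>[-x, h]\<close> to functionals supported in
  \<open>[-(x + m - 1) div m, (h + N) div m]\<close>; the recursion shrinks any support into the index set.
\<close>

lemma functional_decay:
  assumes \<theta>: "jsr_masks m N l (limit_points b) < \<theta>" and c: "\<And>\<alpha>. \<bar>c \<alpha>\<bar> \<le> S"
  shows "int N < (int m - 1) * int h + int m \<Longrightarrow> \<exists>C\<ge>0. \<forall>w. annihilates l (ibox (- int x) (int h)) w \<longrightarrow>
    (\<forall>k \<gamma>. \<bar>\<Sum>\<alpha>\<in>ibox (- int x) (int h). w \<alpha> * it k c (\<gamma> - \<alpha>)\<bar> \<le> C * \<theta> ^ k * (\<Sum>\<alpha>\<in>ibox (- int x) (int h). \<bar>w \<alpha>\<bar>))"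
proof (induction "x + h" arbitrary: x h rule: less_induct)
  case less
  have \<theta>0: "0 < \<theta>" using \<theta> jsr_nonneg by linarith
  have S0: "0 \<le> S" using c[of undefined] by linarith
  let ?X = "ibox (- int x) (int h) :: (int ^ 's) set"
  show ?case
  \<comment> \<open>Under these bounds the box lies inside the index set, whose coordinates range
    from \<open>- m / (m - 1)\<close>, which is at most -1, up to
    \<open>(N + 1) / (m - 1)\<close>.\<close>
  proof (cases "x \<le> 1 \<and> (int m - 1) * int h \<le> int N + 1")
    case True
    have XK: "?X \<subseteq> K"
    proof
      fix \<alpha> assume \<alpha>: "\<alpha> \<in> ?X"
      have "- int m \<le> (int m - 1) * \<alpha> $ i \<and> (int m - 1) * \<alpha> $ i \<le> int N + 1" for i
      proof -
        have "- int x \<le> \<alpha> $ i" "\<alpha> $ i \<le> int h" using \<alpha> by (auto simp: ibox_def)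
        then have i: "- 1 \<le> \<alpha> $ i" "\<alpha> $ i \<le> int h" using True by linarith+
        have "(int m - 1) * (- 1) \<le> (int m - 1) * \<alpha> $ i" using i m by (intro mult_left_mono) auto
        moreover have "(int m - 1) * \<alpha> $ i \<le> (int m - 1) * int h" using i m by (intro mult_left_mono) auto
        ultimately show ?thesis using True by (auto simp: algebra_simps)
      qed
      then show "\<alpha> \<in> K" unfolding index_set_eq[OF m] by blast
    qed
    have fin: "finite K" by (rule finite_index_set[OF m])
    obtain C where C: "C \<ge> 0" "\<And>k v \<gamma>. v \<in> V \<Longrightarrow> \<bar>pair v (it k c) \<gamma>\<bar> \<le> C * \<theta> ^ k * L2_set v K"
      using pair_decay[where c = c and S = S, OF \<theta> c] by blast
    have "\<bar>\<Sum>\<alpha>\<in>?X. w \<alpha> * it k c (\<gamma> - \<alpha>)\<bar> \<le> C * \<theta> ^ k * (\<Sum>\<alpha>\<in>?X. \<bar>w \<alpha>\<bar>)"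
      if w: "annihilates l ?X w" for w k \<gamma>
    proof -
      define v where "v \<alpha> = (if \<alpha> \<in> ?X then w \<alpha> else 0)" for \<alpha>
      have sums: "(\<Sum>\<alpha>\<in>?X. w \<alpha> * f \<alpha>) = (\<Sum>\<alpha>\<in>K. v \<alpha> * f \<alpha>)" for f :: "int ^ 's \<Rightarrow> real"
        by (rule sum.mono_neutral_cong_left[OF fin XK]) (auto simp: v_def)
      have "v \<in> V" unfolding V_space_iff
        using w XK unfolding annihilates_def sums by (auto simp: v_def)
      then have "\<bar>pair v (it k c) \<gamma>\<bar> \<le> C * \<theta> ^ k * L2_set v K" by (rule C(2))
      also have "\<dots> \<le> C * \<theta> ^ k * (\<Sum>\<alpha>\<in>K. \<bar>v \<alpha>\<bar>)"
        using C(1) \<theta>0 by (intro mult_left_mono L2_set_le_sum_abs) auto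
      also have "(\<Sum>\<alpha>\<in>K. \<bar>v \<alpha>\<bar>) = (\<Sum>\<alpha>\<in>?X. \<bar>w \<alpha>\<bar>)"
        by (rule sum.mono_neutral_cong_right[OF fin XK]) (auto simp: v_def)
      finally show ?thesis by (simp add: sums pair_def)
    qed
    then show ?thesis using C(1) by blast
  next
    case False
    define x' where "x' = (x + m - 1) div m"
    define h' where "h' = (h + N) div m"
    let ?Y = "ibox (- int x') (int h') :: (int ^ 's) set"
    have m1: "int m > 0" using m by simp
    \<comment> \<open>The side condition on \<open>h\<close> says \<open>h + N < m (h + 1)\<close>,
      so the upper end never grows; the lower end does not grow either, and outside the first case
      one of them moves strictly.\<close>
    have hp: "N + 1 \<le> (m - 1) * h + m"
    proof -
      have "int N < int ((m - 1) * h + m)" using less.prems m by (simp add: of_nat_diff)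
      then show ?thesis by linarith
    qed
    have x'x: "x' \<le> x" and h'h: "h' \<le> h"
    proof -
      obtain m' where m': "m = Suc m'" using m by (cases m) auto
      have "x + m - 1 < m * Suc x" using m' by simp
      then have "x' < Suc x" unfolding x'_def using m by (intro less_mult_imp_div_less) (simp add: mult.commute)
      then show "x' \<le> x" by simp
      have "h + N < Suc h * m" using hp m' by (simp add: algebra_simps)
      then have "h' < Suc h" unfolding h'_def by (rule less_mult_imp_div_less)
      then show "h' \<le> h" by simp
    qed
    have "x' + h' < x + h"
    proof (cases "x \<ge> 2")
      case True
      obtain m' where m': "m = Suc m'" using m by (cases m) auto
      obtain y where y: "x = Suc (Suc y)" using True by (metis add_2_eq_Suc le_Suc_ex)
      have "x + m - 1 < x * m" using m m' y by simp
      then have "x' < x" unfolding x'_def by (rule less_mult_imp_div_less)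
      then show ?thesis using h'h by simp
    next
      case F: False
      then have "(int m - 1) * int h > int N + 1" using False by simp
      then have "int (h + N) < int (h * m)" by (simp add: algebra_simps)
      then have "h + N < h * m" by (simp only: of_nat_less_iff)
      then have "h' < h" unfolding h'_def by (rule less_mult_imp_div_less)
      then show ?thesis using x'x by simp
    qed
    moreover have "int N < (int m - 1) * int h' + int m"
    proof -
      have "h + N < m * Suc h'" unfolding h'_def using m by (metis dividend_less_times_div mult_Suc_right add.commute gr0I not_numeral_le_zero)
      then have "int (h + N) < int (m * Suc h')" by (simp only: of_nat_less_iff)
      then have "int h + int N + 1 \<le> int m * int h' + int m" by (simp add: algebra_simps)
      then have a: "(int m - 1) * (int h + int N + 1) \<le> (int m - 1) * (int m * int h' + int m)"
        using m by (intro mult_left_mono) auto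
      have "int m * int N < int m * ((int m - 1) * int h' + int m)"
        using a less.prems m by (simp add: algebra_simps)
      then show ?thesis using m1 by (simp add: mult_less_cancel_left_pos)
    qed
    ultimately obtain C where C: "C \<ge> 0" "\<And>w k \<gamma>. annihilates l ?Y w \<Longrightarrow>
      \<bar>\<Sum>\<alpha>\<in>?Y. w \<alpha> * it k c (\<gamma> - \<alpha>)\<bar> \<le> C * \<theta> ^ k * (\<Sum>\<alpha>\<in>?Y. \<bar>w \<alpha>\<bar>)"
      using less.hyps[of x' h'] by blast
    \<comment> \<open>\<open>S\<close> serves level 0, where no step is available; the division by
      \<open>\<theta>\<close> pays for the one level consumed by the shrinking step.\<close>
    define C' where "C' = S + C * (real (card ?Y) * B) / \<theta>"
    have C': "0 \<le> C'" unfolding C'_def using S0 C B0 \<theta>0 by simp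
    have "\<bar>\<Sum>\<alpha>\<in>?X. w \<alpha> * it k c (\<gamma> - \<alpha>)\<bar> \<le> C' * \<theta> ^ k * (\<Sum>\<alpha>\<in>?X. \<bar>w \<alpha>\<bar>)"
      if w: "annihilates l ?X w" for w k \<gamma>
    proof (cases k)
      case 0
      have "\<bar>\<Sum>\<alpha>\<in>?X. w \<alpha> * it k c (\<gamma> - \<alpha>)\<bar> \<le> (\<Sum>\<alpha>\<in>?X. S * \<bar>w \<alpha>\<bar>)"
      proof (rule order_trans[OF sum_abs sum_mono])
        show "\<bar>w \<alpha> * it k c (\<gamma> - \<alpha>)\<bar> \<le> S * \<bar>w \<alpha>\<bar>" for \<alpha>
          using mult_right_mono[OF c[of "\<gamma> - \<alpha>"], of "\<bar>w \<alpha>\<bar>"] by (simp add: 0 abs_mult mult.commute)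
      qed
      also have "\<dots> = S * (\<Sum>\<alpha>\<in>?X. \<bar>w \<alpha>\<bar>)" by (simp add: sum_distrib_left)
      also have "\<dots> \<le> C' * (\<Sum>\<alpha>\<in>?X. \<bar>w \<alpha>\<bar>)"
        unfolding C'_def using C B0 \<theta>0 by (intro mult_right_mono sum_nonneg) auto
      finally show ?thesis by (simp add: 0)
    next
      case (Suc k')
      obtain \<gamma>' \<epsilon> where \<gamma>: "\<gamma> = int m *s \<gamma>' + \<epsilon>" "\<epsilon> \<in> digits m" using vec_mod_decomp[OF m0] by blast
      have closed: "\<beta> \<in> ?Y" if "\<alpha> \<in> ?X" "b k (\<epsilon> + int m *s \<beta> - \<alpha>) \<noteq> 0" for \<alpha> \<beta>
      proof -
        have "- int x' \<le> \<beta> $ i \<and> \<beta> $ i \<le> int h'" for i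
        proof -
          have s: "0 \<le> \<epsilon> $ i + int m * \<beta> $ i - \<alpha> $ i" "\<epsilon> $ i + int m * \<beta> $ i - \<alpha> $ i \<le> int N"
            using supported_maskD[OF supported that(2)] Suc by (auto simp: ibox_def)
          have e: "0 \<le> \<epsilon> $ i" "\<epsilon> $ i \<le> int m - 1" using \<gamma>(2) by (auto simp: digits_def)
          have a: "- int x \<le> \<alpha> $ i" "\<alpha> $ i \<le> int h" using that(1) by (auto simp: ibox_def)
          have div: "y \<le> z div int m" if "y * int m \<le> z" for y z
            using zdiv_mono1[OF that m1] m1 by simp
          have "- \<beta> $ i * int m \<le> int (x + m - 1)" using s e a m by (simp add: of_nat_diff algebra_simps)
          then have "- \<beta> $ i \<le> int x'" unfolding x'_def zdiv_int by (rule div)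
          moreover have "\<beta> $ i * int m \<le> int (h + N)" using s e a by (simp add: algebra_simps)
          then have "\<beta> $ i \<le> int h'" unfolding h'_def zdiv_int by (rule div)
          ultimately show ?thesis by simp
        qed
        then show ?thesis by (simp add: ibox_def)
      qed
      let ?w = "\<lambda>\<beta>. \<Sum>\<alpha>\<in>?X. b k (\<epsilon> + int m *s \<beta> - \<alpha>) * w \<alpha>"
      have k1: "k \<ge> 1" using Suc by simp
      have "(\<Sum>\<alpha>\<in>?X. w \<alpha> * it k c (\<gamma> - \<alpha>)) = (\<Sum>\<alpha>\<in>?X. w \<alpha> * subdivision m (b k) (it k' c) (int m *s \<gamma>' + \<epsilon> - \<alpha>))"
        by (simp add: Suc \<gamma>)
      also have "\<dots> = (\<Sum>\<beta>\<in>?Y. ?w \<beta> * it k' c (\<gamma>' - \<beta>))"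
        by (rule subdivision_pairing) (use closed in auto)
      finally have "\<bar>\<Sum>\<alpha>\<in>?X. w \<alpha> * it k c (\<gamma> - \<alpha>)\<bar> \<le> C * \<theta> ^ k' * (\<Sum>\<beta>\<in>?Y. \<bar>?w \<beta>\<bar>)"
        using C(2)[OF annihilates_step[OF m0 regular[OF k1] w _ _ closed]] by simp
      also have "(\<Sum>\<beta>\<in>?Y. \<bar>?w \<beta>\<bar>) \<le> (\<Sum>\<beta>\<in>?Y. B * (\<Sum>\<alpha>\<in>?X. \<bar>w \<alpha>\<bar>))"
      proof (rule sum_mono)
        fix \<beta>
        have "\<bar>?w \<beta>\<bar> \<le> (\<Sum>\<alpha>\<in>?X. B * \<bar>w \<alpha>\<bar>)"
          by (rule order_trans[OF sum_abs sum_mono]) (simp add: abs_mult mult_right_mono bounded_masks[OF k1] del: One_nat_def)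
        then show "\<bar>?w \<beta>\<bar> \<le> B * (\<Sum>\<alpha>\<in>?X. \<bar>w \<alpha>\<bar>)" by (simp add: sum_distrib_left)
      qed
      also have "C * \<theta> ^ k' * (\<Sum>\<beta>\<in>?Y. B * (\<Sum>\<alpha>\<in>?X. \<bar>w \<alpha>\<bar>))
          = C * (real (card ?Y) * B) / \<theta> * \<theta> ^ k * (\<Sum>\<alpha>\<in>?X. \<bar>w \<alpha>\<bar>)"
        using \<theta>0 by (simp add: Suc)
      also have "\<dots> \<le> C' * \<theta> ^ k * (\<Sum>\<alpha>\<in>?X. \<bar>w \<alpha>\<bar>)"
        unfolding C'_def using S0 \<theta>0 by (intro mult_right_mono sum_nonneg) auto
      finally show ?thesis using C(1) \<theta>0 by (simp add: mult_left_mono)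
    qed
    then show ?thesis using C' by blast
  qed
qed

lemma differences_decay:
  assumes \<theta>: "jsr_masks m N l (limit_points b) < \<theta>" and c: "\<And>\<alpha>. \<bar>c \<alpha>\<bar> \<le> S"
  shows "\<exists>C\<ge>0. \<forall>\<mu> k \<gamma>. length \<mu> = Suc l \<longrightarrow> \<bar>fdiffs \<mu> (it k c) \<gamma>\<bar> \<le> C * \<theta> ^ k"
proof -
  have \<theta>0: "0 < \<theta>" using \<theta> jsr_nonneg by linarith
  let ?X = "ibox (- int (Suc l)) (int N) :: (int ^ 's) set" and ?Z = "ibox (- int (Suc l)) 0 :: (int ^ 's) set"
  have XX: "?Z \<subseteq> ?X" by (auto simp: ibox_def intro: order_trans)
  \<comment> \<open>The kernel of the difference ends at 0; it is extended by zero up to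
    \<open>N\<close>, for which the side condition of \<open>functional_decay\<close> holds.\<close>
  have "1 * int N \<le> (int m - 1) * int N" using m by (intro mult_right_mono) auto
  then have "int N < (int m - 1) * int N + int m" using m by linarith
  from functional_decay[where c = c and S = S and x = "Suc l" and h = N, OF \<theta> c this] obtain C where C: "C \<ge> 0"
    "\<And>w k \<gamma>. annihilates l ?X w \<Longrightarrow>
       \<bar>\<Sum>\<alpha>\<in>?X. w \<alpha> * it k c (\<gamma> - \<alpha>)\<bar> \<le> C * \<theta> ^ k * (\<Sum>\<alpha>\<in>?X. \<bar>w \<alpha>\<bar>)" by auto
  have "\<exists>D\<ge>0. \<forall>k \<gamma>. \<bar>fdiffs \<mu> (it k c) \<gamma>\<bar> \<le> D * \<theta> ^ k" if \<mu>: "length \<mu> = Suc l" for \<mu>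
  proof -
    obtain w where w: "\<And>c \<gamma>. fdiffs \<mu> c \<gamma> = (\<Sum>\<alpha>\<in>?Z. w \<alpha> * c (\<gamma> - \<alpha>))"
      using fdiffs_representation[of \<mu>] \<mu> by auto
    define u where "u \<alpha> = (if \<alpha> \<in> ?Z then w \<alpha> else 0)" for \<alpha>
    have u: "fdiffs \<mu> c \<gamma> = (\<Sum>\<alpha>\<in>?X. u \<alpha> * c (\<gamma> - \<alpha>))" for c \<gamma>
      unfolding w by (rule sum.mono_neutral_cong_left[OF _ XX]) (auto simp: u_def)
    have "annihilates l ?X u"
      unfolding annihilates_def
    proof
      fix p :: "real ^ 's \<Rightarrow> real" assume "p \<in> pol (Suc l)"
      from pol_affine[OF this, of 0 "-1"] have "(\<lambda>x. p (- x)) \<in> pol (length \<mu>)" by (simp add: \<mu>)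
      from fdiffs_pol_eq_0[OF this, of 0] show "(\<Sum>\<alpha>\<in>?X. u \<alpha> * p (of_int_vec \<alpha>)) = 0"
        unfolding u by (simp add: of_int_vec_minus)
    qed
    then have "\<bar>fdiffs \<mu> (it k c) \<gamma>\<bar> \<le> C * (\<Sum>\<alpha>\<in>?X. \<bar>u \<alpha>\<bar>) * \<theta> ^ k" for k \<gamma>
      using C(2)[of u k \<gamma>] unfolding u by (simp add: algebra_simps)
    then show ?thesis using C(1) by (intro exI[of _ "C * (\<Sum>\<alpha>\<in>?X. \<bar>u \<alpha>\<bar>)"]) (auto intro: sum_nonneg)
  qed
  then obtain D where D: "\<And>\<mu>. length \<mu> = Suc l \<Longrightarrow> D \<mu> \<ge> 0"
    "\<And>\<mu> k \<gamma>. length \<mu> = Suc l \<Longrightarrow> \<bar>fdiffs \<mu> (it k c) \<gamma>\<bar> \<le> D \<mu> * \<theta> ^ k" by metis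
  \<comment> \<open>There are finitely many lists of directions of this length, so summing their
    constants gives one for all.\<close>
  define M where "M = {\<mu> :: 's list. length \<mu> = Suc l}"
  have fin: "finite M" unfolding M_def using finite_lists_length_eq[of "UNIV :: 's set" "Suc l"] by simp
  have "\<bar>fdiffs \<mu> (it k c) \<gamma>\<bar> \<le> sum D M * \<theta> ^ k" if "length \<mu> = Suc l" for \<mu> k \<gamma>
  proof -
    have "D \<mu> \<le> sum D M" using that D fin by (intro member_le_sum) (auto simp: M_def)
    then have "D \<mu> * \<theta> ^ k \<le> sum D M * \<theta> ^ k" using \<theta>0 by (intro mult_right_mono) auto
    then show ?thesis using D(2)[OF that, of k \<gamma>] by linarith
  qed
  moreover have "0 \<le> sum D M" using D by (intro sum_nonneg) (auto simp: M_def)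
  ultimately show ?thesis by blast
qed

end

section \<open>Limits of scaled differences\<close>

lemma l1_dilate: "m > 0 \<Longrightarrow> l1 \<beta> \<le> l1 (int m *s \<beta>)"
  unfolding l1_def by (intro sum_mono) (auto simp: abs_mult mult_le_cancel_right1)

lemma l1_ibox: "\<gamma> \<in> ibox 0 (int n) \<Longrightarrow> l1 (\<gamma> :: int ^ 's::finite) \<le> real (CARD('s) * n)"
proof -
  assume "\<gamma> \<in> ibox 0 (int n)"
  then have "\<bar>\<gamma> $ i\<bar> \<le> int n" for i by (auto simp: ibox_def)
  then have "real_of_int \<bar>\<gamma> $ i\<bar> \<le> real n" for i by (metis of_int_le_iff of_int_of_nat_eq)
  then have "l1 \<gamma> \<le> (\<Sum>i\<in>(UNIV :: 's set). real n)" unfolding l1_def by (intro sum_mono)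
  then show ?thesis by simp
qed

text \<open>A unit shift at most doubles the weight \<open>1 + l1 \<alpha>\<close>, whence a factor
  \<open>2^n + 1\<close> per difference.\<close>

lemma fdiffs_growth:
  assumes "\<And>\<beta>. \<bar>e \<beta>\<bar> \<le> \<delta> * (1 + l1 \<beta>) ^ n"
  shows "\<bar>fdiffs \<mu> e \<alpha>\<bar> \<le> (2 ^ n + 1) ^ length \<mu> * \<delta> * (1 + l1 \<alpha>) ^ n"
proof (induction \<mu> arbitrary: \<alpha>)
  case Nil
  then show ?case using assms by simp
next
  case (Cons i \<mu>)
  let ?D = "(2 ^ n + 1) ^ length \<mu> * \<delta>"
  have "0 \<le> \<delta>" using assms[of 0] by (simp add: l1_def)
  then have D0: "0 \<le> ?D" by simp
  have "\<bar>fdiffs (i # \<mu>) e \<alpha>\<bar> \<le> \<bar>fdiffs \<mu> e (\<alpha> + axis i 1)\<bar> + \<bar>fdiffs \<mu> e \<alpha>\<bar>" by (simp add: fdiff_def)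
  also have "\<dots> \<le> ?D * (1 + l1 (\<alpha> + axis i 1)) ^ n + ?D * (1 + l1 \<alpha>) ^ n" by (intro add_mono Cons.IH)
  also have "(1 + l1 (\<alpha> + axis i 1)) ^ n \<le> 2 ^ n * (1 + l1 \<alpha>) ^ n"
    unfolding power_mult_distrib[symmetric]
    using l1_triangle[of \<alpha> "axis i 1"] l1_axis[of i] l1_nonneg[of \<alpha>] l1_nonneg[of "\<alpha> + axis i 1"]
    by (intro power_mono) simp_all
  finally show ?case using D0 by (simp add: algebra_simps mult_left_mono mult_right_mono)
qed

text \<open>Lets the local analysis around a coarse index \<open>\<gamma>\<close> be carried out at
  the origin.\<close>

lemma subdivision_shift:
  "subdivision m a c (int m *s \<gamma> + \<alpha>) = subdivision m a (\<lambda>\<beta>. c (\<gamma> + \<beta>)) \<alpha>"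
  unfolding subdivision_def
proof (rule sum.reindex_bij_witness[of _ "\<lambda>\<beta>. \<gamma> + \<beta>" "\<lambda>\<beta>. \<beta> - \<gamma>"])
  have eq: "\<alpha> - int m *s (\<beta> - \<gamma>) = int m *s \<gamma> + \<alpha> - int m *s \<beta>" for \<beta> by (simp add: vec_eq_iff algebra_simps)
  show "\<beta> - \<gamma> \<in> {\<beta>. a (\<alpha> - int m *s \<beta>) \<noteq> 0}" if "\<beta> \<in> {\<beta>. a (int m *s \<gamma> + \<alpha> - int m *s \<beta>) \<noteq> 0}" for \<beta>
    using that unfolding mem_Collect_eq eq .
  show "a (\<alpha> - int m *s (\<beta> - \<gamma>)) * c (\<gamma> + (\<beta> - \<gamma>)) = a (int m *s \<gamma> + \<alpha> - int m *s \<beta>) * c \<beta>"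
    if "\<beta> \<in> {\<beta>. a (int m *s \<gamma> + \<alpha> - int m *s \<beta>) \<noteq> 0}" for \<beta>
    unfolding eq by simp
  show "\<gamma> + \<beta> \<in> {\<beta>. a (int m *s \<gamma> + \<alpha> - int m *s \<beta>) \<noteq> 0}" if "\<beta> \<in> {\<beta>. a (\<alpha> - int m *s \<beta>) \<noteq> 0}" for \<beta>
    using that unfolding mem_Collect_eq eq[symmetric] by simp
qed auto

lemma subdivision_add: "subdivision m a (\<lambda>\<alpha>. c \<alpha> + d \<alpha>) = (\<lambda>\<alpha>. subdivision m a c \<alpha> + subdivision m a d \<alpha>)"
  by (simp add: subdivision_def distrib_left sum.distrib)

text \<open>An index \<open>\<beta>\<close> that contributes at \<open>\<alpha>\<close> satisfies
  \<open>l1 \<beta> \<le> l1 (m \<beta>) \<le> l1 \<alpha> + s N\<close>, so polynomial weights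
  survive up to a constant; at most one \<open>\<beta>\<close> belongs to each point of the support
  box.\<close>

lemma subdivision_growth:
  fixes a :: "'s::finite seq"
  assumes m: "m > 0" and a: "supported_mask N a" "\<And>\<alpha>. \<bar>a \<alpha>\<bar> \<le> B"
    and e: "\<And>\<beta>. \<bar>e \<beta>\<bar> \<le> \<delta> * (1 + l1 \<beta>) ^ n"
  shows "\<bar>subdivision m a e \<alpha>\<bar> \<le> (real (card (ibox 0 (int N) :: (int ^ 's) set)) * B * (1 + real (CARD('s) * N)) ^ n)
    * \<delta> * (1 + l1 \<alpha>) ^ n"
proof -
  let ?X = "ibox 0 (int N) :: (int ^ 's) set" and ?F = "{\<beta>. a (\<alpha> - int m *s \<beta>) \<noteq> 0}"
  let ?b = "\<delta> * ((1 + real (CARD('s) * N)) * (1 + l1 \<alpha>)) ^ n"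
  have \<delta>: "0 \<le> \<delta>" using e[of 0] by (simp add: l1_def)
  have B: "0 \<le> B" using a(2)[of 0] by linarith
  have "\<bar>subdivision m a e \<alpha>\<bar> \<le> (\<Sum>\<beta>\<in>?F. B * ?b)"
    unfolding subdivision_def
  proof (rule order_trans[OF sum_abs sum_mono])
    fix \<beta> assume "\<beta> \<in> ?F"
    then have "\<alpha> - int m *s \<beta> \<in> ?X" using supported_maskD[OF a(1)] by blast
    then have "l1 (\<alpha> - int m *s \<beta>) \<le> real (CARD('s) * N)" by (rule l1_ibox)
    moreover have "l1 (int m *s \<beta>) \<le> l1 \<alpha> + l1 (\<alpha> - int m *s \<beta>)"
      using l1_triangle[of \<alpha> "- (\<alpha> - int m *s \<beta>)"] l1_minus[of "\<alpha> - int m *s \<beta>"] by simp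
    ultimately have "1 + l1 \<beta> \<le> 1 + l1 \<alpha> + real (CARD('s) * N)"
      using l1_dilate[OF m, of \<beta>] by linarith
    also have "\<dots> \<le> (1 + real (CARD('s) * N)) * (1 + l1 \<alpha>)"
      using l1_nonneg[of \<alpha>] by (simp add: algebra_simps)
    finally have "\<delta> * (1 + l1 \<beta>) ^ n \<le> ?b" using l1_nonneg[of \<beta>] \<delta> by (intro mult_left_mono power_mono) auto
    then have "\<bar>e \<beta>\<bar> \<le> ?b" using e[of \<beta>] by linarith
    then show "\<bar>a (\<alpha> - int m *s \<beta>) * e \<beta>\<bar> \<le> B * ?b"
      unfolding abs_mult using a(2) B by (intro mult_mono) auto
  qed
  also have "\<dots> = real (card ?F) * (B * ?b)" by simp
  also have "\<dots> \<le> real (card ?X) * (B * ?b)"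
  proof (intro mult_right_mono)
    have "card ((\<lambda>\<beta>. \<alpha> - int m *s \<beta>) ` ?F) \<le> card ?X"
      using supported_maskD[OF a(1)] by (intro card_mono) auto
    moreover have "card ((\<lambda>\<beta>. \<alpha> - int m *s \<beta>) ` ?F) = card ?F"
      by (rule card_image[OF inj_on_subset[OF inj_dilate[OF m]]]) auto
    ultimately show "real (card ?F) \<le> real (card ?X)" by simp
    show "0 \<le> B * ?b" using B \<delta> l1_nonneg[of \<alpha>] by simp
  qed
  finally show ?thesis by (simp add: power_mult_distrib mult_ac)
qed

lemma geometric_limit:
  fixes x :: "nat \<Rightarrow> real"
  assumes st: "\<And>k. \<bar>x (Suc k) - x k\<bar> \<le> C * r ^ k" and r: "0 \<le> r" "r < 1"
  shows "\<bar>x k - lim x\<bar> \<le> C / (1 - r) * r ^ k" "convergent x"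
proof -
  have C: "0 \<le> C" using st[of 0] by auto
  have tail: "\<bar>x (k + n) - x k\<bar> \<le> C * r ^ k / (1 - r)" for k n
  proof -
    have "\<bar>x (k + n) - x k\<bar> \<le> C * r ^ k * (\<Sum>i<n. r ^ i)"
    proof (induction n)
      case (Suc n)
      have "\<bar>x (k + Suc n) - x k\<bar> \<le> \<bar>x (Suc (k + n)) - x (k + n)\<bar> + \<bar>x (k + n) - x k\<bar>" by simp
      also have "\<dots> \<le> C * r ^ (k + n) + C * r ^ k * (\<Sum>i<n. r ^ i)" using st[of "k + n"] Suc by linarith
      finally show ?case by (simp add: power_add algebra_simps)
    qed simp
    also have "(\<Sum>i<n. r ^ i) \<le> 1 / (1 - r)"
      using r by (simp add: sum_gp_strict divide_right_mono)
    finally show ?thesis using C r by (simp add: mult_left_mono)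
  qed
  have "Cauchy x"
  proof (rule metric_CauchyI)
    fix e :: real assume "0 < e"
    have "(\<lambda>k. C * r ^ k / (1 - r)) \<longlonglongrightarrow> C * 0 / (1 - r)"
      using r by (intro tendsto_intros LIMSEQ_realpow_zero) auto
    then have "\<forall>\<^sub>F k in sequentially. C * r ^ k / (1 - r) < e / 2" using \<open>0 < e\<close> by (intro order_tendstoD) auto
    then obtain k where k: "C * r ^ k / (1 - r) < e / 2" by (auto simp: eventually_sequentially)
    show "\<exists>M. \<forall>i\<ge>M. \<forall>n\<ge>M. dist (x i) (x n) < e"
    proof (intro exI[of _ k] allI impI)
      fix i n assume "i \<ge> k" "n \<ge> k"
      then have "\<bar>x i - x k\<bar> < e / 2" "\<bar>x n - x k\<bar> < e / 2"
        using tail[of k "i - k"] tail[of k "n - k"] k by (simp_all only: le_add_diff_inverse)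
      then show "dist (x i) (x n) < e" unfolding dist_real_def by linarith
    qed
  qed
  then show conv: "convergent x" by (simp add: Cauchy_convergent_iff)
  then have "(\<lambda>n. x (n + k)) \<longlonglongrightarrow> lim x" by (simp add: LIMSEQ_ignore_initial_segment convergent_LIMSEQ_iff)
  then have "(\<lambda>n. \<bar>x (k + n) - x k\<bar>) \<longlonglongrightarrow> \<bar>lim x - x k\<bar>"
    by (intro tendsto_intros) (simp add: add.commute)
  then have "\<bar>lim x - x k\<bar> \<le> C * r ^ k / (1 - r)"
    by (rule LIMSEQ_le_const2) (use tail in auto)
  then show "\<bar>x k - lim x\<bar> \<le> C / (1 - r) * r ^ k" by (simp add: abs_minus_commute)
qed

definition fl :: "real ^ 's \<Rightarrow> int ^ 's::finite" where
  "fl x = (\<chi> i. \<lfloor>x $ i\<rfloor>)"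

text \<open>One bounded starting sequence \<open>c\<close> with a decay rate
  \<open>\<theta> < m^(-l)\<close>, to be chosen above the spectral radius. The decay of the
  differences of order \<open>l + 1\<close> becomes an assumption, so that the analysis no longer
  mentions operators.\<close>

locale limit_scheme = scheme m N l b B for m N l :: nat and b :: "nat \<Rightarrow> ('s::finite) seq" and B :: real +
  fixes c :: "'s seq" and \<theta> S C\<^sub>0 :: real
  assumes \<theta>0: "0 < \<theta>" and \<theta>l: "real m ^ l * \<theta> < 1"
    and decay: "\<And>\<mu> k \<gamma>. length \<mu> = Suc l \<Longrightarrow> \<bar>fdiffs \<mu> (iterated_subdivision m b k c) \<gamma>\<bar> \<le> C\<^sub>0 * \<theta> ^ k"
    and c_bounded: "\<And>\<alpha>. \<bar>c \<alpha>\<bar> \<le> S"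
begin

text \<open>The ratio of convergence for order \<open>j\<close>: differences of order
  \<open>j + 1\<close> at level \<open>k\<close> are of size \<open>(m^(-j) * rate j)^k\<close>. For
  \<open>j = l\<close> this is the decay \<open>\<theta>^k\<close>; below, they already have the
  size \<open>m^(-(j+1) k)\<close> proper to bounded derivatives.\<close>

definition rate :: "nat \<Rightarrow> real" where
  "rate j = (if j = l then real m ^ l * \<theta> else 1 / real m)"

lemma rate: "0 < rate j" "rate j < 1"
  using \<theta>0 \<theta>l m by (auto simp: rate_def)

text \<open>Around \<open>\<gamma>\<close> the data are a Newton polynomial of degree at most
  \<open>j\<close> plus an error governed by differences of order \<open>j + 1\<close>. On the
  polynomial one step multiplies the differences of order \<open>j\<close> by \<open>m^(-j)\<close>
  exactly; the error has polynomial growth, which subdivision and differences preserve.\<close>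

lemma step_differences:
  assumes j: "j \<le> l"
  shows "\<exists>C\<ge>0. \<forall>k d \<delta> \<mu> \<gamma> \<epsilon>. k \<ge> 1 \<longrightarrow> length \<mu> = j \<longrightarrow> \<epsilon> \<in> digits m \<longrightarrow>
     (\<forall>\<nu> \<beta>. length \<nu> = Suc j \<longrightarrow> \<bar>fdiffs \<nu> d \<beta>\<bar> \<le> \<delta>) \<longrightarrow>
     \<bar>fdiffs \<mu> (subdivision m (b k) d) (int m *s \<gamma> + \<epsilon>) - (1 / real m) ^ j * fdiffs \<mu> d \<gamma>\<bar> \<le> C * \<delta>"
proof -
  define C1 where "C1 = (2 ^ Suc j + 1) ^ j * (real (card (ibox 0 (int N) :: (int ^ 's) set)) * B * (1 + real (CARD('s) * N)) ^ Suc j)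
    * (1 + real (CARD('s) * m)) ^ Suc j"
  define C2 :: real where "C2 = (2 ^ Suc j + 1) ^ j"
  have C: "0 \<le> C1" "0 \<le> C2" using B0 by (auto simp: C1_def C2_def)
  have "\<bar>fdiffs \<mu> (subdivision m (b k) d) (int m *s \<gamma> + \<epsilon>) - (1 / real m) ^ j * fdiffs \<mu> d \<gamma>\<bar> \<le> (C1 + C2) * \<delta>"
    if k: "k \<ge> 1" and \<mu>: "length \<mu> = j" and \<epsilon>: "\<epsilon> \<in> digits m"
      and d: "\<And>\<nu> \<beta>. length \<nu> = Suc j \<Longrightarrow> \<bar>fdiffs \<nu> d \<beta>\<bar> \<le> \<delta>" for k d \<delta> \<mu> \<gamma> \<epsilon>
  proof -
    define d' where "d' \<beta> = d (\<gamma> + \<beta>)" for \<beta>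
    have "\<bar>fdiffs \<nu> d' \<beta>\<bar> \<le> \<delta>" if "length \<nu> = Suc j" for \<nu> \<beta>
      using d[OF that, of "\<gamma> + \<beta>"] by (simp add: d'_def[abs_def] fdiffs_shift)
    from newton_approximation[of "Suc j" d', OF this] obtain p where p: "p \<in> pol (Suc j)"
      "\<And>\<beta>. \<bar>d' \<beta> - p (of_int_vec \<beta>)\<bar> \<le> \<delta> * (1 + l1 \<beta>) ^ Suc j" by blast
    have \<delta>: "0 \<le> \<delta>" using p(2)[of 0] by (simp add: l1_def)
    define e where "e \<beta> = d' \<beta> - p (of_int_vec \<beta>)" for \<beta>
    have d'_eq: "d' = (\<lambda>\<beta>. p (of_int_vec \<beta>) + e \<beta>)" by (auto simp: e_def)
    obtain q where q: "q \<in> pol j" "\<And>\<alpha>. subdivision m (b k) (\<lambda>\<alpha>. p (of_int_vec \<alpha>)) \<alpha>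
      = p ((1 / real m) *\<^sub>R of_int_vec \<alpha>) + q ((1 / real m) *\<^sub>R of_int_vec \<alpha>)"
      using subdivision_pol[OF m0 regular[OF k] p(1) j] by blast
    let ?S = "subdivision m (b k)"
    have "?S d (int m *s \<gamma> + \<alpha>) = p (0 + (1 / real m) *\<^sub>R of_int_vec \<alpha>) + q (0 + (1 / real m) *\<^sub>R of_int_vec \<alpha>) + ?S e \<alpha>" for \<alpha>
      unfolding subdivision_shift d'_def[symmetric] d'_eq subdivision_add q(2) by simp
    then have "fdiffs \<mu> (?S d) (int m *s \<gamma> + \<epsilon>)
      = fdiffs \<mu> (\<lambda>\<alpha>. p (0 + (1 / real m) *\<^sub>R of_int_vec \<alpha>) + q (0 + (1 / real m) *\<^sub>R of_int_vec \<alpha>) + ?S e \<alpha>) \<epsilon>"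
      using fdiffs_shift[of \<mu> "?S d" "int m *s \<gamma>"] by (metis (no_types, lifting) ext)
    also have "\<dots> = (1 / real m) ^ j * partials \<mu> p 0 + fdiffs \<mu> (?S e) \<epsilon>"
      unfolding fdiffs_add
      using fdiffs_pol[of p \<mu> 0 "1 / real m" \<epsilon> 0] fdiffs_pol[of q \<mu> 0 "1 / real m" \<epsilon> 0] p(1) q(1)
        partials_pol_eq_0[of q \<mu> 0] pol_Suc[OF q(1)] \<mu> by simp
    finally have 1: "fdiffs \<mu> (?S d) (int m *s \<gamma> + \<epsilon>) = (1 / real m) ^ j * partials \<mu> p 0 + fdiffs \<mu> (?S e) \<epsilon>" .
    have "fdiffs \<mu> d \<gamma> = fdiffs \<mu> d' 0" using fdiffs_shift[of \<mu> d \<gamma>] by (simp add: d'_def[abs_def])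
    also have "\<dots> = partials \<mu> p 0 + fdiffs \<mu> e 0"
      unfolding d'_eq fdiffs_add using fdiffs_pol_1[of p \<mu> 0 0] p(1) \<mu> by simp
    finally have 2: "fdiffs \<mu> d \<gamma> = partials \<mu> p 0 + fdiffs \<mu> e 0" .
    have e: "\<bar>e \<beta>\<bar> \<le> \<delta> * (1 + l1 \<beta>) ^ Suc j" for \<beta> using p(2) by (simp add: e_def)
    note Se = subdivision_growth[OF m0 supported[OF k] bounded_masks[OF k] e]
    let ?K = "real (card (ibox 0 (int N) :: (int ^ 's) set)) * B * (1 + real (CARD('s) * N)) ^ Suc j"
    have "\<bar>fdiffs \<mu> (?S e) \<epsilon>\<bar> \<le> (2 ^ Suc j + 1) ^ length \<mu> * (?K * \<delta>) * (1 + l1 \<epsilon>) ^ Suc j"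
      by (rule fdiffs_growth) (use Se in simp)
    also have "\<dots> \<le> (2 ^ Suc j + 1) ^ length \<mu> * (?K * \<delta>) * (1 + real (CARD('s) * m)) ^ Suc j"
    proof (intro mult_left_mono power_mono)
      have "\<epsilon> \<in> ibox 0 (int m)" using \<epsilon> by (auto simp: digits_def ibox_def less_imp_le)
      then show "1 + l1 \<epsilon> \<le> 1 + real (CARD('s) * m)" using l1_ibox[of \<epsilon> m] by simp
    qed (use l1_nonneg[of \<epsilon>] B0 \<delta> in auto)
    also have "\<dots> = C1 * \<delta>" by (simp add: C1_def \<mu>)
    finally have 3: "\<bar>fdiffs \<mu> (?S e) \<epsilon>\<bar> \<le> C1 * \<delta>" .
    have 4: "\<bar>fdiffs \<mu> e 0\<bar> \<le> C2 * \<delta>" using fdiffs_growth[of e \<delta> "Suc j" \<mu> 0, OF e] by (simp add: C2_def \<mu> l1_def)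
    have "\<bar>fdiffs \<mu> (?S d) (int m *s \<gamma> + \<epsilon>) - (1 / real m) ^ j * fdiffs \<mu> d \<gamma>\<bar>
      = \<bar>fdiffs \<mu> (?S e) \<epsilon> - (1 / real m) ^ j * fdiffs \<mu> e 0\<bar>" unfolding 1 2 by (simp add: algebra_simps)
    also have "\<dots> \<le> \<bar>fdiffs \<mu> (?S e) \<epsilon>\<bar> + (1 / real m) ^ j * \<bar>fdiffs \<mu> e 0\<bar>"
      by (rule order_trans[OF abs_triangle_ineq4]) (simp add: abs_mult)
    also have "(1 / real m) ^ j * \<bar>fdiffs \<mu> e 0\<bar> \<le> 1 * (C2 * \<delta>)"
      using 4 m by (intro mult_mono power_le_one) auto
    finally show ?thesis using 3 by (simp add: algebra_simps)
  qed
  then show ?thesis using C by (intro exI[of _ "C1 + C2"] conjI allI impI) auto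
qed

text \<open>Divided by \<open>m^(-j k)\<close>, the differences of order \<open>j\<close> change by
  at most a multiple of \<open>r^k\<close> per level; the geometric series keeps them
  bounded.\<close>

lemma differences_bound_step:
  assumes j: "j \<le> l" and nxt: "\<And>\<nu> k \<gamma>. length \<nu> = Suc j \<Longrightarrow> \<bar>fdiffs \<nu> (it k c) \<gamma>\<bar> \<le> D * ((1 / real m) ^ j * r) ^ k"
    and r: "0 < r" "r < 1"
  shows "\<exists>C. \<forall>\<mu> k \<gamma>. length \<mu> = j \<longrightarrow> \<bar>fdiffs \<mu> (it k c) \<gamma>\<bar> \<le> C * ((1 / real m) ^ j) ^ k"
proof -
  obtain A where A: "A \<ge> 0" and step: "\<And>k d \<delta> \<mu> \<gamma> \<epsilon>. k \<ge> 1 \<Longrightarrow> length \<mu> = j \<Longrightarrow> \<epsilon> \<in> digits m \<Longrightarrow>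
     (\<forall>\<nu> \<beta>. length \<nu> = Suc j \<longrightarrow> \<bar>fdiffs \<nu> d \<beta>\<bar> \<le> \<delta>) \<Longrightarrow>
     \<bar>fdiffs \<mu> (subdivision m (b k) d) (int m *s \<gamma> + \<epsilon>) - (1 / real m) ^ j * fdiffs \<mu> d \<gamma>\<bar> \<le> A * \<delta>"
    using step_differences[OF j] by blast
  let ?\<rho> = "(1 / real m) ^ j"
  have \<rho>: "0 < ?\<rho>" using m by simp
  have alg: "R * (R ^ k * X) + A * (D * (R * r) ^ k) = R ^ Suc k * (X + A * D / R * r ^ k)" if "0 < R" for R X k
    using that by (simp add: power_mult_distrib field_simps)
  have D: "0 \<le> D" using nxt[of "replicate (Suc j) undefined" 0 0] by (simp del: replicate.simps)
  have ind: "\<bar>fdiffs \<mu> (it k c) \<gamma>\<bar> \<le> ?\<rho> ^ k * (2 ^ j * S + A * D / ?\<rho> * (\<Sum>i<k. r ^ i))"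
    if "length \<mu> = j" for \<mu> k \<gamma>
  proof (induction k arbitrary: \<gamma>)
    case 0
    have "\<bar>c \<beta>\<bar> \<le> S * (1 + l1 \<beta>) ^ 0" for \<beta> using c_bounded by simp
    from fdiffs_growth[where e = c and \<delta> = S and n = 0 and \<mu> = \<mu> and \<alpha> = \<gamma>, OF this] show ?case using that by simp
  next
    case (Suc k)
    obtain \<gamma>' \<epsilon> where \<gamma>: "\<gamma> = int m *s \<gamma>' + \<epsilon>" "\<epsilon> \<in> digits m" using vec_mod_decomp[OF m0] by blast
    let ?X = "2 ^ j * S + A * D / ?\<rho> * (\<Sum>i<k. r ^ i)"
    have "\<bar>fdiffs \<mu> (it (Suc k) c) \<gamma> - ?\<rho> * fdiffs \<mu> (it k c) \<gamma>'\<bar> \<le> A * (D * (?\<rho> * r) ^ k)"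
      using step[of "Suc k" \<mu> \<epsilon> "it k c" "D * (?\<rho> * r) ^ k" \<gamma>'] nxt that \<gamma> by simp
    moreover have "\<bar>?\<rho> * fdiffs \<mu> (it k c) \<gamma>'\<bar> \<le> ?\<rho> * (?\<rho> ^ k * ?X)"
      unfolding abs_mult using Suc[of \<gamma>'] \<rho> by (simp add: mult_left_mono)
    ultimately have "\<bar>fdiffs \<mu> (it (Suc k) c) \<gamma>\<bar> \<le> ?\<rho> * (?\<rho> ^ k * ?X) + A * (D * (?\<rho> * r) ^ k)" by linarith
    also have "\<dots> = ?\<rho> ^ Suc k * (?X + A * D / ?\<rho> * r ^ k)"
      by (rule alg[OF \<rho>])
    finally show ?case by (simp only: sum.lessThan_Suc distrib_left add.assoc)
  qed
  have "\<bar>fdiffs \<mu> (it k c) \<gamma>\<bar> \<le> (2 ^ j * S + A * D / ?\<rho> * (1 / (1 - r))) * ?\<rho> ^ k" if "length \<mu> = j" for \<mu> k \<gamma>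
  proof -
    have "(\<Sum>i<k. r ^ i) \<le> 1 / (1 - r)" using r by (simp add: sum_gp_strict divide_right_mono)
    then have "?\<rho> ^ k * (2 ^ j * S + A * D / ?\<rho> * (\<Sum>i<k. r ^ i)) \<le> ?\<rho> ^ k * (2 ^ j * S + A * D / ?\<rho> * (1 / (1 - r)))"
      using A D \<rho> by (intro mult_left_mono add_left_mono) auto
    then show ?thesis using ind[OF that, of k \<gamma>] by (simp add: mult.commute)
  qed
  then show ?thesis by blast
qed

text \<open>Downward induction from order \<open>l\<close>: decay in one order gives the bound for
  the order below, which is the premise of the next step.\<close>

lemma next_differences:
  "j \<le> l \<Longrightarrow> \<exists>D. \<forall>\<nu> k \<gamma>. length \<nu> = Suc j \<longrightarrow> \<bar>fdiffs \<nu> (it k c) \<gamma>\<bar> \<le> D * ((1 / real m) ^ j * rate j) ^ k"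
proof (induction j rule: inc_induct)
  case base
  have "(1 / real m) ^ l * rate l = \<theta>" using m by (simp add: rate_def power_one_over)
  then show ?case using decay by metis
next
  case (step j)
  obtain D where D: "\<And>\<nu> k \<gamma>. length \<nu> = Suc (Suc j) \<Longrightarrow> \<bar>fdiffs \<nu> (it k c) \<gamma>\<bar> \<le> D * ((1 / real m) ^ Suc j * rate (Suc j)) ^ k"
    using step.IH by blast
  have "(1 / real m) ^ j * rate j = (1 / real m) ^ Suc j" using step.hyps by (simp add: rate_def)
  then show ?case using differences_bound_step[of "Suc j" D "rate (Suc j)", OF _ D] rate step.hyps by simp
qed

text \<open>A step function on the grid of width \<open>m^(-k)\<close>: the difference quotient of
  order \<open>length \<mu>\<close> of the level \<open>k\<close> data, read off in the cell of
  \<open>x\<close>.\<close>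

definition Gk :: "nat \<Rightarrow> 's list \<Rightarrow> real ^ 's \<Rightarrow> real" where
  "Gk k \<mu> x = real m ^ (length \<mu> * k) * fdiffs \<mu> (it k c) (fl (real m ^ k *\<^sub>R x))"

text \<open>For lists of length at most \<open>l\<close> the limit exists; \<open>G []\<close> will
  be the limit function and \<open>G \<mu>\<close> its derivatives.\<close>

definition G :: "'s list \<Rightarrow> real ^ 's \<Rightarrow> real" where
  "G \<mu> x = lim (\<lambda>k. Gk k \<mu> x)"

lemma fl_decomp: "\<exists>\<epsilon>\<in>digits m. fl (real m ^ Suc k *\<^sub>R x) = int m *s fl (real m ^ k *\<^sub>R x) + \<epsilon>"
proof
  let ?\<epsilon> = "fl (real m ^ Suc k *\<^sub>R x) - int m *s fl (real m ^ k *\<^sub>R x)"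
  show "fl (real m ^ Suc k *\<^sub>R x) = int m *s fl (real m ^ k *\<^sub>R x) + ?\<epsilon>" by simp
  have "0 \<le> \<lfloor>real m * t\<rfloor> - int m * \<lfloor>t\<rfloor> \<and> \<lfloor>real m * t\<rfloor> - int m * \<lfloor>t\<rfloor> < int m" for t :: real
  proof -
    have "real m * real_of_int \<lfloor>t\<rfloor> \<le> real m * t" by (intro mult_left_mono) auto
    then have "int m * \<lfloor>t\<rfloor> \<le> \<lfloor>real m * t\<rfloor>" by (simp add: le_floor_iff)
    moreover have "real m * t < real m * (real_of_int \<lfloor>t\<rfloor> + 1)" using m by (intro mult_strict_left_mono) auto
    then have "\<lfloor>real m * t\<rfloor> < int m * (\<lfloor>t\<rfloor> + 1)" by (simp add: floor_less_iff)
    ultimately show ?thesis by (simp add: algebra_simps)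
  qed
  from this[of "real m ^ k * x $ i" for i] show "?\<epsilon> \<in> digits m"
    by (simp add: digits_def fl_def mult.assoc)
qed

lemma m_powers: "real m ^ (j * k) * ((1 / real m) ^ j * r) ^ k = r ^ k"
  using m by (simp add: power_mult power_mult_distrib power_one_over field_simps)

text \<open>The cell of \<open>x\<close> at level \<open>k + 1\<close> is a child of its cell at
  level \<open>k\<close>, so consecutive values are compared by \<open>step_differences\<close> and
  the increments are geometric, uniformly in \<open>x\<close>.\<close>

lemma Gk_tendsto:
  assumes j: "j \<le> l"
  shows "\<exists>C\<ge>0. \<forall>\<mu> k x. length \<mu> = j \<longrightarrow> \<bar>Gk k \<mu> x - G \<mu> x\<bar> \<le> C * rate j ^ k"
proof -
  obtain A where A: "A \<ge> 0" and step: "\<And>k d \<delta> \<mu> \<gamma> \<epsilon>. k \<ge> 1 \<Longrightarrow> length \<mu> = j \<Longrightarrow> \<epsilon> \<in> digits m \<Longrightarrow>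
     (\<forall>\<nu> \<beta>. length \<nu> = Suc j \<longrightarrow> \<bar>fdiffs \<nu> d \<beta>\<bar> \<le> \<delta>) \<Longrightarrow>
     \<bar>fdiffs \<mu> (subdivision m (b k) d) (int m *s \<gamma> + \<epsilon>) - (1 / real m) ^ j * fdiffs \<mu> d \<gamma>\<bar> \<le> A * \<delta>"
    using step_differences[OF j] by blast
  obtain D where D: "\<And>\<nu> k \<gamma>. length \<nu> = Suc j \<Longrightarrow> \<bar>fdiffs \<nu> (it k c) \<gamma>\<bar> \<le> D * ((1 / real m) ^ j * rate j) ^ k"
    using next_differences[OF j] by blast
  have D0: "0 \<le> D" using D[of "replicate (Suc j) undefined" 0 0] by (simp del: replicate.simps)
  let ?C = "real m ^ j * A * D"
  have "\<bar>Gk (Suc k) \<mu> x - Gk k \<mu> x\<bar> \<le> ?C * rate j ^ k" if \<mu>: "length \<mu> = j" for \<mu> k x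
  proof -
    let ?\<gamma> = "fl (real m ^ k *\<^sub>R x)"
    obtain \<epsilon> where \<epsilon>: "\<epsilon> \<in> digits m" "fl (real m ^ Suc k *\<^sub>R x) = int m *s ?\<gamma> + \<epsilon>" using fl_decomp by blast
    let ?d = "fdiffs \<mu> (subdivision m (b (Suc k)) (it k c)) (int m *s ?\<gamma> + \<epsilon>) - (1 / real m) ^ j * fdiffs \<mu> (it k c) ?\<gamma>"
    have "\<bar>?d\<bar> \<le> A * (D * ((1 / real m) ^ j * rate j) ^ k)" using D \<mu> \<epsilon> by (intro step) auto
    then have "real m ^ (j * Suc k) * \<bar>?d\<bar> \<le> real m ^ (j * Suc k) * (A * (D * ((1 / real m) ^ j * rate j) ^ k))"
      by (intro mult_left_mono) auto
    also have "\<dots> = real m ^ j * A * D * (real m ^ (j * k) * ((1 / real m) ^ j * rate j) ^ k)"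
      by (simp add: power_add algebra_simps)
    also have "\<dots> = ?C * rate j ^ k" by (simp only: m_powers)
    also have "real m ^ (j * Suc k) * \<bar>?d\<bar> = \<bar>real m ^ (j * Suc k) * ?d\<bar>" by (simp add: abs_mult)
    also have "real m ^ (j * Suc k) * ?d = Gk (Suc k) \<mu> x - Gk k \<mu> x"
      using m by (simp only: Gk_def \<epsilon>(2) \<mu> right_diff_distrib iterated_subdivision.simps) (simp add: power_add power_one_over field_simps)
    finally show ?thesis .
  qed
  then have "\<bar>Gk k \<mu> x - G \<mu> x\<bar> \<le> ?C / (1 - rate j) * rate j ^ k"
    if "length \<mu> = j" for \<mu> k x
    unfolding G_def using geometric_limit(1)[of "\<lambda>k. Gk k \<mu> x" ?C "rate j" k] rate[of j] that by (simp add: less_imp_le)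
  moreover have "0 \<le> ?C / (1 - rate j)" using A D0 rate[of j] by simp
  ultimately show ?thesis by blast
qed

lemma floor_diff_le: "\<bar>real_of_int \<lfloor>s\<rfloor> - real_of_int \<lfloor>t\<rfloor>\<bar> \<le> \<bar>s - t\<bar> + 1"
  by linarith

lemma fl_close:
  fixes x y :: "real ^ 's"
  assumes "norm (x - y) \<le> (1 / real m) ^ k"
  shows "l1 (fl (real m ^ k *\<^sub>R x) - fl (real m ^ k *\<^sub>R y)) \<le> 2 * real CARD('s)"
proof -
  have "real_of_int \<bar>(fl (real m ^ k *\<^sub>R x) - fl (real m ^ k *\<^sub>R y)) $ i\<bar> \<le> 2" for i
  proof -
    have "\<bar>x $ i - y $ i\<bar> \<le> (1 / real m) ^ k"
      using component_le_norm_cart[of "x - y" i] assms by simp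
    then have "real m ^ k * \<bar>x $ i - y $ i\<bar> \<le> real m ^ k * (1 / real m) ^ k" by (intro mult_left_mono) auto
    also have "\<dots> = 1" using m by (simp add: power_one_over)
    finally have "\<bar>real m ^ k * x $ i - real m ^ k * y $ i\<bar> \<le> 1"
      by (simp add: right_diff_distrib[symmetric] abs_mult)
    then show ?thesis using floor_diff_le[of "real m ^ k * x $ i" "real m ^ k * y $ i"] by (simp add: fl_def)
  qed
  then have "l1 (fl (real m ^ k *\<^sub>R x) - fl (real m ^ k *\<^sub>R y)) \<le> (\<Sum>i\<in>(UNIV :: 's set). 2)"
    unfolding l1_def by (intro sum_mono)
  then show ?thesis by simp
qed

text \<open>At distance \<open>m^(-k)\<close> level \<open>k\<close> is the right scale: the two
  cells are joined by at most \<open>2 s\<close> unit steps, each costing one difference of order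
  \<open>j + 1\<close>, and passing from \<open>Gk k\<close> to \<open>G\<close> costs the same
  order.\<close>

lemma G_modulus:
  assumes j: "j \<le> l"
  shows "\<exists>C\<ge>0. \<forall>\<mu> k x y. length \<mu> = j \<longrightarrow> norm (x - y) \<le> (1 / real m) ^ k \<longrightarrow> \<bar>G \<mu> x - G \<mu> y\<bar> \<le> C * rate j ^ k"
proof -
  obtain A where A: "A \<ge> 0" "\<And>\<mu> k x. length \<mu> = j \<Longrightarrow> \<bar>Gk k \<mu> x - G \<mu> x\<bar> \<le> A * rate j ^ k"
    using Gk_tendsto[OF j] by blast
  obtain D where D: "\<And>\<nu> k \<gamma>. length \<nu> = Suc j \<Longrightarrow> \<bar>fdiffs \<nu> (it k c) \<gamma>\<bar> \<le> D * ((1 / real m) ^ j * rate j) ^ k"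
    using next_differences[OF j] by blast
  have D0: "0 \<le> D" using D[of "replicate (Suc j) undefined" 0 0] by (simp del: replicate.simps)
  let ?C = "2 * A + D * (2 * real CARD('s))"
  have "\<bar>G \<mu> x - G \<mu> y\<bar> \<le> ?C * rate j ^ k" if \<mu>: "length \<mu> = j" and xy: "norm (x - y) \<le> (1 / real m) ^ k" for \<mu> k x y
  proof -
    let ?x = "fl (real m ^ k *\<^sub>R x)" and ?y = "fl (real m ^ k *\<^sub>R y)"
    define g where "g \<beta> = fdiffs \<mu> (it k c) (?y + \<beta>)" for \<beta>
    have "\<bar>g (?x - ?y) - g 0\<bar> \<le> D * ((1 / real m) ^ j * rate j) ^ k * l1 (?x - ?y)"
    proof (rule path_bound)
      fix i \<gamma>
      have "fdiff i g \<gamma> = fdiffs (i # \<mu>) (it k c) (?y + \<gamma>)" by (simp add: g_def[abs_def] fdiff_shift)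
      then show "\<bar>fdiff i g \<gamma>\<bar> \<le> D * ((1 / real m) ^ j * rate j) ^ k" using D[of "i # \<mu>"] \<mu> by simp
    qed
    also have "\<dots> \<le> D * ((1 / real m) ^ j * rate j) ^ k * (2 * real CARD('s))"
      using fl_close[OF xy] D0 rate[of j] by (intro mult_left_mono) auto
    finally have "real m ^ (j * k) * \<bar>g (?x - ?y) - g 0\<bar>
        \<le> real m ^ (j * k) * (D * ((1 / real m) ^ j * rate j) ^ k * (2 * real CARD('s)))" by (intro mult_left_mono) auto
    also have "\<dots> = D * (2 * real CARD('s)) * (real m ^ (j * k) * ((1 / real m) ^ j * rate j) ^ k)" by simp
    also have "\<dots> = D * (2 * real CARD('s)) * rate j ^ k" by (simp only: m_powers)
    also have "real m ^ (j * k) * \<bar>g (?x - ?y) - g 0\<bar> = \<bar>Gk k \<mu> x - Gk k \<mu> y\<bar>"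
      by (simp add: Gk_def g_def \<mu> right_diff_distrib[symmetric] abs_mult)
    finally show ?thesis using A(2)[OF \<mu>, of k x] A(2)[OF \<mu>, of k y] by (simp add: algebra_simps)
  qed
  then show ?thesis using A(1) D0 by (intro exI[of _ ?C]) auto
qed

lemma G_bounded:
  assumes j: "j \<le> l"
  shows "\<exists>C. \<forall>\<mu> x. length \<mu> = j \<longrightarrow> \<bar>G \<mu> x\<bar> \<le> C"
proof -
  obtain A where A: "A \<ge> 0" "\<And>\<mu> k x. length \<mu> = j \<Longrightarrow> \<bar>Gk k \<mu> x - G \<mu> x\<bar> \<le> A * rate j ^ k"
    using Gk_tendsto[OF j] by blast
  have "\<bar>G \<mu> x\<bar> \<le> A + 2 ^ j * S" if \<mu>: "length \<mu> = j" for \<mu> x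
  proof -
    have "\<bar>c \<beta>\<bar> \<le> S * (1 + l1 \<beta>) ^ 0" for \<beta> using c_bounded by simp
    from fdiffs_growth[where e = c and \<delta> = S and n = 0 and \<mu> = \<mu> and \<alpha> = "fl x", OF this] have "\<bar>Gk 0 \<mu> x\<bar> \<le> 2 ^ j * S" using \<mu> by (simp add: Gk_def)
    then show ?thesis using A(2)[OF \<mu>, of 0 x] by simp
  qed
  then show ?thesis by blast
qed

lemma G_uniformly_continuous:
  assumes "length \<mu> \<le> l" "0 < e"
  shows "\<exists>d>0. \<forall>x y. norm (x - y) \<le> d \<longrightarrow> \<bar>G \<mu> x - G \<mu> y\<bar> < e"
proof -
  obtain C where C: "C \<ge> 0" "\<And>k x y. norm (x - y) \<le> (1 / real m) ^ k \<Longrightarrow> \<bar>G \<mu> x - G \<mu> y\<bar> \<le> C * rate (length \<mu>) ^ k"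
    using G_modulus[OF assms(1)] by blast
  have "(\<lambda>k. C * rate (length \<mu>) ^ k) \<longlonglongrightarrow> C * 0"
    using rate[of "length \<mu>"] by (intro tendsto_intros LIMSEQ_realpow_zero) auto
  then have "\<forall>\<^sub>F k in sequentially. C * rate (length \<mu>) ^ k < e" using assms(2) by (intro order_tendstoD) auto
  then obtain k where "C * rate (length \<mu>) ^ k < e" by (auto simp: eventually_sequentially)
  then show ?thesis using C(2)[of _ _ k] m by (intro exI[of _ "(1 / real m) ^ k"]) (auto intro: le_less_trans)
qed

lemma G_continuous:
  assumes "length \<mu> \<le> l" shows "continuous_on UNIV (G \<mu>)"
proof (rule continuous_onI, goal_cases)
  case (1 x e)
  then show ?case using G_uniformly_continuous[OF assms, of e]
    by (metis dist_norm dist_real_def less_imp_le)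
qed

end

section \<open>Differentiability and comparison with test functions\<close>

lemma norm_axis_real [simp]: "norm (axis i t :: real ^ 's::finite) = \<bar>t\<bar>"
proof -
  have "axis i t = t *\<^sub>R (axis i 1 :: real ^ 's)" by (simp add: vec_eq_iff axis_def)
  then show ?thesis by (simp add: norm_axis_1)
qed

lemma upd_vec_axis: "upd_vec x i (x $ i + h) = x + axis i h" for x :: "real ^ 's::finite"
  by (simp add: vec_eq_iff axis_def)

context limit_scheme
begin

lemma telescope_differences:
  "fdiffs \<mu> d (\<gamma> + of_nat n *s axis i 1) - fdiffs \<mu> d \<gamma>
     = (\<Sum>t<n. fdiffs (i # \<mu>) d (\<gamma> + of_nat t *s axis i 1))"
proof (induction n)
  case (Suc n)
  have "\<gamma> + of_nat (Suc n) *s axis i 1 = \<gamma> + of_nat n *s axis i 1 + axis i (1 :: int)"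
    by (simp add: vec_eq_iff algebra_simps)
  then show ?case using Suc unfolding sum.lessThan_Suc fdiffs_simps fdiff_def by (simp only:)
qed simp

lemma fl_translate:
  assumes "M > 0"
  shows "fl (M *\<^sub>R (x + axis i (real n / M))) = fl (M *\<^sub>R x) + of_nat n *s axis i 1"
  using assms by (auto simp: fl_def vec_eq_iff axis_def distrib_left)

text \<open>A discrete fundamental theorem of calculus: telescoping along direction \<open>i\<close>
  writes an increment of \<open>Gk k \<mu>\<close> as a Riemann sum of
  \<open>Gk k (i # \<mu>)\<close>, and the estimate passes to the limit.\<close>

lemma G_increment:
  assumes \<mu>: "length \<mu> < l" and h: "0 \<le> h"
    and \<omega>: "\<And>t. 0 \<le> t \<Longrightarrow> t \<le> h \<Longrightarrow> \<bar>G (i # \<mu>) (x + axis i t) - g\<bar> \<le> \<omega>"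
  shows "\<bar>G \<mu> (x + axis i h) - G \<mu> x - h * g\<bar> \<le> h * \<omega>"
proof -
  define j where "j = length \<mu>"
  obtain A where A: "A \<ge> 0" "\<And>k x. \<bar>Gk k \<mu> x - G \<mu> x\<bar> \<le> A * rate j ^ k"
    using Gk_tendsto[of j] \<mu> by (auto simp: j_def)
  obtain A' where A': "A' \<ge> 0" "\<And>k x. \<bar>Gk k (i # \<mu>) x - G (i # \<mu>) x\<bar> \<le> A' * rate (Suc j) ^ k"
    using Gk_tendsto[of "Suc j"] \<mu> by (auto simp: j_def)
  define M where "M k = real m ^ k" for k
  \<comment> \<open>\<open>h\<close> is replaced by the largest multiple \<open>s k\<close> of the
    mesh width below it, because cells translate exactly by grid vectors.\<close>
  define n where "n k = nat \<lfloor>h * M k\<rfloor>" for k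
  define s where "s k = real (n k) / M k" for k
  have M: "0 < M k" for k using m by (simp add: M_def)
  have n: "real (n k) \<le> h * M k" "h * M k < real (n k) + 1" for k
    using h M[of k] by (auto simp: n_def of_nat_nat)
  have s: "0 \<le> s k" "s k \<le> h" "h - s k \<le> (1 / real m) ^ k" for k
  proof -
    show "0 \<le> s k" using M[of k] by (simp add: s_def)
    show "s k \<le> h" using n(1)[of k] M[of k] by (simp add: s_def pos_divide_le_eq)
    have "h \<le> (real (n k) + 1) / M k" using n(2)[of k] M[of k] by (simp add: pos_le_divide_eq)
    then show "h - s k \<le> (1 / real m) ^ k" by (simp add: s_def M_def add_divide_distrib power_one_over)
  qed
  have main: "\<bar>G \<mu> (x + axis i (s k)) - G \<mu> x - s k * g\<bar> \<le> 2 * (A * rate j ^ k) + s k * (A' * rate (Suc j) ^ k + \<omega>)" for k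
  proof -
    let ?\<gamma> = "fl (M k *\<^sub>R x)"
    have 1: "fl (real m ^ k *\<^sub>R (x + axis i (real t / M k))) = ?\<gamma> + of_nat t *s axis i 1" for t
      using fl_translate[OF M, of k x i t] by (simp add: M_def)
    have 0: "fl (real m ^ k *\<^sub>R x) = ?\<gamma>" by (simp add: M_def)
    have "Gk k \<mu> (x + axis i (s k)) - Gk k \<mu> x
      = M k ^ j * (fdiffs \<mu> (it k c) (?\<gamma> + of_nat (n k) *s axis i 1) - fdiffs \<mu> (it k c) ?\<gamma>)"
      unfolding Gk_def s_def 1 0 by (simp add: j_def M_def power_mult[symmetric] mult.commute right_diff_distrib)
    also have "\<dots> = M k ^ j * (\<Sum>t<n k. fdiffs (i # \<mu>) (it k c) (?\<gamma> + of_nat t *s axis i 1))"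
      by (simp only: telescope_differences)
    also have "\<dots> = (1 / M k) * (\<Sum>t<n k. Gk k (i # \<mu>) (x + axis i (real t / M k)))"
      unfolding Gk_def 1 using M[of k]
      by (simp add: sum_distrib_left[symmetric] j_def M_def power_mult[symmetric] mult.commute power_add field_simps)
    finally have eq: "Gk k \<mu> (x + axis i (s k)) - Gk k \<mu> x - s k * g
      = (1 / M k) * (\<Sum>t<n k. Gk k (i # \<mu>) (x + axis i (real t / M k)) - g)"
      by (simp add: sum_subtractf s_def right_diff_distrib)
    have "\<bar>\<Sum>t<n k. Gk k (i # \<mu>) (x + axis i (real t / M k)) - g\<bar> \<le> (\<Sum>t<n k. A' * rate (Suc j) ^ k + \<omega>)"
    proof (rule order_trans[OF sum_abs sum_mono])
      fix t assume "t \<in> {..<n k}"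
      then have "real t / M k \<le> s k" using M[of k] by (simp add: s_def divide_right_mono)
      then have "\<bar>G (i # \<mu>) (x + axis i (real t / M k)) - g\<bar> \<le> \<omega>"
        using s(2)[of k] M[of k] by (intro \<omega>) auto
      then show "\<bar>Gk k (i # \<mu>) (x + axis i (real t / M k)) - g\<bar> \<le> A' * rate (Suc j) ^ k + \<omega>"
        using A'(2)[of k "x + axis i (real t / M k)"] by linarith
    qed
    then have "(1 / M k) * \<bar>\<Sum>t<n k. Gk k (i # \<mu>) (x + axis i (real t / M k)) - g\<bar>
      \<le> (1 / M k) * (\<Sum>t<n k. A' * rate (Suc j) ^ k + \<omega>)" using M[of k] by (intro mult_left_mono) auto
    then have "\<bar>Gk k \<mu> (x + axis i (s k)) - Gk k \<mu> x - s k * g\<bar> \<le> s k * (A' * rate (Suc j) ^ k + \<omega>)"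
      unfolding eq abs_mult using M[of k] by (simp add: s_def)
    then show ?thesis using A(2)[of k x] A(2)[of k "x + axis i (s k)"] by linarith
  qed
  have s_lim: "s \<longlonglongrightarrow> h"
  proof (rule tendsto_sandwich[OF _ _ _ tendsto_const])
    show "\<forall>\<^sub>F k in sequentially. h - (1 / real m) ^ k \<le> s k" using s(3) by (simp add: algebra_simps)
    show "\<forall>\<^sub>F k in sequentially. s k \<le> h" using s(2) by simp
    have "(\<lambda>k. h - (1 / real m) ^ k) \<longlonglongrightarrow> h - 0" using m by (intro tendsto_intros LIMSEQ_realpow_zero) auto
    then show "(\<lambda>k. h - (1 / real m) ^ k) \<longlonglongrightarrow> h" by simp
  qed
  have ax: "t *\<^sub>R axis i 1 = axis i t" for t :: real by (simp add: vec_eq_iff axis_def)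
  have "(\<lambda>k. x + s k *\<^sub>R axis i 1) \<longlonglongrightarrow> x + h *\<^sub>R axis i 1" by (intro tendsto_intros s_lim)
  then have "(\<lambda>k. x + axis i (s k)) \<longlonglongrightarrow> x + axis i h" unfolding ax .
  then have "(\<lambda>k. G \<mu> (x + axis i (s k))) \<longlonglongrightarrow> G \<mu> (x + axis i h)"
    using G_continuous[of \<mu>] \<mu> by (intro continuous_on_tendsto_compose[of UNIV "G \<mu>"]) auto
  then have L: "(\<lambda>k. \<bar>G \<mu> (x + axis i (s k)) - G \<mu> x - s k * g\<bar>) \<longlonglongrightarrow> \<bar>G \<mu> (x + axis i h) - G \<mu> x - h * g\<bar>"
    by (intro tendsto_intros s_lim)
  have "(\<lambda>k. 2 * (A * rate j ^ k) + s k * (A' * rate (Suc j) ^ k + \<omega>)) \<longlonglongrightarrow> 2 * (A * 0) + h * (A' * 0 + \<omega>)"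
    using rate[of j] rate[of "Suc j"] by (intro tendsto_intros s_lim LIMSEQ_realpow_zero) auto
  from LIMSEQ_le[OF L this] main show ?thesis by auto
qed

lemma G_derivative:
  assumes \<mu>: "length \<mu> < l"
  shows "((\<lambda>t. G \<mu> (upd_vec x i t)) has_vector_derivative G (i # \<mu>) x) (at (x $ i))"
proof -
  have "((\<lambda>t. G \<mu> (upd_vec x i t)) has_real_derivative G (i # \<mu>) x) (at (x $ i))"
    unfolding DERIV_def
  proof (rule LIM_I)
    fix e :: real assume e: "0 < e"
    obtain d where d: "d > 0" "\<And>x y. norm (x - y) \<le> d \<Longrightarrow> \<bar>G (i # \<mu>) x - G (i # \<mu>) y\<bar> < e / 3"
      using G_uniformly_continuous[of "i # \<mu>" "e / 3"] \<mu> e by auto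
    show "\<exists>s>0. \<forall>h. h \<noteq> 0 \<and> norm (h - 0) < s \<longrightarrow>
        norm ((G \<mu> (upd_vec x i (x $ i + h)) - G \<mu> (upd_vec x i (x $ i))) / h - G (i # \<mu>) x) < e"
    proof (intro exI[of _ d] conjI allI impI d(1))
      fix h :: real assume h: "h \<noteq> 0 \<and> norm (h - 0) < d"
      have "\<bar>G \<mu> (x + axis i h) - G \<mu> x - h * G (i # \<mu>) x\<bar> \<le> \<bar>h\<bar> * (2 * (e / 3))"
      proof (cases "h > 0")
        case True
        have "\<bar>G \<mu> (x + axis i h) - G \<mu> x - h * G (i # \<mu>) x\<bar> \<le> h * (e / 3)"
          using True h by (intro G_increment \<mu> less_imp_le[OF d(2)]) auto
        also have "\<dots> \<le> \<bar>h\<bar> * (2 * (e / 3))" using True e by simp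
        finally show ?thesis .
      next
        case False
        \<comment> \<open>For negative \<open>h\<close> the increment is taken from the left end
          point, since \<open>G_increment\<close> moves forward only.\<close>
        define y where "y = x + axis i h"
        have y: "x = y + axis i (- h)" by (simp add: y_def vec_eq_iff axis_def)
        have "\<bar>G \<mu> (y + axis i (- h)) - G \<mu> y - (- h) * G (i # \<mu>) x\<bar> \<le> (- h) * (e / 3)"
        proof (intro G_increment \<mu> less_imp_le[OF d(2)])
          fix t assume t: "0 \<le> t" "t \<le> - h"
          have "y + axis i t - x = axis i (h + t)" by (simp add: y_def vec_eq_iff axis_def)
          then show "norm (y + axis i t - x) \<le> d" using t h False by simp
        qed (use False in auto)
        then show ?thesis unfolding y[symmetric] using False e by (simp add: y_def[symmetric] abs_minus_commute algebra_simps)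
      qed
      then have "\<bar>G \<mu> (x + axis i h) - G \<mu> x - h * G (i # \<mu>) x\<bar> / \<bar>h\<bar> \<le> 2 * (e / 3)"
        using h by (simp add: field_simps)
      moreover have "(G \<mu> (x + axis i h) - G \<mu> x) / h - G (i # \<mu>) x = (G \<mu> (x + axis i h) - G \<mu> x - h * G (i # \<mu>) x) / h"
        using h by (simp add: field_simps)
      ultimately have "\<bar>(G \<mu> (x + axis i h) - G \<mu> x) / h - G (i # \<mu>) x\<bar> \<le> 2 * (e / 3)" by simp
      then show "norm ((G \<mu> (upd_vec x i (x $ i + h)) - G \<mu> (upd_vec x i (x $ i))) / h - G (i # \<mu>) x) < e"
        using e by (simp only: upd_vec_axis upd_vec_same real_norm_def)
    qed
  qed
  then show ?thesis by (simp add: has_real_derivative_iff_has_vector_derivative)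
qed

lemma partials_G: "length \<mu> \<le> l \<Longrightarrow> partials \<mu> (G []) = G \<mu>"
proof (induction \<mu>)
  case (Cons i \<mu>)
  have "vector_derivative (\<lambda>t. G \<mu> (upd_vec x i t)) (at (x $ i)) = G (i # \<mu>) x" for x
    by (rule vector_derivative_at[OF G_derivative]) (use Cons.prems in simp)
  then show ?case using Cons by (intro ext) (simp add: partial_def)
qed simp

lemma C_k_G: "C_k l (G [])"
  unfolding C_k_def
proof (intro conjI allI impI)
  fix \<mu> :: "'s list" and i x assume "length \<mu> < l"
  then show "(\<lambda>t. partials \<mu> (G []) (upd_vec x i t)) differentiable (at (x $ i))"
    using G_derivative[of \<mu> x i] partials_G[of \<mu>] by (auto simp: differentiableI_vector)
next
  fix \<mu> :: "'s list" assume "length \<mu> \<le> l"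
  then show "continuous_on UNIV (partials \<mu> (G []))" using partials_G G_continuous by simp
qed

end

subsection \<open>Partial derivatives of compactly supported functions\<close>

lemma open_slice:
  fixes x :: "real ^ 's::finite"
  assumes "open U" "x \<in> U"
  shows "\<forall>\<^sub>F t in nhds (x $ i). upd_vec x i t \<in> U"
proof -
  have eq: "upd_vec x i t = x + (t - x $ i) *\<^sub>R axis i 1" for t by (simp add: vec_eq_iff axis_def)
  have "isCont (\<lambda>t. upd_vec x i t) (x $ i)" unfolding eq by (intro continuous_intros)
  then have "((\<lambda>t. upd_vec x i t) \<longlongrightarrow> upd_vec x i (x $ i)) (nhds (x $ i))"
    unfolding isCont_def tendsto_at_iff_tendsto_nhds .
  then have "((\<lambda>t. upd_vec x i t) \<longlongrightarrow> x) (nhds (x $ i))" by simp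
  from topological_tendstoD[OF this assms] show ?thesis .
qed

text \<open>Derivatives depend on germs only; openness of \<open>U\<close> keeps a piece of each
  coordinate slice inside, which the recursion over the list needs.\<close>

lemma partials_local:
  fixes x :: "real ^ 's::finite"
  assumes U: "open U" and eq: "\<And>x. x \<in> U \<Longrightarrow> f x = g x"
  shows "x \<in> U \<Longrightarrow> partials \<mu> f x = partials \<mu> g x"
proof (induction \<mu> arbitrary: x)
  case (Cons i \<mu>)
  have "\<forall>\<^sub>F t in nhds (x $ i). t \<in> UNIV \<longrightarrow> partials \<mu> f (upd_vec x i t) = partials \<mu> g (upd_vec x i t)"
    using open_slice[OF U Cons.prems, of i] by eventually_elim (simp add: Cons.IH)
  then show ?case unfolding partials_simps partial_def
    by (intro vector_derivative_cong_eq) auto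
qed (simp add: eq)

section \<open>Combinations of shifts of a compactly supported function\<close>

definition box_supported :: "nat \<Rightarrow> (real ^ 's::finite \<Rightarrow> real) \<Rightarrow> bool" where
  "box_supported R f \<longleftrightarrow> (\<forall>x i. real R < \<bar>x $ i\<bar> \<longrightarrow> f x = 0)"

lemma compact_box_supported:
  assumes "compact (closure {x. f x \<noteq> 0})"
  shows "\<exists>R. box_supported R f"
proof -
  obtain B where B: "\<And>x. x \<in> closure {x. f x \<noteq> 0} \<Longrightarrow> norm x \<le> B"
    using compact_imp_bounded[OF assms] unfolding bounded_iff by blast
  obtain R :: nat where R: "B \<le> real R" using real_arch_simple by blast
  have "f x = 0" if "real R < \<bar>x $ i\<bar>" for x i
    using B[of x] component_le_norm_cart[of x i] that R closure_subset by force
  then show ?thesis unfolding box_supported_def by blast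
qed

lemma partials_zero: "partials \<mu> (\<lambda>x. 0 :: real) = (\<lambda>x. 0)"
  by (induction \<mu>) (auto simp: partial_def)

lemma box_supported_partials:
  assumes "box_supported R f" shows "box_supported R (partials \<mu> f)"
  unfolding box_supported_def
proof (intro allI impI)
  fix x :: "real ^ 'a" and i assume x: "real R < \<bar>x $ i\<bar>"
  have U: "open {y :: real ^ 'a. real R < \<bar>y $ i\<bar>}" by (intro open_Collect_less continuous_intros)
  have "partials \<mu> f x = partials \<mu> (\<lambda>x. 0) x"
    by (rule partials_local[OF U]) (use assms x in \<open>auto simp: box_supported_def\<close>)
  then show "partials \<mu> f x = 0" by (simp add: partials_zero)
qed

lemma box_supported_bounded:
  assumes "box_supported R f" "continuous_on UNIV f"
  shows "\<exists>H. \<forall>x. \<bar>f x\<bar> \<le> H"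
proof -
  let ?C = "cbox (\<chi> i. - real R) (\<chi> i. real R) :: (real ^ 'a) set"
  have "compact (f ` ?C)" by (intro compact_continuous_image continuous_on_subset[OF assms(2)]) auto
  then have "bounded (f ` ?C)" by (rule compact_imp_bounded)
  then obtain H where "\<forall>y\<in>f ` ?C. norm y \<le> H" unfolding bounded_iff by blast
  then have H: "\<bar>f x\<bar> \<le> H" if "x \<in> ?C" for x using that by simp
  have "\<bar>f x\<bar> \<le> max H 0" for x
  proof (cases "x \<in> ?C")
    case False
    then obtain i where "\<not> (- real R \<le> x $ i \<and> x $ i \<le> real R)" by (auto simp: mem_box_cart)
    then have "real R < \<bar>x $ i\<bar>" by linarith
    then show ?thesis using assms(1) by (auto simp: box_supported_def)
  qed (use H in \<open>auto simp: le_max_iff_disj\<close>)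
  then show ?thesis by blast
qed

text \<open>Contains all shifts that can be nonzero at \<open>y\<close> or at any point closer than
  1 to it in each coordinate. The slack makes the same finite sum valid on a neighbourhood, so it
  can be differentiated term by term.\<close>

definition window :: "nat \<Rightarrow> real ^ 's::finite \<Rightarrow> (int ^ 's) set" where
  "window R y = {\<alpha>. \<forall>i. \<alpha> $ i \<in> {\<lfloor>y $ i\<rfloor> - int R - 1..\<lfloor>y $ i\<rfloor> + int R + 2}}"

lemma finite_window [simp]: "finite (window R y)"
  unfolding window_def by (rule finite_vec_set) auto

lemma window_near:
  assumes f: "box_supported R f" and nz: "f (y - of_int_vec \<alpha>) \<noteq> 0"
    and near: "\<And>i. \<bar>y $ i - y0 $ i\<bar> < 1"
  shows "\<alpha> \<in> window R y0"
proof -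
  have "\<lfloor>y0 $ i\<rfloor> - int R - 1 \<le> \<alpha> $ i \<and> \<alpha> $ i \<le> \<lfloor>y0 $ i\<rfloor> + int R + 2" for i
  proof -
    have "\<bar>(y - of_int_vec \<alpha>) $ i\<bar> \<le> real R"
      using f nz unfolding box_supported_def by (meson not_le)
    then have "real_of_int (\<lfloor>y0 $ i\<rfloor> - int R - 1) < real_of_int (\<alpha> $ i) + 1"
      "real_of_int (\<alpha> $ i) < real_of_int (\<lfloor>y0 $ i\<rfloor> + int R + 2) + 1"
      using near[of i] by (simp_all add: abs_le_iff abs_less_iff) linarith+
    then show ?thesis by linarith
  qed
  then show ?thesis by (simp add: window_def)
qed

lemma shift_combination_window:
  assumes "box_supported R f" "\<And>i. \<bar>y $ i - y0 $ i\<bar> < 1"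
  shows "shift_combination d f y = (\<Sum>\<alpha>\<in>window R y0. d \<alpha> * f (y - of_int_vec \<alpha>))"
  unfolding shift_combination_def
  by (rule sum.mono_neutral_left) (use window_near[OF assms(1) _ assms(2)] in auto)

lemma C_k_derivative:
  assumes "C_k n f" "length \<mu> < n"
  shows "((\<lambda>t. partials \<mu> f (upd_vec x i t)) has_vector_derivative partials (i # \<mu>) f x) (at (x $ i))"
  using assms unfolding C_k_def partials_simps partial_def by (auto simp: vector_derivative_works)

lemma C_k_continuous: "C_k n f \<Longrightarrow> length \<mu> \<le> n \<Longrightarrow> continuous_on UNIV (partials \<mu> f)"
  by (simp add: C_k_def)

lemma C_k_mono: "C_k n f \<Longrightarrow> n' \<le> n \<Longrightarrow> C_k n' f"
  by (auto simp: C_k_def)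

lemma scaled_shift_derivative:
  fixes f :: "real ^ 's::finite \<Rightarrow> real"
  assumes f: "C_k n f" "length \<mu> < n"
  shows "((\<lambda>t. partials \<mu> f (M *\<^sub>R upd_vec x i t - a)) has_vector_derivative M * partials (i # \<mu>) f (M *\<^sub>R x - a)) (at (x $ i))"
proof -
  have eq: "M *\<^sub>R upd_vec x i t - a = upd_vec (M *\<^sub>R x - a) i (M * t - a $ i)" for t
    by (simp add: vec_eq_iff)
  have "((\<lambda>t. partials \<mu> f (upd_vec (M *\<^sub>R x - a) i t)) has_real_derivative partials (i # \<mu>) f (M *\<^sub>R x - a))
      (at (M * x $ i - a $ i))"
    using C_k_derivative[OF f, of "M *\<^sub>R x - a" i] by (simp add: has_real_derivative_iff_has_vector_derivative)
  moreover have "((\<lambda>t. M * t - a $ i) has_real_derivative M) (at (x $ i))"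
    by (auto intro!: derivative_eq_intros)
  ultimately have "((\<lambda>t. partials \<mu> f (upd_vec (M *\<^sub>R x - a) i (M * t - a $ i))) has_real_derivative
      partials (i # \<mu>) f (M *\<^sub>R x - a) * M) (at (x $ i))"
    by (rule DERIV_chain2)
  then show ?thesis unfolding eq by (simp add: has_real_derivative_iff_has_vector_derivative mult.commute)
qed

lemma shift_combination_derivative:
  fixes f :: "real ^ 's::finite \<Rightarrow> real"
  assumes f: "C_k n f" "length \<mu> < n" "box_supported R f" and M: "0 < M"
  shows "((\<lambda>t. shift_combination d (partials \<mu> f) (M *\<^sub>R upd_vec x i t)) has_vector_derivative
    M * shift_combination d (partials (i # \<mu>) f) (M *\<^sub>R x)) (at (x $ i))"
proof -
  let ?W = "window R (M *\<^sub>R x)"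
  have D: "((\<lambda>t. \<Sum>\<alpha>\<in>?W. d \<alpha> * partials \<mu> f (M *\<^sub>R upd_vec x i t - of_int_vec \<alpha>)) has_vector_derivative
      (\<Sum>\<alpha>\<in>?W. d \<alpha> * (M * partials (i # \<mu>) f (M *\<^sub>R x - of_int_vec \<alpha>)))) (at (x $ i))"
    by (intro has_vector_derivative_sum has_vector_derivative_mult_right scaled_shift_derivative[OF f(1,2)])
  have "((\<lambda>t. shift_combination d (partials \<mu> f) (M *\<^sub>R upd_vec x i t)) has_vector_derivative
      (\<Sum>\<alpha>\<in>?W. d \<alpha> * (M * partials (i # \<mu>) f (M *\<^sub>R x - of_int_vec \<alpha>)))) (at (x $ i))"
  proof (rule has_vector_derivative_transform_within_open[OF D])
    show "open {t. \<bar>M * t - M * x $ i\<bar> < 1}" by (intro open_Collect_less continuous_intros)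
    show "x $ i \<in> {t. \<bar>M * t - M * x $ i\<bar> < 1}" by simp
    fix t assume t: "t \<in> {t. \<bar>M * t - M * x $ i\<bar> < 1}"
    show "(\<Sum>\<alpha>\<in>?W. d \<alpha> * partials \<mu> f (M *\<^sub>R upd_vec x i t - of_int_vec \<alpha>))
      = shift_combination d (partials \<mu> f) (M *\<^sub>R upd_vec x i t)"
      by (rule shift_combination_window[OF box_supported_partials[OF f(3)], symmetric]) (use t in auto)
  qed
  moreover have "(\<Sum>\<alpha>\<in>?W. d \<alpha> * (M * partials (i # \<mu>) f (M *\<^sub>R x - of_int_vec \<alpha>)))
    = M * shift_combination d (partials (i # \<mu>) f) (M *\<^sub>R x)"
    by (subst shift_combination_window[OF box_supported_partials[OF f(3)], of _ "M *\<^sub>R x"])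
      (auto simp: sum_distrib_left mult_ac simp del: partials_simps)
  ultimately show ?thesis by (simp only:)
qed

text \<open>Stated for a difference because that is what \<open>C_norm\<close> measures; with
  \<open>g = 0\<close> it also gives the derivatives of the combination itself, up to sign.\<close>

lemma partials_diff_shift_combination:
  fixes f g :: "real ^ 's::finite \<Rightarrow> real"
  assumes g: "C_k n g" and f: "C_k n f" "box_supported R f" and M: "0 < M" and \<mu>: "length \<mu> \<le> n"
  shows "partials \<mu> (\<lambda>x. g x - shift_combination d f (M *\<^sub>R x))
    = (\<lambda>x. partials \<mu> g x - M ^ length \<mu> * shift_combination d (partials \<mu> f) (M *\<^sub>R x))"
  using \<mu>
proof (induction \<mu>)
  case (Cons i \<mu>)
  have IH: "partials \<mu> (\<lambda>x. g x - shift_combination d f (M *\<^sub>R x))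
    = (\<lambda>x. partials \<mu> g x - M ^ length \<mu> * shift_combination d (partials \<mu> f) (M *\<^sub>R x))"
    using Cons by simp
  show ?case
  proof
    fix x
    have "((\<lambda>t. partials \<mu> g (upd_vec x i t) - M ^ length \<mu> * shift_combination d (partials \<mu> f) (M *\<^sub>R upd_vec x i t))
      has_vector_derivative partials (i # \<mu>) g x
        - M ^ length \<mu> * (M * shift_combination d (partials (i # \<mu>) f) (M *\<^sub>R x))) (at (x $ i))"
      by (intro has_vector_derivative_diff has_vector_derivative_mult_right C_k_derivative[OF g]
          shift_combination_derivative[OF f(1) _ f(2) M]) (use Cons.prems in auto)
    then have "partial i (partials \<mu> (\<lambda>x. g x - shift_combination d f (M *\<^sub>R x))) x = partials (i # \<mu>) g x
        - M ^ length \<mu> * (M * shift_combination d (partials (i # \<mu>) f) (M *\<^sub>R x))"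
      unfolding IH partial_def by (rule vector_derivative_at)
    then show "partials (i # \<mu>) (\<lambda>x. g x - shift_combination d f (M *\<^sub>R x)) x
      = partials (i # \<mu>) g x - M ^ length (i # \<mu>) * shift_combination d (partials (i # \<mu>) f) (M *\<^sub>R x)"
      by (simp add: mult_ac)
  qed
qed simp

lemma partials_const_0: "C_k n (\<lambda>x. 0 :: real)"
  by (auto simp: C_k_def partials_zero)

text \<open>\<open>reproducing n f\<close> is what Strang--Fix conditions of order \<open>n + 1\<close> mean for the shifts of \<open>f\<close>.\<close>

definition reproducing :: "nat \<Rightarrow> (real ^ 's::finite \<Rightarrow> real) \<Rightarrow> bool" where
  "reproducing n f \<longleftrightarrow> (\<forall>d\<le>n. \<forall>p\<in>pol (Suc d). \<exists>q\<in>pol d. \<forall>y.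
     shift_combination (\<lambda>\<alpha>. p (of_int_vec \<alpha>)) f y = p y + q y)"

lemma reproducing_partials:
  fixes f :: "real ^ 's::finite \<Rightarrow> real"
  assumes f: "C_k n f" "box_supported R f" and rep: "reproducing n f"
    and \<mu>: "length \<mu> \<le> n" and p: "p \<in> pol (Suc (length \<mu>))"
  shows "shift_combination (\<lambda>\<alpha>. p (of_int_vec \<alpha>)) (partials \<mu> f) y = partials \<mu> p 0"
proof -
  let ?d = "\<lambda>\<alpha>. p (of_int_vec \<alpha>)"
  obtain q where q: "q \<in> pol (length \<mu>)" "\<And>y. shift_combination ?d f y = p y + q y"
    using rep \<mu> p unfolding reproducing_def by blast
  have r: "(\<lambda>x. (- 1) * (p x + q x)) \<in> pol (Suc (length \<mu>))" by (rule pol_scale[OF pol_add[OF p pol_Suc[OF q(1)]]])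
  have "- shift_combination ?d (partials \<mu> f) y = partials \<mu> (\<lambda>x. 0 - shift_combination ?d f (1 *\<^sub>R x)) y"
    by (subst partials_diff_shift_combination[OF partials_const_0 f _ \<mu>]) (auto simp: partials_zero)
  also have "\<dots> = partials \<mu> (\<lambda>x. (- 1) * (p x + q x)) y" by (simp add: q(2))
  \<comment> \<open>For degree at most \<open>length \<mu>\<close> derivatives are differences, for
    which linearity is already available; the part \<open>q\<close> of lower degree then drops
    out.\<close>
  also have "\<dots> = fdiffs \<mu> (\<lambda>\<alpha>. (- 1) * (p (of_int_vec \<alpha>) + q (of_int_vec \<alpha>))) 0"
    using fdiffs_pol_1[OF r, of 0 y] by simp
  also have "\<dots> = - (fdiffs \<mu> ?d 0 + fdiffs \<mu> (\<lambda>\<alpha>. q (of_int_vec \<alpha>)) 0)"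
    unfolding fdiffs_cmult fdiffs_add by simp
  also have "\<dots> = - partials \<mu> p 0"
    using fdiffs_pol_1[OF p, of 0 0] fdiffs_pol_eq_0[OF q(1), of 0] by simp
  finally show ?thesis by simp
qed

context limit_scheme
begin

text \<open>Around the cell of \<open>x\<close> the data are a Newton polynomial plus an error of
  the size of the next differences. On the polynomial the difference and the differentiated shift
  combination agree, by \<open>reproducing_partials\<close>; the error is summed over a window of
  fixed size.\<close>

lemma test_function_comparison:
  assumes f: "C_k n f" "box_supported R f" "reproducing n f" and n: "n \<le> l" and j: "j \<le> n"
  shows "\<exists>C. \<forall>\<mu> k x. length \<mu> = j \<longrightarrow>
    \<bar>G \<mu> x - (real m ^ k) ^ j * shift_combination (it k c) (partials \<mu> f) (real m ^ k *\<^sub>R x)\<bar> \<le> C * rate j ^ k"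
proof -
  have jl: "j \<le> l" using n j by simp
  obtain A where A: "A \<ge> 0" "\<And>\<mu> k x. length \<mu> = j \<Longrightarrow> \<bar>Gk k \<mu> x - G \<mu> x\<bar> \<le> A * rate j ^ k"
    using Gk_tendsto[OF jl] by blast
  obtain D where D: "\<And>\<nu> k \<gamma>. length \<nu> = Suc j \<Longrightarrow> \<bar>fdiffs \<nu> (it k c) \<gamma>\<bar> \<le> D * ((1 / real m) ^ j * rate j) ^ k"
    using next_differences[OF jl] by blast
  have "\<exists>C. \<forall>k x. \<bar>G \<mu> x - (real m ^ k) ^ j * shift_combination (it k c) (partials \<mu> f) (real m ^ k *\<^sub>R x)\<bar> \<le> C * rate j ^ k"
    if \<mu>: "length \<mu> = j" for \<mu>
  proof -
    let ?h = "partials \<mu> f"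
    have hs: "box_supported R ?h" by (rule box_supported_partials[OF f(2)])
    obtain H where H: "\<And>x. \<bar>?h x\<bar> \<le> H"
      using box_supported_bounded[OF hs C_k_continuous[OF f(1)]] \<mu> j by auto
    have H0: "0 \<le> H" using H[of 0] by linarith
    let ?W = "window R (0 :: real ^ 's)"
    define L where "L = (\<Sum>\<beta>\<in>?W. (1 + l1 \<beta>) ^ Suc j * H)"
    define C2 :: real where "C2 = (2 ^ Suc j + 1) ^ j"
    have "\<bar>G \<mu> x - (real m ^ k) ^ j * shift_combination (it k c) ?h (real m ^ k *\<^sub>R x)\<bar> \<le> (A + (L + C2) * D) * rate j ^ k" for k x
    proof -
      let ?y = "real m ^ k *\<^sub>R x" and ?\<delta> = "D * ((1 / real m) ^ j * rate j) ^ k"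
      define \<gamma> where "\<gamma> = fl ?y"
      \<comment> \<open>Recentring at the corner of the cell puts the point into the unit cube, so
        that one window around 0 serves for all \<open>x\<close> and \<open>k\<close>.\<close>
      define z where "z = ?y - of_int_vec \<gamma>"
      have z: "\<bar>z $ i - 0 $ i\<bar> < 1" for i
        unfolding z_def \<gamma>_def fl_def by (simp add: of_int_vec_def) linarith
      define d where "d \<beta> = it k c (\<gamma> + \<beta>)" for \<beta>
      have "\<bar>fdiffs \<nu> d \<beta>\<bar> \<le> ?\<delta>" if "length \<nu> = Suc j" for \<nu> \<beta>
        using D[OF that, of k "\<gamma> + \<beta>"] by (simp add: d_def[abs_def] fdiffs_shift)
      from newton_approximation[of "Suc j" d, OF this] obtain p where p: "p \<in> pol (Suc j)"
        "\<And>\<beta>. \<bar>d \<beta> - p (of_int_vec \<beta>)\<bar> \<le> ?\<delta> * (1 + l1 \<beta>) ^ Suc j" by blast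
      have \<delta>: "0 \<le> ?\<delta>" using p(2)[of 0] by (simp add: l1_def)
      define e where "e \<beta> = d \<beta> - p (of_int_vec \<beta>)" for \<beta>
      have e: "\<bar>e \<beta>\<bar> \<le> ?\<delta> * (1 + l1 \<beta>) ^ Suc j" for \<beta> using p(2) by (simp add: e_def)
      have "shift_combination (it k c) ?h ?y = shift_combination d ?h z"
        unfolding shift_combination_def
        by (rule sum.reindex_bij_witness[of _ "\<lambda>\<beta>. \<gamma> + \<beta>" "\<lambda>\<alpha>. \<alpha> - \<gamma>"])
          (auto simp: z_def d_def of_int_vec_add of_int_vec_diff algebra_simps)
      also have "\<dots> = (\<Sum>\<beta>\<in>?W. d \<beta> * ?h (z - of_int_vec \<beta>))" by (rule shift_combination_window[OF hs z])
      also have "\<dots> = (\<Sum>\<beta>\<in>?W. p (of_int_vec \<beta>) * ?h (z - of_int_vec \<beta>)) + (\<Sum>\<beta>\<in>?W. e \<beta> * ?h (z - of_int_vec \<beta>))"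
        by (simp add: sum.distrib[symmetric] e_def algebra_simps)
      also have "(\<Sum>\<beta>\<in>?W. p (of_int_vec \<beta>) * ?h (z - of_int_vec \<beta>)) = partials \<mu> p 0"
        unfolding shift_combination_window[OF hs z, of "\<lambda>\<beta>. p (of_int_vec \<beta>)", symmetric]
        by (rule reproducing_partials[OF f]) (use \<mu> j p in auto)
      finally have 1: "shift_combination (it k c) ?h ?y = partials \<mu> p 0 + (\<Sum>\<beta>\<in>?W. e \<beta> * ?h (z - of_int_vec \<beta>))" .
      have d_eq: "d = (\<lambda>\<beta>. p (of_int_vec \<beta>) + e \<beta>)" by (auto simp: e_def)
      have "fdiffs \<mu> (it k c) \<gamma> = fdiffs \<mu> d 0" using fdiffs_shift[of \<mu> "it k c" \<gamma>] by (simp add: d_def[abs_def])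
      also have "\<dots> = partials \<mu> p 0 + fdiffs \<mu> e 0"
        unfolding d_eq fdiffs_add using fdiffs_pol_1[of p \<mu> 0 0] p(1) \<mu> by simp
      finally have 2: "fdiffs \<mu> (it k c) \<gamma> = partials \<mu> p 0 + fdiffs \<mu> e 0" .
      have 3: "\<bar>fdiffs \<mu> e 0\<bar> \<le> C2 * ?\<delta>"
        using fdiffs_growth[of e ?\<delta> "Suc j" \<mu> 0, OF e] by (simp add: C2_def \<mu> l1_def)
      have 4: "\<bar>\<Sum>\<beta>\<in>?W. e \<beta> * ?h (z - of_int_vec \<beta>)\<bar> \<le> L * ?\<delta>"
        unfolding L_def sum_distrib_right
      proof (rule order_trans[OF sum_abs sum_mono])
        fix \<beta>
        have "\<bar>e \<beta>\<bar> * \<bar>?h (z - of_int_vec \<beta>)\<bar> \<le> (?\<delta> * (1 + l1 \<beta>) ^ Suc j) * H"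
          using e[of \<beta>] H \<delta> l1_nonneg[of \<beta>] by (intro mult_mono) auto
        then show "\<bar>e \<beta> * ?h (z - of_int_vec \<beta>)\<bar> \<le> (1 + l1 \<beta>) ^ Suc j * H * ?\<delta>"
          by (simp add: abs_mult mult_ac)
      qed
      have "\<bar>fdiffs \<mu> (it k c) \<gamma> - shift_combination (it k c) ?h ?y\<bar> \<le> (L + C2) * ?\<delta>"
        unfolding 1 2 using 3 4 by (simp add: distrib_right)
      then have "real m ^ (j * k) * \<bar>fdiffs \<mu> (it k c) \<gamma> - shift_combination (it k c) ?h ?y\<bar>
        \<le> real m ^ (j * k) * ((L + C2) * ?\<delta>)" by (intro mult_left_mono) auto
      also have "\<dots> = (L + C2) * D * (real m ^ (j * k) * ((1 / real m) ^ j * rate j) ^ k)" by simp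
      also have "\<dots> = (L + C2) * D * rate j ^ k" by (simp only: m_powers)
      also have "real m ^ (j * k) * \<bar>fdiffs \<mu> (it k c) \<gamma> - shift_combination (it k c) ?h ?y\<bar>
        = \<bar>Gk k \<mu> x - (real m ^ k) ^ j * shift_combination (it k c) ?h ?y\<bar>"
        unfolding Gk_def \<mu> \<gamma>_def[symmetric]
        by (simp add: power_mult[symmetric] mult.commute[of j k] abs_mult right_diff_distrib[symmetric])
      finally show ?thesis using A(2)[OF \<mu>, of k x] by (simp add: distrib_right)
    qed
    then show ?thesis by blast
  qed
  then obtain C where C: "\<And>\<mu> k x. length \<mu> = j \<Longrightarrow>
    \<bar>G \<mu> x - (real m ^ k) ^ j * shift_combination (it k c) (partials \<mu> f) (real m ^ k *\<^sub>R x)\<bar> \<le> C \<mu> * rate j ^ k"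
    by metis
  define M where "M = {\<mu> :: 's list. length \<mu> = j}"
  have fin: "finite M" unfolding M_def using finite_lists_length_eq[of "UNIV :: 's set" j] by simp
  have "\<bar>G \<mu> x - (real m ^ k) ^ j * shift_combination (it k c) (partials \<mu> f) (real m ^ k *\<^sub>R x)\<bar> \<le> (\<Sum>\<mu>\<in>M. \<bar>C \<mu>\<bar>) * rate j ^ k"
    if "length \<mu> = j" for \<mu> k x
  proof -
    have "\<bar>C \<mu>\<bar> \<le> (\<Sum>\<mu>\<in>M. \<bar>C \<mu>\<bar>)" using that fin by (intro member_le_sum) (auto simp: M_def)
    then have "C \<mu> \<le> (\<Sum>\<mu>\<in>M. \<bar>C \<mu>\<bar>)" by linarith
    then have "C \<mu> * rate j ^ k \<le> (\<Sum>\<mu>\<in>M. \<bar>C \<mu>\<bar>) * rate j ^ k" using rate[of j] by (intro mult_right_mono) auto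
    then show ?thesis using C[OF that, of x k] by linarith
  qed
  then show ?thesis by blast
qed

lemma C_norm_tendsto:
  assumes f: "C_k n f" "box_supported R f" "reproducing n f" and n: "n \<le> l"
  shows "(\<lambda>k. C_norm n (\<lambda>x. G [] x - shift_combination (it k c) f ((real m ^ k) *\<^sub>R x))) \<longlonglongrightarrow> 0"
proof -
  obtain C where C: "\<And>j \<mu> k x. j \<le> n \<Longrightarrow> length \<mu> = j \<Longrightarrow>
    \<bar>G \<mu> x - (real m ^ k) ^ j * shift_combination (it k c) (partials \<mu> f) (real m ^ k *\<^sub>R x)\<bar> \<le> C j * rate j ^ k"
    using test_function_comparison[OF f n] by metis
  define u where "u k = (\<Sum>j\<le>n. \<bar>C j\<bar> * rate j ^ k)" for k
  have upper: "C_norm n (\<lambda>x. G [] x - shift_combination (it k c) f ((real m ^ k) *\<^sub>R x)) \<le> ennreal (u k)" for k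
    unfolding C_norm_def sup_norm_def
  proof (intro SUP_least ennreal_leI)
    fix \<mu> :: "'s list" and x assume "\<mu> \<in> {\<mu>. length \<mu> \<le> n}"
    then have \<mu>: "length \<mu> \<le> n" by simp
    have M: "0 < real m ^ k" using m by simp
    have "norm (partials \<mu> (\<lambda>x. G [] x - shift_combination (it k c) f ((real m ^ k) *\<^sub>R x)) x)
      = \<bar>G \<mu> x - (real m ^ k) ^ length \<mu> * shift_combination (it k c) (partials \<mu> f) (real m ^ k *\<^sub>R x)\<bar>"
      unfolding partials_diff_shift_combination[OF C_k_mono[OF C_k_G n] f(1,2) M \<mu>]
      using \<mu> n by (simp add: partials_G)
    also have "\<dots> \<le> C (length \<mu>) * rate (length \<mu>) ^ k" by (rule C[OF \<mu> refl])
    also have "\<dots> \<le> \<bar>C (length \<mu>)\<bar> * rate (length \<mu>) ^ k" using rate[of "length \<mu>"] by (intro mult_right_mono) auto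
    also have "\<dots> \<le> u k" unfolding u_def
      by (rule member_le_sum[of _ _ "\<lambda>j. \<bar>C j\<bar> * rate j ^ k"]) (use \<mu> rate in \<open>auto simp: less_imp_le\<close>)
    finally show "norm (partials \<mu> (\<lambda>x. G [] x - shift_combination (it k c) f ((real m ^ k) *\<^sub>R x)) x) \<le> u k" .
  qed
  have lim: "(\<lambda>k. ennreal (u k)) \<longlonglongrightarrow> 0"
  proof -
    have "u \<longlonglongrightarrow> (\<Sum>j\<le>n. \<bar>C j\<bar> * 0)"
      unfolding u_def[abs_def] using rate by (intro tendsto_intros LIMSEQ_realpow_zero) (auto simp: less_imp_le)
    then have "(\<lambda>k. ennreal (u k)) \<longlonglongrightarrow> ennreal 0" by (intro tendsto_ennrealI) simp
    then show ?thesis by simp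
  qed
  show ?thesis
    by (rule tendsto_sandwich[OF always_eventually always_eventually tendsto_const lim])
      (intro allI zero_le upper)+
qed

end

section \<open>Strang--Fix conditions imply polynomial reproduction\<close>

definition cexp :: "real ^ 's::finite \<Rightarrow> real ^ 's \<Rightarrow> complex" where
  "cexp \<omega> x = exp (- 2 * pi * \<i> * complex_of_real (x \<bullet> \<omega>))"

lemma cexp_continuous [continuous_intros]: "continuous_on S (cexp \<omega>)"
  unfolding cexp_def[abs_def] by (intro continuous_intros)

lemma fourier_cexp: "fourier f \<omega> = (LINT x|lborel. complex_of_real (f x) * cexp \<omega> x)"
  by (simp add: fourier_def cexp_def)

definition cube :: "nat \<Rightarrow> (real ^ 's::finite) set" where
  "cube R = cbox (\<chi> i. - real R) (\<chi> i. real R)"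

lemma not_in_cube: "x \<notin> cube R \<Longrightarrow> \<exists>i. real R < \<bar>x $ i\<bar>"
proof -
  assume "x \<notin> cube R"
  then obtain i where "\<not> (- real R \<le> x $ i \<and> x $ i \<le> real R)" by (auto simp: cube_def mem_box_cart)
  then have "real R < \<bar>x $ i\<bar>" by linarith
  then show ?thesis by blast
qed

lemma box_supported_indicator:
  fixes g :: "real ^ 's::finite \<Rightarrow> real" and h :: "real ^ 's \<Rightarrow> complex"
  assumes "box_supported R g"
  shows "complex_of_real (g x) * h x = indicator (cube R) x *\<^sub>R (complex_of_real (g x) * h x)"
  using assms not_in_cube[of x R] unfolding box_supported_def by (auto simp: indicator_def)

lemma integrable_box_supported:
  fixes g :: "real ^ 's::finite \<Rightarrow> real" and h :: "real ^ 's \<Rightarrow> complex"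
  assumes "box_supported R g" "continuous_on UNIV g" "continuous_on UNIV h"
  shows "integrable lborel (\<lambda>x. complex_of_real (g x) * h x)"
proof -
  have "continuous_on (cube R) (\<lambda>x. complex_of_real (g x) * h x)"
    by (intro continuous_intros continuous_on_subset[OF assms(2)] continuous_on_subset[OF assms(3)]) auto
  then have "integrable lborel (\<lambda>x. indicator (cube R) x *\<^sub>R (complex_of_real (g x) * h x))"
    by (intro borel_integrable_compact) (simp_all add: cube_def)
  then show ?thesis unfolding box_supported_indicator[OF assms(1), symmetric] .
qed

lemma lint_box_supported:
  fixes g :: "real ^ 's::finite \<Rightarrow> real" and h :: "real ^ 's \<Rightarrow> complex"
  assumes "box_supported R g" "continuous_on UNIV g" "continuous_on UNIV h"
  shows "(LINT x|lborel. complex_of_real (g x) * h x) = integral (cube R) (\<lambda>x. complex_of_real (g x) * h x)"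
proof -
  have "set_integrable lborel (cube R) (\<lambda>x. complex_of_real (g x) * h x)"
    unfolding set_integrable_def box_supported_indicator[OF assms(1), symmetric]
    by (rule integrable_box_supported[OF assms])
  from set_borel_integral_eq_integral(2)[OF this] show ?thesis
    unfolding set_lebesgue_integral_def box_supported_indicator[OF assms(1), symmetric] .
qed

lemma cexp_derivative:
  "((\<lambda>t. cexp (upd_vec \<omega> i t) x) has_vector_derivative (- 2 * pi * \<i>) * x $ i * cexp (upd_vec \<omega> i t) x) (at t within S)"
proof -
  have eq: "x \<bullet> upd_vec \<omega> i t = x \<bullet> \<omega> + x $ i * (t - \<omega> $ i)" for t
  proof -
    have "upd_vec \<omega> i t = \<omega> + (t - \<omega> $ i) *\<^sub>R axis i 1" by (simp add: vec_eq_iff axis_def)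
    then show ?thesis by (simp add: inner_add_right inner_axis)
  qed
  have "((\<lambda>t. exp (- 2 * pi * \<i> * complex_of_real (x \<bullet> \<omega> + x $ i * (t - \<omega> $ i)))) has_vector_derivative
      (- 2 * pi * \<i>) * x $ i * exp (- 2 * pi * \<i> * complex_of_real (x \<bullet> \<omega> + x $ i * (t - \<omega> $ i)))) (at t within S)"
  proof -
    define F where "F z = exp (- 2 * pi * \<i> * (complex_of_real (x \<bullet> \<omega>) + x $ i * (z - \<omega> $ i)))" for z :: complex
    have "(F has_field_derivative (- 2 * pi * \<i>) * x $ i * F (complex_of_real t)) (at (complex_of_real t))"
      unfolding F_def[abs_def] by (auto intro!: derivative_eq_intros)
    from has_vector_derivative_real_field[OF this, of S] show ?thesis by (simp add: F_def)
  qed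
  then show ?thesis unfolding cexp_def eq .
qed

text \<open>Differentiation under the integral over a fixed compact cube. Each derivative brings
  down a coordinate, so Strang-Fix conditions become statements about \<open>f\<close> times
  monomials.\<close>

lemma fourier_derivative:
  fixes g :: "real ^ 's::finite \<Rightarrow> real"
  assumes g: "box_supported R g" "continuous_on UNIV g"
  shows "((\<lambda>t. fourier g (upd_vec \<omega> i t)) has_vector_derivative
    (- 2 * pi * \<i>) * fourier (\<lambda>x. x $ i * g x) \<omega>) (at (\<omega> $ i))"
proof -
  let ?F = "\<lambda>t x. complex_of_real (g x) * cexp (upd_vec \<omega> i t) x"
  let ?D = "\<lambda>t x. complex_of_real (g x) * ((- 2 * pi * \<i>) * x $ i * cexp (upd_vec \<omega> i t) x)"
  have g2: "box_supported R (\<lambda>x. x $ i * g x)" "continuous_on UNIV (\<lambda>x. x $ i * g x)"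
    using g by (auto simp: box_supported_def intro!: continuous_intros)
  have cup: "continuous_on UNIV (\<lambda>z :: real \<times> (real ^ 's). upd_vec \<omega> i (fst z))"
  proof -
    have "upd_vec \<omega> i t = \<omega> + (t - \<omega> $ i) *\<^sub>R axis i 1" for t by (simp add: vec_eq_iff axis_def)
    then show ?thesis by (simp only:) (intro continuous_intros)
  qed
  have "((\<lambda>t. integral (cube R) (?F t)) has_vector_derivative integral (cube R) (?D (\<omega> $ i))) (at (\<omega> $ i) within UNIV)"
    unfolding cube_def
  proof (rule leibniz_rule_vector_derivative)
    show "((\<lambda>t. ?F t x) has_vector_derivative ?D t x) (at t within UNIV)" for t x
      by (intro has_vector_derivative_mult_right cexp_derivative)
    show "?F t integrable_on cbox (\<chi> i. - real R) (\<chi> i. real R)" for t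
      by (intro integrable_continuous continuous_intros continuous_on_subset[OF g(2)]) auto
    have "continuous_on UNIV (\<lambda>z :: real \<times> (real ^ 's). cexp (upd_vec \<omega> i (fst z)) (snd z))"
      unfolding cexp_def by (intro continuous_intros cup)
    moreover have "continuous_on UNIV (\<lambda>z :: real \<times> (real ^ 's). g (snd z))"
      by (rule continuous_on_compose2[OF g(2)]) (auto intro: continuous_intros)
    ultimately have "continuous_on UNIV (\<lambda>z. ?D (fst z) (snd z))" by (intro continuous_intros)
    then show "continuous_on (UNIV \<times> cbox (\<chi> i. - real R) (\<chi> i. real R)) (\<lambda>(t, x). ?D t x)"
      by (auto simp: case_prod_beta intro: continuous_on_subset)
  qed auto
  moreover have "integral (cube R) (?F t) = fourier g (upd_vec \<omega> i t)" for t
    unfolding fourier_cexp by (rule lint_box_supported[OF g cexp_continuous, symmetric])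
  moreover have "integral (cube R) (?D (\<omega> $ i)) = (- 2 * pi * \<i>) * fourier (\<lambda>x. x $ i * g x) \<omega>"
  proof -
    have "integral (cube R) (?D (\<omega> $ i)) = integral (cube R) (\<lambda>x. (- 2 * pi * \<i>) * (complex_of_real (x $ i * g x) * cexp \<omega> x))"
      by (rule integral_cong) simp
    also have "\<dots> = (- 2 * pi * \<i>) * integral (cube R) (\<lambda>x. complex_of_real (x $ i * g x) * cexp \<omega> x)"
      by (rule integral_mult_right)
    also have "integral (cube R) (\<lambda>x. complex_of_real (x $ i * g x) * cexp \<omega> x) = fourier (\<lambda>x. x $ i * g x) \<omega>"
      unfolding fourier_cexp by (rule lint_box_supported[OF g2 cexp_continuous, symmetric])
    finally show ?thesis .
  qed
  ultimately show ?thesis by simp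
qed

definition list_monomial :: "'s list \<Rightarrow> real ^ 's \<Rightarrow> real" where
  "list_monomial \<nu> x = prod_list (map (\<lambda>i. x $ i) \<nu>)"

lemma list_monomial_simps [simp]: "list_monomial [] x = 1" "list_monomial (i # \<nu>) x = x $ i * list_monomial \<nu> x"
  by (simp_all add: list_monomial_def)

lemma list_monomial_times:
  assumes "box_supported R f" "continuous_on UNIV f"
  shows "box_supported R (\<lambda>x. list_monomial \<nu> x * f x)" "continuous_on UNIV (\<lambda>x. list_monomial \<nu> x * f x)"
proof -
  show "box_supported R (\<lambda>x. list_monomial \<nu> x * f x)" using assms by (simp add: box_supported_def)
  have "continuous_on UNIV (list_monomial \<nu> :: real ^ 'a \<Rightarrow> real)"
    by (induction \<nu>) (auto simp: continuous_intros)
  then show "continuous_on UNIV (\<lambda>x. list_monomial \<nu> x * f x)" by (intro continuous_intros assms)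
qed

lemma partials_fourier:
  assumes f: "box_supported R f" "continuous_on UNIV f"
  shows "partials \<nu> (fourier f) = (\<lambda>\<omega>. (- 2 * pi * \<i>) ^ length \<nu> * fourier (\<lambda>x. list_monomial \<nu> x * f x) \<omega>)"
proof (induction \<nu>)
  case (Cons i \<nu>)
  show ?case
  proof
    fix \<omega>
    have "((\<lambda>t. (- 2 * pi * \<i>) ^ length \<nu> * fourier (\<lambda>x. list_monomial \<nu> x * f x) (upd_vec \<omega> i t)) has_vector_derivative
      (- 2 * pi * \<i>) ^ length \<nu> * ((- 2 * pi * \<i>) * fourier (\<lambda>x. x $ i * (list_monomial \<nu> x * f x)) \<omega>)) (at (\<omega> $ i))"
      by (intro has_vector_derivative_mult_right fourier_derivative[OF list_monomial_times[OF f]])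
    then show "partials (i # \<nu>) (fourier f) \<omega>
      = (- 2 * pi * \<i>) ^ length (i # \<nu>) * fourier (\<lambda>x. list_monomial (i # \<nu>) x * f x) \<omega>"
      unfolding partials_simps Cons partial_def by (subst vector_derivative_at) (auto simp: mult_ac)
  qed
qed simp

subsection \<open>Periodization\<close>

text \<open>Half-open, so that the integer translates partition space.\<close>

definition unit_cell :: "(real ^ 's::finite) set" where
  "unit_cell = {x. \<forall>i. 0 \<le> x $ i \<and> x $ i < 1}"

lemma unit_cell_sets [measurable]: "(unit_cell :: (real ^ 's::finite) set) \<in> sets borel"
proof -
  have eq: "(unit_cell :: (real ^ 's) set) = (\<Inter>i. {x :: real ^ 's. 0 \<le> x $ i} \<inter> {x. x $ i < 1})" by (auto simp: unit_cell_def)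
  have "{x :: real ^ 's. 0 \<le> x $ i} \<inter> {x. x $ i < 1} \<in> sets borel" for i
    by (intro sets.Int borel_closed borel_open closed_Collect_le open_Collect_less continuous_intros)
  then show ?thesis unfolding eq by (intro sets.finite_INT) simp_all
qed

lemma unit_cell_cbox: "box 0 1 \<subseteq> unit_cell" "unit_cell \<subseteq> cbox 0 (1 :: real ^ 's::finite)"
  by (auto simp: unit_cell_def mem_box_cart less_imp_le)

lemma measure_unit_cell: "measure lborel (unit_cell :: (real ^ 's::finite) set) = 1"
proof -
  have prod: "(\<Prod>b\<in>Basis. (1 - 0 :: real ^ 's) \<bullet> b) = 1"
    by (rule prod.neutral) (auto simp: Basis_vec_def inner_axis)
  have l: "(0 :: real ^ 's) \<bullet> b \<le> 1 \<bullet> b" if "b \<in> Basis" for b using that by (auto simp: Basis_vec_def inner_axis)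
  have eb: "emeasure lborel (box 0 (1 :: real ^ 's)) = 1" "emeasure lborel (cbox 0 (1 :: real ^ 's)) = 1"
    using prod l by (simp_all add: emeasure_lborel_box emeasure_lborel_cbox)
  have "emeasure lborel (box 0 (1 :: real ^ 's)) \<le> emeasure lborel (unit_cell :: (real ^ 's) set)"
    by (rule emeasure_mono[OF unit_cell_cbox(1)]) simp
  moreover have "emeasure lborel (unit_cell :: (real ^ 's) set) \<le> emeasure lborel (cbox 0 (1 :: real ^ 's))"
    by (rule emeasure_mono[OF unit_cell_cbox(2)]) simp
  ultimately have "emeasure lborel (unit_cell :: (real ^ 's) set) = 1" using eb by (simp add: antisym)
  then show ?thesis by (simp add: measure_def)
qed

lemma integrable_unit_cell:
  fixes h :: "real ^ 's::finite \<Rightarrow> 'b::{banach, second_countable_topology}"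
  assumes "continuous_on UNIV h"
  shows "integrable lborel (\<lambda>x. indicator unit_cell x *\<^sub>R h x)"
proof -
  have "integrable lborel (\<lambda>x. indicator (cbox 0 1) x *\<^sub>R h x)"
    by (intro borel_integrable_compact continuous_on_subset[OF assms]) auto
  then have "integrable lborel (\<lambda>x. indicator unit_cell x *\<^sub>R (indicator (cbox 0 1) x *\<^sub>R h x))"
    by (rule integrable_mult_indicator[rotated]) simp
  moreover have "indicator unit_cell x *\<^sub>R (indicator (cbox 0 1) x *\<^sub>R h x) = indicator unit_cell x *\<^sub>R h x" for x
    using unit_cell_cbox(2) by (auto simp: indicator_def)
  ultimately show ?thesis by (simp only:)
qed

lemma lborel_integral_translate:
  fixes h :: "real ^ 's::finite \<Rightarrow> 'b::{banach, second_countable_topology}"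
  assumes "h \<in> borel_measurable borel"
  shows "(LINT x|lborel. h (c + x)) = (LINT x|lborel. h x)"
proof -
  have "(LINT x|lborel. h x) = (LINT x|distr lborel borel ((+) c). h x)" by (simp add: lborel_distr_plus)
  also have "\<dots> = (LINT x|lborel. h (c + x))" by (rule integral_distr) (use assms in auto)
  finally show ?thesis by simp
qed

text \<open>Enough translates to sum a function supported in the cube of radius \<open>R\<close>
  over any point of the unit cell; the 2 is slack.\<close>

definition sbox :: "nat \<Rightarrow> (int ^ 's::finite) set" where
  "sbox R = ibox (- int R - 2) (int R + 2)"

lemma cexp_shift:
  "cexp (of_int_vec \<alpha>) (x + of_int_vec \<beta>) = cexp (of_int_vec \<alpha>) x"
proof -
  have "of_int_vec \<beta> \<bullet> of_int_vec \<alpha> = real_of_int (\<Sum>i\<in>UNIV. \<beta> $ i * \<alpha> $ i)"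
    by (simp add: inner_vec_def)
  then obtain n :: int where n: "of_int_vec \<beta> \<bullet> of_int_vec \<alpha> = real_of_int n" by blast
  have "exp (- 2 * pi * \<i> * complex_of_real (real_of_int n)) = 1"
    by (subst exp_eq_1) (auto intro!: exI[of _ "- n"])
  then show ?thesis unfolding cexp_def inner_add_left n of_real_add distrib_left exp_add by (simp only: mult_1_right)
qed

text \<open>Unfolding: space is cut into translates of the unit cell and each piece is moved back,
  which does not affect \<open>cexp\<close> at an integer frequency. Fourier coefficients of the
  periodization are thus values of the Fourier transform.\<close>

lemma periodization:
  fixes g :: "real ^ 's::finite \<Rightarrow> real"
  assumes g: "box_supported R g" "continuous_on UNIV g"
  shows "(LINT x|lborel. indicator unit_cell x *\<^sub>R
      (complex_of_real (\<Sum>\<beta>\<in>sbox R. g (x + of_int_vec \<beta>)) * cexp (of_int_vec \<alpha>) x)) = fourier g (of_int_vec \<alpha>)"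
proof -
  let ?e = "cexp (of_int_vec \<alpha>)"
  let ?h = "\<lambda>x. complex_of_real (g x) * ?e x"
  have ch: "continuous_on UNIV ?h" by (intro continuous_intros g)
  then have mh: "?h \<in> borel_measurable borel" by (rule borel_measurable_continuous_onI)
  have mi: "(\<lambda>x. indicator unit_cell (x - of_int_vec \<beta>) :: real) \<in> borel_measurable borel" for \<beta> :: "int ^ 's"
    by measurable
  have m2: "(\<lambda>x. indicator unit_cell (x - of_int_vec \<beta>) *\<^sub>R ?h x) \<in> borel_measurable borel" for \<beta> :: "int ^ 's"
    by (intro borel_measurable_scaleR mi mh)
  have int: "integrable lborel (\<lambda>x. indicator unit_cell (x - of_int_vec \<beta>) *\<^sub>R ?h x)" for \<beta> :: "int ^ 's"
  proof (rule Bochner_Integration.integrable_bound[OF integrable_box_supported[OF g cexp_continuous[of UNIV "of_int_vec \<alpha>"]]])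
    show "(\<lambda>x. indicator unit_cell (x - of_int_vec \<beta>) *\<^sub>R ?h x) \<in> borel_measurable lborel" using m2 by simp
  qed (auto simp: indicator_def)
  \<comment> \<open>Exactly one translate of the cell contains \<open>x\<close>, the one at
    \<open>fl x\<close>, and the support condition puts it into \<open>sbox R\<close>.\<close>
  have pw: "?h x = (\<Sum>\<beta>\<in>sbox R. indicator unit_cell (x - of_int_vec \<beta>) *\<^sub>R ?h x)" for x
  proof (cases "g x = 0")
    case False
    have iff: "x - of_int_vec \<beta> \<in> unit_cell \<longleftrightarrow> \<beta> = fl x" for \<beta>
    proof -
      have "0 \<le> x $ i - real_of_int (\<beta> $ i) \<and> x $ i - real_of_int (\<beta> $ i) < 1 \<longleftrightarrow> \<beta> $ i = \<lfloor>x $ i\<rfloor>" for i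
        by linarith
      then show ?thesis by (simp add: unit_cell_def fl_def vec_eq_iff)
    qed
    have "\<bar>x $ i\<bar> \<le> real R" for i using g(1) False unfolding box_supported_def by (meson not_le)
    then have "- int R - 2 \<le> \<lfloor>x $ i\<rfloor> \<and> \<lfloor>x $ i\<rfloor> \<le> int R + 2" for i
    proof -
      have "- real R \<le> x $ i" "x $ i \<le> real R" using \<open>\<bar>x $ i\<bar> \<le> real R\<close> by linarith+
      then show ?thesis by linarith
    qed
    then have "fl x \<in> sbox R" by (simp add: sbox_def ibox_def fl_def)
    then have "(\<Sum>\<beta>\<in>sbox R. (if \<beta> = fl x then ?h x else 0)) = ?h x" by (simp add: sbox_def)
    moreover have "indicator unit_cell (x - of_int_vec \<beta>) *\<^sub>R ?h x = (if \<beta> = fl x then ?h x else 0)" for \<beta>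
      using iff[of \<beta>] by (simp add: indicator_def)
    ultimately show ?thesis by simp
  qed simp
  have "fourier g (of_int_vec \<alpha>) = (LINT x|lborel. (\<Sum>\<beta>\<in>sbox R. indicator unit_cell (x - of_int_vec \<beta>) *\<^sub>R ?h x))"
    unfolding fourier_cexp pw[symmetric] ..
  also have "\<dots> = (\<Sum>\<beta>\<in>sbox R. (LINT x|lborel. indicator unit_cell (x - of_int_vec \<beta>) *\<^sub>R ?h x))"
    by (rule Bochner_Integration.integral_sum) (rule int)
  also have "\<dots> = (\<Sum>\<beta>\<in>sbox R. (LINT x|lborel. indicator unit_cell x *\<^sub>R (complex_of_real (g (x + of_int_vec \<beta>)) * ?e x)))"
  proof (rule sum.cong[OF refl])
    fix \<beta> :: "int ^ 's"
    have "(LINT x|lborel. indicator unit_cell (x - of_int_vec \<beta>) *\<^sub>R ?h x)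
      = (LINT x|lborel. indicator unit_cell (of_int_vec \<beta> + x - of_int_vec \<beta>) *\<^sub>R ?h (of_int_vec \<beta> + x))"
      by (rule lborel_integral_translate[OF m2, symmetric])
    then show "(LINT x|lborel. indicator unit_cell (x - of_int_vec \<beta>) *\<^sub>R ?h x)
      = (LINT x|lborel. indicator unit_cell x *\<^sub>R (complex_of_real (g (x + of_int_vec \<beta>)) * ?e x))"
      by (simp add: cexp_shift add.commute[of "of_int_vec \<beta>"])
  qed
  also have "\<dots> = (LINT x|lborel. (\<Sum>\<beta>\<in>sbox R. indicator unit_cell x *\<^sub>R (complex_of_real (g (x + of_int_vec \<beta>)) * ?e x)))"
  proof (rule Bochner_Integration.integral_sum[symmetric])
    fix \<beta> :: "int ^ 's"
    have "continuous_on UNIV (\<lambda>x. g (x + of_int_vec \<beta>))"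
      by (rule continuous_on_compose2[OF g(2)]) (auto intro!: continuous_intros)
    then show "integrable lborel (\<lambda>x. indicator unit_cell x *\<^sub>R (complex_of_real (g (x + of_int_vec \<beta>)) * ?e x))"
      by (intro integrable_unit_cell continuous_intros)
  qed
  finally show ?thesis by (simp add: sum_distrib_right scaleR_sum_right)
qed

definition IC :: "(real ^ 's::finite \<Rightarrow> complex) \<Rightarrow> complex" where
  "IC h = (LINT x|lborel. indicator unit_cell x *\<^sub>R h x)"

lemma IC_add: "continuous_on UNIV h \<Longrightarrow> continuous_on UNIV k \<Longrightarrow> IC (\<lambda>x. h x + k x) = IC h + IC k"
  unfolding IC_def scaleR_add_right by (intro Bochner_Integration.integral_add integrable_unit_cell)

lemma IC_cmult: "IC (\<lambda>x. c * h x) = c * IC h"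
  unfolding IC_def by (simp flip: mult_scaleR_right)

lemma IC_sum: "(\<And>t. t \<in> A \<Longrightarrow> continuous_on UNIV (h t)) \<Longrightarrow> IC (\<lambda>x. \<Sum>t\<in>A. h t x) = (\<Sum>t\<in>A. IC (h t))"
  unfolding IC_def scaleR_sum_right by (intro Bochner_Integration.integral_sum integrable_unit_cell) auto

lemma cexp_add: "cexp (\<omega> + \<omega>') x = cexp \<omega> x * cexp \<omega>' x"
  by (simp add: cexp_def inner_add_right distrib_left exp_add[symmetric])

lemma cexp_0 [simp]: "cexp 0 x = 1"
  by (simp add: cexp_def)

text \<open>Multiplication by a cosine moves a frequency to its two neighbours; hence orthogonality
  to all exponentials survives multiplication by trigonometric polynomials.\<close>

lemma cos_cexp:
  "complex_of_real (cos (2 * pi * x $ i)) * cexp (of_int_vec \<alpha>) x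
    = (1 / 2) * (cexp (of_int_vec (\<alpha> + axis i 1)) x + cexp (of_int_vec (\<alpha> - axis i 1)) x)"
proof -
  have ax: "x \<bullet> axis i 1 = x $ i" by (simp add: inner_axis)
  have e1: "cexp (axis i 1) x = exp (- (\<i> * complex_of_real (2 * pi * x $ i)))"
    unfolding cexp_def ax by (simp add: mult_ac)
  have e2: "cexp (- axis i 1) x = exp (\<i> * complex_of_real (2 * pi * x $ i))"
    unfolding cexp_def inner_minus_right ax by (simp add: mult_ac)
  have c: "complex_of_real (cos (2 * pi * x $ i)) = (cexp (- axis i 1) x + cexp (axis i 1) x) / 2"
    unfolding e1 e2 cos_of_real[symmetric] cos_exp_eq by simp
  have d: "of_int_vec \<alpha> - axis i 1 = of_int_vec \<alpha> + (- axis i (1 :: real))" by simp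
  show ?thesis unfolding of_int_vec_add of_int_vec_diff of_int_vec_axis d cexp_add c by (simp add: algebra_simps)
qed

text \<open>
  The trigonometric polynomial \<open>T\<close> exceeds 1 only near the centre of the cell, where \<open>Q > 0\<close>, and its
  powers concentrate there, while \<open>Q\<close> is orthogonal to all of them.
\<close>

lemma orthogonal_not_positive:
  fixes Q :: "real ^ 's::finite \<Rightarrow> real"
  assumes Q: "continuous_on UNIV Q"
    and orth: "\<And>\<alpha>. IC (\<lambda>x. complex_of_real (Q x) * cexp (of_int_vec \<alpha>) x) = 0"
  shows "Q (\<chi> i. 1 / 2) \<le> 0"
proof (rule ccontr)
  assume neg: "\<not> ?thesis"
  define c0 :: "real ^ 's" where "c0 = (\<chi> i. 1 / 2)"
  define e where "e = Q c0 / 2"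
  have e: "e > 0" using neg by (simp add: e_def c0_def)
  define s where "s = real CARD('s)"
  have s: "s \<ge> 1" unfolding s_def using zero_less_card_finite[where 'a = 's] by simp
  have "isCont Q c0" using Q by (simp add: continuous_on_eq_continuous_at)
  then have "\<forall>\<^sub>F y in nhds c0. e < Q y"
    using neg by (intro order_tendstoD(1)[of Q "Q c0"]) (auto simp: isCont_def tendsto_at_iff_tendsto_nhds e_def c0_def)
  then obtain d where d: "d > 0" "\<And>y. dist y c0 < d \<Longrightarrow> e < Q y" by (auto simp: eventually_nhds_metric)
  \<comment> \<open>\<open>s * \<delta> \<le> d\<close> converts coordinatewise closeness into
    distance, and \<open>\<delta> \<le> 1 / 4\<close> keeps the angle
    \<open>2 * pi * \<delta>\<close> in the range where cosine decreases.\<close>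
  define \<delta> where "\<delta> = min (1 / 4) (d / s)"
  have \<delta>: "0 < \<delta>" "\<delta> \<le> 1 / 4" "s * \<delta> \<le> d" using d(1) s by (auto simp: \<delta>_def min_def field_simps)
  have near: "e < Q y" if "\<And>i. \<bar>y $ i - 1 / 2\<bar> < \<delta>" for y
  proof -
    have "dist y c0 \<le> (\<Sum>i\<in>UNIV. \<bar>(y - c0) $ i\<bar>)" unfolding dist_norm by (rule norm_le_l1_cart)
    also have "\<dots> < (\<Sum>i\<in>(UNIV :: 's set). \<delta>)" by (rule sum_strict_mono) (use that in \<open>auto simp: c0_def\<close>)
    also have "\<dots> \<le> d" using \<delta>(3) by (simp add: s_def)
    finally show ?thesis by (rule d(2))
  qed
  define \<kappa> where "\<kappa> = cos (2 * pi * \<delta>)"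
  have pi\<delta>: "0 < 2 * pi * \<delta>" "2 * pi * \<delta> \<le> pi" using \<delta> by auto
  have \<kappa>: "\<kappa> < 1" using cos_monotone_0_pi[of 0 "2 * pi * \<delta>"] pi\<delta> by (simp add: \<kappa>_def)
  have \<kappa>1: "\<kappa> \<le> 1" using \<kappa> by simp
  \<comment> \<open>Normalised so that \<open>T\<close> equals 1 when one cosine is
    \<open>- \<kappa>\<close> and all others are -1: a single coordinate at distance
    \<open>\<delta>\<close> from the centre forces \<open>T \<le> 1\<close>, while the centre itself
    gives \<open>T > 1\<close>.\<close>
  define t0 where "t0 = 1 - (1 / (2 * s)) * (s - 1 + \<kappa>)"
  define T where "T x = t0 - (1 / (2 * s)) * (\<Sum>i\<in>UNIV. cos (2 * pi * x $ i))" for x :: "real ^ 's"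
  have contT: "continuous_on UNIV T" unfolding T_def[abs_def] by (intro continuous_intros)
  have T_eq: "T x = 1 + (1 / (2 * s)) * ((\<Sum>i\<in>UNIV. - cos (2 * pi * x $ i)) - (s - 1 + \<kappa>))" for x
  proof -
    have "1 - k * A - k * S = 1 + k * (- S - A)" for k A S :: real by (simp add: algebra_simps)
    then show ?thesis unfolding T_def t0_def sum_negf .
  qed
  have T0: "0 \<le> T x" for x
  proof -
    have "(\<Sum>i\<in>(UNIV :: 's set). - 1) \<le> (\<Sum>i\<in>UNIV. - cos (2 * pi * x $ i))" by (rule sum_mono) simp
    then have "- (2 * s) \<le> (\<Sum>i\<in>UNIV. - cos (2 * pi * x $ i)) - (s - 1 + \<kappa>)" using \<kappa>1 by (simp add: s_def)
    then have "(1 / (2 * s)) * (- (2 * s)) \<le> (1 / (2 * s)) * ((\<Sum>i\<in>UNIV. - cos (2 * pi * x $ i)) - (s - 1 + \<kappa>))"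
      using s by (intro mult_left_mono) auto
    then show ?thesis unfolding T_eq using s by simp
  qed
  have T1: "T x \<le> 1" if x: "x \<in> unit_cell" and i: "\<delta> \<le> \<bar>x $ i - 1 / 2\<bar>" for x i
  proof -
    have "0 \<le> x $ i \<and> x $ i < 1" using x by (simp add: unit_cell_def)
    then have "\<bar>x $ i - 1 / 2\<bar> \<le> 1 / 2" by linarith
    then have "2 * pi * \<bar>x $ i - 1 / 2\<bar> \<le> pi" by simp
    moreover have "2 * pi * \<delta> \<le> 2 * pi * \<bar>x $ i - 1 / 2\<bar>" using i by simp
    ultimately have "cos (2 * pi * \<bar>x $ i - 1 / 2\<bar>) \<le> \<kappa>"
      unfolding \<kappa>_def using pi\<delta> by (intro cos_monotone_0_pi_le) auto
    moreover have "2 * pi * \<bar>x $ i - 1 / 2\<bar> = \<bar>2 * pi * x $ i - pi\<bar>" by (simp add: abs_mult[symmetric] abs_if algebra_simps)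
    ultimately have ci: "- cos (2 * pi * x $ i) \<le> \<kappa>" by (simp add: cos_abs_real)
    have "(\<Sum>j\<in>UNIV. - cos (2 * pi * x $ j)) = - cos (2 * pi * x $ i) + (\<Sum>j\<in>UNIV - {i}. - cos (2 * pi * x $ j))"
      by (rule sum.remove) auto
    also have "(\<Sum>j\<in>UNIV - {i}. - cos (2 * pi * x $ j)) \<le> (\<Sum>j\<in>UNIV - {i}. 1)"
      by (rule sum_mono) (simp add: minus_le_iff)
    also have "(\<Sum>j\<in>UNIV - {i}. 1) = s - 1" by (simp add: s_def card_Diff_singleton of_nat_diff Suc_leI)
    finally have "(\<Sum>j\<in>UNIV. - cos (2 * pi * x $ j)) - (s - 1 + \<kappa>) \<le> 0" using ci by simp
    then have "(1 / (2 * s)) * ((\<Sum>j\<in>UNIV. - cos (2 * pi * x $ j)) - (s - 1 + \<kappa>)) \<le> 0"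
      using s by (intro mult_nonneg_nonpos) auto
    then show ?thesis unfolding T_eq by linarith
  qed
  have Tc: "T c0 > 1"
  proof -
    have "(\<Sum>i\<in>(UNIV :: 's set). - cos (2 * pi * c0 $ i)) = s" by (simp add: c0_def s_def)
    then show ?thesis unfolding T_eq using s \<kappa> by simp
  qed
  define \<tau> where "\<tau> = (1 + T c0) / 2"
  have \<tau>: "1 < \<tau>" "\<tau> < T c0" using Tc by (auto simp: \<tau>_def)
  \<comment> \<open>Prepares a box around the centre on which the powers of \<open>T\<close> grow at
    least like \<open>\<tau>^n\<close>.\<close>
  have op: "open ({y. \<tau> < T y} \<inter> box 0 1)"
    by (intro open_Int open_Collect_less continuous_on_const contT open_box)
  have "c0 \<in> box 0 1" by (simp add: mem_box_cart c0_def)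
  then have "c0 \<in> {y. \<tau> < T y} \<inter> box 0 1" using \<tau>(2) by blast
  then obtain a b where ab: "cbox a b \<subseteq> {y. \<tau> < T y} \<inter> box 0 1" "c0 \<in> box a b"
    "\<forall>i\<in>Basis. a \<bullet> i < b \<bullet> i" by (rule open_contains_cbox[OF op])
  define \<mu> where "\<mu> = measure lborel (cbox a b)"
  have \<mu>: "0 < \<mu>" using content_pos_lt[OF ab(3)] by (simp add: \<mu>_def measure_completion)
  have "compact (Q ` cbox 0 1)" by (intro compact_continuous_image continuous_on_subset[OF Q]) auto
  then have "bounded (Q ` cbox 0 1)" by (rule compact_imp_bounded)
  then obtain M where "\<forall>y\<in>Q ` cbox 0 1. norm y \<le> M" unfolding bounded_iff by blast
  then have M: "\<bar>Q x\<bar> \<le> M" if "x \<in> unit_cell" for x using that unit_cell_cbox(2) by auto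
  have c0u: "c0 \<in> unit_cell" by (simp add: unit_cell_def c0_def)
  have M0: "0 \<le> M" using M[OF c0u] by linarith
  \<comment> \<open>Expanding one factor \<open>T\<close> by \<open>cos_cexp\<close> produces
    neighbouring frequencies, so the induction treats all frequencies at once.\<close>
  have orthT: "IC (\<lambda>x. complex_of_real (Q x * T x ^ n) * cexp (of_int_vec \<alpha>) x) = 0" for n \<alpha>
  proof (induction n arbitrary: \<alpha>)
    case 0
    show ?case using orth by simp
  next
    case (Suc n)
    let ?h = "\<lambda>\<alpha> x. complex_of_real (Q x * T x ^ n) * cexp (of_int_vec \<alpha>) x"
    have ch: "continuous_on UNIV (?h \<alpha>)" for \<alpha> by (intro continuous_intros Q contT)
    have alg: "A * (t * E - k * (\<Sum>i\<in>UNIV. 1 / 2 * (u i + v i))) = t * (A * E) + (\<Sum>i\<in>UNIV. (- k / 2) * (A * u i + A * v i))"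
      for A t E k :: complex and u v :: "'s \<Rightarrow> complex"
    proof -
      have "(\<Sum>i\<in>UNIV. (- k / 2) * (A * u i + A * v i)) = (\<Sum>i\<in>UNIV. (- k * A) * (1 / 2 * (u i + v i)))"
        by (rule sum.cong) (auto simp: algebra_simps)
      also have "\<dots> = (- k * A) * (\<Sum>i\<in>UNIV. 1 / 2 * (u i + v i))" by (simp only: sum_distrib_left)
      finally show ?thesis by (simp add: algebra_simps)
    qed
    have eq: "complex_of_real (Q x * T x ^ Suc n) * cexp (of_int_vec \<alpha>) x
      = complex_of_real t0 * ?h \<alpha> x + (\<Sum>i\<in>UNIV. complex_of_real (- 1 / (4 * s)) * (?h (\<alpha> + axis i 1) x + ?h (\<alpha> - axis i 1) x))" for x
    proof -
      have "complex_of_real (Q x * T x ^ Suc n) * cexp (of_int_vec \<alpha>) x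
        = complex_of_real (Q x * T x ^ n) * (complex_of_real t0 * cexp (of_int_vec \<alpha>) x
           - complex_of_real (1 / (2 * s)) * (\<Sum>i\<in>UNIV. complex_of_real (cos (2 * pi * x $ i)) * cexp (of_int_vec \<alpha>) x))"
        by (simp add: T_def sum_distrib_left sum_distrib_right algebra_simps)
      also have "\<dots> = complex_of_real t0 * ?h \<alpha> x + (\<Sum>i\<in>UNIV. complex_of_real (- 1 / (4 * s)) * (?h (\<alpha> + axis i 1) x + ?h (\<alpha> - axis i 1) x))"
        unfolding cos_cexp alg by simp
      finally show ?thesis .
    qed
    have "IC (\<lambda>x. complex_of_real (Q x * T x ^ Suc n) * cexp (of_int_vec \<alpha>) x)
      = complex_of_real t0 * IC (?h \<alpha>) + (\<Sum>i\<in>UNIV. complex_of_real (- 1 / (4 * s)) * (IC (?h (\<alpha> + axis i 1)) + IC (?h (\<alpha> - axis i 1))))"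
    proof -
      have cc: "continuous_on UNIV (\<lambda>x. complex_of_real (- 1 / (4 * s)) * (?h (\<alpha> + axis i 1) x + ?h (\<alpha> - axis i 1) x))" for i
        by (intro continuous_on_mult continuous_on_const continuous_on_add ch)
      show ?thesis unfolding eq
        by (subst IC_add, intro continuous_on_mult continuous_on_const ch, intro continuous_on_sum cc,
            subst IC_sum, rule cc, unfold IC_cmult, subst IC_add, rule ch, rule ch, rule refl)
    qed
    then show ?case by (simp only: Suc.IH mult_zero_right add_0_right sum.neutral_const)
  qed
  have zero: "(LINT x|lborel. indicator unit_cell x *\<^sub>R (Q x * T x ^ n)) = 0" for n
  proof -
    have "complex_of_real (LINT x|lborel. indicator unit_cell x *\<^sub>R (Q x * T x ^ n))
      = (LINT x|lborel. complex_of_real (indicator unit_cell x *\<^sub>R (Q x * T x ^ n)))"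
      by (rule integral_complex_of_real[symmetric])
    also have "\<dots> = IC (\<lambda>x. complex_of_real (Q x * T x ^ n) * cexp (of_int_vec 0) x)"
      unfolding IC_def by (simp add: scaleR_conv_of_real)
    finally show ?thesis using orthT[of n 0] by (simp only: of_real_eq_0_iff)
  qed
  have sub: "cbox a b \<subseteq> unit_cell" using ab(1) unit_cell_cbox(1) by blast
  \<comment> \<open>The integrand of a vanishing integral is at least \<open>e * \<tau>^n\<close> on
    the box, nonnegative elsewhere near the centre, and at least \<open>- M\<close> on the rest of
    the cell. Since \<open>\<tau> > 1\<close>, this cannot hold for all \<open>n\<close>.\<close>
  have bound: "e * \<tau> ^ n * \<mu> \<le> M" for n
  proof -
    have pw: "(e * \<tau> ^ n) * indicator (cbox a b) x - M * indicator unit_cell x \<le> indicator unit_cell x *\<^sub>R (Q x * T x ^ n)" for x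
    proof (cases "x \<in> unit_cell")
      case True
      have "(e * \<tau> ^ n) * indicator (cbox a b) x - M \<le> Q x * T x ^ n"
      proof (cases "\<forall>i. \<bar>x $ i - 1 / 2\<bar> < \<delta>")
        case near': True
        then have q: "e < Q x" by (intro near) auto
        show ?thesis
        proof (cases "x \<in> cbox a b")
          case True
          then have "\<tau> \<le> T x" using ab(1) by auto
          then have "e * \<tau> ^ n \<le> Q x * T x ^ n" using q e \<tau> by (intro mult_mono power_mono) auto
          then show ?thesis using True M0 by simp
        next
          case False
          have "0 \<le> Q x * T x ^ n" using q e T0 by simp
          then show ?thesis using False M0 by simp
        qed
      next
        case False
        then obtain i where "\<delta> \<le> \<bar>x $ i - 1 / 2\<bar>" by (auto simp: not_less)
        then have t: "T x \<le> 1" using T1 True by blast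
        then have "x \<notin> cbox a b" using ab(1) \<tau> by auto
        moreover have "\<bar>Q x * T x ^ n\<bar> \<le> M * 1"
          unfolding abs_mult using M[OF True] T0[of x] t M0 by (intro mult_mono) (auto intro: power_le_one)
        ultimately show ?thesis by simp
      qed
      then show ?thesis using True by simp
    next
      case False
      then show ?thesis using sub by (auto simp: indicator_def)
    qed
    have i1: "integrable lborel (\<lambda>x. (e * \<tau> ^ n) * indicator (cbox a b) x :: real)"
      using borel_integrable_compact[of "cbox a b" "\<lambda>x. 1 :: real"] by simp
    have i2: "integrable lborel (\<lambda>x :: real ^ 's. M * indicator unit_cell x :: real)"
      using integrable_unit_cell[of "\<lambda>x :: real ^ 's. 1 :: real"] by simp
    have "(LINT x|lborel. (e * \<tau> ^ n) * indicator (cbox a b) x - M * indicator unit_cell x) \<le> (LINT x|lborel. indicator unit_cell x *\<^sub>R (Q x * T x ^ n))"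
      by (intro integral_mono pw Bochner_Integration.integrable_diff i1 i2 integrable_unit_cell continuous_intros Q contT)
    moreover have "(LINT x|lborel. (e * \<tau> ^ n) * indicator (cbox a b) x - M * indicator unit_cell x) = e * \<tau> ^ n * \<mu> - M"
      by (subst Bochner_Integration.integral_diff[OF i1 i2]) (simp add: \<mu>_def measure_unit_cell)
    ultimately show ?thesis unfolding zero by simp
  qed
  obtain n where "M / (e * \<mu>) < \<tau> ^ n" using real_arch_pow[OF \<tau>(1)] by blast
  then have "M < e * \<tau> ^ n * \<mu>" using e \<mu> by (simp add: field_simps)
  then show False using bound[of n] by simp
qed

text \<open>Uses both \<open>Q\<close> and \<open>- Q\<close>. Treating the centre of the cell is
  enough, because any other point can be translated there.\<close>

lemma orthogonal_zero:
  fixes Q :: "real ^ 's::finite \<Rightarrow> real"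
  assumes Q: "continuous_on UNIV Q"
    and orth: "\<And>\<alpha>. IC (\<lambda>x. complex_of_real (Q x) * cexp (of_int_vec \<alpha>) x) = 0"
  shows "Q (\<chi> i. 1 / 2) = 0"
proof -
  have "IC (\<lambda>x. complex_of_real (- Q x) * cexp (of_int_vec \<alpha>) x) = 0" for \<alpha>
    using IC_cmult[of "-1" "\<lambda>x. complex_of_real (Q x) * cexp (of_int_vec \<alpha>) x"] orth by simp
  then have "- Q (\<chi> i. 1 / 2) \<le> 0" by (intro orthogonal_not_positive[of "\<lambda>x. - Q x"] continuous_intros Q)
  moreover have "Q (\<chi> i. 1 / 2) \<le> 0" by (rule orthogonal_not_positive[OF assms])
  ultimately show ?thesis by linarith
qed

subsection \<open>Poisson summation\<close>

lemma fourier_translate: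
  fixes g :: "real ^ 's::finite \<Rightarrow> real"
  assumes "continuous_on UNIV g"
  shows "fourier (\<lambda>x. g (z + x)) \<omega> = exp (2 * pi * \<i> * complex_of_real (z \<bullet> \<omega>)) * fourier g \<omega>"
proof -
  let ?h = "\<lambda>x. exp (2 * pi * \<i> * complex_of_real (z \<bullet> \<omega>)) * (complex_of_real (g x) * cexp \<omega> x)"
  have c: "cexp \<omega> x = exp (2 * pi * \<i> * complex_of_real (z \<bullet> \<omega>)) * cexp \<omega> (z + x)" for x
    unfolding cexp_def exp_add[symmetric] by (simp add: inner_add_left algebra_simps)
  have "complex_of_real (g (z + x)) * cexp \<omega> x = ?h (z + x)" for x
    by (subst c) (simp only: mult_ac)
  then have "fourier (\<lambda>x. g (z + x)) \<omega> = (LINT x|lborel. ?h (z + x))"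
    unfolding fourier_cexp by (simp only:)
  also have "\<dots> = (LINT x|lborel. ?h x)"
    by (rule lborel_integral_translate) (intro borel_measurable_continuous_onI continuous_intros assms)
  also have "\<dots> = exp (2 * pi * \<i> * complex_of_real (z \<bullet> \<omega>)) * fourier g \<omega>" unfolding fourier_cexp by simp
  finally show ?thesis .
qed

lemma shift_sum_sbox:
  fixes g :: "real ^ 's::finite \<Rightarrow> real"
  assumes g: "box_supported R g" and R': "\<And>i. real R + \<bar>y $ i\<bar> \<le> real R' + 2"
  shows "(\<Sum>\<beta>\<in>sbox R'. g (y + of_int_vec \<beta>)) = shift_combination (\<lambda>_. 1) g y"
proof -
  have "shift_combination (\<lambda>_. 1) g y = (\<Sum>\<alpha>\<in>sbox R'. g (y - of_int_vec \<alpha>))"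
    unfolding shift_combination_def
  proof (rule sum.mono_neutral_cong_left)
    show "{\<alpha>. g (y - of_int_vec \<alpha>) \<noteq> 0} \<subseteq> sbox R'"
    proof
      fix \<alpha> assume "\<alpha> \<in> {\<alpha>. g (y - of_int_vec \<alpha>) \<noteq> 0}"
      then have "\<bar>(y - of_int_vec \<alpha>) $ i\<bar> \<le> real R" for i using g unfolding box_supported_def by (meson mem_Collect_eq not_le)
      then have a: "\<bar>y $ i - real_of_int (\<alpha> $ i)\<bar> \<le> real R" for i by simp
      have "- int R' - 2 \<le> \<alpha> $ i \<and> \<alpha> $ i \<le> int R' + 2" for i
      proof -
        have "real_of_int (- int R' - 2) \<le> real_of_int (\<alpha> $ i)" "real_of_int (\<alpha> $ i) \<le> real_of_int (int R' + 2)"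
          using a[of i] R'[of i]
          by (simp_all only: of_int_diff of_int_add of_int_minus of_int_of_nat_eq of_int_numeral)
        then show ?thesis unfolding of_int_le_iff by blast
      qed
      then show "\<alpha> \<in> sbox R'" by (simp add: sbox_def ibox_def)
    qed
  qed (auto simp: sbox_def)
  also have "\<dots> = (\<Sum>\<beta>\<in>sbox R'. g (y + of_int_vec \<beta>))"
    by (rule sum.reindex_bij_witness[of _ uminus uminus])
      (auto simp: of_int_vec_minus sbox_def ibox_def, (smt (verit))+)
  finally show ?thesis by simp
qed

text \<open>The difference of two translates of \<open>g\<close> has vanishing transform at every
  integer point: at nonzero ones by hypothesis, at 0 because translation preserves the integral. So
  its periodization is orthogonal to all exponentials and vanishes at the centre, where it equals
  the difference of the two shift sums.\<close>

lemma shift_sum_constant: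
  fixes g :: "real ^ 's::finite \<Rightarrow> real"
  assumes g: "box_supported R g" "continuous_on UNIV g"
    and van: "\<And>\<alpha>. \<alpha> \<noteq> 0 \<Longrightarrow> fourier g (of_int_vec \<alpha>) = 0"
  shows "shift_combination (\<lambda>_. 1) g y = shift_combination (\<lambda>_. 1) g y'"
proof -
  define c0 :: "real ^ 's" where "c0 = (\<chi> i. 1 / 2)"
  obtain k :: nat where k: "norm y + norm y' + 1 \<le> real k" using real_arch_simple by blast
  define R' where "R' = R + k"
  have yk: "\<bar>y $ i\<bar> + 1 \<le> real k" "\<bar>y' $ i\<bar> + 1 \<le> real k" for i
    using component_le_norm_cart[of y i] component_le_norm_cart[of y' i] k norm_ge_zero[of y] norm_ge_zero[of y'] by linarith+
  have R'y: "real R + \<bar>y $ i\<bar> \<le> real R' + 2" "real R + \<bar>y' $ i\<bar> \<le> real R' + 2" for i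
    unfolding R'_def of_nat_add using yk[of i] by linarith+
  define h where "h z x = g (z + x)" for z x
  have ch: "continuous_on UNIV (h z)" for z
    unfolding h_def[abs_def] by (rule continuous_on_compose2[OF g(2)]) (auto intro!: continuous_intros)
  have bh: "box_supported R' (h (y - c0))" "box_supported R' (h (y' - c0))"
    unfolding box_supported_def h_def
  proof (safe)
    fix x :: "real ^ 's" and i assume x: "real R' < \<bar>x $ i\<bar>"
    have "real R < \<bar>(y - c0 + x) $ i\<bar>" using x yk(1)[of i] by (simp add: R'_def c0_def)
    then show "g (y - c0 + x) = 0" using g(1) unfolding box_supported_def by blast
    have "real R < \<bar>(y' - c0 + x) $ i\<bar>" using x yk(2)[of i] by (simp add: R'_def c0_def)
    then show "g (y' - c0 + x) = 0" using g(1) unfolding box_supported_def by blast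
  qed
  \<comment> \<open>The translations by \<open>y - c0\<close> and \<open>y' - c0\<close> bring both
    points to the centre \<open>c0\<close>.\<close>
  define g' where "g' x = h (y - c0) x - h (y' - c0) x" for x
  have g': "box_supported R' g'" "continuous_on UNIV g'"
    using bh by (auto simp: g'_def[abs_def] box_supported_def intro!: continuous_intros ch)
  have f0: "fourier g' (of_int_vec \<alpha>) = 0" for \<alpha>
  proof -
    have "fourier g' (of_int_vec \<alpha>) = fourier (h (y - c0)) (of_int_vec \<alpha>) - fourier (h (y' - c0)) (of_int_vec \<alpha>)"
      unfolding fourier_cexp g'_def of_real_diff left_diff_distrib
      by (intro Bochner_Integration.integral_diff integrable_box_supported[OF bh(1) ch cexp_continuous]
          integrable_box_supported[OF bh(2) ch cexp_continuous])
    then show ?thesis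
      unfolding h_def[abs_def] fourier_translate[OF g(2)] using van[of \<alpha>] by (cases "\<alpha> = 0") auto
  qed
  define Q where "Q x = (\<Sum>\<beta>\<in>sbox R'. g' (x + of_int_vec \<beta>))" for x
  have cQ: "continuous_on UNIV Q"
    unfolding Q_def[abs_def]
    by (intro continuous_on_sum continuous_on_compose2[OF g'(2)]) (auto intro!: continuous_intros)
  have "IC (\<lambda>x. complex_of_real (Q x) * cexp (of_int_vec \<alpha>) x) = 0" for \<alpha>
    using periodization[OF g', of \<alpha>] by (simp only: IC_def Q_def f0)
  from orthogonal_zero[OF cQ this] have "Q c0 = 0" by (simp add: c0_def)
  moreover have "Q c0 = (\<Sum>\<beta>\<in>sbox R'. g (y + of_int_vec \<beta>)) - (\<Sum>\<beta>\<in>sbox R'. g (y' + of_int_vec \<beta>))"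
    by (simp add: Q_def g'_def h_def sum_subtractf algebra_simps)
  moreover have "(\<Sum>\<beta>\<in>sbox R'. g (y + of_int_vec \<beta>)) = shift_combination (\<lambda>_. 1) g y"
    by (rule shift_sum_sbox[OF g(1)]) (rule R'y(1))
  moreover have "(\<Sum>\<beta>\<in>sbox R'. g (y' + of_int_vec \<beta>)) = shift_combination (\<lambda>_. 1) g y'"
    by (rule shift_sum_sbox[OF g(1)]) (rule R'y(2))
  ultimately show ?thesis by simp
qed

text \<open>A constant periodization equals its mean over the unit cell, and that mean is the
  transform at 0.\<close>

lemma shift_sum_eq_fourier:
  fixes g :: "real ^ 's::finite \<Rightarrow> real"
  assumes g: "box_supported R g" "continuous_on UNIV g"
    and van: "\<And>\<alpha>. \<alpha> \<noteq> 0 \<Longrightarrow> fourier g (of_int_vec \<alpha>) = 0"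
  shows "complex_of_real (shift_combination (\<lambda>_. 1) g y) = fourier g 0"
proof -
  let ?\<kappa> = "shift_combination (\<lambda>_. 1) g y"
  have "fourier g 0 = (LINT x|lborel. indicator unit_cell x *\<^sub>R
      (complex_of_real (\<Sum>\<beta>\<in>sbox R. g (x + of_int_vec \<beta>)) * cexp (of_int_vec 0) x))"
    using periodization[OF g, of 0] by simp
  also have "\<dots> = (LINT x|lborel. complex_of_real (?\<kappa> * indicator (unit_cell :: (real ^ 's) set) x))"
  proof (rule Bochner_Integration.integral_cong[OF refl])
    fix x :: "real ^ 's"
    show "indicator unit_cell x *\<^sub>R (complex_of_real (\<Sum>\<beta>\<in>sbox R. g (x + of_int_vec \<beta>)) * cexp (of_int_vec 0) x)
      = complex_of_real (?\<kappa> * indicator unit_cell x)"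
    proof (cases "x \<in> unit_cell")
      case True
      have "0 \<le> x $ i \<and> x $ i < 1" for i using True by (simp add: unit_cell_def)
      then have "real R + \<bar>x $ i\<bar> \<le> real R + 2" for i by (smt (verit))
      then have "(\<Sum>\<beta>\<in>sbox R. g (x + of_int_vec \<beta>)) = shift_combination (\<lambda>_. 1) g x" by (rule shift_sum_sbox[OF g(1)])
      also have "\<dots> = ?\<kappa>" by (rule shift_sum_constant[OF g van])
      finally show ?thesis using True by simp
    qed simp
  qed
  also have "\<dots> = complex_of_real (LINT x|lborel. ?\<kappa> * indicator (unit_cell :: (real ^ 's) set) x)" by (rule integral_complex_of_real)
  also have "\<dots> = complex_of_real ?\<kappa>" by (simp add: measure_unit_cell)
  finally show ?thesis by simp
qed

text \<open>Strang-Fix conditions make the moments of the shifts, with displacement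
  \<open>y - \<alpha>\<close> and weight \<open>f (y - \<alpha>)\<close>, independent of
  \<open>y\<close>; \<open>pol_average\<close> applies with this displacement as \<open>u\<close>,
  and \<open>fourier f 0 = 1\<close> normalises the moment of order 0.\<close>

lemma test_function_reproducing:
  fixes f :: "real ^ 's::finite \<Rightarrow> real"
  assumes f: "box_supported R f" "continuous_on UNIV f" and sf: "strang_fix n f"
  shows "reproducing n f"
proof -
  have mon: "\<exists>\<kappa>. \<forall>y. (\<Sum>\<alpha>\<in>window R y. f (y - of_int_vec \<alpha>) * list_monomial \<nu> (y - of_int_vec \<alpha>)) = \<kappa>" if "length \<nu> \<le> n" for \<nu>
  proof -
    let ?g = "\<lambda>x. list_monomial \<nu> x * f x"
    note g = list_monomial_times[OF f, of \<nu>]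
    have "fourier ?g (of_int_vec \<alpha>) = 0" if "\<alpha> \<noteq> 0" for \<alpha>
    proof -
      have "partials \<nu> (fourier f) (of_int_vec \<alpha>) = 0" using sf that \<open>length \<nu> \<le> n\<close> unfolding strang_fix_def by auto
      then show ?thesis unfolding partials_fourier[OF f] by simp
    qed
    note const = shift_sum_constant[OF g this]
    have "(\<Sum>\<alpha>\<in>window R y. f (y - of_int_vec \<alpha>) * list_monomial \<nu> (y - of_int_vec \<alpha>)) = shift_combination (\<lambda>_. 1) ?g y" for y
      by (subst shift_combination_window[OF g(1), of y y]) (auto simp: mult.commute)
    then show ?thesis using const[of _ 0] by metis
  qed
  have gen: "\<And>\<nu>. length \<nu> + d \<le> Suc n \<Longrightarrow> \<exists>\<kappa>. \<forall>y. (\<Sum>\<alpha>\<in>window R y. f (y - of_int_vec \<alpha>)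
      * (list_monomial \<nu> (y - of_int_vec \<alpha>) * r (y - of_int_vec \<alpha>))) = \<kappa>" if "r \<in> pol d" for r d
    using that
  proof (induction rule: pol_induct)
    case (const d c)
    obtain \<kappa> where "\<And>y. (\<Sum>\<alpha>\<in>window R y. f (y - of_int_vec \<alpha>) * list_monomial \<nu> (y - of_int_vec \<alpha>)) = \<kappa>"
      using mon[of \<nu>] const by auto
    then show ?case by (intro exI[of _ "\<kappa> * c"]) (simp add: mult.assoc[symmetric] sum_distrib_right[symmetric])
  next
    case (add d p q)
    obtain \<kappa> where "\<And>y. (\<Sum>\<alpha>\<in>window R y. f (y - of_int_vec \<alpha>) * (list_monomial \<nu> (y - of_int_vec \<alpha>) * p (y - of_int_vec \<alpha>))) = \<kappa>"
      using add.IH(1)[OF add.prems] by auto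
    moreover obtain \<kappa>' where "\<And>y. (\<Sum>\<alpha>\<in>window R y. f (y - of_int_vec \<alpha>) * (list_monomial \<nu> (y - of_int_vec \<alpha>) * q (y - of_int_vec \<alpha>))) = \<kappa>'"
      using add.IH(2)[OF add.prems] by auto
    ultimately show ?case by (intro exI[of _ "\<kappa> + \<kappa>'"]) (simp add: distrib_left sum.distrib)
  next
    case (mult d p i)
    then show ?case using mult.IH[of "i # \<nu>"] by (simp add: mult_ac)
  qed simp
  define \<kappa> where "\<kappa> r = (\<Sum>\<alpha>\<in>window R 0. f (0 - of_int_vec \<alpha>) * r (0 - of_int_vec \<alpha>))" for r
  have mom: "(\<Sum>\<alpha>\<in>window R y. f (y - of_int_vec \<alpha>) * r (y - of_int_vec \<alpha>)) = \<kappa> r" if r: "r \<in> pol (Suc n)" for r y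
  proof -
    obtain \<kappa>' where "\<And>y. (\<Sum>\<alpha>\<in>window R y. f (y - of_int_vec \<alpha>) * r (y - of_int_vec \<alpha>)) = \<kappa>'"
      using gen[OF r, of "[]"] by auto
    then show ?thesis unfolding \<kappa>_def by metis
  qed
  have "\<kappa> (\<lambda>x. 1) = 1"
  proof -
    have "fourier f (of_int_vec \<alpha>) = 0" if "\<alpha> \<noteq> 0" for \<alpha>
      using sf that unfolding strang_fix_def by (metis add_gr_0 less_numeral_extra(1) list.size(3) partials_simps(1))
    from shift_sum_eq_fourier[OF f this, of 0] have "complex_of_real (shift_combination (\<lambda>_. 1) f 0) = 1"
      using sf by (simp add: strang_fix_def)
    moreover have "\<kappa> (\<lambda>x. 1) = shift_combination (\<lambda>_. 1) f 0"
      unfolding \<kappa>_def by (subst shift_combination_window[OF f(1), of 0 0]) auto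
    ultimately show ?thesis by simp
  qed
  note one = this
  show ?thesis
    unfolding reproducing_def
  proof (intro allI impI ballI)
    fix d and p :: "real ^ 's \<Rightarrow> real" assume d: "d \<le> n" and p: "p \<in> pol (Suc d)"
    have "\<exists>q\<in>pol d. \<forall>y\<in>UNIV. (\<Sum>\<alpha>\<in>window R y. f (y - of_int_vec \<alpha>) * p (y - (y - of_int_vec \<alpha>))) = p y + q y"
      by (rule pol_average[where l = n and \<kappa> = \<kappa>]) (use mom p d one in auto)
    then obtain q where q: "q \<in> pol d" "\<And>y. (\<Sum>\<alpha>\<in>window R y. f (y - of_int_vec \<alpha>) * p (of_int_vec \<alpha>)) = p y + q y"
      by auto
    have "shift_combination (\<lambda>\<alpha>. p (of_int_vec \<alpha>)) f y = p y + q y" for y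
      unfolding q(2)[symmetric] by (subst shift_combination_window[OF f(1), of y y]) (auto simp: mult.commute)
    then show "\<exists>q\<in>pol d. \<forall>y. shift_combination (\<lambda>\<alpha>. p (of_int_vec \<alpha>)) f y = p y + q y" using q(1) by blast
  qed
qed

section \<open>The hat function\<close>

text \<open>The tensor product of linear B-splines, the concrete test function by which limits of
  order 0 are pinned down.\<close>

definition hat :: "real ^ 's::finite \<Rightarrow> real" where
  "hat x = (\<Prod>i\<in>UNIV. max 0 (1 - \<bar>x $ i\<bar>))"

lemma hat_box_supported: "box_supported 1 hat"
  unfolding box_supported_def hat_def
proof (intro allI impI)
  fix x :: "real ^ 's" and i assume "real 1 < \<bar>x $ i\<bar>"
  then have "max 0 (1 - \<bar>x $ i\<bar>) = 0" by simp
  then show "(\<Prod>i\<in>UNIV. max 0 (1 - \<bar>x $ i\<bar>)) = 0" by (intro prod_zero) auto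
qed

lemma hat_continuous: "continuous_on UNIV hat"
  unfolding hat_def[abs_def] by (intro continuous_intros)

lemma hat_nonneg: "0 \<le> hat x"
  unfolding hat_def by (intro prod_nonneg) auto

text \<open>Only the two integers next to \<open>y\<close> contribute; the summation range is that
  of \<open>window 1\<close>.\<close>

lemma hat_sum_1:
  "(\<Sum>t\<in>{\<lfloor>y\<rfloor> - int 1 - 1..\<lfloor>y\<rfloor> + int 1 + 2}. max 0 (1 - \<bar>y - real_of_int t\<bar>)) = 1" for y :: real
proof -
  have "(\<Sum>t\<in>{\<lfloor>y\<rfloor> - int 1 - 1..\<lfloor>y\<rfloor> + int 1 + 2}. max 0 (1 - \<bar>y - real_of_int t\<bar>))
    = (\<Sum>t\<in>{\<lfloor>y\<rfloor>, \<lfloor>y\<rfloor> + 1}. max 0 (1 - \<bar>y - real_of_int t\<bar>))"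
  proof (rule sum.mono_neutral_right)
    show "\<forall>t\<in>{\<lfloor>y\<rfloor> - int 1 - 1..\<lfloor>y\<rfloor> + int 1 + 2} - {\<lfloor>y\<rfloor>, \<lfloor>y\<rfloor> + 1}. max 0 (1 - \<bar>y - real_of_int t\<bar>) = 0"
    proof
      fix t assume "t \<in> {\<lfloor>y\<rfloor> - int 1 - 1..\<lfloor>y\<rfloor> + int 1 + 2} - {\<lfloor>y\<rfloor>, \<lfloor>y\<rfloor> + 1}"
      then have "t \<le> \<lfloor>y\<rfloor> - 1 \<or> t \<ge> \<lfloor>y\<rfloor> + 2" by auto
      then have "1 \<le> \<bar>y - real_of_int t\<bar>" by linarith
      then show "max 0 (1 - \<bar>y - real_of_int t\<bar>) = 0" by simp
    qed
  qed auto
  also have "\<dots> = max 0 (1 - \<bar>y - real_of_int \<lfloor>y\<rfloor>\<bar>) + max 0 (1 - \<bar>y - real_of_int (\<lfloor>y\<rfloor> + 1)\<bar>)" by simp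
  also have "\<dots> = 1"
  proof -
    have a: "\<bar>y - real_of_int \<lfloor>y\<rfloor>\<bar> = y - real_of_int \<lfloor>y\<rfloor>" by linarith
    have b: "\<bar>y - real_of_int (\<lfloor>y\<rfloor> + 1)\<bar> = real_of_int \<lfloor>y\<rfloor> + 1 - y" by linarith
    have c: "0 \<le> 1 - (y - real_of_int \<lfloor>y\<rfloor>)" "0 \<le> 1 - (real_of_int \<lfloor>y\<rfloor> + 1 - y)" by linarith+
    show ?thesis unfolding a b using c by (simp add: max_def)
  qed
  finally show ?thesis .
qed

lemma hat_window_sum: "(\<Sum>\<alpha>\<in>window 1 y. hat (y - of_int_vec \<alpha>)) = 1"
proof -
  have "(\<Sum>\<alpha>\<in>window 1 y. hat (y - of_int_vec \<alpha>))
    = (\<Prod>i\<in>UNIV. \<Sum>t\<in>{\<lfloor>y $ i\<rfloor> - int 1 - 1..\<lfloor>y $ i\<rfloor> + int 1 + 2}. max 0 (1 - \<bar>y $ i - real_of_int t\<bar>))"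
    unfolding window_def hat_def vector_minus_component of_int_vec_nth
    by (rule sum_vec_prod[of "\<lambda>i. {\<lfloor>y $ i\<rfloor> - int 1 - 1..\<lfloor>y $ i\<rfloor> + int 1 + 2}" "\<lambda>i t. max 0 (1 - \<bar>y $ i - real_of_int t\<bar>)"]) simp
  then show ?thesis by (simp only: hat_sum_1 prod.neutral_const)
qed

lemma hat_partition: "shift_combination (\<lambda>_. 1) hat y = 1"
  by (subst shift_combination_window[OF hat_box_supported, of y y]) (simp_all add: hat_window_sum del: One_nat_def)

lemma hat_interpolates: "shift_combination c hat (of_int_vec \<alpha>) = c \<alpha>"
proof -
  have h: "hat (of_int_vec \<alpha> - of_int_vec \<beta>) = (if \<beta> = \<alpha> then 1 else 0)" for \<beta> :: "int ^ 'a"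
  proof (cases "\<beta> = \<alpha>")
    case False
    then obtain i where "\<beta> $ i \<noteq> \<alpha> $ i" by (auto simp: vec_eq_iff)
    then have "1 \<le> \<bar>\<alpha> $ i - \<beta> $ i\<bar>" by linarith
    then have "1 \<le> \<bar>real_of_int (\<alpha> $ i) - real_of_int (\<beta> $ i)\<bar>" by linarith
    then have "max 0 (1 - \<bar>(of_int_vec \<alpha> - of_int_vec \<beta>) $ i\<bar>) = 0" by simp
    then have "hat (of_int_vec \<alpha> - of_int_vec \<beta>) = 0" unfolding hat_def by (intro prod_zero) auto
    then show ?thesis using False by simp
  qed (simp add: hat_def)
  then have "{\<beta>. hat (of_int_vec \<alpha> - of_int_vec \<beta>) \<noteq> 0} = {\<alpha>}" by auto
  then show ?thesis unfolding shift_combination_def using h[of \<alpha>] by simp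
qed

text \<open>Both constants are 1: interpolation at the integers gives the lower bound, the partition
  of unity the upper one.\<close>

lemma hat_stable: "stable_function hat"
  unfolding stable_function_def
proof (intro exI[of _ 1] conjI allI impI)
  fix c :: "'a seq" assume c: "bounded (range c)"
  show "ennreal 1 * sup_norm c \<le> sup_norm (shift_combination c hat)"
    unfolding sup_norm_def ennreal_1 mult_1_left
  proof (rule SUP_mono)
    fix \<alpha> show "\<exists>x\<in>UNIV. ennreal (norm (c \<alpha>)) \<le> ennreal (norm (shift_combination c hat x))"
      by (rule bexI[of _ "of_int_vec \<alpha>"]) (simp_all add: hat_interpolates)
  qed
  obtain S where S: "\<And>\<alpha>. norm (c \<alpha>) \<le> S" using c unfolding bounded_iff by blast
  define S' where "S' = (SUP \<alpha>. norm (c \<alpha>))"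
  have bdd: "bdd_above (range (\<lambda>\<alpha>. norm (c \<alpha>)))" using S by (intro bdd_aboveI[of _ S]) auto
  have S': "\<bar>c \<alpha>\<bar> \<le> S'" for \<alpha> using cSUP_upper[OF _ bdd, of \<alpha>] by (simp add: S'_def)
  \<comment> \<open>Boundedness turns the extended supremum into a real one, which can be used as a
    factor in sums.\<close>
  have eq: "sup_norm c = ennreal S'"
    unfolding sup_norm_def S'_def
  proof (rule antisym)
    show "(SUP \<alpha>. ennreal (norm (c \<alpha>))) \<le> ennreal (SUP \<alpha>. norm (c \<alpha>))"
      using cSUP_upper[OF _ bdd] by (intro SUP_least ennreal_leI) auto
    show "ennreal (SUP \<alpha>. norm (c \<alpha>)) \<le> (SUP \<alpha>. ennreal (norm (c \<alpha>)))"
    proof (cases "(SUP \<alpha>. ennreal (norm (c \<alpha>)))" rule: ennreal_cases)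
      case (real r)
      then have "ennreal (norm (c \<alpha>)) \<le> ennreal r" for \<alpha> by (metis SUP_upper UNIV_I)
      then have "norm (c \<alpha>) \<le> r" for \<alpha> using real(1) by (metis ennreal_le_iff)
      then show ?thesis unfolding real(2) by (intro ennreal_leI cSUP_least) auto
    next
      case top
      then show ?thesis by (simp only: top_greatest)
    qed
  qed
  show "sup_norm (shift_combination c hat) \<le> ennreal 1 * sup_norm c"
    unfolding eq ennreal_1 mult_1_left unfolding sup_norm_def
  proof (intro SUP_least ennreal_leI)
    fix y :: "real ^ 'a"
    have "norm (shift_combination c hat y) = \<bar>\<Sum>\<alpha>\<in>window 1 y. c \<alpha> * hat (y - of_int_vec \<alpha>)\<bar>"
      by (subst shift_combination_window[OF hat_box_supported, of y y]) auto
    also have "\<dots> \<le> (\<Sum>\<alpha>\<in>window 1 y. S' * hat (y - of_int_vec \<alpha>))"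
      by (rule order_trans[OF sum_abs sum_mono]) (simp add: abs_mult hat_nonneg mult_right_mono S')
    also have "\<dots> = S' * (\<Sum>\<alpha>\<in>window 1 y. hat (y - of_int_vec \<alpha>))" by (simp only: sum_distrib_left)
    also have "\<dots> = S'" by (simp only: hat_window_sum mult_1_right)
    finally show "norm (shift_combination c hat y) \<le> S'" .
  qed
qed simp_all

text \<open>
  All translates of the hat function have the periodization 1, hence the same Fourier coefficients,
  while translation by \<open>z\<close> multiplies them by \<open>exp (2 \<pi> \<i> z \<bullet> \<alpha>)\<close>.
\<close>

lemma fourier_hat: "fourier hat (of_int_vec \<alpha>) = (if \<alpha> = 0 then 1 else 0)" for \<alpha> :: "int ^ 's::finite"
proof -
  have per: "fourier (\<lambda>x. hat (z + x)) (of_int_vec \<alpha>) = IC (cexp (of_int_vec \<alpha>))"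
    for z :: "real ^ 's" and \<alpha>
  proof -
    obtain k :: nat where k: "norm z \<le> real k" using real_arch_simple by blast
    have zk: "\<bar>z $ i\<bar> \<le> real k" for i using component_le_norm_cart[of z i] k by linarith
    have b: "box_supported (k + 1) (\<lambda>x. hat (z + x))"
      unfolding box_supported_def
    proof (intro allI impI)
      fix x :: "real ^ 's" and i assume "real (k + 1) < \<bar>x $ i\<bar>"
      then have "real 1 < \<bar>(z + x) $ i\<bar>" using zk[of i] by simp
      then show "hat (z + x) = 0" using hat_box_supported unfolding box_supported_def by blast
    qed
    have c: "continuous_on UNIV (\<lambda>x. hat (z + x))"
      by (rule continuous_on_compose2[OF hat_continuous]) (auto intro!: continuous_intros)
    have "(\<Sum>\<beta>\<in>sbox (k + 1). hat (z + (x + of_int_vec \<beta>))) = 1" if "x \<in> unit_cell" for x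
    proof -
      have "0 \<le> x $ i \<and> x $ i < 1" for i using that by (simp add: unit_cell_def)
      then have "real 1 + \<bar>(z + x) $ i\<bar> \<le> real (k + 1) + 2" for i using zk[of i] by (smt (verit) of_nat_1 of_nat_add vector_add_component)
      from shift_sum_sbox[OF hat_box_supported this] hat_partition show ?thesis by (simp add: add.assoc)
    qed
    then have "indicator unit_cell x *\<^sub>R (complex_of_real (\<Sum>\<beta>\<in>sbox (k + 1). hat (z + (x + of_int_vec \<beta>))) * cexp (of_int_vec \<alpha>) x)
      = indicator unit_cell x *\<^sub>R cexp (of_int_vec \<alpha>) x" for x
      by (cases "x \<in> unit_cell") auto
    then show ?thesis using periodization[OF b c, of \<alpha>] by (simp only: IC_def)
  qed
  show ?thesis
  proof (cases "\<alpha> = 0")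
    case True
    have "IC (cexp 0 :: real ^ 's \<Rightarrow> complex) = (LINT x|lborel. complex_of_real (indicator (unit_cell :: (real ^ 's) set) x))"
      unfolding IC_def by (simp add: scaleR_conv_of_real)
    also have "\<dots> = complex_of_real (LINT x|lborel. indicator (unit_cell :: (real ^ 's) set) x)" by (rule integral_complex_of_real)
    also have "\<dots> = 1" by (simp add: measure_unit_cell)
    finally show ?thesis using per[of 0 0] True by simp
  next
    case False
    define w where "w = of_int_vec \<alpha> \<bullet> of_int_vec \<alpha>"
    have w: "w \<noteq> 0" using False by (simp add: w_def)
    \<comment> \<open>Chosen with inner product 1/2 with \<open>of_int_vec \<alpha>\<close>, so that
      the translation multiplies the coefficient by -1.\<close>
    define z where "z = (1 / (2 * w)) *\<^sub>R of_int_vec \<alpha>"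
    have zw: "z \<bullet> of_int_vec \<alpha> = 1 / 2" using w by (simp add: z_def w_def)
    have "exp (2 * pi * \<i> * complex_of_real (1 / 2)) = - 1"
      using exp_pi_i by (simp add: mult.commute)
    then have "fourier (\<lambda>x. hat (z + x)) (of_int_vec \<alpha>) = - fourier hat (of_int_vec \<alpha>)"
      unfolding fourier_translate[OF hat_continuous] zw by simp
    moreover have "fourier (\<lambda>x. hat (z + x)) (of_int_vec \<alpha>) = fourier hat (of_int_vec \<alpha>)"
      using per[of z \<alpha>] per[of 0 \<alpha>] by simp
    ultimately show ?thesis using False by simp
  qed
qed

lemma hat_strang_fix: "strang_fix 0 hat"
  unfolding strang_fix_def using fourier_hat[of 0] by (auto simp: fourier_hat)

lemma hat_test_function: "test_function 0 hat"
  unfolding test_function_def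
proof (intro conjI hat_stable hat_strang_fix)
  have "{x. hat x \<noteq> 0} \<subseteq> cube 1"
    using hat_box_supported not_in_cube unfolding box_supported_def by blast
  then have "bounded {x. hat x \<noteq> 0}" using bounded_cbox bounded_subset unfolding cube_def by blast
  then show "compact (closure {x. hat x \<noteq> 0})" by (simp add: compact_closure)
  show "C_k 0 hat" by (simp add: C_k_def hat_continuous)
qed

section \<open>Limit functions\<close>

context scheme
begin

lemma it_add: "it k (\<lambda>\<alpha>. c \<alpha> + d \<alpha>) = (\<lambda>\<alpha>. it k c \<alpha> + it k d \<alpha>)"
  by (induction k) (simp_all add: subdivision_add)

lemma it_scale: "it k (\<lambda>\<alpha>. r * c \<alpha>) = (\<lambda>\<alpha>. r * it k c \<alpha>)"
  by (induction k) (simp_all add: subdivision_def sum_distrib_left mult.left_commute)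

lemma it_sum: "finite T \<Longrightarrow> it k (\<lambda>\<alpha>. \<Sum>t\<in>T. c t \<alpha>) = (\<lambda>\<alpha>. \<Sum>t\<in>T. it k (c t) \<alpha>)"
proof (induction T rule: finite_induct)
  case empty
  show ?case using it_scale[of k 0 "\<lambda>_. 0"] by simp
next
  case (insert t T)
  then show ?case by (simp add: it_add)
qed

lemma it_shift: "it k (\<lambda>\<beta>. c (\<gamma> + \<beta>)) = (\<lambda>\<alpha>. it k c (int m ^ k *s \<gamma> + \<alpha>))"
proof (induction k arbitrary: c)
  case (Suc k)
  have "it (Suc k) (\<lambda>\<beta>. c (\<gamma> + \<beta>)) \<alpha> = it (Suc k) c (int m ^ Suc k *s \<gamma> + \<alpha>)" for \<alpha>
  proof -
    have eq: "int m ^ Suc k *s \<gamma> = int m *s (int m ^ k *s \<gamma>)" by (simp add: vec_eq_iff)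
    show ?thesis unfolding eq iterated_subdivision.simps Suc subdivision_shift ..
  qed
  then show ?case by blast
qed simp

text \<open>\<open>k\<close> steps spread a value by at most
  \<open>N (1 + m + ... + m^(k-1))\<close>, and this is at most \<open>N (m^k - 1)\<close> because
  \<open>m \<ge> 2\<close>.\<close>

lemma it_local:
  assumes "\<And>\<beta>. (\<And>i. 0 \<le> \<alpha> $ i - int m ^ k * \<beta> $ i \<and> \<alpha> $ i - int m ^ k * \<beta> $ i \<le> int N * (int m ^ k - 1)) \<Longrightarrow> c \<beta> = 0"
  shows "it k c \<alpha> = 0"
  using assms
proof (induction k arbitrary: \<alpha>)
  case 0
  then show ?case by simp
next
  case (Suc k)
  have "b (Suc k) (\<alpha> - int m *s \<gamma>) * it k c \<gamma> = 0" for \<gamma>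
  proof (cases "b (Suc k) (\<alpha> - int m *s \<gamma>) = 0")
    case False
    then have "\<alpha> - int m *s \<gamma> \<in> ibox 0 (int N)" using supported_maskD[OF supported[of "Suc k"] False] by simp
    then have g: "0 \<le> \<alpha> $ i - int m * \<gamma> $ i \<and> \<alpha> $ i - int m * \<gamma> $ i \<le> int N" for i by (auto simp: ibox_def)
    have "it k c \<gamma> = 0"
    proof (rule Suc.IH)
      fix \<beta> assume \<beta>: "\<And>i. 0 \<le> \<gamma> $ i - int m ^ k * \<beta> $ i \<and> \<gamma> $ i - int m ^ k * \<beta> $ i \<le> int N * (int m ^ k - 1)"
      show "c \<beta> = 0"
      proof (rule Suc.prems)
        fix i
        have eq: "\<alpha> $ i - int m ^ Suc k * \<beta> $ i = (\<alpha> $ i - int m * \<gamma> $ i) + int m * (\<gamma> $ i - int m ^ k * \<beta> $ i)"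
          by (simp add: algebra_simps)
        have "0 \<le> int m * (\<gamma> $ i - int m ^ k * \<beta> $ i)" using \<beta>[of i] by (intro mult_nonneg_nonneg) auto
        moreover have "int m * (\<gamma> $ i - int m ^ k * \<beta> $ i) \<le> int m * (int N * (int m ^ k - 1))"
          using \<beta>[of i] by (intro mult_left_mono) auto
        moreover have "int N + int m * (int N * (int m ^ k - 1)) \<le> int N * (int m ^ Suc k - 1)"
        proof -
          have "int N * 2 \<le> int N * int m" using m by (intro mult_left_mono) auto
          then show ?thesis by (simp add: algebra_simps)
        qed
        ultimately show "0 \<le> \<alpha> $ i - int m ^ Suc k * \<beta> $ i \<and> \<alpha> $ i - int m ^ Suc k * \<beta> $ i \<le> int N * (int m ^ Suc k - 1)"
          unfolding eq using g[of i] by linarith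
      qed
    qed
    then show ?thesis by simp
  qed simp
  then show ?case unfolding iterated_subdivision.simps subdivision_def by (intro sum.neutral) blast
qed

definition \<delta>\<^sub>0 :: "'s seq" where "\<delta>\<^sub>0 \<alpha> = (if \<alpha> = 0 then 1 else 0)"

text \<open>At every level, only the values of \<open>c\<close> in a window of fixed size around
  \<open>x\<close> reach the cell of \<open>x\<close>; linearity and shift invariance then express
  the iterate by that of the delta sequence. The index set is the same for all \<open>k\<close>, so
  the identity passes to the limit.\<close>

lemma it_superposition:
  "it k c (fl (real m ^ k *\<^sub>R x)) = (\<Sum>\<beta>\<in>window (N + 2) x. c \<beta> * it k \<delta>\<^sub>0 (fl (real m ^ k *\<^sub>R (x - of_int_vec \<beta>))))"
proof -
  let ?W = "window (N + 2) x" and ?\<alpha> = "fl (real m ^ k *\<^sub>R x)"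
  have mk: "0 < real m ^ k" "1 \<le> real m ^ k" using m by auto
  define c' where "c' \<beta> = (if \<beta> \<in> ?W then c \<beta> else 0)" for \<beta>
  have c'_eq: "c' = (\<lambda>\<alpha>. \<Sum>\<beta>\<in>?W. c \<beta> * \<delta>\<^sub>0 (- \<beta> + \<alpha>))"
  proof
    fix \<alpha> :: "int ^ 's"
    have "(\<Sum>\<beta>\<in>?W. c \<beta> * \<delta>\<^sub>0 (- \<beta> + \<alpha>)) = (\<Sum>\<beta>\<in>?W. if \<beta> = \<alpha> then c \<beta> else 0)"
      by (rule sum.cong) (auto simp: \<delta>\<^sub>0_def)
    then show "c' \<alpha> = (\<Sum>\<beta>\<in>?W. c \<beta> * \<delta>\<^sub>0 (- \<beta> + \<alpha>))" by (simp add: c'_def sum.delta)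
  qed
  have "it k (\<lambda>\<alpha>. c \<alpha> + (- 1) * c' \<alpha>) ?\<alpha> = 0"
  proof (rule it_local)
    fix \<beta> assume \<beta>: "\<And>i. 0 \<le> ?\<alpha> $ i - int m ^ k * \<beta> $ i \<and> ?\<alpha> $ i - int m ^ k * \<beta> $ i \<le> int N * (int m ^ k - 1)"
    have "\<lfloor>x $ i\<rfloor> - int (N + 2) - 1 \<le> \<beta> $ i \<and> \<beta> $ i \<le> \<lfloor>x $ i\<rfloor> + int (N + 2) + 2" for i
    proof -
      have "real_of_int 0 \<le> real_of_int (\<lfloor>real m ^ k * x $ i\<rfloor> - int m ^ k * \<beta> $ i)"
        "real_of_int (\<lfloor>real m ^ k * x $ i\<rfloor> - int m ^ k * \<beta> $ i) \<le> real_of_int (int N * (int m ^ k - 1))"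
        unfolding of_int_le_iff using \<beta>[of i] by (simp_all add: fl_def)
      then have f: "0 \<le> real_of_int \<lfloor>real m ^ k * x $ i\<rfloor> - real m ^ k * \<beta> $ i"
        "real_of_int \<lfloor>real m ^ k * x $ i\<rfloor> - real m ^ k * \<beta> $ i \<le> real N * (real m ^ k - 1)" by simp_all
      have "real m ^ k * \<beta> $ i \<le> real m ^ k * x $ i" using f(1) by linarith
      then have 1: "\<beta> $ i \<le> x $ i" using mk(1) by (simp add: mult_le_cancel_left_pos)
      have "real m ^ k * x $ i - real m ^ k * \<beta> $ i \<le> real N * (real m ^ k - 1) + 1" using f(2) by linarith
      also have "\<dots> \<le> real m ^ k * (real N + 1)" using mk(2) by (simp add: algebra_simps)
      finally have "real m ^ k * x $ i - real m ^ k * \<beta> $ i \<le> real m ^ k * (real N + 1)" .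
      then have "real m ^ k * (x $ i - \<beta> $ i) \<le> real m ^ k * (real N + 1)" by (simp only: right_diff_distrib)
      then have 2: "x $ i - \<beta> $ i \<le> real N + 1" using mk(1) by (simp only: mult_le_cancel_left_pos)
      show ?thesis using 1 2 by linarith
    qed
    then have "\<beta> \<in> ?W" by (simp add: window_def)
    then show "c \<beta> + (- 1) * c' \<beta> = 0" by (simp add: c'_def)
  qed
  then have "it k c ?\<alpha> = it k c' ?\<alpha>" unfolding it_add it_scale by simp
  also have "\<dots> = (\<Sum>\<beta>\<in>?W. c \<beta> * it k \<delta>\<^sub>0 (int m ^ k *s (- \<beta>) + ?\<alpha>))"
    unfolding c'_eq it_sum[OF finite_window] it_scale it_shift ..
  also have "\<dots> = (\<Sum>\<beta>\<in>?W. c \<beta> * it k \<delta>\<^sub>0 (fl (real m ^ k *\<^sub>R (x - of_int_vec \<beta>))))"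
  proof (rule sum.cong[OF refl])
    fix \<beta> :: "int ^ 's"
    have "\<lfloor>real m ^ k * x $ i - real m ^ k * real_of_int (\<beta> $ i)\<rfloor> = \<lfloor>real m ^ k * x $ i\<rfloor> - int m ^ k * \<beta> $ i" for i
    proof -
      have "real m ^ k * real_of_int (\<beta> $ i) = real_of_int (int m ^ k * \<beta> $ i)" by simp
      then show ?thesis by (simp only: floor_diff_of_int)
    qed
    then have "int m ^ k *s (- \<beta>) + ?\<alpha> = fl (real m ^ k *\<^sub>R (x - of_int_vec \<beta>))"
      by (simp add: fl_def vec_eq_iff right_diff_distrib)
    then show "c \<beta> * it k \<delta>\<^sub>0 (int m ^ k *s (- \<beta>) + ?\<alpha>) = c \<beta> * it k \<delta>\<^sub>0 (fl (real m ^ k *\<^sub>R (x - of_int_vec \<beta>)))"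
      by simp
  qed
  finally show ?thesis .
qed

lemma it_delta_support:
  assumes "real (N + 1) < \<bar>x $ i\<bar>"
  shows "it k \<delta>\<^sub>0 (fl (real m ^ k *\<^sub>R x)) = 0"
proof (rule it_local)
  have mk: "0 < real m ^ k" "1 \<le> real m ^ k" using m by auto
  fix \<beta> assume \<beta>: "\<And>i. 0 \<le> fl (real m ^ k *\<^sub>R x) $ i - int m ^ k * \<beta> $ i \<and>
    fl (real m ^ k *\<^sub>R x) $ i - int m ^ k * \<beta> $ i \<le> int N * (int m ^ k - 1)"
  show "\<delta>\<^sub>0 \<beta> = 0"
  proof (rule ccontr)
    assume "\<delta>\<^sub>0 \<beta> \<noteq> 0"
    then have "\<beta> = 0" by (simp add: \<delta>\<^sub>0_def split: if_splits)
    then have "real_of_int 0 \<le> real_of_int \<lfloor>real m ^ k * x $ i\<rfloor>"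
        "real_of_int \<lfloor>real m ^ k * x $ i\<rfloor> \<le> real_of_int (int N * (int m ^ k - 1))"
      unfolding of_int_le_iff using \<beta>[of i] by (simp_all add: fl_def)
    then have f: "0 \<le> real m ^ k * x $ i" "real m ^ k * x $ i < real N * (real m ^ k - 1) + 1" by (simp, simp) linarith
    have "0 \<le> x $ i" using f(1) mk(1) by (simp add: zero_le_mult_iff)
    then have "real m ^ k * real (N + 1) < real m ^ k * x $ i" using assms mk(1) by (intro mult_strict_left_mono) auto
    moreover have "real N * (real m ^ k - 1) + 1 \<le> real m ^ k * real (N + 1)" using mk by (simp add: algebra_simps)
    ultimately show False using f(2) by linarith
  qed
qed

end

context limit_scheme
begin

lemma limit_function_G:
  assumes "n \<le> l" shows "limit_function n m b c (G [])"
  unfolding limit_function_def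
proof (intro conjI allI impI)
  show "C_k n (G [])" by (rule C_k_mono[OF C_k_G assms])
  fix f :: "real ^ 's \<Rightarrow> real" assume f: "test_function n f"
  obtain R where R: "box_supported R f" using compact_box_supported f unfolding test_function_def by blast
  have ck: "C_k n f" and "strang_fix n f" using f by (auto simp: test_function_def)
  then have "reproducing n f" using C_k_continuous[OF ck, of "[]"] by (intro test_function_reproducing[OF R]) auto
  then show "(\<lambda>k. C_norm n (\<lambda>x. G [] x - shift_combination (it k c) f ((real m ^ k) *\<^sub>R x))) \<longlonglongrightarrow> 0"
    by (rule C_norm_tendsto[OF ck R _ assms])
qed

text \<open>The hat function is a test function of order 0, so the defining limit with
  \<open>hat\<close> determines \<open>g\<close> pointwise.\<close>

lemma limit_function_unique:
  assumes "limit_function 0 m b c g" shows "g = G []"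
proof
  fix x
  let ?F = "\<lambda>k. shift_combination (it k c) hat ((real m ^ k) *\<^sub>R x)"
  have lim: "?F \<longlonglongrightarrow> h x" if "limit_function 0 m b c h" for h
  proof -
    have "(\<lambda>k. C_norm 0 (\<lambda>x. h x - shift_combination (it k c) hat ((real m ^ k) *\<^sub>R x))) \<longlonglongrightarrow> 0"
      using that hat_test_function unfolding limit_function_def by blast
    note z = this
    have ub: "ennreal \<bar>h x - ?F k\<bar> \<le> C_norm 0 (\<lambda>x. h x - shift_combination (it k c) hat ((real m ^ k) *\<^sub>R x))" for k
      unfolding C_norm_def sup_norm_def by (rule SUP_upper2[of "[]"], simp) (rule SUP_upper2[of x], simp_all)
    have "(\<lambda>k. ennreal \<bar>h x - ?F k\<bar>) \<longlonglongrightarrow> 0"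
      by (rule tendsto_sandwich[OF always_eventually always_eventually tendsto_const z]) (intro allI zero_le ub)+
    then have "(\<lambda>k. \<bar>h x - ?F k\<bar>) \<longlonglongrightarrow> 0"
      using tendsto_ennreal_iff[where f = "\<lambda>k. \<bar>h x - ?F k\<bar>" and x = 0 and F = sequentially] by simp
    then have "(\<lambda>k. h x - (h x - ?F k)) \<longlonglongrightarrow> h x - 0" by (intro tendsto_intros) (simp add: tendsto_rabs_zero_iff)
    then show ?thesis by simp
  qed
  show "g x = G [] x" using LIMSEQ_unique[OF lim[OF assms] lim[OF limit_function_G]] by simp
qed

lemma Gk_Nil_tendsto: "(\<lambda>k. it k c (fl (real m ^ k *\<^sub>R x))) \<longlonglongrightarrow> G [] x"
proof -
  obtain A where A: "\<And>k x. \<bar>Gk k [] x - G [] x\<bar> \<le> A * rate 0 ^ k" using Gk_tendsto[of 0] by auto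
  have "(\<lambda>k. A * rate 0 ^ k) \<longlonglongrightarrow> A * 0" using rate[of 0] by (intro tendsto_intros LIMSEQ_realpow_zero) auto
  then have z: "(\<lambda>k. A * rate 0 ^ k) \<longlonglongrightarrow> 0" by simp
  have "(\<lambda>k. Gk k [] x - G [] x) \<longlonglongrightarrow> 0"
    by (rule Lim_null_comparison[OF _ z]) (simp add: A)
  then show ?thesis by (simp add: Gk_def LIM_zero_iff)
qed

text \<open>The segment is cut into about \<open>norm (x - y) * m^k\<close> pieces of length at most
  \<open>m^(-k)\<close>, each contributing a multiple of \<open>rate l ^ k\<close>; the total tends
  to 0 when \<open>m * rate l < 1\<close>.\<close>

lemma G_top_constant:
  assumes \<mu>: "length \<mu> = l" and fast: "real m * rate l < 1"
  shows "G \<mu> x = G \<mu> y"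
proof -
  obtain C where C: "C \<ge> 0" "\<And>k x y. norm (x - y) \<le> (1 / real m) ^ k \<Longrightarrow> \<bar>G \<mu> x - G \<mu> y\<bar> \<le> C * rate l ^ k"
    using G_modulus[of l] \<mu> by auto
  have bound: "\<bar>G \<mu> x - G \<mu> y\<bar> \<le> C * (norm (x - y) * (real m * rate l) ^ k + 2 * rate l ^ k)" for k
  proof -
    \<comment> \<open>The summand 1 keeps the number of pieces positive, also for
      \<open>x = y\<close>.\<close>
    define n where "n = nat \<lceil>norm (x - y) * real m ^ k\<rceil> + 1"
    define z where "z t = y + (real t / real n) *\<^sub>R (x - y)" for t
    have n: "norm (x - y) * real m ^ k \<le> real n" "real n \<le> norm (x - y) * real m ^ k + 2" "0 < n"
    proof -
      have "0 \<le> norm (x - y) * real m ^ k" by simp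
      then show "norm (x - y) * real m ^ k \<le> real n" "real n \<le> norm (x - y) * real m ^ k + 2" "0 < n"
        unfolding n_def by linarith+
    qed
    have step: "\<bar>G \<mu> (z (Suc t)) - G \<mu> (z t)\<bar> \<le> C * rate l ^ k" for t
    proof (rule C(2))
      have "z (Suc t) - z t = (1 / real n) *\<^sub>R (x - y)"
        by (simp add: z_def add_divide_distrib scaleR_add_left)
      then have "norm (z (Suc t) - z t) = norm (x - y) / real n" by simp
      also have "\<dots> \<le> 1 / real m ^ k" using n m by (simp add: field_simps)
      finally show "norm (z (Suc t) - z t) \<le> (1 / real m) ^ k" by (simp add: power_one_over)
    qed
    have "\<bar>G \<mu> (z t) - G \<mu> (z 0)\<bar> \<le> real t * (C * rate l ^ k)" for t
    proof (induction t)
      case (Suc t)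
      have "\<bar>G \<mu> (z (Suc t)) - G \<mu> (z 0)\<bar> \<le> C * rate l ^ k + real t * (C * rate l ^ k)"
        using Suc step[of t] by linarith
      then show ?case by (simp add: distrib_right)
    qed simp
    from this[of n] have "\<bar>G \<mu> x - G \<mu> y\<bar> \<le> real n * (C * rate l ^ k)" using n(3) by (simp add: z_def)
    also have "\<dots> \<le> (norm (x - y) * real m ^ k + 2) * (C * rate l ^ k)"
      using n(2) C(1) rate[of l] by (intro mult_right_mono) auto
    finally show ?thesis by (simp add: power_mult_distrib algebra_simps)
  qed
  have "(\<lambda>k. C * (norm (x - y) * (real m * rate l) ^ k + 2 * rate l ^ k)) \<longlonglongrightarrow> C * (norm (x - y) * 0 + 2 * 0)"
    using rate[of l] fast by (intro tendsto_intros LIMSEQ_realpow_zero) auto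
  then have "\<bar>G \<mu> x - G \<mu> y\<bar> \<le> C * (norm (x - y) * 0 + 2 * 0)"
    by (rule LIMSEQ_le_const) (use bound in auto)
  then show ?thesis by simp
qed

text \<open>Here the derivatives are constant, so \<open>G \<mu>\<close> is affine, and it is bounded.\<close>

lemma G_step_constant:
  assumes \<mu>: "length \<mu> < l" and const: "\<And>i x y. G (i # \<mu>) x = G (i # \<mu>) y"
  shows "G \<mu> x = G \<mu> y"
proof -
  obtain B' where B': "\<And>x. \<bar>G \<mu> x\<bar> \<le> B'" using G_bounded[of "length \<mu>"] \<mu> by auto
  have B0: "0 \<le> B'" using B'[of 0] by linarith
  have affine: "G \<mu> (x + axis i h) = G \<mu> x + h * G (i # \<mu>) 0" if "0 \<le> h" for x i h
  proof -
    have "\<bar>G (i # \<mu>) (x + axis i t) - G (i # \<mu>) 0\<bar> \<le> 0" for t using const[of i "x + axis i t" 0] by simp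
    from G_increment[OF \<mu> that this] show ?thesis by simp
  qed
  have zero: "G (i # \<mu>) 0 = 0" for i
  proof (rule ccontr)
    let ?\<kappa> = "G (i # \<mu>) 0"
    assume \<kappa>: "?\<kappa> \<noteq> 0"
    \<comment> \<open>Long enough for the affine growth to exceed twice the bound
      \<open>B'\<close>.\<close>
    let ?h = "(2 * B' + 1) / \<bar>?\<kappa>\<bar>"
    have "G \<mu> (0 + axis i ?h) = G \<mu> 0 + ?h * ?\<kappa>" using B0 by (intro affine) auto
    then have "\<bar>?h * ?\<kappa>\<bar> \<le> 2 * B'" using B'[of 0] B'[of "0 + axis i ?h"] by linarith
    moreover have "\<bar>?h * ?\<kappa>\<bar> = 2 * B' + 1" using \<kappa> B0 by (simp add: abs_mult)
    ultimately show False by simp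
  qed
  have line: "G \<mu> (x + axis i h) = G \<mu> x" for x i h
  proof (cases "0 \<le> h")
    case True
    then show ?thesis using affine zero by simp
  next
    case False
    have eq: "x + axis i h + axis i (- h) = x" by (simp add: vec_eq_iff axis_def)
    have "G \<mu> (x + axis i h + axis i (- h)) = G \<mu> (x + axis i h) + - h * G (i # \<mu>) 0"
      by (rule affine) (use False in simp)
    then show ?thesis unfolding eq zero by simp
  qed
  \<comment> \<open>\<open>x\<close> is turned into \<open>y\<close> one coordinate at a
    time.\<close>
  have "G \<mu> (\<chi> i. if i \<in> A then y $ i else x $ i) = G \<mu> x" if "finite A" for A
    using that
  proof (induction A rule: finite_induct)
    case (insert j A)
    have "(\<chi> i. if i \<in> insert j A then y $ i else x $ i)
      = (\<chi> i. if i \<in> A then y $ i else x $ i) + axis j (y $ j - x $ j)"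
      using insert.hyps by (auto simp: vec_eq_iff axis_def)
    then show ?case using line insert.IH by simp
  qed simp
  from this[of UNIV] show ?thesis by simp
qed

lemma G_constant:
  assumes fast: "real m * rate l < 1"
  shows "G [] x = G [] y"
proof -
  have "j \<le> l \<Longrightarrow> \<forall>\<mu> x y. length \<mu> = j \<longrightarrow> G \<mu> x = G \<mu> y" for j
  proof (induction j rule: inc_induct)
    case base
    show ?case using G_top_constant[OF _ fast] by blast
  next
    case (step j)
    have "G \<mu> x = G \<mu> y" if "length \<mu> = j" for \<mu> x y
      by (rule G_step_constant) (use step that in auto)
    then show ?case by blast
  qed
  from this[of 0] show ?thesis by simp
qed

text \<open>Interpolates the modulus between the scales \<open>m^(-k)\<close>: the least
  \<open>k\<close> with \<open>m^(-k) < norm (x - y)\<close> loses only a factor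
  \<open>m powr \<nu>\<close>. Distances above 1 are covered by boundedness of
  \<open>G\<close>.\<close>

lemma G_holder:
  assumes \<nu>: "0 < \<nu>" and rate_eq: "rate l = real m powr (- \<nu>)"
  shows "\<exists>C. \<forall>\<mu> x y. length \<mu> = l \<longrightarrow> \<bar>G \<mu> x - G \<mu> y\<bar> \<le> C * norm (x - y) powr \<nu>"
proof -
  obtain C where C: "C \<ge> 0" "\<And>\<mu> k x y. length \<mu> = l \<Longrightarrow> norm (x - y) \<le> (1 / real m) ^ k \<Longrightarrow> \<bar>G \<mu> x - G \<mu> y\<bar> \<le> C * rate l ^ k"
    using G_modulus[of l] by auto
  obtain D where D: "\<And>\<mu> x. length \<mu> = l \<Longrightarrow> \<bar>G \<mu> x\<bar> \<le> D" using G_bounded[of l] by auto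
  have D0: "0 \<le> D" using D[of "replicate l undefined" 0] by simp
  have m1: "1 < real m" using m by simp
  have "\<bar>G \<mu> x - G \<mu> y\<bar> \<le> (C * real m powr \<nu> + 2 * D) * norm (x - y) powr \<nu>" if \<mu>: "length \<mu> = l" for \<mu> x y
  proof -
    consider "x = y" | "norm (x - y) > 1" | "x \<noteq> y" "norm (x - y) \<le> 1" by linarith
    then show ?thesis
    proof cases
      case 1
      then show ?thesis by simp
    next
      case 2
      then have "1 \<le> norm (x - y) powr \<nu>" using \<nu> by (intro ge_one_powr_ge_zero) auto
      moreover have "\<bar>G \<mu> x - G \<mu> y\<bar> \<le> 2 * D" using D[OF \<mu>, of x] D[OF \<mu>, of y] by linarith
      moreover have "0 \<le> C * real m powr \<nu>" using C(1) by simp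
      ultimately have "\<bar>G \<mu> x - G \<mu> y\<bar> \<le> (C * real m powr \<nu> + 2 * D) * 1" by simp
      also have "\<dots> \<le> (C * real m powr \<nu> + 2 * D) * norm (x - y) powr \<nu>"
        using \<open>1 \<le> norm (x - y) powr \<nu>\<close> C(1) D0 by (intro mult_left_mono) auto
      finally show ?thesis .
    next
      case 3
      then have pos: "0 < norm (x - y)" by simp
      obtain k0 where k0: "(1 / real m) ^ k0 < norm (x - y)" using real_arch_pow_inv[OF pos, of "1 / real m"] m1 by auto
      define k where "k = (LEAST k. (1 / real m) ^ k < norm (x - y))"
      have k: "(1 / real m) ^ k < norm (x - y)" unfolding k_def by (rule LeastI[of _ k0]) (rule k0)
      have "k \<noteq> 0" using k 3(2) by (intro notI) simp
      then obtain k' where k': "k = Suc k'" by (cases k) auto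
      have le: "norm (x - y) \<le> (1 / real m) ^ k'"
        using not_less_Least[of k' "\<lambda>k. (1 / real m) ^ k < norm (x - y)"] k' unfolding k_def by simp
      have "rate l ^ k' = real m powr \<nu> * ((1 / real m) ^ k) powr \<nu>"
      proof -
        have "((1 / real m) ^ k) powr \<nu> = real m powr (- real k * \<nu>)"
          using m1 by (simp add: power_one_over powr_minus_divide[symmetric] powr_realpow[symmetric] powr_powr)
        moreover have "rate l ^ k' = real m powr (- \<nu> * real k')"
          using m1 unfolding rate_eq by (simp add: powr_realpow[symmetric] powr_powr)
        ultimately show ?thesis by (simp add: k' powr_add[symmetric] algebra_simps)
      qed
      also have "\<dots> \<le> real m powr \<nu> * norm (x - y) powr \<nu>"
        using k \<nu> by (intro mult_left_mono powr_mono2) auto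
      finally have "C * rate l ^ k' \<le> C * (real m powr \<nu> * norm (x - y) powr \<nu>)" using C(1) by (intro mult_left_mono)
      moreover have "\<bar>G \<mu> x - G \<mu> y\<bar> \<le> C * rate l ^ k'" by (rule C(2)[OF \<mu> le])
      moreover have "0 \<le> 2 * D * norm (x - y) powr \<nu>" using D0 by simp
      ultimately show ?thesis by (simp add: distrib_right mult.assoc)
    qed
  qed
  then show ?thesis by blast
qed

lemma limit_function_tendsto:
  assumes "limit_function 0 m b c g"
  shows "(\<lambda>k. it k c (fl (real m ^ k *\<^sub>R x))) \<longlonglongrightarrow> g x"
  using Gk_Nil_tendsto unfolding limit_function_unique[OF assms] .

lemma limit_function_C_k: "limit_function 0 m b c g \<Longrightarrow> C_k l g"
  using limit_function_unique C_k_G by blast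

lemma limit_function_constant:
  assumes "limit_function 0 m b c g" "real m ^ Suc l * \<theta> < 1"
  shows "g x = g y"
  unfolding limit_function_unique[OF assms(1)]
  by (rule G_constant) (use assms(2) in \<open>simp add: rate_def mult.assoc\<close>)

lemma limit_function_holder:
  assumes g: "limit_function 0 m b c g" and "0 < \<nu>" "\<theta> = real m powr (- (real l + \<nu>))"
  shows "holder_derivatives l \<nu> g"
proof -
  have "rate l = real m powr (- \<nu>)"
  proof -
    have "rate l = real m powr real l * \<theta>" using m by (simp add: rate_def powr_realpow)
    also have "\<dots> = real m powr (- \<nu>)" unfolding assms(3) powr_add[symmetric] by simp
    finally show ?thesis .
  qed
  from G_holder[OF assms(2) this] show ?thesis
    unfolding holder_derivatives_def limit_function_unique[OF g] by (simp add: partials_G)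
qed

end

section \<open>Bounds for derivatives of any order that the limit functions possess\<close>

lemma card_window:
  fixes y :: "real ^ 's::finite"
  shows "card (window R y) \<le> card (window R (0 :: real ^ 's))"
proof -
  have "window R y \<subseteq> (\<lambda>\<alpha>. fl y + \<alpha>) ` window R 0"
  proof
    fix \<alpha> assume "\<alpha> \<in> window R y"
    then have "\<lfloor>y $ i\<rfloor> - int R - 1 \<le> \<alpha> $ i \<and> \<alpha> $ i \<le> \<lfloor>y $ i\<rfloor> + int R + 2" for i by (simp add: window_def)
    then have "- int R - 1 \<le> \<alpha> $ i - \<lfloor>y $ i\<rfloor> \<and> \<alpha> $ i - \<lfloor>y $ i\<rfloor> \<le> int R + 2" for i by (smt (verit))
    then have "\<alpha> - fl y \<in> window R 0" by (simp add: window_def fl_def)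
    then show "\<alpha> \<in> (\<lambda>\<alpha>. fl y + \<alpha>) ` window R 0" by (intro image_eqI[of _ _ "\<alpha> - fl y"]) auto
  qed
  then have "card (window R y) \<le> card ((\<lambda>\<alpha>. fl y + \<alpha>) ` window R (0 :: real ^ 's))" by (intro card_mono) auto
  also have "\<dots> \<le> card (window R (0 :: real ^ 's))" by (intro card_image_le) simp
  finally show ?thesis .
qed

text \<open>At any point at most a fixed number of shifts is active, so bounded coefficients
  suffice.\<close>

lemma shift_combination_partials_bounded:
  fixes \<phi> :: "real ^ 's::finite \<Rightarrow> real"
  assumes \<phi>: "C_k n \<phi>" "box_supported R \<phi>" and c: "\<And>\<alpha>. \<bar>c \<alpha>\<bar> \<le> S" and \<mu>: "length \<mu> \<le> n"
  shows "\<exists>H. \<forall>x. \<bar>partials \<mu> (shift_combination c \<phi>) x\<bar> \<le> H"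
proof -
  have hs: "box_supported R (partials \<mu> \<phi>)" by (rule box_supported_partials[OF \<phi>(2)])
  obtain H where H: "\<And>x. \<bar>partials \<mu> \<phi> x\<bar> \<le> H"
    using box_supported_bounded[OF hs C_k_continuous[OF \<phi>(1) \<mu>]] by blast
  have S: "0 \<le> S" using c[of 0] by linarith
  have H0: "0 \<le> H" using H[of 0] by linarith
  have neg: "shift_combination (\<lambda>\<alpha>. - c \<alpha>) h y = - shift_combination c h y" for h y
    by (simp add: shift_combination_def sum_negf)
  have "partials \<mu> (\<lambda>x. 0 - shift_combination (\<lambda>\<alpha>. - c \<alpha>) \<phi> (1 *\<^sub>R x))
    = (\<lambda>x. partials \<mu> (\<lambda>x. 0) x - 1 ^ length \<mu> * shift_combination (\<lambda>\<alpha>. - c \<alpha>) (partials \<mu> \<phi>) (1 *\<^sub>R x))"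
    by (rule partials_diff_shift_combination[OF partials_const_0 \<phi> _ \<mu>]) simp
  then have eq: "partials \<mu> (shift_combination c \<phi>) = shift_combination c (partials \<mu> \<phi>)"
    by (simp add: neg partials_zero)
  have "\<bar>partials \<mu> (shift_combination c \<phi>) x\<bar> \<le> real (card (window R (0 :: real ^ 's))) * (S * H)" for x
  proof -
    have "\<bar>partials \<mu> (shift_combination c \<phi>) x\<bar> = \<bar>\<Sum>\<alpha>\<in>window R x. c \<alpha> * partials \<mu> \<phi> (x - of_int_vec \<alpha>)\<bar>"
      unfolding eq by (subst shift_combination_window[OF hs, of x x]) auto
    also have "\<dots> \<le> (\<Sum>\<alpha>\<in>window R x. S * H)"
      by (rule order_trans[OF sum_abs sum_mono]) (auto simp: abs_mult intro!: mult_mono c H S)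
    also have "\<dots> = real (card (window R x)) * (S * H)" by simp
    also have "\<dots> \<le> real (card (window R (0 :: real ^ 's))) * (S * H)"
      using card_window[of R x] S H0 by (intro mult_right_mono) auto
    finally show ?thesis .
  qed
  then show ?thesis by blast
qed

lemma C_k_const: "C_k n (\<lambda>x. r :: real)"
proof -
  have "partials \<mu> (\<lambda>x. r) = (\<lambda>x. if \<mu> = [] then r else 0)" for \<mu> :: "'a list"
    by (induction \<mu>) (auto simp: partial_def)
  then show ?thesis by (simp add: C_k_def)
qed

context scheme
begin

text \<open>Here the spectral radius is traded for the decay assumed in
  \<open>limit_scheme\<close>.\<close>

lemma limit_scheme_exists:
  assumes "jsr_masks m N l (limit_points b) < \<theta>" "real m ^ l * \<theta> < 1" "\<And>\<alpha>. \<bar>c \<alpha>\<bar> \<le> S"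
  shows "\<exists>C. limit_scheme m N l b B c \<theta> S C"
proof -
  obtain C where "\<And>\<mu> k \<gamma>. length \<mu> = Suc l \<Longrightarrow> \<bar>fdiffs \<mu> (it k c) \<gamma>\<bar> \<le> C * \<theta> ^ k"
    using differences_decay[where c = c and S = S, OF assms(1,3)] by blast
  then have "limit_scheme m N l b B c \<theta> S C"
    using assms jsr_nonneg by unfold_locales auto
  then show ?thesis by blast
qed

lemma bounded_sequence:
  fixes c :: "'s seq"
  assumes "bounded (range c)" obtains S where "\<And>\<alpha>. \<bar>c \<alpha>\<bar> \<le> S"
  using assms unfolding bounded_iff by auto

text \<open>\<open>n\<close> may exceed \<open>l\<close>, where \<open>G\<close> gives nothing.
  Every limit function is a shift combination of the limit function of
  \<open>\<delta>\<^sub>0\<close>, whose compact support bounds its continuous derivatives; so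
  exponent 0 is always admissible.\<close>

lemma derivatives_bounded:
  assumes "jsr_masks m N l (limit_points b) < \<theta>" "real m ^ l * \<theta> < 1"
    and G: "\<And>g. g \<in> limit_functions m b \<Longrightarrow> C_k n g" and g: "g \<in> limit_functions m b"
  shows "holder_derivatives n 0 g"
proof -
  obtain c where c: "bounded (range c)" "limit_function 0 m b c g" using g unfolding limit_functions_def by blast
  obtain S where S: "\<And>\<alpha>. \<bar>c \<alpha>\<bar> \<le> S" using bounded_sequence[OF c(1)] by blast
  obtain C where "limit_scheme m N l b B c \<theta> S C" using limit_scheme_exists[where c = c and S = S, OF assms(1,2) S] by blast
  then interpret L: limit_scheme m N l b B c \<theta> S C .
  have d1: "\<bar>\<delta>\<^sub>0 \<alpha>\<bar> \<le> 1" for \<alpha> by (simp add: \<delta>\<^sub>0_def)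
  obtain C' where "limit_scheme m N l b B \<delta>\<^sub>0 \<theta> 1 C'" using limit_scheme_exists[where c = \<delta>\<^sub>0 and S = 1, OF assms(1,2) d1] by blast
  then interpret D: limit_scheme m N l b B \<delta>\<^sub>0 \<theta> 1 C' .
  define \<phi> where "\<phi> = D.G []"
  have \<phi>: "limit_function 0 m b \<delta>\<^sub>0 \<phi>" unfolding \<phi>_def by (rule D.limit_function_G) simp
  have "bounded (range \<delta>\<^sub>0)" using d1 by (intro boundedI[of _ 1]) auto
  \<comment> \<open>The delta sequence is itself a bounded starting sequence, so the common
    smoothness of all limit functions includes that of \<open>\<phi>\<close>.\<close>
  then have C\<phi>: "C_k n \<phi>" using \<phi> by (intro G) (auto simp: limit_functions_def)
  have s\<phi>: "box_supported (N + 2) \<phi>"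
    unfolding box_supported_def
  proof (intro allI impI)
    fix x :: "real ^ 's" and i assume "real (N + 2) < \<bar>x $ i\<bar>"
    then have "real (N + 1) < \<bar>x $ i\<bar>" by simp
    then have "(\<lambda>k. it k \<delta>\<^sub>0 (fl (real m ^ k *\<^sub>R x))) = (\<lambda>k. 0)" by (intro ext it_delta_support)
    then show "\<phi> x = 0" using D.limit_function_tendsto[OF \<phi>, of x] by (simp add: LIMSEQ_const_iff)
  qed
  have "g = shift_combination c \<phi>"
  proof
    fix x
    have "(\<lambda>k. it k c (fl (real m ^ k *\<^sub>R x))) \<longlonglongrightarrow> (\<Sum>\<beta>\<in>window (N + 2) x. c \<beta> * \<phi> (x - of_int_vec \<beta>))"
      unfolding it_superposition[of _ c] by (intro tendsto_intros D.limit_function_tendsto \<phi>)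
    from LIMSEQ_unique[OF L.limit_function_tendsto[OF c(2)] this]
    have "g x = (\<Sum>\<beta>\<in>window (N + 2) x. c \<beta> * \<phi> (x - of_int_vec \<beta>))" .
    then show "g x = shift_combination c \<phi> x"
      by (subst shift_combination_window[OF s\<phi>, of x x]) auto
  qed
  then have "\<exists>H. \<forall>x. \<bar>partials \<mu> g x\<bar> \<le> H" if "length \<mu> \<le> n" for \<mu>
    using shift_combination_partials_bounded[where c = c and S = S, OF C\<phi> s\<phi> S that] by simp
  then obtain H where H: "\<And>\<mu> x. length \<mu> \<le> n \<Longrightarrow> \<bar>partials \<mu> g x\<bar> \<le> H \<mu>" by metis
  define M where "M = {\<mu> :: 's list. length \<mu> = n}"
  have fin: "finite M" unfolding M_def using finite_lists_length_eq[of "UNIV :: 's set" n] by simp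
  have H0: "0 \<le> H \<mu>" if "\<mu> \<in> M" for \<mu> using H[of \<mu> 0] that by (simp add: M_def)
  have "\<bar>partials \<mu> g x - partials \<mu> g y\<bar> \<le> (\<Sum>\<mu>\<in>M. 2 * H \<mu>) * norm (x - y) powr 0" if "length \<mu> = n" for \<mu> x y
  proof (cases "x = y")
    case False
    have "\<bar>partials \<mu> g x - partials \<mu> g y\<bar> \<le> 2 * H \<mu>" using H[of \<mu> x] H[of \<mu> y] that by linarith
    also have "\<dots> \<le> (\<Sum>\<mu>\<in>M. 2 * H \<mu>)"
      by (rule member_le_sum[of _ _ "\<lambda>\<mu>. 2 * H \<mu>"]) (use that fin H0 in \<open>auto simp: M_def\<close>)
    finally show ?thesis using False by simp
  qed simp
  then show ?thesis unfolding holder_derivatives_def by blast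
qed

lemma C_convergent_scheme:
  assumes \<rho>: "jsr_masks m N l (limit_points b) < real m powr (- real l)"
  shows "C_convergent l m b"
  unfolding C_convergent_def
proof (intro allI impI)
  fix c :: "'s seq" assume "bounded (range c)"
  then obtain S where S: "\<And>\<alpha>. \<bar>c \<alpha>\<bar> \<le> S" using bounded_sequence by blast
  obtain \<theta> where \<theta>: "jsr_masks m N l (limit_points b) < \<theta>" "\<theta> < real m powr (- real l)" using dense[OF \<rho>] by blast
  have "real m ^ l * \<theta> < 1" using \<theta>(2) m by (simp add: powr_minus_divide powr_realpow field_simps)
  then obtain C where "limit_scheme m N l b B c \<theta> S C" using limit_scheme_exists[where c = c and S = S, OF \<theta>(1) _ S] by blast
  then interpret L: limit_scheme m N l b B c \<theta> S C .
  show "\<exists>g. limit_function l m b c g" using L.limit_function_G by blast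
qed

lemma holder_exponent_scheme:
  assumes \<rho>: "jsr_masks m N l (limit_points b) < real m powr (- real l)"
  shows "holder_exponent m b \<ge> - ext_log (real m) (jsr_masks m N l (limit_points b))"
proof -
  let ?\<rho> = "jsr_masks m N l (limit_points b)" and ?G = "limit_functions m b"
  have m1: "1 < real m" using m by simp
  have scaled: "real m ^ j * \<theta> < 1" if "\<theta> < real m powr (- real j)" for j \<theta>
    using that m by (simp add: powr_minus_divide powr_realpow field_simps)
  have scheme: "\<exists>c S C. limit_function 0 m b c g \<and> limit_scheme m N l b B c \<theta> S C"
    if g: "g \<in> ?G" and \<theta>: "?\<rho> < \<theta>" "\<theta> < real m powr (- real l)" for g \<theta>
  proof -
    obtain c where c: "bounded (range c)" "limit_function 0 m b c g" using g unfolding limit_functions_def by blast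
    obtain S where S: "\<And>\<alpha>. \<bar>c \<alpha>\<bar> \<le> S" using bounded_sequence[OF c(1)] by blast
    show ?thesis using limit_scheme_exists[where c = c and S = S, OF \<theta>(1) scaled[OF \<theta>(2)] S] c(2) by blast
  qed
  show ?thesis
  proof (cases "\<forall>n. \<forall>g\<in>?G. C_k n g")
    case True
    then show ?thesis by (simp add: holder_exponent_def)
  next
    case rough: False
    define n where "n = (GREATEST n. \<forall>g\<in>?G. C_k n g)"
    obtain n0 where n0: "\<not> (\<forall>g\<in>?G. C_k n0 g)" using rough by blast
    \<comment> \<open>\<open>C_k\<close> is monotone in the order, so one failure bounds all
      admissible orders and \<open>GREATEST\<close> is attained.\<close>
    have bdd: "n' \<le> n0" if "\<forall>g\<in>?G. C_k n' g" for n'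
    proof (rule ccontr)
      assume "\<not> n' \<le> n0"
      then have "n0 \<le> n'" by simp
      then show False using n0 that C_k_mono by blast
    qed
    obtain \<theta>\<^sub>1 where \<theta>\<^sub>1: "?\<rho> < \<theta>\<^sub>1" "\<theta>\<^sub>1 < real m powr (- real l)" using dense[OF \<rho>] by blast
    have "C_k l g" if g: "g \<in> ?G" for g
    proof -
      obtain c S C where "limit_function 0 m b c g" "limit_scheme m N l b B c \<theta>\<^sub>1 S C"
        using scheme[OF g \<theta>\<^sub>1] by blast
      then show ?thesis by (simp add: limit_scheme.limit_function_C_k)
    qed
    then have Cl: "\<forall>g\<in>?G. C_k l g" by blast
    have ln: "l \<le> n" unfolding n_def by (rule Greatest_le_nat[of "\<lambda>n. \<forall>g\<in>?G. C_k n g", OF Cl]) (rule bdd)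
    have Cn: "\<forall>g\<in>?G. C_k n g" unfolding n_def by (rule GreatestI_nat[of "\<lambda>n. \<forall>g\<in>?G. C_k n g", OF Cl]) (rule bdd)
    define N' where "N' = {\<nu> :: real. 0 \<le> \<nu> \<and> \<nu> \<le> 1 \<and> (\<forall>g\<in>?G. holder_derivatives n \<nu> g)}"
    have exponent: "holder_exponent m b = ereal (real n) + (SUP \<nu>\<in>N'. ereal \<nu>)"
      unfolding holder_exponent_def Let_def n_def[symmetric] N'_def if_not_P[OF rough] ..
    \<comment> \<open>An empty set of exponents would make the supremum
      \<open>-\<infinity>\<close>.\<close>
    have "0 \<in> N'" using derivatives_bounded[OF \<theta>\<^sub>1(1) scaled[OF \<theta>\<^sub>1(2)]] Cn by (auto simp: N'_def)
    then have sup0: "0 \<le> (SUP \<nu>\<in>N'. ereal \<nu>)" by (rule SUP_upper2) simp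
    \<comment> \<open>A smaller radius would make all limit functions constant, hence smooth,
      against \<open>rough\<close>. In particular the radius is positive and \<open>ext_log\<close>
      is an ordinary logarithm.\<close>
    have slow: "real m powr (- real (Suc l)) \<le> ?\<rho>"
    proof (rule ccontr)
      assume "\<not> ?thesis"
      then obtain \<theta> where \<theta>: "?\<rho> < \<theta>" "\<theta> < real m powr (- real (Suc l))" using dense not_le by blast
      have "real m powr (- real (Suc l)) \<le> real m powr (- real l)" using m1 by (intro powr_mono) auto
      then have \<theta>l: "\<theta> < real m powr (- real l)" using \<theta>(2) by linarith
      have "C_k n0 g" if g: "g \<in> ?G" for g
      proof -
        obtain c S C where *: "limit_function 0 m b c g" "limit_scheme m N l b B c \<theta> S C"
          using scheme[OF g \<theta>(1) \<theta>l] by blast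
        have "g x = g 0" for x
          by (rule limit_scheme.limit_function_constant[OF *(2) *(1) scaled[OF \<theta>(2)]])
        then have eq: "g = (\<lambda>x. g 0)" by (rule ext)
        show ?thesis by (subst eq) (rule C_k_const)
      qed
      then show False using n0 by blast
    qed
    have "0 < real m powr (- real (Suc l))" using m1 by simp
    then have \<rho>0: "0 < ?\<rho>" using slow by (rule less_le_trans)
    define A where "A = - log (real m) ?\<rho>"
    have \<rho>A: "?\<rho> = real m powr (- A)" using \<rho>0 m1 by (simp add: A_def powr_log_cancel)
    \<comment> \<open>The exponent to be reached lies above \<open>l\<close> and at most at
      \<open>l + 1\<close>, so \<open>A - l\<close> respects the cap 1 on admissible
      \<open>\<nu>\<close>.\<close>
    have A: "real l < A" "A \<le> real (Suc l)" using \<rho> slow m1 unfolding \<rho>A by auto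
    have "ereal A \<le> ereal (real n) + (SUP \<nu>\<in>N'. ereal \<nu>)"
    proof (cases "n = l")
      case False
      then have "A \<le> real n" using ln A(2) by simp
      then have "ereal A \<le> ereal (real n) + 0" by simp
      also have "\<dots> \<le> ereal (real n) + (SUP \<nu>\<in>N'. ereal \<nu>)" by (rule add_left_mono[OF sup0])
      finally show ?thesis .
    next
      case True
      have "ereal (A - real l) \<le> (SUP \<nu>\<in>N'. ereal \<nu>)"
      \<comment> \<open>Every positive \<open>\<nu>\<close> below \<open>A - l\<close> is
        admissible, with \<open>\<theta> = m powr (- (l + \<nu>))\<close> strictly above the radius;
        the end point need not be, so the supremum is approached from below.\<close>
      proof (rule dense_le_bounded[of 0])
        show "0 < ereal (A - real l)" using A by simp
        fix w assume w: "0 < w" "w < ereal (A - real l)"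
        then obtain \<nu> where \<nu>: "w = ereal \<nu>" by (cases w) auto
        have \<nu>b: "0 < \<nu>" "\<nu> < A - real l" using w \<nu> by auto
        define \<theta> where "\<theta> = real m powr (- (real l + \<nu>))"
        have \<theta>: "?\<rho> < \<theta>" "\<theta> < real m powr (- real l)" unfolding \<rho>A \<theta>_def using \<nu>b m1 by auto
        have "holder_derivatives n \<nu> g" if g: "g \<in> ?G" for g
        proof -
          obtain c S C where *: "limit_function 0 m b c g" "limit_scheme m N l b B c \<theta> S C"
            using scheme[OF g \<theta>] by blast
          show ?thesis unfolding True
            by (rule limit_scheme.limit_function_holder[OF *(2) *(1) \<nu>b(1) \<theta>_def])
        qed
        then have "\<nu> \<in> N'" using \<nu>b A(2) by (simp add: N'_def)
        then show "w \<le> (SUP \<nu>\<in>N'. ereal \<nu>)" unfolding \<nu> by (rule SUP_upper)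
      qed
      then have "ereal (real n) + ereal (A - real l) \<le> ereal (real n) + (SUP \<nu>\<in>N'. ereal \<nu>)" by (rule add_left_mono)
      then show ?thesis using True by simp
    qed
    then show ?thesis using \<rho>0 by (simp add: exponent ext_log_def A_def)
  qed
qed

end

theorem corollary1:
  fixes a b :: "nat \<Rightarrow> ('s::finite) seq"
    and l m N :: nat
  assumes "m \<ge> 2"
    and "\<And>k. k \<ge> 1 \<Longrightarrow> supported_mask N (a k)"
    and "\<And>k. k \<ge> 1 \<Longrightarrow> sum_rules m l (a k)"
    and "jsr_masks m N l (limit_points a) < real m powr (- real l)"
    and "\<And>k. k \<ge> 1 \<Longrightarrow> supported_mask N (b k)"
    and "\<And>k. k \<ge> 1 \<Longrightarrow> sum_rules m l (b k)"
    and "asymptotically_similar a b"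
    and b_bounded: "\<exists>B. \<forall>k\<ge>1. \<forall>\<alpha>. \<bar>b k \<alpha>\<bar> \<le> B"
  shows "C_convergent l m b \<and>
    holder_exponent m b \<ge> - ext_log (real m) (jsr_masks m N l (limit_points a))"
proof -
  obtain B where B: "\<And>k \<alpha>. k \<ge> 1 \<Longrightarrow> \<bar>b k \<alpha>\<bar> \<le> B" using b_bounded by blast
  interpret scheme m N l b B
    by unfold_locales (use assms(1,5,6) B in \<open>auto intro: regular_maskI\<close>)
  show ?thesis
    using C_convergent_scheme holder_exponent_scheme assms(4,7)
    unfolding asymptotically_similar_def by simp
qed

end
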